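(* Let $X$ be a log-correlated field on $U\subset\mathbb{R}^d$, let $X_n=(X*\eta_{c_n})\mathbf{1}_U$ be a convolution approximation of $X$ with $C_n(x,y)=\mathbb{E}X_n(x)X_n(y)$ (see context), and let $0<\beta<\sqrt d$. (i) Assume that $H:\mathbb{R}\to\mathbb{R}$ is a $2\pi/\beta$-periodic even function with absolutely convergent Fourier series and mean zero. Then there is a constant $a$ such that for every test function $\varphi\in C_c^\infty(U)$, $$\int_U\varphi(x)e^{\frac12\beta^2C_n(x,x)}H(X_n(x))\,dx\to\langle a\cos(\beta X),\varphi\rangle$$ in probability as $n\to\infty$. (ii) Assume that $d=2$, that $g\in C^2(U\times U)$ with $g(x,x)=g(y,y)$ for all $x,y\in U$, and that the bump function $\eta$ is additionally non-negative, radially decreasing and symmetric (so that $\eta(0)>0$). Then the conclusion of (i) holds assuming only that $H:\mathbb{R}\to\mathbb{R}$ is a locally integrable $2\pi/\beta$-periodic even function with mean zero.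
   Context: Setting: $d\ge1$, $U\subset\mathbb{R}^d$ is a bounded simply connected domain, and $C_X(x,y)=\log|x-y|^{-1}+g(x,y)$ for $x,y\in U$, where $g:U\times U\to\mathbb{R}$ belongs to $L^1(U\times U)\cap C(U\times U)$ and is bounded from above. $C_X$ is extended by $0$ outside $U\times U$ and is assumed to be a covariance kernel: symmetric and $\int\int C_X(x,y)f(x)\overline{f(y)}\,dx\,dy\ge0$ for all $f\in C_c^\infty(\mathbb{R}^d)$. The log-correlated field $X$ with covariance $C_X$ is the centered Gaussian random generalized function with $\mathbb{E}X(f)X(h)=\int\int C_X(x,y)f(x)h(y)\,dx\,dy$ for real test functions $f,h$, realized as a random element of the Sobolev space $H^{-\varepsilon}(\mathbb{R}^d)$ for every $\varepsilon>0$. Convolution approximations: $\eta\in C_c^\infty(\mathbb{R}^d)$ is non-negative, radially symmetric, with $\int\eta=1$ and support in $B(0,1)$; $\eta_\varepsilon=\varepsilon^{-d}\eta(\cdot/\varepsilon)$; $(c_n)$ is a sequence of positive numbers decreasing to $0$. Cosine: for $0<\beta<\sqrt d$, $\cos(\beta X)$ denotes the real part of the imaginary multiplicative chaos of $X$, i.e. for $\varphi\in C_c^\infty(U)$, $\langle\cos(\beta X),\varphi\rangle=\lim_{n\to\infty}\int_Ue^{\frac12\beta^2\mathbb{E}(X_n(x)^2)}\cos(\beta X_n(x))\varphi(x)\,dx$, a limit in probability along convolution approximations (it exists and does not depend on $\eta$ or $(c_n)$). "Mean zero" means that the integral of $H$ over a period vanishes. *)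

theory Defs
  imports "HOL-Probability.Probability" "HOL-Library.Nonpos_Ints"
begin

section \<open>Test functions\<close>

text \<open>\<open>C\<^sup>k\<close> regularity, meant for open \<open>S\<close>. In finite dimensions, continuity of all directional
  derivatives \<open>x \<mapsto> Df(x) v\<close> is continuity of \<open>Df\<close>.\<close>

primrec C_times_on ::
  "nat \<Rightarrow> 'a::euclidean_space set \<Rightarrow> ('a \<Rightarrow> 'b::real_normed_vector) \<Rightarrow> bool" where
  "C_times_on 0 S f \<longleftrightarrow> continuous_on S f"
| "C_times_on (Suc k) S f \<longleftrightarrow>
     (\<forall>x\<in>S. f differentiable (at x)) \<and>
     (\<forall>v. C_times_on k S (\<lambda>x. frechet_derivative f (at x) v))"

definition fun_support :: "('a::topological_space \<Rightarrow> 'b::zero) \<Rightarrow> 'a set" where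
  "fun_support f = closure {x. f x \<noteq> 0}"

definition test_function ::
  "'a::euclidean_space set \<Rightarrow> ('a \<Rightarrow> 'b::real_normed_vector) \<Rightarrow> bool" where
  "test_function U f \<longleftrightarrow>
     (\<forall>k. C_times_on k UNIV f) \<and> compact (fun_support f) \<and> fun_support f \<subseteq> U"

section \<open>Sobolev spaces of real distributions\<close>

text \<open>\<open>H\<^sup>s\<close>, defined through the Fourier transform: \<open>F\<close> is the Fourier transform of \<open>u\<close>, and the last
  conjunct is \<open>u(f) = \<integral> F(\<xi>) (\<integral> f(x) exp(2 \<pi> i x \<cdot> \<xi>) dx) d\<xi>\<close>, i.e. \<open>u\<close> is the inverse Fourier
  transform of \<open>F\<close>. A distribution is a functional that is only looked at on real test functions;
  its linearity and continuity follow from this representation.\<close>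

definition in_sobolev :: "real \<Rightarrow> (('a::euclidean_space \<Rightarrow> real) \<Rightarrow> real) \<Rightarrow> bool" where
  "in_sobolev s u \<longleftrightarrow>
     (\<exists>F::'a \<Rightarrow> complex. F \<in> borel_measurable borel \<and>
        integrable lborel (\<lambda>\<xi>. (1 + (norm \<xi>)\<^sup>2) powr s * (cmod (F \<xi>))\<^sup>2) \<and>
        (\<forall>f. test_function UNIV f \<longrightarrow>
           complex_of_real (u f) =
             (LINT \<xi>|lborel. F \<xi> * (LINT x|lborel. complex_of_real (f x) * cis (2 * pi * (x \<bullet> \<xi>))))))"

section \<open>Log-correlated fields\<close>

text \<open>On the (null) diagonal the formula uses the convention \<open>ln 0 = 0\<close>.\<close>

definition log_kernel ::
  "'a::euclidean_space set \<Rightarrow> ('a \<Rightarrow> 'a \<Rightarrow> real) \<Rightarrow> 'a \<Rightarrow> 'a \<Rightarrow> real" where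
  "log_kernel U g x y =
     (if x \<in> U \<and> y \<in> U then ln (inverse (norm (x - y))) + g x y else 0)"

definition covariance_kernel :: "('a::euclidean_space \<Rightarrow> 'a \<Rightarrow> real) \<Rightarrow> bool" where
  "covariance_kernel C \<longleftrightarrow>
     (\<forall>x y. C x y = C y x) \<and>
     (\<forall>f::'a \<Rightarrow> complex. test_function UNIV f \<longrightarrow>
        (LINT (x, y)|lborel. complex_of_real (C x y) * f x * cnj (f y)) \<in> \<real>\<^sub>\<ge>\<^sub>0)"

definition centered_gaussian :: "'w measure \<Rightarrow> ('w \<Rightarrow> real) \<Rightarrow> bool" where
  "centered_gaussian M Y \<longleftrightarrow>
     Y \<in> borel_measurable M \<and>
     ((AE \<omega> in M. Y \<omega> = 0) \<or>
      (\<exists>\<sigma>>0. distributed M lborel Y (\<lambda>x. ennreal (normal_density 0 \<sigma> x))))"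

text \<open>\<open>X \<omega> f\<close> is the pairing of the realization \<open>X \<omega>\<close> with \<open>f\<close>. As \<open>X \<omega>\<close> is linear on test
  functions, Gaussianity of every \<open>X(f)\<close> is joint Gaussianity of the family; as test functions are
  dense in the dual of the separable Hilbert space \<open>H\<^sup>-\<^sup>\<epsilon>\<close>, measurability of every \<open>X(f)\<close> is Borel
  measurability of \<open>X\<close>.\<close>

definition log_correlated_field ::
  "'w measure \<Rightarrow> 'a::euclidean_space set \<Rightarrow> ('a \<Rightarrow> 'a \<Rightarrow> real) \<Rightarrow>
     ('w \<Rightarrow> ('a \<Rightarrow> real) \<Rightarrow> real) \<Rightarrow> bool" where
  "log_correlated_field M U g X \<longleftrightarrow>
     prob_space M \<and>
     U \<noteq> {} \<and> open U \<and> connected U \<and> bounded U \<and> simply_connected U \<and>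
     set_integrable lborel (U \<times> U) (\<lambda>(x, y). g x y) \<and>
     continuous_on (U \<times> U) (\<lambda>(x, y). g x y) \<and>
     bdd_above ((\<lambda>(x, y). g x y) ` (U \<times> U)) \<and>
     covariance_kernel (log_kernel U g) \<and>
     (\<forall>\<epsilon>>0. \<forall>\<omega>\<in>space M. in_sobolev (- \<epsilon>) (X \<omega>)) \<and>
     (\<forall>f. test_function UNIV f \<longrightarrow> centered_gaussian M (\<lambda>\<omega>. X \<omega> f)) \<and>
     (\<forall>f h. test_function UNIV f \<longrightarrow> test_function UNIV h \<longrightarrow>
        (LINT \<omega>|M. X \<omega> f * X \<omega> h) = (LINT (x, y)|lborel. log_kernel U g x y * f x * h y))"

section \<open>Convolution approximations\<close>

definition mollifier :: "('a::euclidean_space \<Rightarrow> real) \<Rightarrow> bool" where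
  "mollifier \<eta> \<longleftrightarrow>
     test_function (ball 0 1) \<eta> \<and> (\<forall>x. 0 \<le> \<eta> x) \<and>
     (\<forall>x y. norm x = norm y \<longrightarrow> \<eta> x = \<eta> y) \<and> (LINT x|lborel. \<eta> x) = 1"

definition radially_decreasing :: "('a::euclidean_space \<Rightarrow> real) \<Rightarrow> bool" where
  "radially_decreasing \<eta> \<longleftrightarrow> (\<forall>x y. norm x \<le> norm y \<longrightarrow> \<eta> y \<le> \<eta> x)"

definition scale_sequence :: "(nat \<Rightarrow> real) \<Rightarrow> bool" where
  "scale_sequence c \<longleftrightarrow> (\<forall>n. 0 < c n) \<and> decseq c \<and> c \<longlonglongrightarrow> 0"

definition rescale :: "('a::euclidean_space \<Rightarrow> real) \<Rightarrow> real \<Rightarrow> 'a \<Rightarrow> real" where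
  "rescale \<eta> \<epsilon> x = \<eta> (x /\<^sub>R \<epsilon>) / \<epsilon> ^ DIM('a)"

definition conv_approx ::
  "'a::euclidean_space set \<Rightarrow> ('w \<Rightarrow> ('a \<Rightarrow> real) \<Rightarrow> real) \<Rightarrow> ('a \<Rightarrow> real) \<Rightarrow> real \<Rightarrow>
     'w \<Rightarrow> 'a \<Rightarrow> real" where
  "conv_approx U X \<eta> \<epsilon> \<omega> x = (if x \<in> U then X \<omega> (\<lambda>y. rescale \<eta> \<epsilon> (x - y)) else 0)"

definition approx_cov ::
  "'w measure \<Rightarrow> 'a::euclidean_space set \<Rightarrow> ('w \<Rightarrow> ('a \<Rightarrow> real) \<Rightarrow> real) \<Rightarrow>
     ('a \<Rightarrow> real) \<Rightarrow> real \<Rightarrow> 'a \<Rightarrow> 'a \<Rightarrow> real" where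
  "approx_cov M U X \<eta> \<epsilon> x y =
     (LINT \<omega>|M. conv_approx U X \<eta> \<epsilon> \<omega> x * conv_approx U X \<eta> \<epsilon> \<omega> y)"

text \<open>The integral is taken over \<^const>\<open>lebesgue\<close> because \<open>H\<close> need only be Lebesgue measurable.\<close>

definition approx_pairing ::
  "'w measure \<Rightarrow> 'a::euclidean_space set \<Rightarrow> ('w \<Rightarrow> ('a \<Rightarrow> real) \<Rightarrow> real) \<Rightarrow>
     ('a \<Rightarrow> real) \<Rightarrow> real \<Rightarrow> real \<Rightarrow> (real \<Rightarrow> real) \<Rightarrow> ('a \<Rightarrow> complex) \<Rightarrow> 'w \<Rightarrow> complex" where
  "approx_pairing M U X \<eta> \<epsilon> \<beta> H \<phi> \<omega> =
     (LINT x:U|lebesgue. \<phi> x *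
        complex_of_real (exp (1/2 * \<beta>\<^sup>2 * approx_cov M U X \<eta> \<epsilon> x x) * H (conv_approx U X \<eta> \<epsilon> \<omega> x)))"

section \<open>Convergence in probability and the cosine of the field\<close>

text \<open>Measurability is required explicitly, since \<^const>\<open>measure\<close> vanishes on nonmeasurable sets. When
  \<open>H\<close> is only Lebesgue measurable, \<open>approx_pairing\<close> is a random variable on the completion of the
  probability space only.\<close>

definition tendsto_in_probability ::
  "'w measure \<Rightarrow> (nat \<Rightarrow> 'w \<Rightarrow> 'b::metric_space) \<Rightarrow> ('w \<Rightarrow> 'b) \<Rightarrow> bool" where
  "tendsto_in_probability M Y Z \<longleftrightarrow>
     (\<forall>n. Y n \<in> borel_measurable M) \<and> Z \<in> borel_measurable M \<and>
     (\<forall>e>0. (\<lambda>n. measure M {\<omega> \<in> space M. e < dist (Y n \<omega>) (Z \<omega>)}) \<longlonglongrightarrow> 0)"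

text \<open>\<open>\<langle>cos(\<beta>X), \<phi>\<rangle>\<close>: the common limit in probability along all convolution approximations. Limits
  in probability are determined only almost surely, hence the choice of a version.\<close>

definition cos_chaos ::
  "'w measure \<Rightarrow> 'a::euclidean_space set \<Rightarrow> ('w \<Rightarrow> ('a \<Rightarrow> real) \<Rightarrow> real) \<Rightarrow> real \<Rightarrow>
     ('a \<Rightarrow> complex) \<Rightarrow> 'w \<Rightarrow> complex" where
  "cos_chaos M U X \<beta> \<phi> =
     (SOME Y. \<forall>\<eta> c. mollifier \<eta> \<longrightarrow> scale_sequence c \<longrightarrow>
        tendsto_in_probability M
          (\<lambda>n. approx_pairing M U X \<eta> (c n) \<beta> (\<lambda>t. cos (\<beta> * t)) \<phi>) Y)"

section \<open>Periodic functions\<close>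

definition periodic :: "real \<Rightarrow> (real \<Rightarrow> real) \<Rightarrow> bool" where
  "periodic T H \<longleftrightarrow> (\<forall>x. H (x + T) = H x)"

definition even_fun :: "(real \<Rightarrow> real) \<Rightarrow> bool" where
  "even_fun H \<longleftrightarrow> (\<forall>x. H (- x) = H x)"

definition mean_zero :: "real \<Rightarrow> (real \<Rightarrow> real) \<Rightarrow> bool" where
  "mean_zero T H \<longleftrightarrow> (LINT x:{0..T}|lebesgue. H x) = 0"

definition locally_integrable :: "(real \<Rightarrow> real) \<Rightarrow> bool" where
  "locally_integrable H \<longleftrightarrow> (\<forall>K. compact K \<longrightarrow> H absolutely_integrable_on K)"

definition fourier_coeff :: "real \<Rightarrow> (real \<Rightarrow> real) \<Rightarrow> int \<Rightarrow> complex" where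
  "fourier_coeff T H k =
     (LINT x:{0..T}|lebesgue. complex_of_real (H x) * cis (- 2 * pi * of_int k * x / T)) / of_real T"

definition abs_convergent_fourier :: "real \<Rightarrow> (real \<Rightarrow> real) \<Rightarrow> bool" where
  "abs_convergent_fourier T H \<longleftrightarrow>
     H absolutely_integrable_on {0..T} \<and>
     (\<lambda>k. norm (fourier_coeff T H k)) summable_on UNIV \<and>
     (\<forall>x. ((\<lambda>k. fourier_coeff T H k * cis (2 * pi * of_int k * x / T))
             has_sum complex_of_real (H x)) UNIV)"

end

theory Submission
  imports Defs
begin

text \<open>
  Expand \<open>H\<close> into cosines \<open>\<Sum>k\<ge>1. a k * cos (k \<beta> t)\<close>; sines and the constant term are absent because \<open>H\<close> is
  even with mean zero. The factor \<open>exp (\<beta>\<^sup>2 C\<^sub>n(x,x) / 2)\<close> is the exact normalisation of the first cosine, while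
  \<open>cos (k \<beta> X\<^sub>n(x))\<close> oscillates so fast for \<open>k \<ge> 2\<close> that its correlations are damped by a power of
  \<open>exp (- C\<^sub>n(x,x))\<close>, which tends to \<open>0\<close> because the variance diverges. Hence only \<open>a 1 * cos (\<beta> X)\<close> survives.

  Everything is measured by second moments. The correlation of two Gaussian cosines is explicit
  (\<open>expectation_cos_cos\<close>), and with the normalising weights it becomes \<open>cosh (\<beta>\<^sup>2 C\<^sub>n(x,y))\<close> for the first
  mode (\<open>weighted_cos_cos\<close>). By the two-sided bounds of \<open>cov_log_bounds\<close> it is dominated by a multiple of
  \<open>|x - y|\<close> to the power \<open>- \<beta>\<^sup>2\<close>, which is integrable as \<open>\<beta>\<^sup>2 < d\<close>. The limit of the mixed moments of two
  approximations does not see the mollifiers or the scales (\<open>cross_limit\<close>), so all approximations of the cosine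
  have one common limit in mean (\<open>cos_limit_exists\<close>, \<open>cos_chaos_limit\<close>). The same domination bounds all modes
  in mean, uniformly in order and scale (\<open>mode_uniform_bound\<close>), and dominated convergence removes the higher
  ones (\<open>higher_mode_vanishes\<close>). If the coefficients are summable, limit and series can be exchanged
  (\<open>summable_cosine_series_limit\<close>).

  For a merely integrable \<open>H\<close> the coefficients are only bounded, by the \<open>L\<^sup>1\<close> norm of \<open>H\<close> over a period. What
  replaces summability is that the modes are almost orthogonal in the plane: the pairings with modes \<open>k\<close> and
  \<open>l\<close> have a correlation of order \<open>exp (- |k - l|) / (k l)\<close>, uniformly in the scale (\<open>mode_kernel_integral\<close>),
  and these numbers have a finite double sum. Two properties of the approximations enter. Their variance changes
  at most linearly in \<open>|x - y| / \<epsilon>\<close> (\<open>variance_oscillation\<close>), which bounds the price of comparing different orders.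
  Their increments satisfy \<open>E (X\<^sub>n(x) - X\<^sub>n(y))\<^sup>2 \<ge> c min (1, |x - y| / \<epsilon>)\<^sup>2\<close>, also with the sign of \<open>X\<^sub>n(y)\<close> reversed
  (\<open>increment_lower\<close>); so high modes decorrelate beyond the distance \<open>\<epsilon> / sqrt (k l)\<close>, and in dimension two the
  pairs of points within that distance give the factor \<open>1 / (k l)\<close>. The lower bound for increments rests on
  writing \<open>- ln r\<close> as a mixture of Gaussians, which makes the energy of a neutral charge a sum of squares.
  Consequently the mean of a cosine polynomial of the field is at most a constant times its largest coefficient
  (\<open>cos_poly_uniform_bound\<close>), hence times its \<open>L\<^sup>1\<close> norm. Approximating \<open>H\<close> in \<open>L\<^sup>1\<close> by cosine polynomials then
  gives a convergence that is uniform in the scale; at each fixed scale the approximation passes to \<open>H\<close> itself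
  because \<open>X\<^sub>n(x)\<close> has a bounded density with exponential tails (\<open>pairing_L1_majorant\<close>).
\<close>

section \<open>Test functions\<close>

lemma C_times_on_affine:
 fixes f :: "'a::euclidean_space => 'b::real_normed_vector"
 assumes "C_times_on k UNIV f"
 shows "C_times_on k UNIV (\<lambda>y. c *\<^sub>R f (t + r *\<^sub>R y))"
 using assms
proof (induction k arbitrary: f c)
 case 0
 then have f: "continuous_on UNIV f" by simp
 have "continuous_on UNIV (\<lambda>y. f (t + r *\<^sub>R y))"
  by (rule continuous_on_compose2[OF f, of UNIV "\<lambda>y. t + r *\<^sub>R y"]) (auto intro!: continuous_intros)
 then show ?case
  by (auto intro!: continuous_intros)
next
 case (Suc k)
 have der: "((\<lambda>y. c *\<^sub>R f (t + r *\<^sub>R y)) has_derivative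
   (\<lambda>v. c *\<^sub>R frechet_derivative f (at (t + r *\<^sub>R y)) (r *\<^sub>R v))) (at y)" for y
 proof -
  have f: "(f has_derivative frechet_derivative f (at (t + r *\<^sub>R y))) (at (t + r *\<^sub>R y))"
   using Suc.prems by (simp add: frechet_derivative_works)
  have "((\<lambda>y. t + r *\<^sub>R y) has_derivative (\<lambda>v. r *\<^sub>R v)) (at y)"
   by (auto intro!: derivative_eq_intros)
  from has_derivative_compose[OF this f] show ?thesis
   by (intro has_derivative_scaleR_right) simp
 qed
 have fd: "frechet_derivative (\<lambda>y. c *\<^sub>R f (t + r *\<^sub>R y)) (at y) v
   = c *\<^sub>R frechet_derivative f (at (t + r *\<^sub>R y)) (r *\<^sub>R v)" for y v
  using frechet_derivative_at[OF der, of y] by metis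
 have "C_times_on k UNIV (\<lambda>y. c *\<^sub>R frechet_derivative f (at (t + r *\<^sub>R y)) (r *\<^sub>R v))" for v
  using Suc.prems by (intro Suc.IH) auto
 then show ?case
  using der by (auto simp: fd differentiable_def)
qed

lemma C_times_on_add:
 fixes f g :: "'a::euclidean_space => 'b::real_normed_vector"
 assumes "C_times_on k UNIV f" "C_times_on k UNIV g"
 shows "C_times_on k UNIV (\<lambda>y. f y + g y)"
 using assms
proof (induction k arbitrary: f g)
 case 0
 then show ?case by (auto intro!: continuous_intros)
next
 case (Suc k)
 have der: "((\<lambda>y. f y + g y) has_derivative
   (\<lambda>v. frechet_derivative f (at y) v + frechet_derivative g (at y) v)) (at y)" for y
  using Suc.prems by (intro has_derivative_add) (simp_all add: frechet_derivative_works)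
 have fd: "frechet_derivative (\<lambda>y. f y + g y) (at y) v
   = frechet_derivative f (at y) v + frechet_derivative g (at y) v" for y v
  using frechet_derivative_at[OF der, of y] by metis
 show ?case
  using Suc der by (auto simp: fd differentiable_def)
qed

lemma test_function_UNIV_iff:
 fixes f :: "'a::euclidean_space => 'b::real_normed_vector"
 shows "test_function UNIV f \<longleftrightarrow> (\<forall>k. C_times_on k UNIV f) \<and> bounded {x. f x \<noteq> 0}"
 unfolding test_function_def fun_support_def by (simp add: compact_closure)

lemma test_function_affine:
 fixes f :: "'a::euclidean_space => 'b::real_normed_vector"
 assumes f: "test_function UNIV f" and r: "r \<noteq> 0"
 shows "test_function UNIV (\<lambda>y. c *\<^sub>R f (t + r *\<^sub>R y))"
proof -
 have "bounded ((\<lambda>x. (1/r) *\<^sub>R (x - t)) ` {x. f x \<noteq> 0})"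
 proof -
  have "bounded {x. f x \<noteq> 0}" using f unfolding test_function_UNIV_iff by blast
  then obtain R where "\<And>x. f x \<noteq> 0 ==> norm x \<le> R" unfolding bounded_iff by blast
  then have "norm (x - t) \<le> R + norm t" if "f x \<noteq> 0" for x
   using order_trans[OF norm_triangle_ineq4[of x t] add_right_mono] that by auto
  then have "norm ((1/r) *\<^sub>R (x - t)) \<le> \<bar>1/r\<bar> * (R + norm t)" if "f x \<noteq> 0" for x
   using that unfolding norm_scaleR by (intro mult_left_mono) auto
  then show ?thesis unfolding bounded_iff by (intro exI[of _ "\<bar>1/r\<bar> * (R + norm t)"]) auto
 qed
 moreover have "{y. c *\<^sub>R f (t + r *\<^sub>R y) \<noteq> 0} \<subseteq> (\<lambda>x. (1/r) *\<^sub>R (x - t)) ` {x. f x \<noteq> 0}"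
 proof
  fix y assume "y \<in> {y. c *\<^sub>R f (t + r *\<^sub>R y) \<noteq> 0}"
  then show "y \<in> (\<lambda>x. (1/r) *\<^sub>R (x - t)) ` {x. f x \<noteq> 0}"
   using r by (intro image_eqI[of _ _ "t + r *\<^sub>R y"]) auto
 qed
 ultimately have "bounded {y. c *\<^sub>R f (t + r *\<^sub>R y) \<noteq> 0}"
  by (rule bounded_subset)
 moreover have "C_times_on k UNIV (\<lambda>y. c *\<^sub>R f (t + r *\<^sub>R y))" for k
  using f unfolding test_function_UNIV_iff by (intro C_times_on_affine[of k f c t r]) blast
 ultimately show ?thesis
  unfolding test_function_UNIV_iff by blast
qed

lemma test_function_add:
 fixes f g :: "'a::euclidean_space => 'b::real_normed_vector"
 assumes "test_function UNIV f" "test_function UNIV g"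
 shows "test_function UNIV (\<lambda>y. f y + g y)"
proof -
 have "bounded ({y. f y \<noteq> 0} \<union> {y. g y \<noteq> 0})"
  using assms by (auto simp: test_function_UNIV_iff)
 then have "bounded {y. f y + g y \<noteq> 0}"
  by (rule bounded_subset) auto
 moreover have "C_times_on k UNIV (\<lambda>y. f y + g y)" for k
  using assms unfolding test_function_UNIV_iff by (intro C_times_on_add[of k f g]) blast+
 ultimately show ?thesis
  unfolding test_function_UNIV_iff by blast
qed

lemma test_function_combination:
 fixes f g :: "'a::euclidean_space => real"
 assumes "test_function UNIV f" "test_function UNIV g"
 shows "test_function UNIV (\<lambda>y. a * f y + b * g y)"
proof -
 have f: "test_function UNIV (\<lambda>y. a *\<^sub>R f (0 + 1 *\<^sub>R y))"
  by (rule test_function_affine[OF assms(1), of 1 a 0]) simp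
 have g: "test_function UNIV (\<lambda>y. b *\<^sub>R g (0 + 1 *\<^sub>R y))"
  by (rule test_function_affine[OF assms(2), of 1 b 0]) simp
 show ?thesis
  using test_function_add[OF f g] by (simp only: add_0 scaleR_one real_scaleR_def)
qed

lemma test_function_deriv:
 fixes f :: "'a::euclidean_space => 'b::real_normed_vector"
 assumes "test_function UNIV f"
 shows "test_function UNIV (\<lambda>x. frechet_derivative f (at x) v)"
proof -
 have ck: "C_times_on (Suc k) UNIV f" and bd: "bounded {x. f x \<noteq> 0}" for k
  using assms unfolding test_function_UNIV_iff by simp_all
 have zero: "frechet_derivative f (at x) v = 0" if x: "x \<notin> closure {x. f x \<noteq> 0}" for x
 proof -
  have "(f has_derivative (\<lambda>_. 0)) (at x)"
  proof (rule has_derivative_transform_within_open)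
   show "((\<lambda>_. 0) has_derivative (\<lambda>_. 0)) (at x)" by simp
   show "open (- closure {x. f x \<noteq> 0})" by auto
   show "x \<in> - closure {x. f x \<noteq> 0}" using x by auto
   show "\<And>y. y \<in> - closure {x. f x \<noteq> 0} ==> 0 = f y"
    using closure_subset[of "{x. f x \<noteq> 0}"] by auto
  qed
  from frechet_derivative_at[OF this] show ?thesis by metis
 qed
 have "bounded (closure {x. f x \<noteq> 0})"
  using bd by (rule bounded_closure)
 then have "bounded {x. frechet_derivative f (at x) v \<noteq> 0}"
  by (rule bounded_subset) (use zero in blast)
 moreover have "C_times_on k UNIV (\<lambda>x. frechet_derivative f (at x) v)" for k
  using ck[of k] unfolding C_times_on.simps by blast
 ultimately show ?thesis
  unfolding test_function_UNIV_iff by blast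
qed

lemma test_function_has_derivative:
 assumes "test_function UNIV f"
 shows "(f has_derivative frechet_derivative f (at x)) (at x)"
proof -
 have "C_times_on (Suc 0) UNIV f" using assms by (auto simp: test_function_UNIV_iff)
 then show ?thesis by (simp add: frechet_derivative_works)
qed

lemma test_function_continuous:
 assumes "test_function UNIV f"
 shows "continuous_on UNIV f"
proof -
 have "C_times_on 0 UNIV f" using assms by (auto simp: test_function_UNIV_iff)
 then show ?thesis by simp
qed

lemma test_function_measurable:
 fixes f :: "'a::euclidean_space => 'b::real_normed_vector"
 assumes "test_function UNIV f"
 shows "f \<in> borel_measurable borel"
 using test_function_continuous[OF assms] by (rule borel_measurable_continuous_onI)

lemma test_function_bounds:
 fixes f :: "'a::euclidean_space => 'b::real_normed_vector"
 assumes "test_function UNIV f"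
 obtains B R where "0 < B" "0 < R" "\<And>x. norm (f x) \<le> B" "\<And>x. R < norm x ==> f x = 0"
proof -
 obtain R where R: "\<And>x. f x \<noteq> 0 ==> norm x \<le> R"
  using assms by (auto simp: test_function_UNIV_iff bounded_iff)
 have "compact (f ` cball 0 R)"
  using test_function_continuous[OF assms] by (intro compact_continuous_image) (auto intro: continuous_on_subset)
 then obtain B where B: "\<And>x. x \<in> cball 0 R ==> norm (f x) \<le> B"
  using compact_imp_bounded[of "f ` cball 0 R"] unfolding bounded_iff by blast
 show ?thesis
 proof (rule that[of "max B 1" "max R 1"])
  show "norm (f x) \<le> max B 1" for x
   using R[of x] B[of x] by (cases "f x = 0") auto
  show "f x = 0" if "max R 1 < norm x" for x using R[of x] that by force
 qed auto
qed

lemma integrable_bounded_support: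
 fixes f :: "'a::euclidean_space => 'b::{banach, second_countable_topology}"
 assumes [measurable]: "f \<in> borel_measurable borel"
  and B: "\<And>x. norm (f x) \<le> B" and R: "\<And>x. R < norm x ==> f x = 0"
 shows "integrable lborel f"
proof (rule Bochner_Integration.integrable_bound)
 show "integrable lborel (\<lambda>x. B * indicator (cball 0 R) x :: real)"
  using emeasure_lborel_cball_finite[of 0 R] by (auto intro!: integrable_mult_right)
 show "AE x in lborel. norm (f x) \<le> norm (B * indicator (cball 0 R) x :: real)"
 proof (rule AE_I2)
  fix x show "norm (f x) \<le> norm (B * indicator (cball 0 R) x :: real)"
   using B[of x] R[of x] norm_ge_zero[of "f x"] by (auto simp: indicator_def)
 qed
qed auto

lemma test_function_integrable:
 fixes f :: "'a::euclidean_space => 'b::{banach, second_countable_topology}"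
 assumes "test_function UNIV f"
 shows "integrable lborel f"
proof -
 obtain B R where "\<And>x. norm (f x) \<le> B" "\<And>x. R < norm x ==> f x = 0"
  using test_function_bounds[OF assms] by metis
 then show ?thesis
  by (intro integrable_bounded_support[where B=B and R=R] test_function_measurable assms)
qed

lemma test_function_Lipschitz:
 fixes f :: "'a::euclidean_space => real"
 assumes f: "test_function UNIV f"
 obtains L where "0 < L" "\<And>x y. \<bar>f x - f y\<bar> \<le> L * norm (x - y)"
proof -
 have "\<exists>B. \<forall>x. \<bar>frechet_derivative f (at x) b\<bar> \<le> B" for b
  using test_function_bounds[OF test_function_deriv[OF f, of b]] by (metis real_norm_def)
 then obtain B where B: "\<And>b x. \<bar>frechet_derivative f (at x) b\<bar> \<le> B b"
  by metis
 define L where "L = (\<Sum>b\<in>Basis. B b) + 1"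
 have B0: "0 \<le> B b" for b using order_trans[OF abs_ge_zero B] .
 have "0 < L" unfolding L_def using sum_nonneg[of Basis B] B0 by (smt (verit))
 moreover have "onorm (frechet_derivative f (at x)) \<le> L" for x
 proof -
  have bl: "bounded_linear (frechet_derivative f (at x))"
   using test_function_has_derivative[OF f] by (rule has_derivative_bounded_linear)
  show ?thesis
  proof (rule onorm_le)
   fix v :: 'a
   have "frechet_derivative f (at x) v = (\<Sum>b\<in>Basis. (v \<bullet> b) *\<^sub>R frechet_derivative f (at x) b)"
    using Linear_Algebra.linear_componentwise[of "frechet_derivative f (at x)" v 1] bl
    by (simp add: bounded_linear.linear)
   also have "\<bar>\<dots>\<bar> \<le> (\<Sum>b\<in>Basis. norm v * B b)"
    using B Basis_le_norm
    by (intro order_trans[OF sum_abs] sum_mono) (auto simp: abs_mult intro!: mult_mono)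
   also have "\<dots> \<le> L * norm v" unfolding L_def
    by (simp add: sum_distrib_right[symmetric] algebra_simps)
   finally show "norm (frechet_derivative f (at x) v) \<le> L * norm v" by simp
  qed
 qed
 then have "norm (f x - f y) \<le> L * norm (x - y)" for x y
  using test_function_has_derivative[OF f]
  by (intro differentiable_bound[of UNIV]) auto
 ultimately show ?thesis using that by auto
qed

lemma mollifier_test_function:
 assumes "mollifier \<eta>" shows "test_function UNIV \<eta>"
 using assms by (simp add: mollifier_def test_function_def)

lemma test_function_translate:
 fixes f :: "'a::euclidean_space => real"
 assumes "test_function UNIV f"
 shows "test_function UNIV (\<lambda>y. f (x - y))"
 using test_function_affine[OF assms, of "-1" 1 x] by simp

lemma test_function_rescale:
 fixes \<eta> :: "'a::euclidean_space => real"
 assumes "mollifier \<eta>" "0 < e"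
 shows "test_function UNIV (rescale \<eta> e)"
proof -
 have "test_function UNIV (\<lambda>x. (1 / e ^ DIM('a)) *\<^sub>R \<eta> (0 + (1/e) *\<^sub>R x))"
  using assms(2) by (intro test_function_affine[OF mollifier_test_function[OF assms(1)]]) simp
 moreover have "(\<lambda>x. (1 / e ^ DIM('a)) *\<^sub>R \<eta> (0 + (1/e) *\<^sub>R x)) = rescale \<eta> e"
  by (rule ext) (simp add: rescale_def inverse_eq_divide)
 ultimately show ?thesis by simp
qed

section \<open>Integrals of powers of the norm\<close>

lemma nn_integral_lborel_affine:
 fixes f :: "'a::euclidean_space => ennreal"
 assumes [measurable]: "f \<in> borel_measurable borel" and "c \<noteq> 0"
 shows "(\<integral>\<^sup>+x. f x \<partial>lborel) = \<bar>c\<bar>^DIM('a) * (\<integral>\<^sup>+x. f (t + c *\<^sub>R x) \<partial>lborel)"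
 by (subst lborel_affine[OF assms(2), of t])
   (simp add: nn_integral_density nn_integral_distr nn_integral_cmult ennreal_power)

text \<open>On each shell the integrand is bounded by \<open>b n\<close> and the volume by a multiple of the
  \<open>d\<close>-th power of \<open>r n\<close>; the origin is a null set.\<close>

lemma nn_integral_shells:
 fixes h :: "'a::euclidean_space => ennreal"
 assumes [measurable]: "h \<in> borel_measurable borel"
  and b: "\<And>n x. x \<in> S n ==> h x \<le> ennreal (b n)" and b0: "\<And>n. 0 \<le> b n"
  and S: "\<And>n. S n \<subseteq> ball 0 (r n)" and r0: "\<And>n. 0 \<le> r n"
  and cover: "\<And>x. x \<notin> (\<Union>n. S n) ==> x \<noteq> 0 ==> h x = 0"
  and sm: "summable (\<lambda>n. b n * r n ^ DIM('a))"
 shows "(\<integral>\<^sup>+x. h x \<partial>lborel) < \<infinity>"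
proof -
 have "(\<integral>\<^sup>+x. h x \<partial>lborel) \<le> (\<integral>\<^sup>+x. (\<Sum>n. ennreal (b n) * indicator (ball (0::'a) (r n)) x) \<partial>lborel)"
 proof (rule nn_integral_mono_AE)
  have "AE x in lborel. x \<noteq> (0::'a)" by (rule AE_lborel_singleton)
  then show "AE x in lborel. h x \<le> (\<Sum>n. ennreal (b n) * indicator (ball 0 (r n)) x)"
  proof eventually_elim
   case (elim x)
   show ?case
   proof (cases "x \<in> (\<Union>n. S n)")
    case True
    then obtain n where n: "x \<in> S n" by auto
    have "h x \<le> ennreal (b n) * indicator (ball 0 (r n)) x"
     using b[OF n] S[of n] n by (auto simp: indicator_def)
    also have "\<dots> \<le> (\<Sum>n. ennreal (b n) * indicator (ball 0 (r n)) x)"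
    proof -
     have "sum F {n} \<le> suminf F" for F :: "nat => ennreal" by (intro sum_le_suminf) auto
     then have "F n \<le> suminf F" for F :: "nat => ennreal" by simp
     then show ?thesis .
    qed
    finally show ?thesis .
   qed (use cover[of x] elim in simp)
  qed
 qed
 also have "\<dots> = (\<Sum>n. ennreal (b n) * emeasure lborel (ball (0::'a) (r n)))"
 proof (subst nn_integral_suminf)
  show "(\<lambda>x. ennreal (b i) * indicator (ball (0::'a) (r i)) x) \<in> borel_measurable lborel" for i
   by (intro borel_measurable_times_ennreal borel_measurable_const borel_measurable_indicator) simp
 qed (simp add: nn_integral_cmult_indicator)
 also have "\<dots> = (\<Sum>n. ennreal (unit_ball_vol DIM('a) * (b n * r n ^ DIM('a))))"
  using r0 b0 by (intro suminf_cong) (auto simp: emeasure_ball ennreal_mult[symmetric] mult_ac)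
 also have "\<dots> < \<infinity>"
  using sm r0 b0 by (subst suminf_ennreal2) (auto intro!: mult_nonneg_nonneg)
 finally show ?thesis .
qed

text \<open>The punctured ball is cut into dyadic shells, on which the negative power grows more slowly than
  the volume shrinks.\<close>

lemma nn_integral_norm_powr_ball:
 fixes R s :: real
 assumes "0 < R" "0 \<le> s" "s < DIM('a)"
 shows "(\<integral>\<^sup>+x. ennreal (norm (x::'a::euclidean_space) powr - s) * indicator (ball 0 R) x \<partial>lborel) < \<infinity>"
proof -
 define S where "S n = {x::'a. R / 2 ^ Suc n \<le> norm x \<and> norm x < R / 2 ^ n}" for n
 let ?b = "\<lambda>n::nat. (R / 2 ^ Suc n) powr - s" and ?r = "\<lambda>n::nat. R / 2 ^ n"
 have pw: "((1/2) ^ n) powr a = ((1/2) powr a) ^ n" for a :: real and n :: nat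
 proof (induction n)
  case (Suc n)
  have "((1/2) ^ Suc n) powr a = ((1/2) * (1/2) ^ n) powr a" by (simp only: power_Suc)
  also have "\<dots> = (1/2) powr a * ((1/2) powr a) ^ n"
   unfolding Suc.IH[symmetric] by (rule powr_mult)
  finally show ?case by (simp only: power_Suc)
 qed simp
 have eq: "?b n * ?r n ^ DIM('a) = (2 powr s * R powr (DIM('a) - s)) * ((1/2) powr (DIM('a) - s)) ^ n" for n
 proof -
  define q where "q = R / 2 ^ n"
  have q: "0 < q" "q = R * (1/2) ^ n" using assms by (simp_all add: q_def power_divide)
  have "?b n * ?r n ^ DIM('a) = (q / 2) powr - s * q powr DIM('a)"
  proof -
   have e: "R / 2 ^ Suc n = q / 2" by (simp add: q_def)
   show ?thesis unfolding e q_def[symmetric] powr_realpow[OF q(1)] ..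
  qed
  also have "\<dots> = 2 powr s * (q powr - s * q powr DIM('a))"
   using q(1) by (simp add: powr_divide powr_minus field_simps)
  also have "q powr - s * q powr DIM('a) = q powr (DIM('a) - s)"
   by (simp add: powr_add[symmetric])
  also have "\<dots> = R powr (DIM('a) - s) * ((1/2) powr (DIM('a) - s)) ^ n"
   using assms unfolding q(2) by (subst powr_mult) (simp_all only: pw)
  finally show ?thesis by (simp only: mult.assoc)
 qed
 have lt1: "(1/2) powr (DIM('a) - s) < 1"
  using assms powr_less_mono'[of "1/2" 0 "DIM('a) - s"] by simp
 show ?thesis
 proof (rule nn_integral_shells[where S=S and b="?b" and r="?r"])
  show "summable (\<lambda>n. ?b n * ?r n ^ DIM('a))"
   unfolding eq using lt1 by (intro summable_mult summable_geometric) auto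
  show "S n \<subseteq> ball 0 (?r n)" for n by (auto simp: S_def)
  show "ennreal (norm x powr - s) * indicator (ball 0 R) x \<le> ennreal (?b n)" if "x \<in> S n" for n x
   using that assms by (auto simp: S_def indicator_def intro!: ennreal_leI powr_mono2')
  show "ennreal (norm x powr - s) * indicator (ball 0 R) x = 0"
   if "x \<notin> (\<Union>n. S n)" "x \<noteq> 0" for x
  proof (rule ccontr)
   assume "\<not> ?thesis"
   then have x: "norm x < R" by (auto simp: indicator_def split: if_splits)
   have "\<exists>n. R / 2 ^ n \<le> norm x"
   proof -
    obtain n where "R / norm x < 2 ^ n" using real_arch_pow[of 2] by auto
    then show ?thesis using that(2) by (intro exI[of _ n]) (simp add: field_simps)
   qed
   then obtain n where n: "R / 2 ^ n \<le> norm x" "\<And>m. m < n ==> \<not> R / 2 ^ m \<le> norm x"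
    using exists_least_iff[of "\<lambda>n. R / 2 ^ n \<le> norm x"] by auto
   with x obtain m where m: "n = Suc m" by (cases n) auto
   then have "x \<in> S m" using n(1) n(2)[of m] by (auto simp: S_def)
   with that show False by auto
  qed
  have [measurable]: "ball (0::'a) R \<in> sets borel" by simp
  show "(\<lambda>x. ennreal (norm x powr - s) * indicator (ball (0::'a) R) x) \<in> borel_measurable borel"
   by measurable
 qed (use assms in simp_all)
qed

lemma nn_integral_norm_decay:
 fixes p :: nat
 assumes "DIM('a) + 2 \<le> p"
 shows "(\<integral>\<^sup>+x. ennreal (1 / (1 + norm (x::'a::euclidean_space)) ^ p) \<partial>lborel) < \<infinity>"
proof (rule nn_integral_shells)
 define S where "S n = {x::'a. n \<le> norm x \<and> norm x < n + 1}" for n :: nat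
 show "ennreal (1 / (1 + norm x) ^ p) \<le> ennreal (1 / (1 + real n) ^ p)" if "x \<in> S n" for n x
  using that by (auto simp: S_def intro!: ennreal_leI divide_left_mono power_mono)
 show "S n \<subseteq> ball 0 (real n + 1)" for n by (auto simp: S_def)
 show "ennreal (1 / (1 + norm x) ^ p) = 0" if "x \<notin> (\<Union>n. S n)" for x
 proof -
  have "x \<in> S (nat \<lfloor>norm x\<rfloor>)"
  proof -
   have "real (nat \<lfloor>norm x\<rfloor>) = real_of_int \<lfloor>norm x\<rfloor>" by simp
   then show ?thesis unfolding S_def mem_Collect_eq by linarith
  qed
  with that show ?thesis by auto
 qed
 show "summable (\<lambda>n::nat. 1 / (1 + real n) ^ p * (real n + 1) ^ DIM('a))"
 proof (rule summable_comparison_test')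
  show "summable (\<lambda>n::nat. 1 / (real (Suc n)) ^ 2)"
  proof -
   have "summable (\<lambda>n::nat. inverse (real n ^ 2))"
    using inverse_power_summable[of 2, where 'a=real] by (simp add: power_inverse)
   then have "summable (\<lambda>n::nat. inverse (real (Suc n) ^ 2))"
    by (subst summable_Suc_iff[of "\<lambda>n. inverse (real n ^ 2)"])
   then show ?thesis by (simp only: inverse_eq_divide)
  qed
  fix n :: nat assume "0 \<le> n"
  have "(real n + 1) ^ DIM('a) * (real n + 1) ^ 2 = (1 + real n) ^ (DIM('a) + 2)"
   by (simp only: power_add add.commute)
  also have "\<dots> \<le> (1 + real n) ^ p"
   using assms by (intro power_increasing) auto
  finally have "(real n + 1) ^ DIM('a) * (real n + 1) ^ 2 \<le> (1 + real n) ^ p" .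
  then show "norm (1 / (1 + real n) ^ p * (real n + 1) ^ DIM('a)) \<le> 1 / real (Suc n) ^ 2"
   by (simp add: field_simps)
 qed
 show "(\<lambda>x. ennreal (1 / (1 + norm x) ^ p)) \<in> borel_measurable borel" by measurable
qed simp_all

lemma integrable_norm_decay:
 assumes "DIM('a) + 2 \<le> p"
 shows "integrable lborel (\<lambda>x::'a::euclidean_space. 1 / (1 + norm x) ^ p)"
 using nn_integral_norm_decay[OF assms]
 by (intro integrableI_nonneg) auto

section \<open>Pairing a negative-order Sobolev distribution with test functions\<close>

lemma lborel_integral_affine:
 fixes f :: "'a::euclidean_space => 'b::{banach, second_countable_topology}"
 assumes [measurable]: "f \<in> borel_measurable borel" and c: "c \<noteq> 0"
 shows "(LINT x|lborel. f x) = \<bar>c\<bar>^DIM('a) *\<^sub>R (LINT x|lborel. f (t + c *\<^sub>R x))"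
proof -
 have "(LINT x|lborel. f x)
   = (LINT x|density (distr lborel borel (\<lambda>x. t + c *\<^sub>R x)) (\<lambda>_. ennreal (\<bar>c\<bar>^DIM('a))). f x)"
  using lborel_affine[OF c, of t] by simp
 also have "\<dots> = (LINT x|distr lborel borel (\<lambda>x. t + c *\<^sub>R x). \<bar>c\<bar>^DIM('a) *\<^sub>R f x)"
  by (rule integral_density) auto
 also have "\<dots> = (LINT x|lborel. \<bar>c\<bar>^DIM('a) *\<^sub>R f (t + c *\<^sub>R x))"
  by (rule integral_distr) auto
 finally show ?thesis by simp
qed

lemma lborel_integrable_affine:
 fixes f :: "'a::euclidean_space => 'b::{banach, second_countable_topology}"
 assumes f: "integrable lborel f" and c: "c \<noteq> 0"
 shows "integrable lborel (\<lambda>x. f (t + c *\<^sub>R x))"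
proof -
 have [measurable]: "f \<in> borel_measurable borel" using f by simp
 have "(\<integral>\<^sup>+x. norm (f x) \<partial>lborel) = ennreal \<bar>c\<bar>^DIM('a) * (\<integral>\<^sup>+x. norm (f (t + c *\<^sub>R x)) \<partial>lborel)"
  by (subst nn_integral_lborel_affine[where t=t, OF _ c]) (auto simp: ennreal_power)
 moreover have "(\<integral>\<^sup>+x. norm (f x) \<partial>lborel) < \<infinity>"
  using f unfolding integrable_iff_bounded by blast
 ultimately have "(\<integral>\<^sup>+x. norm (f (t + c *\<^sub>R x)) \<partial>lborel) < \<infinity>"
  using c by (auto simp: ennreal_mult_less_top ennreal_power)
 then show ?thesis
  unfolding integrable_iff_bounded by (simp add: measurable_compose)
qed

lemma cis_measurable [measurable]: "cis \<in> borel_measurable borel"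
 by (rule borel_measurable_continuous_onI) (auto intro!: continuous_intros)

definition fourier :: "('a::euclidean_space => real) => 'a => complex" where
 "fourier f \<xi> = (LINT x|lborel. complex_of_real (f x) * cis (2 * pi * (x \<bullet> \<xi>)))"

lemma fourier_measurable:
 assumes "test_function UNIV f"
 shows "fourier f \<in> borel_measurable borel"
proof -
 have [measurable]: "f \<in> borel_measurable borel" using assms by (rule test_function_measurable)
 show ?thesis unfolding fourier_def[abs_def] by measurable
qed

lemma fourier_integrable:
 assumes "test_function UNIV f"
 shows "integrable lborel (\<lambda>x. complex_of_real (f x) * cis (2 * pi * (x \<bullet> \<xi>)))"
proof -
 have [measurable]: "f \<in> borel_measurable borel" using assms by (rule test_function_measurable)
 show ?thesis
  by (rule Bochner_Integration.integrable_bound[OF test_function_integrable[OF assms]])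
    (auto simp: norm_mult)
qed

lemma fourier_translate:
 assumes f: "test_function UNIV f"
 shows "fourier (\<lambda>x. f (x + v)) \<xi> = cis (- 2 * pi * (v \<bullet> \<xi>)) * fourier f \<xi>"
proof -
 have [measurable]: "f \<in> borel_measurable borel" using f by (rule test_function_measurable)
 have "fourier (\<lambda>x. f (x + v)) \<xi>
   = (LINT x|lborel. complex_of_real (f x) * cis (2 * pi * ((x - v) \<bullet> \<xi>)))"
  unfolding fourier_def
  by (subst lborel_integral_affine[where c=1 and t="- v"]) (simp_all add: algebra_simps)
 also have "\<dots> = (LINT x|lborel. cis (- 2 * pi * (v \<bullet> \<xi>)) * (complex_of_real (f x) * cis (2 * pi * (x \<bullet> \<xi>))))"
  by (intro Bochner_Integration.integral_cong refl) (simp add: cis_mult algebra_simps)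
 finally show ?thesis unfolding fourier_def by simp
qed

text \<open>Difference quotients of \<open>f\<close> have Fourier transforms that are explicit multiples of that of \<open>f\<close>;
  letting the increment tend to \<open>0\<close> replaces an integration by parts.\<close>

lemma fourier_deriv_lower:
 fixes f :: "'a::euclidean_space => real"
 assumes f: "test_function UNIV f"
 shows "2 * pi * \<bar>b \<bullet> \<xi>\<bar> * norm (fourier f \<xi>) \<le> norm (fourier (\<lambda>x. frechet_derivative f (at x) b) \<xi>)"
proof -
 let ?D = "\<lambda>x. frechet_derivative f (at x) b"
 have [measurable]: "f \<in> borel_measurable borel" using f by (rule test_function_measurable)
 have [measurable]: "?D \<in> borel_measurable borel"
  using f by (intro test_function_measurable test_function_deriv)
 obtain L where L: "0 < L" "\<And>x y. \<bar>f x - f y\<bar> \<le> L * norm (x - y)"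
  using test_function_Lipschitz[OF f] by metis
 obtain B R where R: "0 < R" "\<And>x. R < norm x ==> f x = 0"
  using test_function_bounds[OF f] by metis
 define t where "t n = 1 / real (Suc n)" for n
 have t: "0 < t n" "t n \<le> 1" for n by (auto simp: t_def)
 have t0: "t \<longlonglongrightarrow> 0" unfolding t_def by (rule LIMSEQ_Suc[OF lim_1_over_n])
 define h where "h n x = (f (x + t n *\<^sub>R b) - f x) / t n" for n x
 have [measurable]: "h n \<in> borel_measurable borel" for n unfolding h_def by measurable
 have lim: "(\<lambda>n. h n x) \<longlonglongrightarrow> ?D x" for x
 proof -
  have "((\<lambda>s. f (x + s *\<^sub>R b)) has_derivative (\<lambda>s. frechet_derivative f (at x) (s *\<^sub>R b))) (at 0)"
  proof (rule has_derivative_compose[where g=f and f="\<lambda>s. x + s *\<^sub>R b"])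
   show "((\<lambda>s. x + s *\<^sub>R b) has_derivative (\<lambda>s. s *\<^sub>R b)) (at 0)"
    by (auto intro!: derivative_eq_intros)
   show "(f has_derivative frechet_derivative f (at x)) (at (x + 0 *\<^sub>R b))"
    using test_function_has_derivative[OF f, of x] by simp
  qed
  moreover have "frechet_derivative f (at x) (s *\<^sub>R b) = ?D x * s" for s
   using linear_scale[OF bounded_linear.linear[OF has_derivative_bounded_linear[OF test_function_has_derivative[OF f, of x]]], of s b]
   by simp
  then have "(\<lambda>s. frechet_derivative f (at x) (s *\<^sub>R b)) = (*) (?D x)"
   by (intro ext)
  ultimately have "((\<lambda>s. f (x + s *\<^sub>R b)) has_field_derivative ?D x) (at 0)"
   unfolding has_field_derivative_def by simp
  then have *: "((\<lambda>s. (f (x + s *\<^sub>R b) - f x) / s) \<longlongrightarrow> ?D x) (at 0)"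
   by (simp add: has_field_derivative_iff)
  have "filterlim t (at 0) sequentially"
   using t0 t(1) by (auto simp: filterlim_at intro!: always_eventually less_imp_neq[symmetric])
  from filterlim_compose[OF * this] show ?thesis unfolding h_def .
 qed
 let ?w = "\<lambda>n x. complex_of_real (h n x) * cis (2 * pi * (x \<bullet> \<xi>))"
 have conv: "(\<lambda>n. LINT x|lborel. ?w n x) \<longlonglongrightarrow> fourier ?D \<xi>"
  unfolding fourier_def
 proof (rule integral_dominated_convergence)
  show "integrable lborel (\<lambda>x::'a. L * norm b * indicator (cball 0 (R + norm b)) x :: real)"
   using emeasure_lborel_cball_finite[of "0::'a" "R + norm b"] by (auto intro!: integrable_mult_right)
  show "AE x in lborel. (\<lambda>n. ?w n x) \<longlonglongrightarrow> complex_of_real (?D x) * cis (2 * pi * (x \<bullet> \<xi>))"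
   using lim by (auto intro!: AE_I2 tendsto_mult tendsto_of_real tendsto_const)
  fix n
  show "AE x in lborel. norm (?w n x) \<le> L * norm b * indicator (cball 0 (R + norm b)) x"
  proof (rule AE_I2)
   fix x :: 'a
   have "\<bar>f (x + t n *\<^sub>R b) - f x\<bar> \<le> L * (t n * norm b)"
    using L(2)[of "x + t n *\<^sub>R b" x] t(1)[of n] by simp
   then have "\<bar>h n x\<bar> \<le> L * norm b"
    using t(1)[of n] by (simp add: h_def abs_divide divide_le_eq mult_ac)
   moreover have "h n x = 0" if "R + norm b < norm x"
   proof -
    have "norm (t n *\<^sub>R b) \<le> norm b" using t[of n] by (simp add: mult_left_le_one_le)
    then have "R < norm (x + t n *\<^sub>R b)" using that norm_diff_ineq[of x "t n *\<^sub>R b"] by linarith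
    moreover have "R < norm x" using that norm_ge_zero[of b] by linarith
    ultimately show ?thesis using R(2) by (simp add: h_def)
   qed
   ultimately show "norm (?w n x) \<le> L * norm b * indicator (cball 0 (R + norm b)) x"
    by (auto simp: norm_mult indicator_def not_le)
  qed
 qed measurable
 define \<theta> where "\<theta> = 2 * pi * (b \<bullet> \<xi>)"
 have eq: "(LINT x|lborel. ?w n x) = (cis (- \<theta> * t n) - 1) / t n * fourier f \<xi>" for n
 proof -
  have tr: "test_function UNIV (\<lambda>x. f (x + t n *\<^sub>R b))"
   using test_function_affine[OF f, of 1 1 "t n *\<^sub>R b"] by (simp add: add.commute)
  have "(LINT x|lborel. ?w n x) = (LINT x|lborel. (1 / t n) *
    (complex_of_real (f (x + t n *\<^sub>R b)) * cis (2 * pi * (x \<bullet> \<xi>)) - complex_of_real (f x) * cis (2 * pi * (x \<bullet> \<xi>))))"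
   by (intro Bochner_Integration.integral_cong refl) (simp add: h_def algebra_simps diff_divide_distrib)
  also have "\<dots> = (1 / t n) * (fourier (\<lambda>x. f (x + t n *\<^sub>R b)) \<xi> - fourier f \<xi>)"
   unfolding fourier_def
   by (subst integral_mult_right_zero, subst Bochner_Integration.integral_diff)
     (use fourier_integrable[OF f] fourier_integrable[OF tr] in auto)
  also have "\<dots> = (cis (- \<theta> * t n) - 1) / t n * fourier f \<xi>"
   unfolding fourier_translate[OF f] by (simp add: \<theta>_def algebra_simps diff_divide_distrib)
  finally show ?thesis .
 qed
 have lower: "(\<bar>\<theta>\<bar> - \<theta>\<^sup>2 / 2 * t n) * norm (fourier f \<xi>) \<le> norm (LINT x|lborel. ?w n x)" for n
 proof -
  define x where "x = - \<theta> * t n"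
  have "cmod (iexp x - (\<Sum>k \<le> 1. (\<i> * x)^k / fact k)) \<le> \<bar>x\<bar>^(Suc 1) / fact (Suc 1)"
   by (rule iexp_approx1)
  then have "cmod ((cis x - 1) - \<i> * x) \<le> x\<^sup>2 / 2"
   by (simp add: cis_conv_exp numeral_2_eq_2 algebra_simps)
  moreover have "cmod (\<i> * x) = \<bar>\<theta>\<bar> * t n" using t(1)[of n] by (simp add: x_def norm_mult abs_mult)
  moreover have "cmod (\<i> * x) - cmod (cis x - 1) \<le> cmod ((cis x - 1) - \<i> * x)"
   by (metis norm_minus_commute norm_triangle_ineq2)
  ultimately have "\<bar>\<theta>\<bar> * t n - x\<^sup>2 / 2 \<le> cmod (cis x - 1)" by linarith
  then have "(\<bar>\<theta>\<bar> * t n - x\<^sup>2 / 2) / t n \<le> cmod (cis x - 1) / t n"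
   using t(1)[of n] by (intro divide_right_mono) auto
  moreover have "(\<bar>\<theta>\<bar> * t n - x\<^sup>2 / 2) / t n = \<bar>\<theta>\<bar> - \<theta>\<^sup>2 / 2 * t n"
   using t(1)[of n] by (simp add: x_def field_simps power2_eq_square)
  ultimately have "\<bar>\<theta>\<bar> - \<theta>\<^sup>2 / 2 * t n \<le> cmod ((cis x - 1) / t n)"
   using t(1)[of n] by (simp add: norm_divide)
  then show ?thesis
   unfolding eq norm_mult x_def by (intro mult_right_mono) auto
 qed
 have "(\<lambda>n. (\<bar>\<theta>\<bar> - \<theta>\<^sup>2 / 2 * t n) * norm (fourier f \<xi>)) \<longlonglongrightarrow> (\<bar>\<theta>\<bar> - \<theta>\<^sup>2 / 2 * 0) * norm (fourier f \<xi>)"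
  by (intro tendsto_intros t0)
 from LIMSEQ_le[OF this tendsto_norm[OF conv]] lower
 show ?thesis by (auto simp: \<theta>_def abs_mult)
qed

text \<open>Each derivative in a coordinate direction gains one power of the frequency.\<close>

lemma fourier_decay:
 fixes f :: "'a::euclidean_space => real"
 assumes "test_function UNIV f"
 shows "\<exists>C. \<forall>\<xi>. (1 + norm \<xi>) ^ N * norm (fourier f \<xi>) \<le> C"
 using assms
proof (induction N arbitrary: f)
 case 0
 have "norm (fourier f \<xi>) \<le> (LINT x|lborel. \<bar>f x\<bar>)" for \<xi>
  unfolding fourier_def by (rule order_trans[OF integral_norm_bound]) (simp add: norm_mult)
 then show ?case by auto
next
 case (Suc N)
 let ?D = "\<lambda>b x. frechet_derivative f (at x) b"
 obtain C0 where C0: "\<And>\<xi>. (1 + norm \<xi>) ^ N * norm (fourier f \<xi>) \<le> C0"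
  using Suc by blast
 have "\<exists>C. \<forall>\<xi>. (1 + norm \<xi>) ^ N * norm (fourier (?D b) \<xi>) \<le> C" for b
  using Suc.IH[OF test_function_deriv[OF Suc.prems]] .
 then obtain C where C: "\<And>b \<xi>. (1 + norm \<xi>) ^ N * norm (fourier (?D b) \<xi>) \<le> C b" by metis
 have "(1 + norm \<xi>) ^ Suc N * norm (fourier f \<xi>) \<le> C0 + (\<Sum>b\<in>Basis. C b)" for \<xi>
 proof -
  let ?n = "norm (fourier f \<xi>)" and ?p = "(1 + norm \<xi>) ^ N"
  have "norm \<xi> * ?n \<le> (\<Sum>b\<in>Basis. \<bar>\<xi> \<bullet> b\<bar>) * ?n"
   by (intro mult_right_mono norm_le_l1) auto
  also have "\<dots> \<le> (\<Sum>b\<in>Basis. norm (fourier (?D b) \<xi>))"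
   unfolding sum_distrib_right
  proof (intro sum_mono)
   fix b :: 'a
   have "1 * (\<bar>\<xi> \<bullet> b\<bar> * ?n) \<le> (2 * pi) * (\<bar>\<xi> \<bullet> b\<bar> * ?n)"
    using pi_gt3 by (intro mult_right_mono) auto
   also have "\<dots> \<le> norm (fourier (?D b) \<xi>)"
    using fourier_deriv_lower[OF Suc.prems, of b \<xi>] by (simp add: inner_commute mult.assoc)
   finally show "\<bar>\<xi> \<bullet> b\<bar> * ?n \<le> norm (fourier (?D b) \<xi>)" by simp
  qed
  finally have "?p * (norm \<xi> * ?n) \<le> ?p * (\<Sum>b\<in>Basis. norm (fourier (?D b) \<xi>))"
   by (intro mult_left_mono) auto
  also have "\<dots> \<le> (\<Sum>b\<in>Basis. C b)"
   unfolding sum_distrib_left by (intro sum_mono C)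
  finally show ?thesis using C0[of \<xi>] by (simp add: algebra_simps)
 qed
 then show ?case by blast
qed

text \<open>The Cauchy-Schwarz inequality in frequency space: the weight of the Sobolev norm is compensated by
  the fast decay of the Fourier transform of a test function.\<close>

lemma sobolev_pairing:
 fixes u :: "('a::euclidean_space => real) => real"
 assumes "in_sobolev (- 1) u"
 obtains F :: "'a => complex" where "F \<in> borel_measurable borel"
  "\<And>f. test_function UNIV f ==> integrable lborel (\<lambda>\<xi>. F \<xi> * fourier f \<xi>)"
  "\<And>f. test_function UNIV f ==> complex_of_real (u f) = (LINT \<xi>|lborel. F \<xi> * fourier f \<xi>)"
proof -
 obtain F :: "'a => complex" where F[measurable]: "F \<in> borel_measurable borel"
  and int: "integrable lborel (\<lambda>\<xi>. (1 + (norm \<xi>)\<^sup>2) powr - 1 * (cmod (F \<xi>))\<^sup>2)"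
  and eq: "\<And>f. test_function UNIV f ==> complex_of_real (u f) = (LINT \<xi>|lborel. F \<xi> * fourier f \<xi>)"
  using assms unfolding in_sobolev_def fourier_def by blast
 show ?thesis
 proof (rule that[OF F _ eq])
  fix f :: "'a => real" assume f: "test_function UNIV f"
  let ?N = "DIM('a) + 2"
  obtain C where C: "\<And>\<xi>. (1 + norm \<xi>) ^ ?N * norm (fourier f \<xi>) \<le> C"
   using fourier_decay[OF f] by blast
  have [measurable]: "fourier f \<in> borel_measurable borel" using f by (rule fourier_measurable)
  show "integrable lborel (\<lambda>\<xi>. F \<xi> * fourier f \<xi>)"
  proof (rule Bochner_Integration.integrable_bound)
   show "integrable lborel (\<lambda>\<xi>::'a. (1 + (norm \<xi>)\<^sup>2) powr - 1 * (cmod (F \<xi>))\<^sup>2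
     + C\<^sup>2 * (1 / (1 + norm \<xi>) ^ ?N))"
    by (intro Bochner_Integration.integrable_add int integrable_mult_right integrable_norm_decay) simp
   show "AE \<xi> in lborel. norm (F \<xi> * fourier f \<xi>) \<le> norm ((1 + (norm \<xi>)\<^sup>2) powr - 1 * (cmod (F \<xi>))\<^sup>2
     + C\<^sup>2 * (1 / (1 + norm \<xi>) ^ ?N))"
   proof (rule AE_I2)
    fix \<xi> :: 'a
    define n s a b where "n = norm \<xi>" and "s = 1 + n\<^sup>2" and "a = cmod (F \<xi>)" and "b = norm (fourier f \<xi>)"
    have n0: "0 \<le> n" by (simp add: n_def)
    have s: "0 < s" by (simp add: s_def add_pos_nonneg)
    have "s \<le> (1 + n)\<^sup>2" using n0 by (simp add: s_def power2_sum)
    have "0 \<le> (a / sqrt s - b * sqrt s)\<^sup>2 + a * b * 1 * 1 + 0"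
     by (simp add: a_def b_def)
    also have "(a / sqrt s - b * sqrt s)\<^sup>2 = a\<^sup>2 / s + b\<^sup>2 * s - 2 * a * b"
     using s by (simp add: power2_diff power_divide power_mult_distrib)
    finally have "a * b \<le> s powr - 1 * a\<^sup>2 + b\<^sup>2 * s"
     using s by (simp add: powr_minus divide_inverse mult.commute)
    also have "b\<^sup>2 * s \<le> C\<^sup>2 * (1 / (1 + n) ^ ?N)"
    proof -
     have b: "b \<le> C / (1 + n) ^ ?N"
     proof -
      have pos: "0 < (1 + norm \<xi>) ^ ?N" by (intro zero_less_power add_pos_nonneg) auto
      show ?thesis
       using C[of \<xi>] unfolding b_def n_def pos_le_divide_eq[OF pos] by (simp only: mult.commute)
     qed
     have "b\<^sup>2 * s \<le> (C / (1 + n) ^ ?N)\<^sup>2 * (1 + n)\<^sup>2"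
      using b \<open>s \<le> (1 + n)\<^sup>2\<close> s by (intro mult_mono power_mono) (auto simp: b_def)
     also have "\<dots> = C\<^sup>2 * ((1 + n)\<^sup>2 / ((1 + n) ^ ?N * (1 + n) ^ ?N))"
      by (simp add: power_divide power2_eq_square)
     also have "\<dots> \<le> C\<^sup>2 * (1 / (1 + n) ^ ?N)"
     proof (intro mult_left_mono)
      have "(1 + n)\<^sup>2 \<le> (1 + n) ^ ?N" using n0 by (intro power_increasing) auto
      then show "(1 + n)\<^sup>2 / ((1 + n) ^ ?N * (1 + n) ^ ?N) \<le> 1 / (1 + n) ^ ?N"
       using n0 by (simp add: divide_simps)
     qed auto
     finally show ?thesis .
    qed
    finally show "norm (F \<xi> * fourier f \<xi>) \<le> norm ((1 + (norm \<xi>)\<^sup>2) powr - 1 * (cmod (F \<xi>))\<^sup>2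
     + C\<^sup>2 * (1 / (1 + norm \<xi>) ^ ?N))"
     by (simp add: norm_mult a_def b_def s_def n_def)
   qed
  qed measurable
 qed
qed

lemma sobolev_linear:
 assumes u: "in_sobolev (- 1) u" and f: "test_function UNIV f" and h: "test_function UNIV h"
 shows "u (\<lambda>y. a * f y + b * h y) = a * u f + b * u h"
proof -
 obtain F where F: "\<And>f. test_function UNIV f ==> integrable lborel (\<lambda>\<xi>. F \<xi> * fourier f \<xi>)"
  "\<And>f. test_function UNIV f ==> complex_of_real (u f) = (LINT \<xi>|lborel. F \<xi> * fourier f \<xi>)"
  using sobolev_pairing[OF u] by metis
 have lin: "fourier (\<lambda>y. a * f y + b * h y) \<xi> = a * fourier f \<xi> + b * fourier h \<xi>" for \<xi>
 proof -
  have "fourier (\<lambda>y. a * f y + b * h y) \<xi> = (LINT x|lborel.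
    a * (complex_of_real (f x) * cis (2 * pi * (x \<bullet> \<xi>))) + b * (complex_of_real (h x) * cis (2 * pi * (x \<bullet> \<xi>))))"
   unfolding fourier_def by (intro Bochner_Integration.integral_cong refl) (simp add: algebra_simps)
  also have "\<dots> = a * fourier f \<xi> + b * fourier h \<xi>"
   unfolding fourier_def
   by (subst Bochner_Integration.integral_add) (use fourier_integrable[OF f] fourier_integrable[OF h] in auto)
  finally show ?thesis .
 qed
 have "complex_of_real (u (\<lambda>y. a * f y + b * h y))
   = (LINT \<xi>|lborel. a * (F \<xi> * fourier f \<xi>) + b * (F \<xi> * fourier h \<xi>))"
  by (subst F(2)[OF test_function_combination[OF f h]]) (simp add: lin algebra_simps)
 also have "\<dots> = a * (LINT \<xi>|lborel. F \<xi> * fourier f \<xi>) + b * (LINT \<xi>|lborel. F \<xi> * fourier h \<xi>)"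
  by (subst Bochner_Integration.integral_add) (use F(1)[OF f] F(1)[OF h] in auto)
 also have "\<dots> = complex_of_real (a * u f + b * u h)"
  by (simp add: F(2)[OF f] F(2)[OF h])
 finally show ?thesis by (simp only: of_real_eq_iff)
qed

text \<open>A translation only multiplies the Fourier transform by a phase, so dominated convergence applies to
  the frequency integral.\<close>

lemma sobolev_translate_continuous:
 fixes f :: "'a::euclidean_space => real"
 assumes u: "in_sobolev (- 1) u" and f: "test_function UNIV f"
 shows "continuous_on UNIV (\<lambda>x. u (\<lambda>y. f (x - y)))"
proof -
 obtain F where [measurable]: "F \<in> borel_measurable borel"
  and F: "\<And>f. test_function UNIV f ==> integrable lborel (\<lambda>\<xi>. F \<xi> * fourier f \<xi>)"
  "\<And>f. test_function UNIV f ==> complex_of_real (u f) = (LINT \<xi>|lborel. F \<xi> * fourier f \<xi>)"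
  using sobolev_pairing[OF u] by metis
 let ?f0 = "\<lambda>y. f (0 - y)"
 have f0: "test_function UNIV ?f0" using f by (rule test_function_translate)
 have [measurable]: "fourier ?f0 \<in> borel_measurable borel" using f0 by (rule fourier_measurable)
 then have [measurable]: "fourier (\<lambda>y. f (- y)) \<in> borel_measurable borel" by simp
 have tr: "fourier (\<lambda>y. f (x - y)) \<xi> = cis (2 * pi * (x \<bullet> \<xi>)) * fourier ?f0 \<xi>" for x \<xi>
  using fourier_translate[OF f0, of "- x" \<xi>] by simp
 have eq: "complex_of_real (u (\<lambda>y. f (x - y)))
   = (LINT \<xi>|lborel. F \<xi> * (cis (2 * pi * (x \<bullet> \<xi>)) * fourier ?f0 \<xi>))" for x
  using F(2)[OF test_function_translate[OF f, of x]] unfolding tr[of x] .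
 have "(\<lambda>n. complex_of_real (u (\<lambda>y. f (s n - y)))) \<longlonglongrightarrow> complex_of_real (u (\<lambda>y. f (x - y)))"
  if s: "s \<longlonglongrightarrow> x" for s x
  unfolding eq
 proof (rule integral_dominated_convergence)
  show "integrable lborel (\<lambda>\<xi>. norm (F \<xi> * fourier ?f0 \<xi>))"
   using F(1)[OF f0] by (rule integrable_norm)
  show "AE \<xi> in lborel. (\<lambda>n. F \<xi> * (cis (2 * pi * (s n \<bullet> \<xi>)) * fourier ?f0 \<xi>))
    \<longlonglongrightarrow> F \<xi> * (cis (2 * pi * (x \<bullet> \<xi>)) * fourier ?f0 \<xi>)"
   using s by (intro AE_I2 tendsto_intros)
 qed (auto simp: norm_mult)
 then show ?thesis
  unfolding continuous_on_eq_continuous_at[OF open_UNIV] continuous_at_sequentially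
  by (auto simp: comp_def tendsto_of_real_iff)
qed

section \<open>Gaussian fields evaluated along translates\<close>

text \<open>A function that is measurable in one variable and continuous in the other is jointly measurable,
  being the pointwise limit of its values at dyadic-type grid points.\<close>

lemma measurable_Caratheodory:
 fixes Y :: "'w => 'a::euclidean_space => real"
 assumes meas: "\<And>x. (\<lambda>w. Y w x) \<in> borel_measurable M"
  and cont: "\<And>w. w \<in> space M ==> continuous_on UNIV (Y w)"
 shows "(\<lambda>(w, x). Y w x) \<in> borel_measurable (M \<Otimes>\<^sub>M borel)"
proof -
 define q :: "nat => 'a => 'a"
  where "q m x = (\<Sum>b\<in>Basis. (real_of_int \<lfloor>real (Suc m) * (x \<bullet> b)\<rfloor> / real (Suc m)) *\<^sub>R b)" for m x
 have q_meas [measurable]: "q m \<in> borel_measurable borel" for m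
  unfolding q_def by measurable
 have cnt: "countable (range (q m))" for m
 proof -
  have "range (q m) \<subseteq> (\<lambda>k. \<Sum>b\<in>Basis. (real_of_int (k b) / real (Suc m)) *\<^sub>R b) ` (Basis \<rightarrow>\<^sub>E UNIV)"
  proof
   fix y assume "y \<in> range (q m)"
   then obtain x where "y = q m x" by auto
   then show "y \<in> (\<lambda>k. \<Sum>b\<in>Basis. (real_of_int (k b) / real (Suc m)) *\<^sub>R b) ` (Basis \<rightarrow>\<^sub>E UNIV)"
    by (intro image_eqI[of _ _ "restrict (\<lambda>b. \<lfloor>real (Suc m) * (x \<bullet> b)\<rfloor>) Basis"])
      (auto simp: q_def intro!: sum.cong)
  qed
  moreover have "countable ((Basis::'a set) \<rightarrow>\<^sub>E (UNIV::int set))"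
   by (intro countable_PiE) auto
  ultimately show ?thesis by (meson countable_image countable_subset)
 qed
 have grid: "(\<lambda>p. Y (fst p) (q m (snd p))) \<in> borel_measurable (M \<Otimes>\<^sub>M borel)" for m
 proof (rule measurable_compose_countable'[where I="range (q m)" and g="\<lambda>p. q m (snd p)" and f="\<lambda>i p. Y (fst p) i"])
  show "(\<lambda>p. Y (fst p) i) \<in> borel_measurable (M \<Otimes>\<^sub>M borel)" for i
   using meas[of i] by measurable
  show "(\<lambda>p. q m (snd p)) \<in> M \<Otimes>\<^sub>M borel \<rightarrow>\<^sub>M count_space (range (q m))"
   unfolding measurable_count_space_eq_countable[OF cnt]
  proof (intro conjI ballI)
   fix a assume "a \<in> range (q m)"
   have "(\<lambda>p. q m (snd p)) \<in> borel_measurable (M \<Otimes>\<^sub>M borel)" by measurable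
   then show "(\<lambda>p. q m (snd p)) -` {a} \<inter> space (M \<Otimes>\<^sub>M borel) \<in> sets (M \<Otimes>\<^sub>M borel)"
    by (rule measurable_sets) auto
  qed auto
 qed (rule cnt)
 have qlim: "(\<lambda>m. q m x) \<longlonglongrightarrow> x" for x
 proof (rule metric_LIMSEQ_I)
  fix e :: real assume e: "0 < e"
  have dist: "dist (q m x) x \<le> DIM('a) / real (Suc m)" for m
  proof -
   have "q m x - x = (\<Sum>b\<in>Basis. (real_of_int \<lfloor>real (Suc m) * (x \<bullet> b)\<rfloor> / real (Suc m) - x \<bullet> b) *\<^sub>R b)"
    unfolding q_def scaleR_diff_left sum_subtractf euclidean_representation ..
   also have "norm \<dots> \<le> (\<Sum>b\<in>(Basis::'a set). 1 / real (Suc m))"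
   proof (rule order_trans[OF norm_sum sum_mono])
    fix b :: 'a assume b: "b \<in> Basis"
    define y where "y = real (Suc m) * (x \<bullet> b)"
    have "real_of_int \<lfloor>y\<rfloor> / real (Suc m) - x \<bullet> b = (real_of_int \<lfloor>y\<rfloor> - y) / real (Suc m)"
     by (simp add: y_def diff_divide_distrib)
    moreover have "\<bar>real_of_int \<lfloor>y\<rfloor> - y\<bar> \<le> 1" by linarith
    ultimately have "\<bar>real_of_int \<lfloor>y\<rfloor> / real (Suc m) - x \<bullet> b\<bar> \<le> 1 / real (Suc m)"
     by (simp add: abs_divide divide_right_mono del: of_nat_Suc)
    then show "norm ((real_of_int \<lfloor>real (Suc m) * (x \<bullet> b)\<rfloor> / real (Suc m) - x \<bullet> b) *\<^sub>R b) \<le> 1 / real (Suc m)"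
     using b by (simp add: y_def)
   qed
   finally show ?thesis by (simp add: dist_norm)
  qed
  have "(\<lambda>m. DIM('a) / real (Suc m)) \<longlonglongrightarrow> 0"
   by (rule LIMSEQ_Suc[OF lim_const_over_n])
  then obtain N where "\<And>m. m \<ge> N ==> \<bar>DIM('a) / real (Suc m)\<bar> < e"
   using e unfolding LIMSEQ_iff real_norm_def diff_0_right by blast
  then show "\<exists>N. \<forall>m\<ge>N. dist (q m x) x < e"
   using dist by (intro exI[of _ N]) (metis abs_ge_self le_less_trans)
 qed
 have "(\<lambda>p. Y (fst p) (snd p)) \<in> borel_measurable (M \<Otimes>\<^sub>M borel)"
 proof (rule borel_measurable_LIMSEQ_real[OF _ grid])
  fix p assume "p \<in> space (M \<Otimes>\<^sub>M (borel :: 'a measure))"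
  then have "fst p \<in> space M" by (auto simp: space_pair_measure)
  then show "(\<lambda>m. Y (fst p) (q m (snd p))) \<longlonglongrightarrow> Y (fst p) (snd p)"
   by (intro continuous_on_tendsto_compose[OF cont[of "fst p"] qlim]) auto
 qed
 then show ?thesis by (simp add: case_prod_beta')
qed

text \<open>A degenerate Gaussian is almost surely \<open>0\<close>; both cases have the same characteristic
  function, and a positive variance excludes the degenerate one.\<close>

lemma centered_gaussian_moments:
 assumes M: "prob_space M" and Y: "centered_gaussian M Y"
 shows "integrable M (\<lambda>w. (Y w)\<^sup>2)"
  and "(LINT w|M. cos (Y w)) = exp (- (LINT w|M. (Y w)\<^sup>2) / 2)"
  and "0 < (LINT w|M. (Y w)\<^sup>2) ==>
   distributed M lborel Y (\<lambda>x. ennreal (normal_density 0 (sqrt (LINT w|M. (Y w)\<^sup>2)) x))"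
proof -
 interpret prob_space M by fact
 have [measurable]: "Y \<in> borel_measurable M" using Y by (simp add: centered_gaussian_def)
 have "integrable M (\<lambda>w. (Y w)\<^sup>2) \<and> (LINT w|M. cos (Y w)) = exp (- (LINT w|M. (Y w)\<^sup>2) / 2)
  \<and> (0 < (LINT w|M. (Y w)\<^sup>2) \<longrightarrow>
   distributed M lborel Y (\<lambda>x. ennreal (normal_density 0 (sqrt (LINT w|M. (Y w)\<^sup>2)) x)))"
 proof (cases "AE w in M. Y w = 0")
  case True
  have sq: "AE w in M. (Y w)\<^sup>2 = 0" using True by eventually_elim simp
  have "integrable M (\<lambda>w. (Y w)\<^sup>2) \<longleftrightarrow> integrable M (\<lambda>w. 0::real)"
   by (rule Bochner_Integration.integrable_cong_AE) (use sq in auto)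
  moreover have z: "(LINT w|M. (Y w)\<^sup>2) = (LINT w|M. 0)"
   by (rule integral_cong_AE) (use sq in auto)
  moreover have "(LINT w|M. cos (Y w)) = (LINT w|M. 1)"
   by (rule integral_cong_AE) (use True in auto)
  ultimately show ?thesis by (simp add: prob_space)
 next
  case False
  then obtain \<sigma> where \<sigma>: "0 < \<sigma>" and d: "distributed M lborel Y (\<lambda>x. ennreal (normal_density 0 \<sigma> x))"
   using Y unfolding centered_gaussian_def by blast
  have i2: "integrable M (\<lambda>w. (Y w)\<^sup>2)"
   using integrable_normal_moment[OF \<sigma>, of 0 2] distributed_integrable[OF d, of "\<lambda>x. x\<^sup>2"] by simp
  have e2: "(LINT w|M. (Y w)\<^sup>2) = \<sigma>\<^sup>2"
  proof -
   have "(LINT w|M. (Y w)\<^sup>2) = (LINT x|lborel. normal_density 0 \<sigma> x * x\<^sup>2)"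
    by (subst distributed_integral[OF d, of "\<lambda>x. x\<^sup>2", symmetric]) auto
   also have "\<dots> = \<sigma>\<^sup>2"
    using integral_normal_moment_even[OF \<sigma>, of 0 1] by (simp add: numeral_2_eq_2)
   finally show ?thesis .
  qed
  have Z: "distributed M lborel (\<lambda>w. (Y w - 0) / \<sigma>) (\<lambda>x. ennreal (std_normal_density x))"
   using normal_standard_normal_convert[OF \<sigma>, of Y 0] d by simp
  have "(LINT w|M. cos (Y w)) = (LINT w|M. cos (\<sigma> * ((Y w - 0) / \<sigma>)))"
   using \<sigma> by simp
  also have "\<dots> = (LINT x|lborel. std_normal_density x * cos (\<sigma> * x))"
   by (subst distributed_integral[OF Z, of "\<lambda>x. cos (\<sigma> * x)", symmetric]) auto
  also have "\<dots> = (LINT x|std_normal_distribution. cos (\<sigma> * x))"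
   by (subst integral_density) auto
  also have "\<dots> = (LINT x|std_normal_distribution. Re (iexp (\<sigma> * x)))"
   by (intro Bochner_Integration.integral_cong refl) (simp add: cis_conv_exp[symmetric] del: of_real_mult)
  also have "\<dots> = Re (char std_normal_distribution \<sigma>)"
  proof -
   interpret N: real_distribution std_normal_distribution by (rule real_dist_normal_dist)
   have "integrable std_normal_distribution (\<lambda>x. iexp (\<sigma> * x))"
    by (rule N.integrable_iexp) auto
   from integral_Re[OF this] show ?thesis by (simp add: char_def)
  qed
  also have "\<dots> = exp (- \<sigma>\<^sup>2 / 2)"
   by (simp only: char_std_normal_distribution Re_complex_of_real)
  finally show ?thesis using i2 e2 d \<sigma> by simp
 qed
 then show "integrable M (\<lambda>w. (Y w)\<^sup>2)"
  and "(LINT w|M. cos (Y w)) = exp (- (LINT w|M. (Y w)\<^sup>2) / 2)"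
  and "0 < (LINT w|M. (Y w)\<^sup>2) ==>
   distributed M lborel Y (\<lambda>x. ennreal (normal_density 0 (sqrt (LINT w|M. (Y w)\<^sup>2)) x))"
  by blast+
qed

locale log_field =
 fixes M :: "'w measure" and U :: "'a::euclidean_space set" and g :: "'a => 'a => real"
  and X :: "'w => ('a => real) => real"
 assumes field: "log_correlated_field M U g X"
begin

sublocale prob_space M
 using field by (simp add: log_correlated_field_def)

definition cov :: "('a => real) => ('a => real) => real" where
 "cov f h = (LINT w|M. X w f * X w h)"

lemma sobolev: "w \<in> space M ==> in_sobolev (- 1) (X w)"
 using field unfolding log_correlated_field_def by (meson zero_less_one)

lemma gaussian: "test_function UNIV f ==> centered_gaussian M (\<lambda>w. X w f)"
 using field unfolding log_correlated_field_def by blast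

lemma cov_kernel:
 "test_function UNIV f ==> test_function UNIV h ==>
  cov f h = (LINT (x, y)|lborel. log_kernel U g x y * f x * h y)"
 using field unfolding log_correlated_field_def cov_def by blast

lemma X_measurable: "test_function UNIV f ==> (\<lambda>w. X w f) \<in> borel_measurable M"
 using gaussian by (simp add: centered_gaussian_def)

lemma X_combination:
 "w \<in> space M ==> test_function UNIV f ==> test_function UNIV h ==>
  X w (\<lambda>y. a * f y + b * h y) = a * X w f + b * X w h"
 by (rule sobolev_linear[OF sobolev])

text \<open>Each realization is continuous in the translation and each evaluation is measurable in the
  realization.\<close>

lemma X_translates_measurable:
 assumes f: "test_function UNIV f"
 shows "(\<lambda>(w, x). X w (\<lambda>y. f (x - y))) \<in> borel_measurable (M \<Otimes>\<^sub>M borel)"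
proof (rule measurable_Caratheodory)
 show "(\<lambda>w. X w (\<lambda>y. f (x - y))) \<in> borel_measurable M" for x
  by (intro X_measurable test_function_translate f)
 show "continuous_on UNIV (\<lambda>x. X w (\<lambda>y. f (x - y)))" if "w \<in> space M" for w
  by (intro sobolev_translate_continuous sobolev f that)
qed

lemma cov_integrable:
 assumes f: "test_function UNIV f" and h: "test_function UNIV h"
 shows "integrable M (\<lambda>w. X w f * X w h)"
proof (rule Bochner_Integration.integrable_bound)
 show "integrable M (\<lambda>w. (X w f)\<^sup>2 + (X w h)\<^sup>2)"
  by (intro Bochner_Integration.integrable_add centered_gaussian_moments(1) gaussian f h prob_space_axioms)
 show "(\<lambda>w. X w f * X w h) \<in> borel_measurable M"
  by (intro borel_measurable_times X_measurable f h)
 show "AE w in M. norm (X w f * X w h) \<le> norm ((X w f)\<^sup>2 + (X w h)\<^sup>2)"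
 proof (rule AE_I2)
  fix w
  have "2 * (\<bar>X w f\<bar> * \<bar>X w h\<bar>) \<le> \<bar>X w f\<bar>\<^sup>2 + \<bar>X w h\<bar>\<^sup>2"
   using sum_squares_bound[of "\<bar>X w f\<bar>" "\<bar>X w h\<bar>"] by simp
  moreover have "0 \<le> \<bar>X w f\<bar> * \<bar>X w h\<bar>" by simp
  ultimately have "\<bar>X w f\<bar> * \<bar>X w h\<bar> \<le> (X w f)\<^sup>2 + (X w h)\<^sup>2"
   unfolding power2_abs by linarith
  then show "norm (X w f * X w h) \<le> norm ((X w f)\<^sup>2 + (X w h)\<^sup>2)"
   by (simp add: abs_mult)
 qed
qed

lemma cov_commute: "cov f h = cov h f"
 unfolding cov_def by (simp add: mult.commute)

lemma cov_self_nonneg: "0 \<le> cov f f"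
 unfolding cov_def by simp

lemma cov_combination:
 assumes f: "test_function UNIV f" and h: "test_function UNIV h"
 shows "cov (\<lambda>y. a * f y + b * h y) (\<lambda>y. a * f y + b * h y)
  = a\<^sup>2 * cov f f + b\<^sup>2 * cov h h + 2 * a * b * cov f h"
proof -
 note i = cov_integrable[OF f f] cov_integrable[OF h h] cov_integrable[OF f h]
 have "cov (\<lambda>y. a * f y + b * h y) (\<lambda>y. a * f y + b * h y)
   = (LINT w|M. a\<^sup>2 * (X w f * X w f) + b\<^sup>2 * (X w h * X w h) + 2 * a * b * (X w f * X w h))"
  unfolding cov_def
  by (intro Bochner_Integration.integral_cong refl)
    (simp add: X_combination[OF _ f h] power2_eq_square algebra_simps)
 also have "\<dots> = a\<^sup>2 * cov f f + b\<^sup>2 * cov h h + 2 * a * b * cov f h"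
  unfolding cov_def using i by simp
 finally show ?thesis .
qed

lemma cov_abs_le:
 assumes f: "test_function UNIV f" and h: "test_function UNIV h"
 shows "2 * \<bar>cov f h\<bar> \<le> cov f f + cov h h"
 using cov_self_nonneg[of "\<lambda>y. 1 * f y + 1 * h y"] cov_self_nonneg[of "\<lambda>y. 1 * f y + (- 1) * h y"]
 unfolding cov_combination[OF f h] by simp

text \<open>The product is a sum of two cosines of the Gaussian combinations \<open>s X(f) \<plusminus> t
  X(h)\<close>.\<close>

lemma expectation_cos_cos:
 assumes f: "test_function UNIV f" and h: "test_function UNIV h"
 shows "(LINT w|M. cos (s * X w f) * cos (t * X w h))
  = (exp (- (s\<^sup>2 * cov f f + t\<^sup>2 * cov h h - 2 * s * t * cov f h) / 2)
   + exp (- (s\<^sup>2 * cov f f + t\<^sup>2 * cov h h + 2 * s * t * cov f h) / 2)) / 2"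
proof -
 let ?p = "\<lambda>y. s * f y + t * h y" and ?m = "\<lambda>y. s * f y + (- t) * h y"
 have p: "test_function UNIV ?p" and m: "test_function UNIV ?m"
  by (rule test_function_combination[OF f h])+
 have E: "(LINT w|M. cos (X w q)) = exp (- cov q q / 2)" "integrable M (\<lambda>w. cos (X w q))"
  if "test_function UNIV q" for q
 proof -
  show "(LINT w|M. cos (X w q)) = exp (- cov q q / 2)"
   using centered_gaussian_moments(2)[OF prob_space_axioms gaussian[OF that]]
   by (simp add: cov_def power2_eq_square)
  have [measurable]: "(\<lambda>w. X w q) \<in> borel_measurable M" by (rule X_measurable[OF that])
  show "integrable M (\<lambda>w. cos (X w q))"
   by (rule integrable_const_bound[of _ 1]) auto
 qed
 have "X w ?m = s * X w f - t * X w h" "X w ?p = s * X w f + t * X w h" if "w \<in> space M" for w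
  using X_combination[OF that f h, of s "- t"] X_combination[OF that f h, of s t] by simp_all
 then have "(LINT w|M. cos (s * X w f) * cos (t * X w h))
   = (LINT w|M. (cos (X w ?m) + cos (X w ?p)) / 2)"
  by (intro Bochner_Integration.integral_cong refl) (simp only: cos_times_cos)
 also have "\<dots> = ((LINT w|M. cos (X w ?m)) + (LINT w|M. cos (X w ?p))) / 2"
  using E(2)[OF p] E(2)[OF m] by simp
 finally show ?thesis
  unfolding E(1)[OF p] E(1)[OF m] cov_combination[OF f h] by simp
qed

end

section \<open>The logarithmic kernel\<close>

lemma abs_ln_le: "\<bar>ln r\<bar> \<le> 2 * r powr - (1/2) + r" if "0 < r" for r :: real
proof (cases "1 \<le> r")
 case True
 then show ?thesis using ln_le_minus_one[of r] that by (simp add: add_nonneg_pos) (smt (verit) powr_ge_zero)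
next
 case False
 have "ln (r powr - (1/2)) \<le> r powr - (1/2) - 1" using that by (intro ln_le_minus_one) auto
 then have "- ln r \<le> 2 * r powr - (1/2)" using that by (simp add: ln_powr)
 then show ?thesis using False that by simp
qed

lemma nn_integral_ln_ball:
 "(\<integral>\<^sup>+w. ennreal \<bar>ln (norm (w::'a::euclidean_space))\<bar> * indicator (ball 0 R) w \<partial>lborel) < \<infinity>"
proof (cases "0 < R")
 case R: True
 have "(\<integral>\<^sup>+w. ennreal \<bar>ln (norm (w::'a))\<bar> * indicator (ball 0 R) w \<partial>lborel)
  \<le> (\<integral>\<^sup>+w. 2 * (ennreal (norm (w::'a) powr - (1/2)) * indicator (ball 0 R) w)
    + ennreal R * indicator (ball 0 R) w \<partial>lborel)"
 proof (rule nn_integral_mono)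
  fix w :: 'a
  show "ennreal \<bar>ln (norm w)\<bar> * indicator (ball 0 R) w
   \<le> 2 * (ennreal (norm w powr - (1/2)) * indicator (ball 0 R) w) + ennreal R * indicator (ball 0 R) w"
  proof (cases "w \<in> ball 0 R")
   case True
   have "\<bar>ln (norm w)\<bar> \<le> 2 * norm w powr - (1/2) + R"
    using abs_ln_le[of "norm w"] True R by (cases "w = 0") (auto simp: less_imp_le intro: order_trans)
   then have "ennreal \<bar>ln (norm w)\<bar> \<le> ennreal (2 * norm w powr - (1/2) + R)" by (rule ennreal_leI)
   also have "\<dots> = 2 * ennreal (norm w powr - (1/2)) + ennreal R"
    using R by (subst ennreal_plus) (auto simp: ennreal_mult)
   finally show ?thesis using True by simp
  qed simp
 qed
 also have "\<dots> = 2 * (\<integral>\<^sup>+w. ennreal (norm (w::'a) powr - (1/2)) * indicator (ball 0 R) w \<partial>lborel)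
   + ennreal R * emeasure lborel (ball (0::'a) R)"
 proof -
  have [measurable]: "ball (0::'a) R \<in> sets borel" by simp
  show ?thesis
   by (subst nn_integral_add) (simp_all add: nn_integral_cmult nn_integral_cmult_indicator)
 qed
 also have "\<dots> < \<infinity>"
  using nn_integral_norm_powr_ball[where 'a='a, of R "1/2"] R emeasure_lborel_ball_finite[of "0::'a" R]
   DIM_positive[where 'a='a]
  by (auto simp: ennreal_mult_less_top Suc_le_eq[symmetric])
 finally show ?thesis .
qed (auto simp: ball_empty)

lemma convolution_pair_integrable:
 fixes f h k :: "'a::euclidean_space => real"
 assumes [measurable]: "f \<in> borel_measurable borel" "h \<in> borel_measurable borel" "k \<in> borel_measurable borel"
  and k: "\<And>r. (\<integral>\<^sup>+w. ennreal \<bar>k w\<bar> * indicator (ball 0 r) w \<partial>lborel) < \<infinity>" "\<And>w. k (- w) = k w"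
  and f: "\<And>x. \<bar>f x\<bar> \<le> B" "\<And>x. R < norm x ==> f x = 0"
  and h: "\<And>x. \<bar>h x\<bar> \<le> B" "\<And>x. R < norm x ==> h x = 0"
 shows "integrable lborel (\<lambda>(u, v). k (u - v) * f u * h v)"
proof (rule integrableI_bounded)
 let ?F = "\<lambda>p. ennreal (norm (case p of (u, v) => k (u - v) * f u * h v))"
 have B: "0 \<le> B" using f(1) abs_ge_zero order_trans by blast
 have [measurable]: "cball (0::'a) R \<in> sets borel" "ball (0::'a) (2 * R + 1) \<in> sets borel" by simp_all
 show meas: "(\<lambda>(u, v). k (u - v) * f u * h v) \<in> borel_measurable lborel"
  unfolding lborel_prod[symmetric] by measurable
 define I where "I = (\<integral>\<^sup>+w. ennreal \<bar>k w\<bar> * indicator (ball 0 (2 * R + 1)) w \<partial>lborel)"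
 have I: "I < \<infinity>" unfolding I_def by (rule k(1))
 have "(\<integral>\<^sup>+p. ?F p \<partial>lborel) = (\<integral>\<^sup>+u. \<integral>\<^sup>+v. ?F (u, v) \<partial>lborel \<partial>lborel)"
  unfolding lborel_prod[symmetric]
  by (rule lborel.nn_integral_fst[symmetric]) measurable
 also have "\<dots> \<le> (\<integral>\<^sup>+u. (ennreal (B * B) * I) * indicator (cball (0::'a) R) u \<partial>lborel)"
 proof (rule nn_integral_mono)
  fix u :: 'a
  show "(\<integral>\<^sup>+v. ?F (u, v) \<partial>lborel) \<le> (ennreal (B * B) * I) * indicator (cball (0::'a) R) u"
  proof (cases "u \<in> cball 0 R")
   case True
   have "(\<integral>\<^sup>+v. ?F (u, v) \<partial>lborel)
     \<le> (\<integral>\<^sup>+v. ennreal (B * B) * (ennreal \<bar>k (u - v)\<bar> * indicator (cball 0 R) v) \<partial>lborel)"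
   proof (rule nn_integral_mono)
    fix v :: 'a
    have "\<bar>f u\<bar> * \<bar>h v\<bar> \<le> B * B" using f(1) h(1) B by (intro mult_mono) auto
    then have "\<bar>k (u - v)\<bar> * (\<bar>f u\<bar> * \<bar>h v\<bar>) \<le> \<bar>k (u - v)\<bar> * (B * B)"
     by (intro mult_left_mono) auto
    then have "ennreal (\<bar>k (u - v)\<bar> * (\<bar>f u\<bar> * \<bar>h v\<bar>)) \<le> ennreal (B * B) * ennreal \<bar>k (u - v)\<bar>"
     using B by (subst ennreal_mult[symmetric]) (auto simp: mult.commute intro!: ennreal_leI)
    then show "?F (u, v) \<le> ennreal (B * B) * (ennreal \<bar>k (u - v)\<bar> * indicator (cball 0 R) v)"
     using h(2)[of v] by (cases "v \<in> cball 0 R") (auto simp: abs_mult mult.assoc)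
   qed
   also have "\<dots> = ennreal (B * B) * (\<integral>\<^sup>+v. ennreal \<bar>k (u - v)\<bar> * indicator (cball 0 R) v \<partial>lborel)"
    by (rule nn_integral_cmult) measurable
   also have "(\<integral>\<^sup>+v. ennreal \<bar>k (u - v)\<bar> * indicator (cball 0 R) v \<partial>lborel)
     = (\<integral>\<^sup>+w. ennreal \<bar>k (u - (u + 1 *\<^sub>R w))\<bar> * indicator (cball 0 R) (u + 1 *\<^sub>R w) \<partial>lborel)"
    by (subst nn_integral_lborel_affine[where c=1 and t=u]) simp_all
   also have "\<dots> \<le> I"
    unfolding I_def
   proof (rule nn_integral_mono)
    fix w :: 'a
    have "norm w < 2 * R + 1" if "norm (u + w) \<le> R"
     using that True norm_triangle_ineq4[of "u + w" u] by simp
    then show "ennreal \<bar>k (u - (u + 1 *\<^sub>R w))\<bar> * indicator (cball 0 R) (u + 1 *\<^sub>R w)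
      \<le> ennreal \<bar>k w\<bar> * indicator (ball 0 (2 * R + 1)) w"
     by (auto simp: indicator_def k(2))
   qed
   finally show ?thesis using True by (simp add: mult_left_mono)
  qed (use f(2)[of u] in auto)
 qed
 also have "\<dots> = (ennreal (B * B) * I) * emeasure lborel (cball (0::'a) R)"
  by (rule nn_integral_cmult_indicator) simp
 also have "\<dots> < \<infinity>"
  using I emeasure_lborel_cball_finite[of "0::'a" R] by (auto simp: ennreal_mult_less_top)
 finally show "(\<integral>\<^sup>+p. ?F p \<partial>lborel) < \<infinity>" .
qed

lemma log_pair_integrable:
 fixes f h :: "'a::euclidean_space => real"
 assumes "f \<in> borel_measurable borel" "h \<in> borel_measurable borel"
  and f: "\<And>x. \<bar>f x\<bar> \<le> B" "\<And>x. R < norm x ==> f x = 0"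
  and h: "\<And>x. \<bar>h x\<bar> \<le> B" "\<And>x. R < norm x ==> h x = 0"
 shows "integrable lborel (\<lambda>(u, v). ln (norm (u - v)) * f u * h v)"
 by (rule convolution_pair_integrable[OF assms(1,2) _ nn_integral_ln_ball _ f h]) simp_all

text \<open>A Schur test with a translation invariant kernel.\<close>

lemma convolution_pair_le:
 fixes f h k :: "'a::euclidean_space => real"
 assumes meas: "f \<in> borel_measurable borel" "h \<in> borel_measurable borel"
  and k: "integrable lborel k" "\<And>w. 0 \<le> k w" "\<And>w. k (- w) = k w"
  and f: "\<And>x. 0 \<le> f x" "\<And>x. f x \<le> B" "\<And>x. R < norm x ==> f x = 0"
  and h: "\<And>x. 0 \<le> h x" "\<And>x. h x \<le> B" "\<And>x. R < norm x ==> h x = 0"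
 shows "integrable lborel (\<lambda>p. k (fst p - snd p) * f (fst p) * h (snd p))"
  and "(LINT p|lborel. k (fst p - snd p) * f (fst p) * h (snd p)) \<le> B * (LINT x|lborel. f x) * (LINT w|lborel. k w)"
proof -
 have km: "k \<in> borel_measurable borel" using k(1) by simp
 have "(\<integral>\<^sup>+w. ennreal \<bar>k w\<bar> * indicator (ball 0 r) w \<partial>lborel) < \<infinity>" for r
 proof (rule le_less_trans)
  show "(\<integral>\<^sup>+w. ennreal \<bar>k w\<bar> * indicator (ball 0 r) w \<partial>lborel) \<le> (\<integral>\<^sup>+w. ennreal (norm (k w)) \<partial>lborel)"
   by (intro nn_integral_mono) (auto simp: indicator_def)
  show "(\<integral>\<^sup>+w. ennreal (norm (k w)) \<partial>lborel) < \<infinity>" using k(1) unfolding integrable_iff_bounded by blast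
 qed
 then have i': "integrable lborel (\<lambda>(u, v). k (u - v) * f u * h v)"
  using f h by (intro convolution_pair_integrable[OF meas km _ k(3), of B R]) auto
 then show i: "integrable lborel (\<lambda>p. k (fst p - snd p) * f (fst p) * h (snd p))"
  by (simp add: case_prod_beta')
 have fi: "integrable lborel f"
  using f by (intro integrable_bounded_support[OF meas(1), of B R]) auto
 have i2: "integrable (lborel \<Otimes>\<^sub>M lborel) (\<lambda>p. k (fst p - snd p) * f (fst p) * h (snd p))"
  using i unfolding lborel_prod .
 have "(LINT p|lborel. k (fst p - snd p) * f (fst p) * h (snd p)) = (LINT u|lborel. LINT v|lborel. k (u - v) * f u * h v)"
  using lborel_pair.integral_fst'[OF i2] unfolding lborel_prod by simp
 also have "\<dots> \<le> (LINT u|lborel. f u * (B * (LINT w|lborel. k w)))"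
 proof (rule integral_mono_AE)
  show "integrable lborel (\<lambda>u. LINT v|lborel. k (u - v) * f u * h v)"
   using lborel_pair.integrable_fst'[OF i2] by simp
  show "integrable lborel (\<lambda>u. f u * (B * (LINT w|lborel. k w)))" using fi by simp
  have "AE u in lborel. integrable lborel (\<lambda>v. k (u - v) * f u * h v)"
   using lborel_pair.AE_integrable_fst'[OF i2] by simp
  then show "AE u in lborel. (LINT v|lborel. k (u - v) * f u * h v) \<le> f u * (B * (LINT w|lborel. k w))"
  proof eventually_elim
   case (elim u)
   have ki: "integrable lborel (\<lambda>v. k (u - v))"
    using lborel_integrable_affine[OF k(1), of "- 1" u] by simp
   have "(LINT v|lborel. k (u - v) * f u * h v) \<le> (LINT v|lborel. (f u * B) * k (u - v))"
   proof (rule integral_mono[OF elim])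
    fix v
    have "k (u - v) * (f u * h v) \<le> k (u - v) * (f u * B)"
     using k(2) f(1) h(2) by (intro mult_left_mono) auto
    then show "k (u - v) * f u * h v \<le> (f u * B) * k (u - v)" by (simp add: mult_ac)
   qed (use ki in simp)
   also have "\<dots> = (f u * B) * (LINT w|lborel. k w)"
    using lborel_integral_affine[OF km, of "- 1" u] by simp
   finally show ?case by (simp add: mult_ac)
  qed
 qed
 also have "\<dots> = B * (LINT x|lborel. f x) * (LINT w|lborel. k w)" by simp
 finally show "(LINT p|lborel. k (fst p - snd p) * f (fst p) * h (snd p)) \<le> B * (LINT x|lborel. f x) * (LINT w|lborel. k w)" .
qed

text \<open>The logarithmic potential of a bounded density is bounded above, because only the unit ball around
  the evaluation point contributes positively; scaling adds the logarithm of the scale.\<close>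

lemma log_potential_upper:
 fixes \<eta> :: "'a::euclidean_space => real"
 assumes \<eta>: "mollifier \<eta>"
 obtains c where "0 \<le> c"
  "\<And>e x v. 0 < e ==> (LINT u|lborel. rescale \<eta> e (x - u) * - ln (norm (u - v))) \<le> - ln e + c"
proof -
 have t: "test_function UNIV \<eta>" using \<eta> by (rule mollifier_test_function)
 have \<eta>0: "\<And>x. 0 \<le> \<eta> x" and \<eta>1: "(LINT x|lborel. \<eta> x) = 1" using \<eta> unfolding mollifier_def by blast+
 have [measurable]: "\<eta> \<in> borel_measurable borel" using t by (rule test_function_measurable)
 obtain B R where B: "0 < B" "\<And>x. norm (\<eta> x) \<le> B" and R: "0 < R" "\<And>x. R < norm x ==> \<eta> x = 0"
  by (rule test_function_bounds[OF t]) blast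
 have [measurable]: "ball (0::'a) r \<in> sets borel" for r by simp
 have int_ln: "integrable lborel (\<lambda>w::'a. \<bar>ln (norm w)\<bar> * indicator (ball 0 r) w)" for r
  using nn_integral_ln_ball[where 'a='a, of r]
  by (intro integrableI_bounded) (auto simp: ennreal_mult ennreal_indicator)
 define c where "c = B * (LINT w|lborel. \<bar>ln (norm (w::'a))\<bar> * indicator (ball 0 1) w)"
 have main: "(LINT a|lborel. \<eta> a * - ln (norm (z - a))) \<le> c"
  and intg: "integrable lborel (\<lambda>a. \<eta> a * - ln (norm (z - a)))" for z
 proof -
  have shift: "integrable lborel (\<lambda>a. \<bar>ln (norm (z - a))\<bar> * indicator (ball 0 r) (z - a))" for r
   using lborel_integrable_affine[OF int_ln[of r], of "-1" z] by simp
  show i: "integrable lborel (\<lambda>a. \<eta> a * - ln (norm (z - a)))"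
  proof (rule Bochner_Integration.integrable_bound)
   show "integrable lborel (\<lambda>a. B * (\<bar>ln (norm (z - a))\<bar> * indicator (ball 0 (norm z + R + 1)) (z - a)))"
    by (intro integrable_mult_right shift)
   show "AE a in lborel. norm (\<eta> a * - ln (norm (z - a)))
     \<le> norm (B * (\<bar>ln (norm (z - a))\<bar> * indicator (ball 0 (norm z + R + 1)) (z - a)))"
   proof (rule AE_I2)
    fix a
    have "norm (z - a) < norm z + R + 1" if "norm a \<le> R"
     using that norm_triangle_ineq4[of z a] by linarith
    then show "norm (\<eta> a * - ln (norm (z - a)))
     \<le> norm (B * (\<bar>ln (norm (z - a))\<bar> * indicator (ball 0 (norm z + R + 1)) (z - a)))"
     using R(2)[of a] B(2)[of a] B(1)
     by (cases "norm a \<le> R") (auto simp: abs_mult intro!: mult_right_mono)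
   qed
  qed measurable
  have "(LINT a|lborel. \<eta> a * - ln (norm (z - a)))
    \<le> (LINT a|lborel. B * (\<bar>ln (norm (z - a))\<bar> * indicator (ball 0 1) (z - a)))"
  proof (rule integral_mono[OF i])
   show "integrable lborel (\<lambda>a. B * (\<bar>ln (norm (z - a))\<bar> * indicator (ball 0 1) (z - a)))"
    by (intro integrable_mult_right shift)
   fix a
   show "\<eta> a * - ln (norm (z - a)) \<le> B * (\<bar>ln (norm (z - a))\<bar> * indicator (ball 0 1) (z - a))"
   proof (cases "norm (z - a) < 1")
    case True
    have "\<eta> a * - ln (norm (z - a)) \<le> \<eta> a * \<bar>ln (norm (z - a))\<bar>"
     using \<eta>0[of a] by (intro mult_left_mono) auto
    also have "\<dots> \<le> B * \<bar>ln (norm (z - a))\<bar>"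
     using B(2)[of a] by (intro mult_right_mono) auto
    finally show ?thesis using True by simp
   next
    case False
    then have "0 \<le> ln (norm (z - a))" by simp
    then show ?thesis using False \<eta>0[of a] by simp
   qed
  qed
  also have "\<dots> = c"
   unfolding c_def by (subst (2) lborel_integral_affine[where c="-1" and t=z]) simp_all
  finally show "(LINT a|lborel. \<eta> a * - ln (norm (z - a))) \<le> c" .
 qed
 show ?thesis
 proof (rule that)
  show "0 \<le> c" unfolding c_def using B by (intro mult_nonneg_nonneg) auto
  fix e :: real and x v :: 'a assume e: "0 < e"
  have "(LINT u|lborel. rescale \<eta> e (x - u) * - ln (norm (u - v)))
    = \<bar>- e\<bar> ^ DIM('a) * (LINT a|lborel. rescale \<eta> e (x - (x + (- e) *\<^sub>R a)) * - ln (norm (x + (- e) *\<^sub>R a - v)))"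
   unfolding rescale_def
   by (subst lborel_integral_affine[where c="- e" and t=x]) (use e in simp_all)
  also have "\<dots> = (LINT a|lborel. e ^ DIM('a) * (rescale \<eta> e (e *\<^sub>R a) * - ln (norm (x + (- e) *\<^sub>R a - v))))"
   using e by simp
  also have "\<dots> = (LINT a|lborel. - ln e * \<eta> a + \<eta> a * - ln (norm ((1/e) *\<^sub>R (x - v) - a)))"
  proof (rule integral_cong_AE)
   have "AE a in lborel. a \<noteq> (1/e) *\<^sub>R (x - v)" by (rule AE_lborel_singleton)
   then show "AE a in lborel. e ^ DIM('a) * (rescale \<eta> e (e *\<^sub>R a) * - ln (norm (x + (- e) *\<^sub>R a - v)))
     = - ln e * \<eta> a + \<eta> a * - ln (norm ((1/e) *\<^sub>R (x - v) - a))"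
   proof eventually_elim
    case (elim a)
    have "x + (- e) *\<^sub>R a - v = e *\<^sub>R ((1/e) *\<^sub>R (x - v) - a)"
     using e by (simp add: scaleR_diff_right)
    then have "norm (x + (- e) *\<^sub>R a - v) = e * norm ((1/e) *\<^sub>R (x - v) - a)"
     using e by simp
    moreover have "0 < norm ((1/e) *\<^sub>R (x - v) - a)" using elim by simp
    ultimately have "ln (norm (x + (- e) *\<^sub>R a - v)) = ln e + ln (norm ((1/e) *\<^sub>R (x - v) - a))"
     using e by (simp add: ln_mult_pos)
    then show ?case using e by (simp add: rescale_def algebra_simps)
   qed
  qed (unfold rescale_def, measurable)
  also have "\<dots> = - ln e * 1 + (LINT a|lborel. \<eta> a * - ln (norm ((1/e) *\<^sub>R (x - v) - a)))"
   by (subst Bochner_Integration.integral_add)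
     (use intg test_function_integrable[OF t] in \<open>auto simp: \<eta>1\<close>)
  also have "\<dots> \<le> - ln e + c" using main by simp
  finally show "(LINT u|lborel. rescale \<eta> e (x - u) * - ln (norm (u - v))) \<le> - ln e + c" .
 qed
qed

text \<open>The integrand is itself an integral of \<open>exp (- s t)\<close> over \<open>s\<close> between
  \<open>a\<close> and \<open>b\<close>; exchange the two integrals.\<close>

lemma frullani_nn:
 fixes a b :: real
 assumes "0 < a" "a \<le> b"
 shows "(\<integral>\<^sup>+t. ennreal ((exp (- a * t) - exp (- b * t)) / t) * indicator {0<..} t \<partial>lborel) = ennreal (ln (b / a))"
proof -
 have inner: "ennreal ((exp (- a * t) - exp (- b * t)) / t) = (\<integral>\<^sup>+s. ennreal (exp (- s * t)) * indicator {a..b} s \<partial>lborel)"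
  if "0 < t" for t
 proof -
  have "(\<integral>\<^sup>+s. ennreal (exp (- s * t)) * indicator {a..b} s \<partial>lborel)
    = ennreal ((- exp (- b * t) / t) - (- exp (- a * t) / t))"
  proof (rule nn_integral_FTC_Icc)
   show "((\<lambda>s. - exp (- s * t) / t) has_real_derivative exp (- s * t)) (at s)" for s
    using \<open>0 < t\<close> by (auto intro!: derivative_eq_intros simp: field_simps)
  qed (use assms in auto)
  then show ?thesis by (simp add: diff_divide_distrib)
 qed
 have outer: "(\<integral>\<^sup>+t. ennreal (exp (- s * t)) * indicator {0<..} t \<partial>lborel) = ennreal (1 / s)" if "0 < s" for s
 proof -
  have "(\<integral>\<^sup>+t. ennreal (exp (- s * t)) * indicator {0<..} t \<partial>lborel)
    = (\<integral>\<^sup>+t. ennreal (exp (- s * t)) * indicator {0..} t \<partial>lborel)"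
  proof (rule nn_integral_cong_AE)
   have "AE t in lborel. t \<noteq> (0::real)" by (rule AE_lborel_singleton)
   then show "AE t in lborel. ennreal (exp (- s * t)) * indicator {0<..} t = ennreal (exp (- s * t)) * indicator {0..} t"
    by eventually_elim (auto simp: indicator_def)
  qed
  also have "\<dots> = ennreal (0 - (- exp (- s * 0) / s))"
  proof (rule nn_integral_FTC_atLeast)
   show "((\<lambda>t. - exp (- s * t) / s) has_real_derivative exp (- s * t)) (at t)" for t
    using that by (auto intro!: derivative_eq_intros simp: field_simps)
   have "((\<lambda>t. exp (- s * t)) \<longlongrightarrow> 0) at_top"
    using that by (intro filterlim_compose[OF exp_at_bot] filterlim_tendsto_neg_mult_at_bot[OF tendsto_const _ filterlim_ident]) auto
   then have "((\<lambda>t. - exp (- s * t) / s) \<longlongrightarrow> - 0 / s) at_top"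
    using that by (intro tendsto_intros) auto
   then show "((\<lambda>t. - exp (- s * t) / s) \<longlongrightarrow> 0) at_top" by simp
  qed auto
  finally show ?thesis by simp
 qed
 have "(\<integral>\<^sup>+t. ennreal ((exp (- a * t) - exp (- b * t)) / t) * indicator {0<..} t \<partial>lborel)
   = (\<integral>\<^sup>+t. \<integral>\<^sup>+s. ennreal (exp (- s * t)) * indicator {a..b} s * indicator {0<..} t \<partial>lborel \<partial>lborel)"
 proof (intro nn_integral_cong)
  fix t :: real
  show "ennreal ((exp (- a * t) - exp (- b * t)) / t) * indicator {0<..} t
    = (\<integral>\<^sup>+s. ennreal (exp (- s * t)) * indicator {a..b} s * indicator {0<..} t \<partial>lborel)"
   using inner[of t] by (cases "0 < t") (auto simp: indicator_def)
 qed
 also have "\<dots> = (\<integral>\<^sup>+s. \<integral>\<^sup>+t. ennreal (exp (- s * t)) * indicator {a..b} s * indicator {0<..} t \<partial>lborel \<partial>lborel)"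
  by (rule lborel_pair.Fubini') measurable
 also have "\<dots> = (\<integral>\<^sup>+s. ennreal (1 / s) * indicator {a..b} s \<partial>lborel)"
 proof (intro nn_integral_cong)
  fix s :: real
  have "(\<integral>\<^sup>+t. ennreal (exp (- s * t)) * indicator {a..b} s * indicator {0<..} t \<partial>lborel)
    = (\<integral>\<^sup>+t. ennreal (exp (- s * t)) * indicator {0<..} t \<partial>lborel) * indicator {a..b} s"
   by (cases "s \<in> {a..b}") auto
  then show "(\<integral>\<^sup>+t. ennreal (exp (- s * t)) * indicator {a..b} s * indicator {0<..} t \<partial>lborel)
    = ennreal (1 / s) * indicator {a..b} s"
   using outer[of s] assms by (cases "s \<in> {a..b}") auto
 qed
 also have "\<dots> = ennreal (ln b - ln a)"
 proof (rule nn_integral_FTC_Icc)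
  show "(ln has_real_derivative 1 / s) (at s)" if "s \<in> {a..b}" for s
   using that assms by (auto intro!: derivative_eq_intros)
 qed (use assms in auto)
 finally show ?thesis using assms by (simp add: ln_div)
qed

definition log_mix :: "real => real => real" where
 "log_mix r t = (exp (- t * r\<^sup>2) - exp (- t)) / (2 * t) * indicator {0<..} t"

lemma log_mix_measurable [measurable]: "case_prod log_mix \<in> borel_measurable (borel \<Otimes>\<^sub>M borel)"
 unfolding log_mix_def[abs_def] by measurable

text \<open>Minus the logarithm is a mixture of Gaussians up to additive constants (a Frullani integral).\<close>

lemma log_mix_integral:
 assumes r: "0 < r"
 shows "integrable lborel (log_mix r)" and "(LINT t|lborel. \<bar>log_mix r t\<bar>) = \<bar>ln r\<bar>"
  and "(LINT t|lborel. log_mix r t) = - ln r"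
proof -
 have [measurable]: "log_mix r \<in> borel_measurable borel" unfolding log_mix_def[abs_def] by measurable
 have *: "(\<integral>\<^sup>+t. ennreal (s * log_mix r t) \<partial>lborel) = ennreal (s * - ln r)"
  "\<And>t. 0 \<le> s * log_mix r t" "0 \<le> s * - ln r"
  if s: "(s = 1 \<and> r \<le> 1) \<or> (s = - 1 \<and> 1 \<le> r)" for s
 proof -
  define a b where "a = (if s = 1 then r\<^sup>2 else 1)" and "b = (if s = 1 then 1 else r\<^sup>2)"
  have ab: "0 < a" "a \<le> b" using s r by (auto simp: a_def b_def power_le_one)
  have eq: "s * log_mix r t = (1/2) * ((exp (- a * t) - exp (- b * t)) / t * indicator {0<..} t)" for t
   using s by (auto simp: log_mix_def a_def b_def indicator_def field_simps)
  have nn: "0 \<le> (exp (- a * t) - exp (- b * t)) / t * indicator {0<..} t" for t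
   using ab by (auto simp: indicator_def)
  show "0 \<le> s * log_mix r t" for t unfolding eq using nn[of t] by simp
  have "ln (b / a) = 2 * (s * - ln r)"
   using s r by (auto simp: a_def b_def ln_div ln_realpow)
  moreover have "0 \<le> ln (b / a)" using ab by simp
  ultimately show "0 \<le> s * - ln r" by simp
  have "(\<integral>\<^sup>+t. ennreal (s * log_mix r t) \<partial>lborel)
    = (\<integral>\<^sup>+t. ennreal (1/2) * (ennreal ((exp (- a * t) - exp (- b * t)) / t) * indicator {0<..} t) \<partial>lborel)"
  proof (intro nn_integral_cong)
   fix t :: real
   show "ennreal (s * log_mix r t) = ennreal (1/2) * (ennreal ((exp (- a * t) - exp (- b * t)) / t) * indicator {0<..} t)"
    unfolding eq using nn[of t] by (subst ennreal_mult) (auto simp: indicator_def)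
  qed
  also have "\<dots> = ennreal (1/2) * ennreal (ln (b / a))"
   by (subst nn_integral_cmult) (simp_all add: frullani_nn[OF ab, simplified])
  also have "\<dots> = ennreal (s * - ln r)"
   using \<open>0 \<le> ln (b / a)\<close> \<open>ln (b / a) = _\<close> by (subst ennreal_mult[symmetric]) auto
  finally show "(\<integral>\<^sup>+t. ennreal (s * log_mix r t) \<partial>lborel) = ennreal (s * - ln r)" .
 qed
 obtain s :: real where s: "(s = 1 \<and> r \<le> 1) \<or> (s = - 1 \<and> 1 \<le> r)" 
  using that[of 1] that[of "- 1"] by (cases "r \<le> 1") auto
 have abs: "\<bar>log_mix r t\<bar> = s * log_mix r t" for t
  using s *(2)[OF s, of t] by auto
 have absr: "\<bar>ln r\<bar> = s * - ln r" using s *(3)[OF s] by auto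
 have nn: "(\<integral>\<^sup>+t. ennreal \<bar>log_mix r t\<bar> \<partial>lborel) = ennreal \<bar>ln r\<bar>"
  unfolding abs absr by (rule *(1)[OF s])
 show "integrable lborel (log_mix r)"
  by (rule integrableI_bounded) (auto simp: nn)
 show abs_int: "(LINT t|lborel. \<bar>log_mix r t\<bar>) = \<bar>ln r\<bar>"
  by (subst integral_eq_nn_integral) (auto simp: nn)
 have "(LINT t|lborel. s * log_mix r t) = s * - ln r"
  using abs_int unfolding abs absr .
 then show "(LINT t|lborel. log_mix r t) = - ln r" using s by auto
qed

lemma AE_lborel_prod_neq: "AE p in (lborel :: ('a::euclidean_space \<times> 'a) measure). fst p \<noteq> snd p"
proof -
 have "AE p in (lborel \<Otimes>\<^sub>M lborel :: ('a \<times> 'a) measure). fst p \<noteq> snd p"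
 proof (rule lborel_pair.AE_pair_measure)
  show "{p \<in> space (lborel \<Otimes>\<^sub>M lborel :: ('a \<times> 'a) measure). fst p \<noteq> snd p} \<in> sets (lborel \<Otimes>\<^sub>M lborel)"
   by measurable
  show "AE x in lborel. AE y in lborel. fst (x, y) \<noteq> snd (x, y :: 'a)"
  proof (rule AE_I2)
   fix x :: 'a
   have "AE y in lborel. y \<noteq> x" by (rule AE_lborel_singleton)
   then show "AE y in lborel. fst (x, y) \<noteq> snd (x, y)" by eventually_elim simp
  qed
 qed
 then show ?thesis unfolding lborel_prod .
qed

lemma integrable_gaussian:
 assumes "0 < s"
 shows "integrable lborel (\<lambda>w::'a::euclidean_space. exp (- s * (norm w)\<^sup>2))"
proof (rule Bochner_Integration.integrable_bound)
 define k where "k = DIM('a) + 2"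
 define C where "C = real k ^ k * exp (1 / (4 * s))"
 have C0: "0 \<le> C" by (simp add: C_def)
 show "integrable lborel (\<lambda>w::'a. C * (1 / (1 + norm w) ^ k))"
  unfolding k_def by (intro integrable_mult_right integrable_norm_decay) simp
 show "AE w in lborel. norm (exp (- s * (norm w)\<^sup>2)) \<le> norm (C * (1 / (1 + norm (w::'a)) ^ k))"
 proof (rule AE_I2)
  fix w :: 'a
  define n where "n = norm w"
  have n: "0 \<le> n" by (simp add: n_def)
  have k: "1 \<le> real k" "0 < k" by (simp_all add: k_def)
  have "(1 + n) ^ k \<le> (real k * (1 + n / real k)) ^ k"
   using k n by (intro power_mono) (auto simp: distrib_left)
  also have "\<dots> \<le> real k ^ k * exp n"
   unfolding power_mult_distrib using k n
   by (intro mult_left_mono exp_ge_one_plus_x_over_n_power_n) auto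
  also have "exp n \<le> exp (1 / (4 * s) + s * n\<^sup>2)"
  proof -
   have "0 \<le> s * (n - 1 / (2 * s))\<^sup>2" using assms by simp
   also have "\<dots> = s * n\<^sup>2 - n + 1 / (4 * s)"
    using assms by (simp add: power2_eq_square field_simps)
   finally show ?thesis by simp
  qed
  finally have "(1 + n) ^ k * exp (- s * n\<^sup>2) \<le> real k ^ k * exp (1 / (4 * s) + s * n\<^sup>2) * exp (- s * n\<^sup>2)"
   by (simp add: mult_right_mono mult_left_mono)
  also have "\<dots> = C" unfolding C_def by (simp add: exp_add exp_minus field_simps)
  finally have "exp (- s * n\<^sup>2) \<le> C * (1 / (1 + n) ^ k)"
   using n by (simp add: field_simps)
  then show "norm (exp (- s * (norm w)\<^sup>2)) \<le> norm (C * (1 / (1 + norm w) ^ k))"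
   using C0 by (simp add: n_def)
 qed
qed measurable

text \<open>The parallelogram identity for \<open>a - w\<close> and \<open>b - w\<close>. It factorises a
  Gaussian kernel as a convolution square, which turns its quadratic form into an integral of squares.\<close>

lemma gaussian_product_formula:
 fixes a b :: "'a::euclidean_space"
 assumes "0 < t"
 shows "(LINT w|lborel. exp (- 2 * t * (norm (a - w))\<^sup>2) * exp (- 2 * t * (norm (b - w))\<^sup>2))
  = exp (- t * (norm (a - b))\<^sup>2) * (LINT w|lborel. exp (- (4 * t) * (norm (w::'a))\<^sup>2))"
  and "integrable lborel (\<lambda>w. exp (- 2 * t * (norm (a - w))\<^sup>2) * exp (- 2 * t * (norm (b - w))\<^sup>2))"
proof -
 let ?G = "\<lambda>w::'a. exp (- (4 * t) * (norm w)\<^sup>2)"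
 define m where "m = (1/2) *\<^sub>R (a + b)"
 have eq: "exp (- 2 * t * (norm (a - w))\<^sup>2) * exp (- 2 * t * (norm (b - w))\<^sup>2)
   = exp (- t * (norm (a - b))\<^sup>2) * ?G (m + (- 1) *\<^sub>R w)" for w
 proof -
  have "2 * (norm (a - w))\<^sup>2 + 2 * (norm (b - w))\<^sup>2 = (norm (a - b))\<^sup>2 + 4 * (norm (m + (- 1) *\<^sub>R w))\<^sup>2"
   unfolding power2_norm_eq_inner m_def
   by (simp add: inner_diff inner_add inner_commute algebra_simps)
  then have "- 2 * t * (norm (a - w))\<^sup>2 + - 2 * t * (norm (b - w))\<^sup>2
    = - t * (norm (a - b))\<^sup>2 + - (4 * t) * (norm (m + (- 1) *\<^sub>R w))\<^sup>2"
   by (metis (no_types, opaque_lifting) distrib_left minus_mult_commute mult.assoc mult.left_commute)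
  then show ?thesis by (simp only: exp_add[symmetric])
 qed
 have i: "integrable lborel ?G" using assms by (intro integrable_gaussian) simp
 show "integrable lborel (\<lambda>w. exp (- 2 * t * (norm (a - w))\<^sup>2) * exp (- 2 * t * (norm (b - w))\<^sup>2))"
  unfolding eq by (intro integrable_mult_right lborel_integrable_affine[OF i]) simp
 show "(LINT w|lborel. exp (- 2 * t * (norm (a - w))\<^sup>2) * exp (- 2 * t * (norm (b - w))\<^sup>2))
  = exp (- t * (norm (a - b))\<^sup>2) * (LINT w|lborel. ?G w)"
  unfolding eq by (subst (2) lborel_integral_affine[where c="- 1" and t=m]) simp_all
qed


lemma integral_lborel_product:
 fixes f :: "'a::euclidean_space => 'c::{real_normed_field, banach, second_countable_topology}"
  and h :: "'b::euclidean_space => 'c"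
 assumes f: "integrable lborel f" and h: "integrable lborel h"
 shows "integrable lborel (\<lambda>p. f (fst p) * h (snd p))"
  and "(LINT p|lborel. f (fst p) * h (snd p)) = (LINT x|lborel. f x) * (LINT y|lborel. h y)"
proof -
 have [measurable]: "f \<in> borel_measurable borel" "h \<in> borel_measurable borel" using f h by simp_all
 have i: "integrable (lborel \<Otimes>\<^sub>M lborel) (\<lambda>p. f (fst p) * h (snd p))"
 proof (rule lborel_pair.Fubini_integrable)
  show "integrable lborel (\<lambda>x. LINT y|lborel. norm (f (fst (x, y)) * h (snd (x, y))))"
   using f by (simp add: norm_mult)
  show "AE x in lborel. integrable lborel (\<lambda>y. f (fst (x, y)) * h (snd (x, y)))"
   using h by simp
 qed measurable
 then show "integrable lborel (\<lambda>p. f (fst p) * h (snd p))" unfolding lborel_prod .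
 show "(LINT p|lborel. f (fst p) * h (snd p)) = (LINT x|lborel. f x) * (LINT y|lborel. h y)"
  using lborel_pair.integral_fst'[OF i] unfolding lborel_prod by simp
qed

text \<open>Against a charge \<open>q\<close> of total mass \<open>0\<close> the additive constants of the Gaussian mixture disappear,
  and each Gaussian energy is a square integral, hence nonnegative.\<close>

lemma log_energy_mixture:
 fixes q :: "'a::euclidean_space => real"
 assumes [measurable]: "q \<in> borel_measurable borel"
  and B: "\<And>x. \<bar>q x\<bar> \<le> B" and R: "\<And>x. R < norm x ==> q x = 0"
  and q0: "(LINT x|lborel. q x) = 0"
 defines "J \<equiv> \<lambda>t. LINT w|lborel. exp (- (4 * t) * (norm (w::'a))\<^sup>2)"
 defines "S \<equiv> \<lambda>t. LINT w|lborel. (LINT a|lborel. q a * exp (- 2 * t * (norm (a - w))\<^sup>2))\<^sup>2"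
 shows "integrable lborel (\<lambda>t. S t / (2 * t * J t) * indicator {0<..} t)"
  and "(LINT p|lborel. q (fst p) * q (snd p) * - ln (norm (fst p - snd p)))
   = (LINT t|lborel. S t / (2 * t * J t) * indicator {0<..} t)"
  and "\<And>t. 0 < t ==>
   integrable lborel (\<lambda>w. (LINT a|lborel. q a * exp (- 2 * t * (norm (a - w))\<^sup>2))\<^sup>2)"
proof -
 have [measurable]: "(\<lambda>p. q (fst p)) \<in> borel_measurable (borel :: ('a \<times> 'a) measure)"
  "(\<lambda>p. q (snd p)) \<in> borel_measurable (borel :: ('a \<times> 'a) measure)"
  unfolding borel_prod[symmetric] by measurable
 have qi: "integrable lborel q"
  using B R by (intro integrable_bounded_support[where B=B and R=R]) auto
 have lnmeas [measurable]: "(\<lambda>p::'a \<times> 'a. norm (fst p - snd p)) \<in> borel_measurable borel"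
  unfolding borel_prod[symmetric] by measurable
 have qq: "integrable lborel (\<lambda>p. q (fst p) * q (snd p))" "(LINT p|lborel. q (fst p) * q (snd p)) = 0"
  using integral_lborel_product[OF qi qi] q0 by simp_all
 have ln_int: "integrable lborel (\<lambda>p. q (fst p) * q (snd p) * - ln (norm (fst p - snd p)))"
  using log_pair_integrable[of q q B R] B R
  by (simp add: case_prod_beta' mult_ac)
 let ?r = "\<lambda>p::'a \<times> 'a. norm (fst p - snd p)"
 let ?f = "\<lambda>p t. q (fst p) * q (snd p) * log_mix (?r p) t"
 have ae: "AE p in (lborel :: ('a \<times> 'a) measure). 0 < ?r p"
  using AE_lborel_prod_neq by eventually_elim simp
 have i: "integrable (lborel \<Otimes>\<^sub>M lborel) (\<lambda>(p, t). ?f p t)"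
 proof (rule lborel_pair.Fubini_integrable)
  show "(\<lambda>(p, t). ?f p t) \<in> borel_measurable (lborel \<Otimes>\<^sub>M lborel)"
   unfolding log_mix_def by measurable
  have "AE p in lborel. (LINT t|lborel. norm (?f p t)) = \<bar>q (fst p) * q (snd p) * - ln (?r p)\<bar>"
   using ae by eventually_elim (simp add: abs_mult log_mix_integral)
  moreover have "integrable lborel (\<lambda>p. \<bar>q (fst p) * q (snd p) * - ln (?r p)\<bar>)"
   using ln_int by simp
  moreover have "(\<lambda>p. LINT t|lborel. norm (?f p t)) \<in> borel_measurable lborel"
   unfolding log_mix_def by measurable
  ultimately show "integrable lborel (\<lambda>p. LINT t|lborel. norm (case (p, t) of (p, t) => ?f p t))"
   by (subst Bochner_Integration.integrable_cong_AE[where g="\<lambda>p. \<bar>q (fst p) * q (snd p) * - ln (?r p)\<bar>"])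
     (auto simp del: abs_mult)
  show "AE p in lborel. integrable lborel (\<lambda>t. case (p, t) of (p, t) => ?f p t)"
   using ae by eventually_elim (simp add: log_mix_integral)
 qed
 have sq: "S t = (LINT p|lborel. q (fst p) * q (snd p) * exp (- t * (?r p)\<^sup>2)) * J t"
  and sqi: "integrable lborel (\<lambda>w. (LINT a|lborel. q a * exp (- 2 * t * (norm (a - w))\<^sup>2))\<^sup>2)"
  if t: "0 < t" for t
 proof -
  let ?e = "\<lambda>a w::'a. exp (- 2 * t * (norm (a - w))\<^sup>2)"
  let ?h = "\<lambda>p w. q (fst p) * q (snd p) * (?e (fst p) w * ?e (snd p) w)"
  note gp = gaussian_product_formula[OF t]
  have hi: "integrable (lborel \<Otimes>\<^sub>M lborel) (\<lambda>(p, w). ?h p w)"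
  proof (rule lborel_pair.Fubini_integrable)
   show "(\<lambda>(p, w). ?h p w) \<in> borel_measurable (lborel \<Otimes>\<^sub>M lborel)"
    unfolding borel_prod[symmetric] lborel_prod[symmetric] by measurable
   have "(LINT w|lborel. norm (?h p w)) = norm (q (fst p) * q (snd p)) * (exp (- t * (?r p)\<^sup>2) * J t)" for p
    using gp(1)[of "fst p" "snd p"] by (simp add: abs_mult J_def)
   moreover have "integrable lborel (\<lambda>p. norm (q (fst p) * q (snd p)) * (exp (- t * (?r p)\<^sup>2) * J t))"
   proof (rule Bochner_Integration.integrable_bound)
    show "integrable lborel (\<lambda>p. q (fst p) * q (snd p) * J t)" using qq(1) by simp
    show "AE p in lborel. norm (norm (q (fst p) * q (snd p)) * (exp (- t * (?r p)\<^sup>2) * J t))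
      \<le> norm (q (fst p) * q (snd p) * J t)"
    proof (rule AE_I2)
     fix p :: "'a \<times> 'a"
     have "norm (q (fst p) * q (snd p) * J t) * exp (- t * (?r p)\<^sup>2) \<le> norm (q (fst p) * q (snd p) * J t)"
      using t by (intro mult_left_le) auto
     then show "norm (norm (q (fst p) * q (snd p)) * (exp (- t * (?r p)\<^sup>2) * J t))
       \<le> norm (q (fst p) * q (snd p) * J t)"
      by (simp add: abs_mult mult_ac)
    qed
   qed measurable
   ultimately show "integrable lborel (\<lambda>p. LINT w|lborel. norm (case (p, w) of (p, w) => ?h p w))"
    by simp
   show "AE p in lborel. integrable lborel (\<lambda>w. case (p, w) of (p, w) => ?h p w)"
   proof (rule AE_I2)
    fix p :: "'a \<times> 'a"
    have "integrable lborel (?h p)" by (rule integrable_mult_right[OF gp(2)])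
    then show "integrable lborel (\<lambda>w. case (p, w) of (p, w) => ?h p w)" by (simp only: prod.case)
   qed
  qed
  have qe: "integrable lborel (\<lambda>a. q a * ?e a w)" for w
   using B R by (intro integrable_bounded_support[where B=B and R=R])
    (use t in \<open>auto simp: abs_mult intro!: mult_left_le[THEN order_trans]\<close>)
  have prod: "(LINT p|lborel. ?h p w) = (LINT a|lborel. q a * ?e a w)\<^sup>2" for w
   using integral_lborel_product(2)[OF qe[of w] qe[of w]] by (simp add: power2_eq_square mult_ac)
  show "integrable lborel (\<lambda>w. (LINT a|lborel. q a * ?e a w)\<^sup>2)"
   using lborel_pair.integrable_snd[OF hi] unfolding prod .
  have "S t = (LINT w|lborel. LINT p|lborel. ?h p w)"
   unfolding S_def prod ..
  also have "\<dots> = (LINT p|lborel. LINT w|lborel. ?h p w)"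
   by (rule lborel_pair.Fubini_integral[OF hi])
  also have "\<dots> = (LINT p|lborel. q (fst p) * q (snd p) * exp (- t * (?r p)\<^sup>2) * J t)"
  proof (intro Bochner_Integration.integral_cong refl)
   fix p :: "'a \<times> 'a"
   show "(LINT w|lborel. ?h p w) = q (fst p) * q (snd p) * exp (- t * (?r p)\<^sup>2) * J t"
    unfolding integral_mult_right_zero gp(1) J_def by (simp only: mult.assoc)
  qed
  finally show "S t = (LINT p|lborel. q (fst p) * q (snd p) * exp (- t * (?r p)\<^sup>2)) * J t" by simp
 qed
 have J: "0 < J t" if "0 < t" for t
 proof -
  have i: "integrable lborel (\<lambda>w::'a. exp (- (4 * t) * (norm w)\<^sup>2))"
   using that by (intro integrable_gaussian) simp
  have "J t \<noteq> 0"
  proof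
   assume "J t = 0"
   then have "AE w::'a in lborel. exp (- (4 * t) * (norm w)\<^sup>2) = 0"
    unfolding J_def using integral_nonneg_eq_0_iff_AE[OF i] by simp
   then have "AE w::'a in lborel. False" by simp
   then show False using AE_iff_measurable[of UNIV "lborel :: 'a measure" "\<lambda>_. False"] emeasure_lborel_UNIV[where 'a='a] by simp
  qed
  moreover have "0 \<le> J t" unfolding J_def by simp
  ultimately show ?thesis by simp
 qed
 have mix: "(LINT p|lborel. ?f p t) = S t / (2 * t * J t) * indicator {0<..} t" for t
 proof (cases "0 < t")
  case t: True
  have ei: "integrable lborel (\<lambda>p. q (fst p) * q (snd p) * exp (- t * (?r p)\<^sup>2))"
  proof (rule Bochner_Integration.integrable_bound[OF qq(1)])
   show "AE p in lborel. norm (q (fst p) * q (snd p) * exp (- t * (?r p)\<^sup>2)) \<le> norm (q (fst p) * q (snd p))"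
   proof (rule AE_I2)
    fix p :: "'a \<times> 'a"
    show "norm (q (fst p) * q (snd p) * exp (- t * (?r p)\<^sup>2)) \<le> norm (q (fst p) * q (snd p))"
     unfolding norm_mult[of "q (fst p) * q (snd p)"] using t by (intro mult_left_le) auto
   qed
  qed measurable
  have "(LINT p|lborel. ?f p t) = (LINT p|lborel. (1 / (2 * t)) *
    (q (fst p) * q (snd p) * exp (- t * (?r p)\<^sup>2) - exp (- t) * (q (fst p) * q (snd p))))"
   using t by (intro Bochner_Integration.integral_cong refl) (simp add: log_mix_def field_simps)
  also have "\<dots> = (1 / (2 * t)) * (LINT p|lborel. q (fst p) * q (snd p) * exp (- t * (?r p)\<^sup>2))"
   using ei qq by simp
  also have "(LINT p|lborel. q (fst p) * q (snd p) * exp (- t * (?r p)\<^sup>2)) = S t / J t"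
   using sq[OF t] J[OF t] by simp
  finally show ?thesis using t by simp
 qed (simp add: log_mix_def)
 show "integrable lborel (\<lambda>t. S t / (2 * t * J t) * indicator {0<..} t)"
  using lborel_pair.integrable_snd[OF i] unfolding mix .
 have "(LINT p|lborel. q (fst p) * q (snd p) * - ln (?r p)) = (LINT p|lborel. LINT t|lborel. ?f p t)"
 proof (rule integral_cong_AE)
  show "AE p in lborel. q (fst p) * q (snd p) * - ln (?r p) = (LINT t|lborel. ?f p t)"
   using ae by eventually_elim (simp add: log_mix_integral)
  show "(\<lambda>p. LINT t|lborel. ?f p t) \<in> borel_measurable lborel"
   unfolding log_mix_def by measurable
 qed (use ln_int in auto)
 also have "\<dots> = (LINT t|lborel. LINT p|lborel. ?f p t)"
  by (rule lborel_pair.Fubini_integral[OF i, symmetric])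
 also have "\<dots> = (LINT t|lborel. S t / (2 * t * J t) * indicator {0<..} t)"
  unfolding mix ..
 finally show "(LINT p|lborel. q (fst p) * q (snd p) * - ln (norm (fst p - snd p)))
   = (LINT t|lborel. S t / (2 * t * J t) * indicator {0<..} t)" .
 show "\<And>t. 0 < t ==>
   integrable lborel (\<lambda>w. (LINT a|lborel. q a * exp (- 2 * t * (norm (a - w))\<^sup>2))\<^sup>2)"
  by (rule sqi)
qed


text \<open>Far out in direction \<open>z\<close> the Gaussian smoothing of \<open>\<eta>\<close> decreases strictly along \<open>z\<close>; this
  bounds from below every Gaussian energy of the difference of \<open>\<eta>\<close> and its translate by \<open>z\<close>.\<close>

lemma log_energy_lower:
 fixes \<eta> :: "'a::euclidean_space => real"
 assumes \<eta>: "mollifier \<eta>" and A: "0 < A"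
 obtains c where "0 < c" "\<And>z. norm z \<le> A ==> c * (norm z)\<^sup>2 \<le>
  (LINT p|lborel. (\<eta> (fst p) - \<eta> (fst p + z)) * (\<eta> (snd p) - \<eta> (snd p + z)) * - ln (norm (fst p - snd p)))"
proof -
 have t: "test_function UNIV \<eta>" using \<eta> by (rule mollifier_test_function)
 have \<eta>0: "\<And>x. 0 \<le> \<eta> x" and \<eta>1: "(LINT x|lborel. \<eta> x) = 1" using \<eta> unfolding mollifier_def by blast+
 have supp: "\<eta> x = 0" if "1 \<le> norm x" for x
 proof -
  have "fun_support \<eta> \<subseteq> ball 0 1" using \<eta> unfolding mollifier_def test_function_def by blast
  then have "x \<notin> {x. \<eta> x \<noteq> 0}" using that closure_subset[of "{x. \<eta> x \<noteq> 0}"] unfolding fun_support_def by force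
  then show ?thesis by simp
 qed
 have [measurable]: "\<eta> \<in> borel_measurable borel" using t by (rule test_function_measurable)
 have int\<eta>: "integrable lborel \<eta>" using t by (rule test_function_integrable)
 obtain B R0 where B: "0 < B" "\<And>x. norm (\<eta> x) \<le> B" and "0 < R0" "\<And>x. R0 < norm x ==> \<eta> x = 0"
  by (rule test_function_bounds[OF t]) blast
 define J where "J t = (LINT w|lborel. exp (- (4 * t) * (norm (w::'a))\<^sup>2))" for t
 \<comment> \<open>\<open>exp (- 100)\<close> is the least value of \<open>exp (- 2 t |a - w|\<^sup>2)\<close> for \<open>t \<le> 2\<close> and \<open>|a - w| \<le> 5\<close>; the other
  factor comes from \<open>1 - exp (- 4 n) \<ge> 4 n / (1 + 4 n)\<close> for \<open>n \<le> A\<close>.\<close>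
 define m where "m = exp (- 100) * (4 / (1 + 4 * A))"
 define V where "V = measure lborel (ball (0::'a) 1)"
 have m: "0 < m" using A by (simp add: m_def)
 have V: "0 < V" unfolding V_def by simp
 have gi: "integrable lborel (\<lambda>w::'a. exp (- (4 * t) * (norm w)\<^sup>2))" if "0 < t" for t
  using that by (intro integrable_gaussian) simp
 have J0: "0 \<le> J t" for t unfolding J_def by simp
 have J1: "J t \<le> J 1" if "1 \<le> t" for t
  unfolding J_def
 proof (rule integral_mono)
  fix w :: 'a
  have "1 * (norm w)\<^sup>2 \<le> t * (norm w)\<^sup>2" using that by (intro mult_right_mono) auto
  then show "exp (- (4 * t) * (norm w)\<^sup>2) \<le> exp (- (4 * 1) * (norm w)\<^sup>2)" by simp
 qed (use that gi[of t] gi[of 1] in auto)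
 define c where "c = m\<^sup>2 * V / (4 * (J 1 + 1))"
 show ?thesis
 proof (rule that)
  show "0 < c" using m V J0[of 1] by (simp add: c_def)
  fix z :: 'a assume zA: "norm z \<le> A"
  define q where "q x = \<eta> x - \<eta> (x + z)" for x
  have [measurable]: "q \<in> borel_measurable borel" unfolding q_def by measurable
  have tr: "integrable lborel (\<lambda>x. \<eta> (x + z))" "(LINT x|lborel. \<eta> (x + z)) = 1"
   using lborel_integrable_affine[OF int\<eta>, of 1 z] lborel_integral_affine[of \<eta> 1 z] \<eta>1
   by (simp_all add: add.commute)
  have q0: "(LINT x|lborel. q x) = 0"
   unfolding q_def using int\<eta> tr \<eta>1 by simp
  have qB: "\<bar>q x\<bar> \<le> 2 * B" for x
   unfolding q_def using B(2)[of x] B(2)[of "x + z"] by (simp add: abs_le_iff)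
  have qR: "q x = 0" if "A + 1 < norm x" for x
  proof -
   have "1 \<le> norm (x + z)" using that zA norm_diff_ineq[of x z] by linarith
   then show ?thesis using that A supp[of x] supp[of "x + z"] unfolding q_def by simp
  qed
  define P where "P t w = (LINT a|lborel. q a * exp (- 2 * t * (norm (a - w))\<^sup>2))" for t w
  define S where "S t = (LINT w|lborel. (P t w)\<^sup>2)" for t
  note mix = log_energy_mixture[OF \<open>q \<in> borel_measurable borel\<close> qB qR q0, folded P_def, folded S_def J_def]
  have S0: "0 \<le> S t" for t unfolding S_def by simp
  have low: "c * (norm z)\<^sup>2 * 4 \<le> S t / J t" if t12: "1 \<le> t" "t \<le> 2" for t
  proof (cases "z = 0")
   case False
   define zh where "zh = (1 / norm z) *\<^sub>R z"
   have zh: "norm zh = 1" "z = norm z *\<^sub>R zh" using False by (simp_all add: zh_def)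
   have zz: "zh \<bullet> z = norm z" using False by (simp add: zh_def power2_norm_eq_inner[symmetric] power2_eq_square)
   \<comment> \<open>From a point \<open>w\<close> far out in direction \<open>z\<close>, moving the support back by \<open>z\<close> increases all
    distances.\<close>
   have Pw: "m * norm z \<le> P t w" if w: "w \<in> ball (3 *\<^sub>R zh) 1" for w
   proof -
    have wd: "norm (w - 3 *\<^sub>R zh) < 1" using w by (simp add: dist_norm norm_minus_commute)
    have wn: "norm w \<le> 4" using norm_triangle_sub[of w "3 *\<^sub>R zh"] wd zh by simp
    have "w \<bullet> z = 3 * norm z + (w - 3 *\<^sub>R zh) \<bullet> z" using zz by (simp add: inner_diff_left)
    moreover have "\<bar>(w - 3 *\<^sub>R zh) \<bullet> z\<bar> \<le> 1 * norm z"
     using wd by (intro order_trans[OF Cauchy_Schwarz_ineq2] mult_right_mono) auto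
    ultimately have wz: "2 * norm z \<le> w \<bullet> z" by linarith
    let ?E = "\<lambda>a. exp (- 2 * t * (norm (a - w))\<^sup>2)"
    have E1: "?E a \<le> 1" for a using t12 by simp
    have i1: "integrable lborel (\<lambda>a. \<eta> a * ?E a)"
     by (rule Bochner_Integration.integrable_bound[OF int\<eta>]) (use E1 in \<open>auto simp: abs_mult intro!: mult_left_le\<close>)
    have i2: "integrable lborel (\<lambda>a. \<eta> (a + z) * ?E a)"
     by (rule Bochner_Integration.integrable_bound[OF tr(1)]) (use E1 in \<open>auto simp: abs_mult intro!: mult_left_le\<close>)
    have e2: "(LINT a|lborel. \<eta> (a + z) * ?E a) = (LINT a|lborel. \<eta> a * ?E (a - z))"
     by (subst (2) lborel_integral_affine[where c=1 and t=z]) (simp_all add: add.commute)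
    have i3: "integrable lborel (\<lambda>a. \<eta> a * ?E (a - z))"
     using lborel_integrable_affine[OF i2, of 1 "- z"] by (simp add: add.commute)
    have "P t w = (LINT a|lborel. \<eta> a * ?E a - \<eta> (a + z) * ?E a)"
     unfolding P_def q_def by (simp add: left_diff_distrib)
    also have "\<dots> = (LINT a|lborel. \<eta> a * ?E a) - (LINT a|lborel. \<eta> a * ?E (a - z))"
     using i1 i2 e2 by simp
    also have "\<dots> = (LINT a|lborel. \<eta> a * ?E a - \<eta> a * ?E (a - z))"
     using i1 i3 by simp
    also have "\<dots> \<ge> (LINT a|lborel. m * norm z * \<eta> a)"
    proof (rule integral_mono)
     show "integrable lborel (\<lambda>a. m * norm z * \<eta> a)" using int\<eta> by simp
     show "integrable lborel (\<lambda>a. \<eta> a * ?E a - \<eta> a * ?E (a - z))" using i1 i3 by simp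
     fix a
     show "m * norm z * \<eta> a \<le> \<eta> a * ?E a - \<eta> a * ?E (a - z)"
     proof (cases "norm a < 1")
      case True
      define n where "n = norm z"
      have n: "0 \<le> n" "n \<le> A" using zA by (simp_all add: n_def)
      have aw: "norm (a - w) \<le> 5" using True wn norm_triangle_ineq4[of a w] by linarith
      have az: "a \<bullet> z \<le> n"
       using True Cauchy_Schwarz_ineq2[of a z] mult_right_mono[of "norm a" 1 "norm z"]
       unfolding n_def by (simp add: abs_le_iff)
      have nsq: "(norm (a - z - w))\<^sup>2 = (norm (a - w))\<^sup>2 + (norm z)\<^sup>2 + 2 * (w \<bullet> z - a \<bullet> z)"
       unfolding power2_norm_eq_inner by (simp add: inner_diff inner_commute algebra_simps)
      then have "(norm (a - w))\<^sup>2 + 2 * n \<le> (norm (a - z - w))\<^sup>2"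
      proof -
       have az': "a \<bullet> z \<le> n" by (rule az)
       have wz': "2 * n \<le> w \<bullet> z" using wz by (simp only: n_def)
       have d: "n \<le> w \<bullet> z - a \<bullet> z" using add_mono[OF wz' az'] by (simp add: algebra_simps)
       have d2: "2 * n \<le> 2 * (w \<bullet> z - a \<bullet> z)" using d by (intro mult_left_mono) auto
       show ?thesis unfolding nsq
        by (rule add_mono[OF add_increasing2[OF zero_le_power2 order_refl] d2])
      qed
      then have "2 * t * ((norm (a - w))\<^sup>2 + 2 * n) \<le> 2 * t * (norm (a - z - w))\<^sup>2"
       using t12 by (intro mult_left_mono) auto
      moreover have "4 * n \<le> 2 * t * (2 * n)" using t12 n mult_right_mono[of 1 t "4 * n"] by simp
      ultimately have "- 2 * t * (norm (a - z - w))\<^sup>2 \<le> - 2 * t * (norm (a - w))\<^sup>2 + - (4 * n)"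
       by (simp add: distrib_left)
      then have "?E (a - z) \<le> exp (- 2 * t * (norm (a - w))\<^sup>2 + - (4 * n))"
       by (simp only: exp_le_cancel_iff)
      also have "\<dots> = ?E a * exp (- (4 * n))" by (rule exp_add)
      finally have d1: "?E a * (1 - exp (- (4 * n))) \<le> ?E a - ?E (a - z)" by (simp add: right_diff_distrib)
      have "exp (- (4 * n)) \<le> 1 / (1 + 4 * n)"
       using exp_ge_add_one_self[of "4 * n"] n unfolding exp_minus
       by (simp add: inverse_eq_divide frac_le)
      then have "4 * n / (1 + 4 * n) \<le> 1 - exp (- (4 * n))" using n by (simp add: field_simps)
      moreover have "4 * n / (1 + 4 * A) \<le> 4 * n / (1 + 4 * n)"
       using n by (intro divide_left_mono mult_pos_pos) auto
      ultimately have d2: "4 * n / (1 + 4 * A) \<le> 1 - exp (- (4 * n))" by linarith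
      have "t * (norm (a - w))\<^sup>2 \<le> 2 * 5\<^sup>2"
       using t12 aw by (intro mult_mono power_mono) auto
      then have d3: "exp (- 100) \<le> ?E a" by simp
      have "m * n = exp (- 100) * (4 * n / (1 + 4 * A))" by (simp add: m_def)
      also have "\<dots> \<le> ?E a * (1 - exp (- (4 * n)))"
       using d2 d3 n A by (intro mult_mono) auto
      finally have "m * n \<le> ?E a - ?E (a - z)" using d1 by linarith
      from mult_left_mono[OF this \<eta>0[of a]] show ?thesis by (simp add: n_def algebra_simps)
     qed (use supp[of a] in simp)
    qed
    finally show ?thesis using \<eta>1 by simp
   qed
   have "m\<^sup>2 * (norm z)\<^sup>2 * V = (LINT w|lborel. (m * norm z)\<^sup>2 * indicator (ball (3 *\<^sub>R zh) 1) w)"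
    by (simp add: V_def power_mult_distrib content_ball)
   also have "\<dots> \<le> S t"
    unfolding S_def
   proof (rule integral_mono)
    show "integrable lborel (\<lambda>w. (m * norm z)\<^sup>2 * indicator (ball (3 *\<^sub>R zh) 1) w :: real)"
     using emeasure_lborel_ball_finite[of "3 *\<^sub>R zh" 1] by (auto intro!: integrable_mult_right)
    show "integrable lborel (\<lambda>w. (P t w)\<^sup>2)" by (rule mix(3)[of "A + 1"]) (use t12 in auto)
    fix w
    show "(m * norm z)\<^sup>2 * indicator (ball (3 *\<^sub>R zh) 1) w \<le> (P t w)\<^sup>2"
    proof (cases "w \<in> ball (3 *\<^sub>R zh) 1")
     case True
     then show ?thesis using Pw[OF True] m by (simp add: power_mono)
    qed simp
   qed
   finally have S_low: "m\<^sup>2 * (norm z)\<^sup>2 * V \<le> S t" .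
   have Jp: "0 < J t"
   proof (rule ccontr)
    assume "\<not> 0 < J t"
    then have "J t = 0" using J0[of t] by simp
    then have "AE w::'a in lborel. exp (- (4 * t) * (norm w)\<^sup>2) = 0"
     unfolding J_def using integral_nonneg_eq_0_iff_AE[OF gi[of t]] t12 by simp
    then have "AE w::'a in lborel. False" by simp
    then show False using AE_iff_measurable[of UNIV "lborel :: 'a measure" "\<lambda>_. False"] emeasure_lborel_UNIV[where 'a='a] by simp
   qed
   have "c * (norm z)\<^sup>2 * 4 = m\<^sup>2 * (norm z)\<^sup>2 * V / (J 1 + 1)"
    using J0[of 1] by (simp add: c_def field_simps)
   also have "\<dots> \<le> m\<^sup>2 * (norm z)\<^sup>2 * V / J t"
    using J1[OF t12(1)] Jp V by (intro divide_left_mono mult_nonneg_nonneg mult_pos_pos) auto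
   also have "\<dots> \<le> S t / J t" using S_low Jp by (intro divide_right_mono) auto
   finally show ?thesis .
  qed (use S0 J0 in simp)
  have "c * (norm z)\<^sup>2 = (LINT t|lborel. c * (norm z)\<^sup>2 * indicator {1..2} (t::real))" by simp
  also have "\<dots> \<le> (LINT t|lborel. S t / (2 * t * J t) * indicator {0<..} t)"
  proof (rule integral_mono)
   show "integrable lborel (\<lambda>t. S t / (2 * t * J t) * indicator {0<..} t)" by (rule mix(1))
   fix t :: real
   show "c * (norm z)\<^sup>2 * indicator {1..2} t \<le> S t / (2 * t * J t) * indicator {0<..} t"
   proof (cases "t \<in> {1..2}")
    case True
    have "c * (norm z)\<^sup>2 = (c * (norm z)\<^sup>2 * 4) / 4" by simp
    also have "\<dots> \<le> (S t / J t) / 4" using low[of t] True by (intro divide_right_mono) auto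
    also have "\<dots> \<le> (S t / J t) / (2 * t)" using True S0[of t] J0[of t] by (intro divide_left_mono) auto
    finally show ?thesis using True by (simp add: mult_ac)
   next
    case False
    then show ?thesis using S0[of t] J0[of t] by (auto simp: indicator_def)
   qed
  qed (simp add: integrable_real_indicator)
  also have "\<dots> = (LINT p|lborel. q (fst p) * q (snd p) * - ln (norm (fst p - snd p)))"
   by (rule mix(2)[symmetric])
  finally show "c * (norm z)\<^sup>2 \<le> (LINT p|lborel. (\<eta> (fst p) - \<eta> (fst p + z)) * (\<eta> (snd p) - \<eta> (snd p + z)) * - ln (norm (fst p - snd p)))"
   unfolding q_def .
 qed
qed

section \<open>Covariances of the convolution approximations\<close>

definition mol :: "('a::euclidean_space => real) => real => 'a => 'a => real" where
 "mol \<eta> e x = (\<lambda>u. rescale \<eta> e (x - u))"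

lemma mollifier_zero:
 assumes "mollifier \<eta>" "1 \<le> norm x"
 shows "\<eta> x = 0"
proof -
 have "fun_support \<eta> \<subseteq> ball 0 1" using assms(1) unfolding mollifier_def test_function_def by blast
 then have "x \<notin> {x. \<eta> x \<noteq> 0}" using assms(2) closure_subset[of "{x. \<eta> x \<noteq> 0}"] unfolding fun_support_def by force
 then show ?thesis by simp
qed

lemma mol_test_function:
 "mollifier \<eta> ==> 0 < e ==> test_function UNIV (mol \<eta> e x)"
 unfolding mol_def by (intro test_function_translate test_function_rescale)

lemma mol_nonneg:
 assumes "mollifier \<eta>" "0 < e"
 shows "0 \<le> mol \<eta> e x u"
proof -
 have "0 \<le> \<eta> v" for v using assms(1) unfolding mollifier_def by blast
 then show ?thesis using assms(2) by (simp add: mol_def rescale_def)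
qed

lemma mol_support:
 assumes "mollifier \<eta>" "0 < e" "mol \<eta> e x u \<noteq> 0"
 shows "dist x u < e"
proof -
 have "\<eta> ((x - u) /\<^sub>R e) \<noteq> 0" using assms(3) by (auto simp: mol_def rescale_def)
 then have "norm ((x - u) /\<^sub>R e) < 1" using mollifier_zero[OF assms(1)] not_le by blast
 moreover have "norm ((x - u) /\<^sub>R e) = norm (x - u) / e"
  unfolding norm_scaleR using assms(2) by (simp add: divide_inverse mult.commute)
 ultimately show ?thesis using assms(2) by (simp add: dist_norm)
qed

lemma mol_affine: "0 < e ==> mol \<eta> e x (w + (- e) *\<^sub>R a) = \<eta> (a + (x - w) /\<^sub>R e) / e ^ DIM('a)"
 for x :: "'a::euclidean_space"
 by (simp add: mol_def rescale_def scaleR_diff_right scaleR_add_right algebra_simps)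

lemma mol_integral:
 fixes \<eta> :: "'a::euclidean_space => real"
 assumes \<eta>: "mollifier \<eta>" "0 < e"
 shows "(LINT u|lborel. mol \<eta> e x u) = 1"
proof -
 have [measurable]: "mol \<eta> e x \<in> borel_measurable borel"
  by (intro test_function_measurable mol_test_function \<eta>)
 have \<eta>1: "(LINT x|lborel. \<eta> x) = 1" using \<eta> unfolding mollifier_def by blast
 have "(LINT u|lborel. mol \<eta> e x u) = \<bar>- e\<bar> ^ DIM('a) *\<^sub>R (LINT a|lborel. mol \<eta> e x (x + (- e) *\<^sub>R a))"
  using \<eta>(2) by (intro lborel_integral_affine) auto
 also have "\<dots> = (LINT a|lborel. \<eta> a)"
  unfolding mol_affine[OF \<eta>(2)] using \<eta>(2) by simp
 finally show ?thesis using \<eta>1 by simp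
qed

lemma test_function_uniform_bounds:
 fixes f h :: "'a::euclidean_space => real"
 assumes "test_function UNIV f" "test_function UNIV h"
 obtains B R where "\<And>x. \<bar>f x\<bar> \<le> B" "\<And>x. R < norm x ==> f x = 0"
  "\<And>x. \<bar>h x\<bar> \<le> B" "\<And>x. R < norm x ==> h x = 0"
proof -
 obtain B R where f: "0 < B" "0 < R" "\<And>x. norm (f x) \<le> B" "\<And>x. R < norm x ==> f x = 0"
  by (rule test_function_bounds[OF assms(1)]) blast
 obtain B' R' where h: "0 < B'" "0 < R'" "\<And>x. norm (h x) \<le> B'" "\<And>x. R' < norm x ==> h x = 0"
  by (rule test_function_bounds[OF assms(2)]) blast
 show ?thesis
 proof (rule that[of "max B B'" "max R R'"])
  show "\<bar>f x\<bar> \<le> max B B'" "\<bar>h x\<bar> \<le> max B B'" for x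
   using f(3)[of x] h(3)[of x] by auto
 qed (use f(4) h(4) in auto)
qed

lemma log_pair_integrable_test:
 fixes f h :: "'a::euclidean_space => real"
 assumes "test_function UNIV f" "test_function UNIV h"
 shows "integrable lborel (\<lambda>p. - ln (norm (fst p - snd p)) * f (fst p) * h (snd p))"
proof -
 obtain B R where b: "\<And>x. \<bar>f x\<bar> \<le> B" "\<And>x. R < norm x ==> f x = 0"
  "\<And>x. \<bar>h x\<bar> \<le> B" "\<And>x. R < norm x ==> h x = 0"
  by (rule test_function_uniform_bounds[OF assms]) blast
 have "integrable lborel (\<lambda>(u, v). ln (norm (u - v)) * f u * h v)"
  by (rule log_pair_integrable[of f h B R])
    (use b test_function_measurable[OF assms(1)] test_function_measurable[OF assms(2)] in auto)
 then have "integrable lborel (\<lambda>p. - (ln (norm (fst p - snd p)) * f (fst p) * h (snd p)))"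
  by (simp add: case_prod_beta')
 then show ?thesis by simp
qed

text \<open>The mollifier is Lipschitz and has bounded support; the scale enters by homogeneity.\<close>

lemma translate_L1_bound:
 fixes \<eta> :: "'a::euclidean_space => real"
 assumes \<eta>: "mollifier \<eta>"
 obtains L where "0 < L"
  "\<And>e x y. 0 < e ==> (LINT u|lborel. \<bar>mol \<eta> e x u - mol \<eta> e y u\<bar>) \<le> L * (norm (x - y) / e)"
proof -
 have t: "test_function UNIV \<eta>" using \<eta> by (rule mollifier_test_function)
 obtain L where L: "0 < L" "\<And>x y. \<bar>\<eta> x - \<eta> y\<bar> \<le> L * norm (x - y)"
  by (rule test_function_Lipschitz[OF t]) blast
 have [measurable]: "\<eta> \<in> borel_measurable borel" using t by (rule test_function_measurable)
 define V where "V = measure lborel (ball (0::'a) 1)"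
 have V: "0 < V" unfolding V_def by simp
 show ?thesis
 proof (rule that)
  show "0 < 2 * L * V" using L V by simp
  fix e :: real and x y :: 'a assume e: "0 < e"
  define z where "z = (y - x) /\<^sub>R e"
  have [measurable]: "mol \<eta> e w \<in> borel_measurable borel" for w
   by (intro test_function_measurable mol_test_function \<eta> e)
  have "(LINT u|lborel. \<bar>mol \<eta> e x u - mol \<eta> e y u\<bar>)
    = \<bar>- e\<bar> ^ DIM('a) *\<^sub>R (LINT a|lborel. \<bar>mol \<eta> e x (x + (- e) *\<^sub>R a) - mol \<eta> e y (x + (- e) *\<^sub>R a)\<bar>)"
   using e by (intro lborel_integral_affine) auto
  also have "\<dots> = (LINT a|lborel. \<bar>\<eta> a - \<eta> (a + z)\<bar>)"
   unfolding mol_affine[OF e] z_def using e by (simp add: diff_divide_distrib[symmetric] abs_divide)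
  also have "\<dots> \<le> (LINT a|lborel. L * norm z * (indicator (ball 0 1) a + indicator (ball (- z) 1) a))"
  proof (rule integral_mono)
   have "integrable lborel (\<lambda>a. \<eta> (a + z))"
    using lborel_integrable_affine[OF test_function_integrable[OF t], of 1 z] by (simp add: add.commute)
   then show "integrable lborel (\<lambda>a. \<bar>\<eta> a - \<eta> (a + z)\<bar>)"
    using test_function_integrable[OF t] by simp
   have "integrable lborel (indicator (ball w 1) :: 'a => real)" for w
    using emeasure_lborel_ball_finite[of w 1] by simp
   then show "integrable lborel (\<lambda>a. L * norm z * (indicator (ball 0 1) a + indicator (ball (- z) 1) a :: real))"
    by (intro integrable_mult_right Bochner_Integration.integrable_add)
   fix a
   show "\<bar>\<eta> a - \<eta> (a + z)\<bar> \<le> L * norm z * (indicator (ball 0 1) a + indicator (ball (- z) 1) a)"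
   proof (cases "\<eta> a = 0 \<and> \<eta> (a + z) = 0")
    case False
    then have "norm a < 1 \<or> norm (a + z) < 1" using mollifier_zero[OF \<eta>] not_le by blast
    then have "(1::real) \<le> indicator (ball 0 1) a + indicator (ball (- z) 1) a"
     by (auto simp: indicator_def dist_norm norm_minus_commute add.commute)
    then have "L * norm z * 1 \<le> L * norm z * (indicator (ball 0 1) a + indicator (ball (- z) 1) a)"
     using L by (intro mult_left_mono) auto
    then show ?thesis using L(2)[of a "a + z"] by simp
   qed (use L in simp)
  qed
  also have "\<dots> = L * norm z * (V + measure lborel (ball (- z) 1))"
  proof -
   have "integrable lborel (indicator (ball w 1) :: 'a => real)" for w
    using emeasure_lborel_ball_finite[of w 1] by simp
   then show ?thesis unfolding V_def by simp
  qed
  also have "measure lborel (ball (- z) 1) = V" unfolding V_def by (simp add: content_ball)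
  also have "L * norm z * (V + V) = 2 * L * V * (norm (x - y) / e)"
  proof -
   have "norm z = norm (x - y) / e"
    unfolding z_def norm_scaleR using e by (simp add: norm_minus_commute[of y x] divide_inverse mult.commute)
   then show ?thesis by simp
  qed
  finally show "(LINT u|lborel. \<bar>mol \<eta> e x u - mol \<eta> e y u\<bar>) \<le> 2 * L * V * (norm (x - y) / e)" .
 qed
qed

lemma compact_neighbourhood:
 fixes K U :: "'a::euclidean_space set"
 assumes "compact K" "open U" "K \<subseteq> U"
 obtains \<rho> K' where "0 < \<rho>" "compact K'" "K' \<subseteq> U" "\<And>x u. x \<in> K ==> dist x u \<le> \<rho> ==> u \<in> K'"
proof (cases "K = {}")
 case True
 then show ?thesis using that[of 1 "{}"] by auto
next
 case False
 obtain e where e: "0 < e" "{x. infdist x K \<le> e} \<subseteq> U"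
  using compact_in_open_separated[OF False assms] by metis
 show ?thesis
 proof (rule that[OF e(1) _ e(2)])
  show "compact {x. infdist x K \<le> e}" by (rule compact_infdist_le[OF False assms(1) e(1)])
  show "u \<in> {x. infdist x K \<le> e}" if "x \<in> K" "dist x u \<le> e" for x u
   using infdist_le[OF that(1), of u] that(2) by (simp add: dist_commute)
 qed
qed

context log_field
begin

lemma U_open: "open U" and g_continuous: "continuous_on (U \<times> U) (\<lambda>(x, y). g x y)"
 using field unfolding log_correlated_field_def by blast+

text \<open>The cutoff to \<open>K\<close> makes the bounded part of the kernel bounded and Borel on the whole
  space.\<close>

definition gK :: "'a set => 'a \<times> 'a => real" where
 "gK K p = indicator (K \<times> K) p *\<^sub>R g (fst p) (snd p)"

lemma gK_measurable [measurable]: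
 assumes "compact K" "K \<subseteq> U"
 shows "gK K \<in> borel_measurable borel"
 unfolding gK_def[abs_def]
proof (rule borel_measurable_continuous_on_indicator)
 show "K \<times> K \<in> sets borel" using assms by (intro borel_compact compact_Times)
 show "continuous_on (K \<times> K) (\<lambda>p. g (fst p) (snd p))"
  using continuous_on_subset[OF g_continuous, of "K \<times> K"] assms by (auto simp: case_prod_beta')
qed

lemma g_bounded:
 assumes "compact K" "K \<subseteq> U"
 obtains G where "0 \<le> G" "\<And>x y. x \<in> K ==> y \<in> K ==> \<bar>g x y\<bar> \<le> G" "\<And>p. \<bar>gK K p\<bar> \<le> G"
proof -
 have "compact ((\<lambda>(x, y). g x y) ` (K \<times> K))"
  using assms by (intro compact_continuous_image continuous_on_subset[OF g_continuous] compact_Times) auto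
 then obtain G where G: "\<forall>z \<in> (\<lambda>(x, y). g x y) ` (K \<times> K). norm z \<le> G"
  using compact_imp_bounded bounded_iff by metis
 have b: "\<bar>g x y\<bar> \<le> max G 0" if "x \<in> K" "y \<in> K" for x y
  using G that by fastforce
 show ?thesis
 proof (rule that[of "max G 0"])
  show "\<bar>gK K p\<bar> \<le> max G 0" for p
   using b[of "fst p" "snd p"] by (cases p) (auto simp: gK_def indicator_def)
 qed (use b in auto)
qed

text \<open>Inside a compact subset of \<open>U\<close> the covariance splits into a logarithmic energy, which is
  invariant under translations, and a bounded remainder.\<close>

lemma cov_split:
 assumes K: "compact K" "K \<subseteq> U"
  and f: "test_function UNIV f" "\<And>u. f u \<noteq> 0 ==> u \<in> K"
  and h: "test_function UNIV h" "\<And>u. h u \<noteq> 0 ==> u \<in> K"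
 shows "cov f h = (LINT p|lborel. - ln (norm (fst p - snd p)) * f (fst p) * h (snd p))
   + (LINT p|lborel. gK K p * (f (fst p) * h (snd p)))"
  and "integrable lborel (\<lambda>p. gK K p * (f (fst p) * h (snd p)))"
proof -
 obtain G where G: "0 \<le> G" "\<And>p. \<bar>gK K p\<bar> \<le> G" using g_bounded[OF K] by metis
 have [measurable]: "gK K \<in> borel_measurable borel" by (rule gK_measurable[OF K])
 have fh: "integrable lborel (\<lambda>p. f (fst p) * h (snd p))"
  by (intro integral_lborel_product test_function_integrable f h)
 have [measurable]: "(\<lambda>p. f (fst p) * h (snd p)) \<in> borel_measurable borel" using fh by simp
 show gi: "integrable lborel (\<lambda>p. gK K p * (f (fst p) * h (snd p)))"
 proof (rule Bochner_Integration.integrable_bound)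
  show "integrable lborel (\<lambda>p. G * (f (fst p) * h (snd p)))" using fh by (rule integrable_mult_right)
  show "AE p in lborel. norm (gK K p * (f (fst p) * h (snd p))) \<le> norm (G * (f (fst p) * h (snd p)))"
   using G by (intro AE_I2) (simp add: abs_mult mult_right_mono)
 qed measurable
 have "cov f h = (LINT p|lborel. - ln (norm (fst p - snd p)) * f (fst p) * h (snd p) + gK K p * (f (fst p) * h (snd p)))"
  unfolding cov_kernel[OF f(1) h(1)]
 proof (intro Bochner_Integration.integral_cong refl)
  fix p :: "'a \<times> 'a"
  obtain u v where p: "p = (u, v)" by (cases p)
  show "(case p of (x, y) => log_kernel U g x y * f x * h y)
    = - ln (norm (fst p - snd p)) * f (fst p) * h (snd p) + gK K p * (f (fst p) * h (snd p))"
  proof (cases "f u = 0 \<or> h v = 0")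
   case False
   then have "u \<in> K" "v \<in> K" using f(2) h(2) by auto
   then show ?thesis using K(2) by (auto simp: p log_kernel_def gK_def ln_inverse algebra_simps)
  qed (auto simp: p)
 qed
 also have "\<dots> = (LINT p|lborel. - ln (norm (fst p - snd p)) * f (fst p) * h (snd p))
   + (LINT p|lborel. gK K p * (f (fst p) * h (snd p)))"
  by (rule Bochner_Integration.integral_add[OF log_pair_integrable_test[OF f(1) h(1)] gi])
 finally show "cov f h = (LINT p|lborel. - ln (norm (fst p - snd p)) * f (fst p) * h (snd p))
   + (LINT p|lborel. gK K p * (f (fst p) * h (snd p)))" .
qed

text \<open>Pointwise bounds for the kernel become bounds for the covariances of probability densities.\<close>

lemma cov_average:
 assumes K: "compact K" "K \<subseteq> U"
  and f: "test_function UNIV f" "\<And>u. f u \<noteq> 0 ==> u \<in> K" "\<And>u. 0 \<le> f u" "(LINT u|lborel. f u) = 1"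
  and h: "test_function UNIV h" "\<And>u. h u \<noteq> 0 ==> u \<in> K" "\<And>u. 0 \<le> h u" "(LINT u|lborel. h u) = 1"
 shows "(\<And>u v. f u \<noteq> 0 ==> h v \<noteq> 0 ==> u \<noteq> v ==> - ln (norm (u - v)) + g u v \<le> c) ==> cov f h \<le> c"
  and "(\<And>u v. f u \<noteq> 0 ==> h v \<noteq> 0 ==> u \<noteq> v ==> c \<le> - ln (norm (u - v)) + g u v) ==> c \<le> cov f h"
proof -
 let ?F = "\<lambda>p. - ln (norm (fst p - snd p)) * f (fst p) * h (snd p) + gK K p * (f (fst p) * h (snd p))"
 note s = cov_split[OF K f(1,2) h(1,2)] and l = log_pair_integrable_test[OF f(1) h(1)]
 have eq: "cov f h = (LINT p|lborel. ?F p)" and i: "integrable lborel ?F"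
  using s l by simp_all
 have fh: "integrable lborel (\<lambda>p. c * (f (fst p) * h (snd p)))" "(LINT p|lborel. c * (f (fst p) * h (snd p))) = c"
  using integral_lborel_product[OF test_function_integrable[OF f(1)] test_function_integrable[OF h(1)]] f(4) h(4)
  by simp_all
 have F: "?F p = (- ln (norm (fst p - snd p)) + g (fst p) (snd p)) * (f (fst p) * h (snd p))" for p
  using f(2)[of "fst p"] h(2)[of "snd p"] by (cases p) (auto simp: gK_def indicator_def algebra_simps)
 have fh0: "0 \<le> f u * h v" for u v using f(3) h(3) by simp
 show "cov f h \<le> c" if *: "\<And>u v. f u \<noteq> 0 ==> h v \<noteq> 0 ==> u \<noteq> v ==> - ln (norm (u - v)) + g u v \<le> c"
 proof -
  have "(LINT p|lborel. ?F p) \<le> (LINT p|lborel. c * (f (fst p) * h (snd p)))"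
  proof (rule integral_mono_AE[OF i fh(1)])
   show "AE p in lborel. ?F p \<le> c * (f (fst p) * h (snd p))"
    using AE_lborel_prod_neq
   proof eventually_elim
    case (elim p)
    show ?case
    proof (cases "f (fst p) = 0 \<or> h (snd p) = 0")
     case False
     then show ?thesis unfolding F
      using *[of "fst p" "snd p"] elim fh0[of "fst p" "snd p"] by (intro mult_right_mono) auto
    qed auto
   qed
  qed
  then show ?thesis unfolding eq fh(2) .
 qed
 show "c \<le> cov f h" if *: "\<And>u v. f u \<noteq> 0 ==> h v \<noteq> 0 ==> u \<noteq> v ==> c \<le> - ln (norm (u - v)) + g u v"
 proof -
  have "(LINT p|lborel. c * (f (fst p) * h (snd p))) \<le> (LINT p|lborel. ?F p)"
  proof (rule integral_mono_AE[OF fh(1) i])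
   show "AE p in lborel. c * (f (fst p) * h (snd p)) \<le> ?F p"
    using AE_lborel_prod_neq
   proof eventually_elim
    case (elim p)
    show ?case
    proof (cases "f (fst p) = 0 \<or> h (snd p) = 0")
     case False
     then show ?thesis unfolding F
      using *[of "fst p" "snd p"] elim fh0[of "fst p" "snd p"] by (intro mult_right_mono) auto
    qed auto
   qed
  qed
  then show ?thesis unfolding eq fh(2) .
 qed
qed

text \<open>The logarithmic potential of a mollifier at scale \<open>\<epsilon>\<close> is at most \<open>- ln
  \<epsilon>\<close> plus a constant, and an average of it obeys the same bound.\<close>

lemma cov_upper_scale:
 assumes K: "compact K" "K \<subseteq> U" and \<eta>: "mollifier \<eta>"
 obtains c where "0 \<le> c" "\<And>e x h. 0 < e ==> (\<And>u. dist x u \<le> e ==> u \<in> K) ==>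
  test_function UNIV h ==> (\<And>u. h u \<noteq> 0 ==> u \<in> K) ==> (\<And>u. 0 \<le> h u) ==> (LINT u|lborel. h u) = 1 ==>
  cov (mol \<eta> e x) h \<le> - ln e + c"
proof -
 obtain c where c: "0 \<le> c"
  "\<And>e x v. 0 < e ==> (LINT u|lborel. rescale \<eta> e (x - u) * - ln (norm (u - v))) \<le> - ln e + c"
  by (rule log_potential_upper[OF \<eta>]) blast
 obtain G where G: "0 \<le> G" "\<And>p. \<bar>gK K p\<bar> \<le> G" using g_bounded[OF K] by metis
 show ?thesis
 proof (rule that)
  show "0 \<le> c + G" using c(1) G(1) by simp
  fix e :: real and x :: 'a and h :: "'a => real"
  assume e: "0 < e" and x: "\<And>u. dist x u \<le> e ==> u \<in> K" and h: "test_function UNIV h"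
   "\<And>u. h u \<noteq> 0 ==> u \<in> K" "\<And>u. 0 \<le> h u" "(LINT u|lborel. h u) = 1"
  let ?f = "mol \<eta> e x"
  have f: "test_function UNIV ?f" by (rule mol_test_function[OF \<eta> e])
  have fK: "u \<in> K" if "?f u \<noteq> 0" for u using mol_support[OF \<eta> e that] x by simp
  have s1: "cov ?f h = (LINT p|lborel. - ln (norm (fst p - snd p)) * ?f (fst p) * h (snd p))
   + (LINT p|lborel. gK K p * (?f (fst p) * h (snd p)))"
   by (rule cov_split(1)[OF K f fK h(1,2)])
  have s2: "integrable lborel (\<lambda>p. gK K p * (?f (fst p) * h (snd p)))"
   by (rule cov_split(2)[OF K f fK h(1,2)])
  have i: "integrable (lborel \<Otimes>\<^sub>M lborel) (\<lambda>(u, v). - ln (norm (u - v)) * ?f u * h v)"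
   using log_pair_integrable_test[OF f h(1)] unfolding lborel_prod by (simp add: case_prod_beta')
  have "(LINT p|lborel. - ln (norm (fst p - snd p)) * ?f (fst p) * h (snd p))
    = (LINT v|lborel. LINT u|lborel. - ln (norm (u - v)) * ?f u * h v)"
   using lborel_pair.integral_snd[OF i] unfolding lborel_prod by (simp add: case_prod_beta')
  also have "\<dots> \<le> (LINT v|lborel. (- ln e + c) * h v)"
  proof (rule integral_mono)
   show "integrable lborel (\<lambda>v. LINT u|lborel. - ln (norm (u - v)) * ?f u * h v)"
    by (rule lborel_pair.integrable_snd[OF i])
   show "integrable lborel (\<lambda>v. (- ln e + c) * h v)"
    using test_function_integrable[OF h(1)] by simp
   fix v
   have "(LINT u|lborel. - ln (norm (u - v)) * ?f u * h v) = (LINT u|lborel. rescale \<eta> e (x - u) * - ln (norm (u - v))) * h v"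
    unfolding mol_def by (simp add: mult.commute)
   also have "\<dots> \<le> (- ln e + c) * h v" by (intro mult_right_mono c e h)
   finally show "(LINT u|lborel. - ln (norm (u - v)) * ?f u * h v) \<le> (- ln e + c) * h v" .
  qed
  also have "\<dots> = - ln e + c" using h(4) by simp
  finally have 1: "(LINT p|lborel. - ln (norm (fst p - snd p)) * ?f (fst p) * h (snd p)) \<le> - ln e + c" .
  have fh: "integrable lborel (\<lambda>p. G * (?f (fst p) * h (snd p)))" "(LINT p|lborel. G * (?f (fst p) * h (snd p))) = G"
   using integral_lborel_product[OF test_function_integrable[OF f] test_function_integrable[OF h(1)]]
    mol_integral[OF \<eta> e, of x] h(4) by simp_all
  have "(LINT p|lborel. gK K p * (?f (fst p) * h (snd p))) \<le> (LINT p|lborel. G * (?f (fst p) * h (snd p)))"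
  proof (rule integral_mono[OF s2 fh(1)])
   fix p show "gK K p * (?f (fst p) * h (snd p)) \<le> G * (?f (fst p) * h (snd p))"
    using G(2)[of p] mol_nonneg[OF \<eta> e] h(3) by (intro mult_right_mono) (auto simp: abs_le_iff)
  qed
  then have 2: "(LINT p|lborel. gK K p * (?f (fst p) * h (snd p))) \<le> G" unfolding fh(2) .
  show "cov ?f h \<le> - ln e + (c + G)" unfolding s1 using add_mono[OF 1 2] by (simp only: add.assoc)
 qed
qed


text \<open>Two-sided control of the covariances, uniform in the scales and the mollifiers: they follow the
  logarithmic kernel as long as the points are further apart than the scales, and saturate at the
  logarithm of the larger scale otherwise.\<close>

lemma cov_log_bounds:
 assumes K: "compact K" "K \<subseteq> U" and \<eta>: "mollifier \<eta>" and \<eta>': "mollifier \<eta>'"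
 obtains \<rho> c where "0 < \<rho>" "0 \<le> c"
  "\<And>e \<delta> x y. 0 < e ==> e < \<rho> ==> 0 < \<delta> ==> \<delta> < \<rho> ==> x \<in> K ==> y \<in> K ==>
   cov (mol \<eta> e x) (mol \<eta>' \<delta> y) \<le> - ln e + c"
  "\<And>e \<delta> x y. 0 < e ==> e < \<rho> ==> 0 < \<delta> ==> \<delta> < \<rho> ==> x \<in> K ==> y \<in> K ==> x \<noteq> y ==>
   \<bar>cov (mol \<eta> e x) (mol \<eta>' \<delta> y)\<bar> \<le> - ln (norm (x - y)) + c"
  "\<And>e \<delta> x y. 0 < e ==> e < \<rho> ==> 0 < \<delta> ==> \<delta> < \<rho> ==> x \<in> K ==> y \<in> K ==>
   - ln (norm (x - y) + e + \<delta>) - c \<le> cov (mol \<eta> e x) (mol \<eta>' \<delta> y)"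
proof -
 obtain \<rho> K' where K': "0 < \<rho>" "compact K'" "K' \<subseteq> U" "\<And>x u. x \<in> K ==> dist x u \<le> \<rho> ==> u \<in> K'"
  using compact_neighbourhood[OF K(1) U_open K(2)] by metis
 obtain G where G: "0 \<le> G" "\<And>x y. x \<in> K' ==> y \<in> K' ==> \<bar>g x y\<bar> \<le> G"
  using g_bounded[OF K'(2,3)] by metis
 obtain D0 where D0: "\<And>x. x \<in> K' ==> norm x \<le> D0"
  using compact_imp_bounded[OF K'(2)] bounded_iff by metis
 define D where "D = max 1 (2 * D0)"
 have D: "1 \<le> D" "\<And>u v. u \<in> K' ==> v \<in> K' ==> norm (u - v) \<le> D"
 proof -
  show "norm (u - v) \<le> D" if "u \<in> K'" "v \<in> K'" for u v
   using norm_triangle_ineq4[of u v] D0[OF that(1)] D0[OF that(2)] by (simp add: D_def)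
 qed (simp add: D_def)
 obtain c1 where c1: "0 \<le> c1" "\<And>e x h. 0 < e ==> (\<And>u. dist x u \<le> e ==> u \<in> K') ==>
  test_function UNIV h ==> (\<And>u. h u \<noteq> 0 ==> u \<in> K') ==> (\<And>u. 0 \<le> h u) ==> (LINT u|lborel. h u) = 1 ==>
  cov (mol \<eta> e x) h \<le> - ln e + c1"
  by (rule cov_upper_scale[OF K'(2,3) \<eta>]) blast
 obtain c2 where c2: "0 \<le> c2" "\<And>e x h. 0 < e ==> (\<And>u. dist x u \<le> e ==> u \<in> K') ==>
  test_function UNIV h ==> (\<And>u. h u \<noteq> 0 ==> u \<in> K') ==> (\<And>u. 0 \<le> h u) ==> (LINT u|lborel. h u) = 1 ==>
  cov (mol \<eta>' e x) h \<le> - ln e + c2"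
  by (rule cov_upper_scale[OF K'(2,3) \<eta>']) blast
 define c where "c = max c1 c2 + ln 4 + 2 * ln D + G"
 have lnD: "0 \<le> ln D" using D(1) by simp
 have ln4: "ln 2 \<le> (ln 4 :: real)" "0 \<le> (ln 4 :: real)" by simp_all
 have cc: "0 \<le> c" "c1 \<le> c" "ln 4 + c1 \<le> c" "ln 4 + c2 \<le> c" "ln 2 + G \<le> c" "2 * ln D + G \<le> c" "G \<le> c"
  using G(1) c1(1) c2(1) lnD ln4 unfolding c_def by linarith+
 have supp: "u \<in> K'" if "mollifier \<eta>''" "0 < e" "e < \<rho>" "x \<in> K" "mol \<eta>'' e x u \<noteq> 0" for \<eta>'' e x u
  using mol_support[OF that(1,2,5)] K'(4)[OF that(4), of u] that(3) by simp
 show ?thesis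
 proof (rule that[OF K'(1) cc(1)])
  fix e \<delta> :: real and x y :: 'a
  assume *: "0 < e" "e < \<rho>" "0 < \<delta>" "\<delta> < \<rho>" "x \<in> K" "y \<in> K"
  let ?f = "mol \<eta> e x" and ?h = "mol \<eta>' \<delta> y"
  note f = mol_test_function[OF \<eta> *(1), of x] supp[OF \<eta> *(1,2,5)] mol_nonneg[OF \<eta> *(1), of x] mol_integral[OF \<eta> *(1), of x]
  note h = mol_test_function[OF \<eta>' *(3), of y] supp[OF \<eta>' *(3,4,6)] mol_nonneg[OF \<eta>' *(3), of y] mol_integral[OF \<eta>' *(3), of y]
  note avg = cov_average[OF K'(2,3) f h]
  have up1: "cov ?f ?h \<le> - ln e + c1"
   by (rule c1(2)[OF *(1) _ h]) (use K'(4)[OF *(5)] *(2) in auto)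
  have up2: "cov ?f ?h \<le> - ln \<delta> + c2"
   unfolding cov_commute[of ?f] by (rule c2(2)[OF *(3) _ f]) (use K'(4)[OF *(6)] *(4) in auto)
  show "cov ?f ?h \<le> - ln e + c" using up1 cc(2) by simp
  have near: "norm (x - y) - e - \<delta> \<le> norm (u - v)" "norm (u - v) \<le> norm (x - y) + e + \<delta>" "\<bar>g u v\<bar> \<le> G" "norm (u - v) \<le> D"
   if "?f u \<noteq> 0" "?h v \<noteq> 0" for u v
  proof -
   have d: "norm (x - u) < e" "norm (y - v) < \<delta>"
    using mol_support[OF \<eta> *(1) that(1)] mol_support[OF \<eta>' *(3) that(2)] by (simp_all add: dist_norm)
   have e: "x - y = (u - v) + ((x - u) - (y - v))" "u - v = (x - y) - ((x - u) - (y - v))" by simp_all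
   have t: "norm ((x - u) - (y - v)) \<le> e + \<delta>"
    using norm_triangle_ineq4[of "x - u" "y - v"] d by linarith
   show "norm (x - y) - e - \<delta> \<le> norm (u - v)"
    using norm_triangle_ineq[of "u - v" "(x - u) - (y - v)"] t unfolding e(1)[symmetric] by linarith
   show "norm (u - v) \<le> norm (x - y) + e + \<delta>"
    using norm_triangle_ineq4[of "x - y" "(x - u) - (y - v)"] t unfolding e(2)[symmetric] by linarith
   show "\<bar>g u v\<bar> \<le> G" "norm (u - v) \<le> D" using G(2) D(2) f(2)[OF that(1)] h(2)[OF that(2)] by auto
  qed
  show "- ln (norm (x - y) + e + \<delta>) - c \<le> cov ?f ?h"
  proof (rule avg(2))
   fix u v assume uv: "?f u \<noteq> 0" "?h v \<noteq> 0" "u \<noteq> v"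
   have "ln (norm (u - v)) \<le> ln (norm (x - y) + e + \<delta>)"
    using near(2)[OF uv(1,2)] uv(3) by (intro ln_mono) auto
   then show "- ln (norm (x - y) + e + \<delta>) - c \<le> - ln (norm (u - v)) + g u v"
    using near(3)[OF uv(1,2)] cc(7) by (simp add: abs_le_iff)
  qed
  assume xy: "x \<noteq> y"
  define r where "r = norm (x - y)"
  have r: "0 < r" using xy by (simp add: r_def)
  have "x \<in> K'" "y \<in> K'" using K'(4)[OF *(5), of x] K'(4)[OF *(6), of y] K'(1) by auto
  then have rD: "ln r \<le> ln D" using D(2)[of x y] r by (intro ln_mono) (auto simp: r_def)
  have "- ln D - G \<le> cov ?f ?h"
  proof (rule avg(2))
   fix u v assume uv: "?f u \<noteq> 0" "?h v \<noteq> 0" "u \<noteq> v"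
   have "ln (norm (u - v)) \<le> ln D"
    using near(4)[OF uv(1,2)] uv(3) by (intro ln_mono) auto
   then show "- ln D - G \<le> - ln (norm (u - v)) + g u v"
    using near(3)[OF uv(1,2)] by (simp add: abs_le_iff)
  qed
  then have low: "- (- ln r + c) \<le> cov ?f ?h" using rD cc(6) by linarith
  have "cov ?f ?h \<le> - ln r + c"
  proof (cases "4 * e \<le> r \<and> 4 * \<delta> \<le> r")
   case True
   have "cov ?f ?h \<le> - ln r + (ln 2 + G)"
   proof (rule avg(1))
    fix u v assume uv: "?f u \<noteq> 0" "?h v \<noteq> 0" "u \<noteq> v"
    have "ln (r / 2) \<le> ln (norm (u - v))"
     using near(1)[OF uv(1,2)] True r by (intro ln_mono) (auto simp: r_def)
    then show "- ln (norm (u - v)) + g u v \<le> - ln r + (ln 2 + G)"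
     using near(3)[OF uv(1,2)] r by (simp add: abs_le_iff ln_div)
   qed
   then show ?thesis using cc(5) by linarith
  next
   case False
   then consider "r / 4 < e" | "r / 4 < \<delta>" by fastforce
   then show ?thesis
   proof cases
    case 1
    then have "ln (r / 4) \<le> ln e" using r by (intro ln_mono) auto
    then show ?thesis using up1 cc(3) r by (simp add: ln_div)
   next
    case 2
    then have "ln (r / 4) \<le> ln \<delta>" using r by (intro ln_mono) auto
    then show ?thesis using up2 cc(4) r by (simp add: ln_div)
   qed
  qed
  with low show "\<bar>cov ?f ?h\<bar> \<le> - ln (norm (x - y)) + c" by (simp add: abs_le_iff r_def)
 qed
qed

text \<open>At positive distance the kernel is continuous, and the covariance is an average of its values near
  the two points.\<close>

lemma cov_limit:
 assumes \<eta>: "mollifier \<eta>" and \<eta>': "mollifier \<eta>'"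
  and e: "\<And>n. 0 < e n" "e \<longlonglongrightarrow> 0" and d: "\<And>n. 0 < \<delta> n" "\<delta> \<longlonglongrightarrow> 0"
  and x: "x \<in> U" and y: "y \<in> U" and xy: "x \<noteq> y"
 shows "(\<lambda>n. cov (mol \<eta> (e n) x) (mol \<eta>' (\<delta> n) y)) \<longlonglongrightarrow> - ln (norm (x - y)) + g x y"
proof (rule LIMSEQ_I)
 fix r :: real assume r: "0 < r"
 obtain \<rho> K' where K': "0 < \<rho>" "compact K'" "K' \<subseteq> U" "\<And>z u. z \<in> {x, y} ==> dist z u \<le> \<rho> ==> u \<in> K'"
  using compact_neighbourhood[of "{x, y}" U] U_open x y by (metis empty_subsetI finite.emptyI finite_imp_compact finite_insert insert_subset)
 let ?k = "\<lambda>p. - ln (norm (fst p - snd p)) + g (fst p) (snd p)"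
 have "isCont ?k (x, y)"
 proof -
  have "continuous_on (U \<times> U) (\<lambda>p. g (fst p) (snd p))" using g_continuous by (simp add: case_prod_beta')
  moreover have "open (U \<times> U)" using U_open by (intro open_Times)
  ultimately have "isCont (\<lambda>p. g (fst p) (snd p)) (x, y)"
   using x y by (auto simp: continuous_on_eq_continuous_at)
  moreover have "isCont (\<lambda>p. - ln (norm (fst p - snd p))) (x, y)"
   using xy by (intro continuous_intros) auto
  ultimately show ?thesis by (rule continuous_add[rotated])
 qed
 then obtain s where s: "0 < s" "\<And>p. dist p (x, y) < s ==> dist (?k p) (?k (x, y)) < r / 2"
  using r unfolding continuous_at_eps_delta by (metis half_gt_zero)
 have "\<forall>\<^sub>F n in sequentially. e n < min \<rho> (s / 2)" "\<forall>\<^sub>F n in sequentially. \<delta> n < min \<rho> (s / 2)"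
  using order_tendstoD(2)[OF e(2), of "min \<rho> (s / 2)"] order_tendstoD(2)[OF d(2), of "min \<rho> (s / 2)"] K'(1) s(1) by auto
 then have "\<forall>\<^sub>F n in sequentially. norm (cov (mol \<eta> (e n) x) (mol \<eta>' (\<delta> n) y) - (- ln (norm (x - y)) + g x y)) < r"
 proof eventually_elim
  case (elim n)
  let ?f = "mol \<eta> (e n) x" and ?h = "mol \<eta>' (\<delta> n) y"
  have fs: "u \<in> K'" "dist u x < s / 2" if "?f u \<noteq> 0" for u
   using mol_support[OF \<eta> e(1) that] K'(4)[of x u] elim by (auto simp: dist_commute)
  have hs: "u \<in> K'" "dist u y < s / 2" if "?h u \<noteq> 0" for u
   using mol_support[OF \<eta>' d(1) that] K'(4)[of y u] elim by (auto simp: dist_commute)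
  note avg = cov_average[OF K'(2,3) mol_test_function[OF \<eta> e(1)] fs(1) mol_nonneg[OF \<eta> e(1)] mol_integral[OF \<eta> e(1)]
   mol_test_function[OF \<eta>' d(1)] hs(1) mol_nonneg[OF \<eta>' d(1)] mol_integral[OF \<eta>' d(1)]]
  have near: "\<bar>(- ln (norm (u - v)) + g u v) - (- ln (norm (x - y)) + g x y)\<bar> < r / 2" if "?f u \<noteq> 0" "?h v \<noteq> 0" for u v
  proof -
   have "dist (u, v) (x, y) \<le> dist u x + dist v y"
    unfolding dist_Pair_Pair by (rule sqrt_sum_squares_le_sum) auto
   then have "dist (u, v) (x, y) < s" using fs(2)[OF that(1)] hs(2)[OF that(2)] by linarith
   from s(2)[OF this] show ?thesis by (simp add: dist_real_def)
  qed
  have "cov ?f ?h \<le> (- ln (norm (x - y)) + g x y) + r / 2"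
  proof (rule avg(1))
   fix u v assume "?f u \<noteq> 0" "?h v \<noteq> 0" "u \<noteq> v"
   from near[OF this(1,2)] show "- ln (norm (u - v)) + g u v \<le> (- ln (norm (x - y)) + g x y) + r / 2"
    unfolding abs_less_iff by linarith
  qed
  moreover have "(- ln (norm (x - y)) + g x y) - r / 2 \<le> cov ?f ?h"
  proof (rule avg(2))
   fix u v assume "?f u \<noteq> 0" "?h v \<noteq> 0" "u \<noteq> v"
   from near[OF this(1,2)] show "(- ln (norm (x - y)) + g x y) - r / 2 \<le> - ln (norm (u - v)) + g u v"
    unfolding abs_less_iff by linarith
  qed
  ultimately have "\<bar>cov ?f ?h - (- ln (norm (x - y)) + g x y)\<bar> \<le> r / 2" by (simp only: abs_le_iff) linarith
  then show ?case using r by simp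
 qed
 then show "\<exists>N. \<forall>n\<ge>N. norm (cov (mol \<eta> (e n) x) (mol \<eta>' (\<delta> n) y) - (- ln (norm (x - y)) + g x y)) < r"
  by (simp add: eventually_sequentially)
qed


lemma translate_difference_test:
 assumes "mollifier \<eta>" "0 < e"
 shows "test_function UNIV (\<lambda>u. 1 * mol \<eta> e x u + (- 1) * mol \<eta> e y u)"
 by (rule test_function_combination[OF mol_test_function[OF assms] mol_test_function[OF assms]])

text \<open>The logarithmic part of the variance does not depend on the point, so the variance can only vary
  through the bounded part of the kernel.\<close>

lemma variance_oscillation:
 assumes K: "compact K" "K \<subseteq> U" and \<eta>: "mollifier \<eta>"
 obtains \<rho> L where "0 < \<rho>" "0 < L" "\<And>e x y. 0 < e ==> e < \<rho> ==> x \<in> K ==> y \<in> K ==>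
   \<bar>cov (mol \<eta> e x) (mol \<eta> e x) - cov (mol \<eta> e y) (mol \<eta> e y)\<bar> \<le> L * min 1 (norm (x - y) / e)"
proof -
 obtain \<rho> K' where K': "0 < \<rho>" "compact K'" "K' \<subseteq> U" "\<And>x u. x \<in> K ==> dist x u \<le> \<rho> ==> u \<in> K'"
  using compact_neighbourhood[OF K(1) U_open K(2)] by metis
 obtain G where G: "0 \<le> G" "\<And>p. \<bar>gK K' p\<bar> \<le> G"
  using g_bounded[OF K'(2,3)] by metis
 have [measurable]: "gK K' \<in> borel_measurable borel" by (rule gK_measurable[OF K'(2,3)])
 obtain L where L: "0 < L"
  "\<And>e x y. 0 < e ==> (LINT u|lborel. \<bar>mol \<eta> e x u - mol \<eta> e y u\<bar>) \<le> L * (norm (x - y) / e)"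
  by (rule translate_L1_bound[OF \<eta>]) blast
 have supp: "u \<in> K'" if "0 < e" "e < \<rho>" "x \<in> K" "mol \<eta> e x u \<noteq> 0" for e x u
  using mol_support[OF \<eta> that(1,4)] K'(4)[OF that(3), of u] that(2) by simp
 show ?thesis
 proof (rule that)
  show "0 < \<rho>" by (rule K'(1))
  show "0 < 2 * (G + 1) * (L + 2)" using G L by simp
  fix e x y assume *: "0 < e" "e < \<rho>" "x \<in> K" "y \<in> K"
  let ?f = "mol \<eta> e x" and ?h = "mol \<eta> e y"
  note fi = test_function_integrable[OF mol_test_function[OF \<eta> *(1)]]
  have split: "cov (mol \<eta> e z) (mol \<eta> e z) = (LINT p|lborel. - ln (norm (fst p - snd p)) * mol \<eta> e z (fst p) * mol \<eta> e z (snd p))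
   + (LINT p|lborel. gK K' p * (mol \<eta> e z (fst p) * mol \<eta> e z (snd p)))"
   and gi: "integrable lborel (\<lambda>p. gK K' p * (mol \<eta> e z (fst p) * mol \<eta> e z (snd p)))" if "z \<in> K" for z
   using cov_split[OF K'(2,3) mol_test_function[OF \<eta> *(1), of z] _ mol_test_function[OF \<eta> *(1), of z]] supp[OF *(1,2) that]
   by blast+
  have inv: "(LINT p|lborel. - ln (norm (fst p - snd p)) * ?f (fst p) * ?f (snd p))
    = (LINT p|lborel. - ln (norm (fst p - snd p)) * ?h (fst p) * ?h (snd p))"
  proof -
   let ?F = "\<lambda>p. - ln (norm (fst p - snd p)) * ?f (fst p) * ?f (snd p)"
   have "?F \<in> borel_measurable borel"
    using log_pair_integrable_test[OF mol_test_function[OF \<eta> *(1), of x] mol_test_function[OF \<eta> *(1), of x]] by simp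
   then have "(LINT p|lborel. ?F p) = (LINT p|lborel. ?F ((x - y, x - y) + 1 *\<^sub>R p))"
    by (subst lborel_integral_affine[where c=1 and t="(x - y, x - y)"]) simp_all
   also have "\<dots> = (LINT p|lborel. - ln (norm (fst p - snd p)) * ?h (fst p) * ?h (snd p))"
    by (simp add: mol_def algebra_simps)
   finally show ?thesis .
  qed
  let ?d = "\<lambda>u. \<bar>?f u - ?h u\<bar>"
  define N where "N = (LINT u|lborel. ?d u)"
  have di: "integrable lborel ?d" using fi by simp
  have N0: "0 \<le> N" unfolding N_def by simp
  have N1: "N \<le> L * (norm (x - y) / e)" unfolding N_def by (rule L(2)[OF *(1)])
  have N2: "N \<le> 2"
  proof -
   have "N \<le> (LINT u|lborel. ?f u + ?h u)"
    unfolding N_def using fi mol_nonneg[OF \<eta> *(1)]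
    by (intro integral_mono) (auto simp: abs_le_iff add_increasing add_increasing2)
   also have "\<dots> = 2" using fi mol_integral[OF \<eta> *(1)] by simp
   finally show ?thesis .
  qed
  have fd: "integrable lborel (\<lambda>p. ?f (fst p) * ?d (snd p))" "(LINT p|lborel. ?f (fst p) * ?d (snd p)) = N"
   "integrable lborel (\<lambda>p. ?d (fst p) * ?h (snd p))" "(LINT p|lborel. ?d (fst p) * ?h (snd p)) = N"
   using integral_lborel_product[OF fi[of x] di] integral_lborel_product[OF di fi[of y]]
    mol_integral[OF \<eta> *(1)] by (simp_all add: N_def)
  have "\<bar>(LINT p|lborel. gK K' p * (?f (fst p) * ?f (snd p))) - (LINT p|lborel. gK K' p * (?h (fst p) * ?h (snd p)))\<bar>
    = \<bar>LINT p|lborel. gK K' p * (?f (fst p) * ?f (snd p)) - gK K' p * (?h (fst p) * ?h (snd p))\<bar>"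
   using gi[OF *(3)] gi[OF *(4)] by simp
  also have "\<dots> \<le> (LINT p|lborel. G * (?f (fst p) * ?d (snd p) + ?d (fst p) * ?h (snd p)))"
  proof (rule order_trans[OF integral_abs_bound], rule integral_mono)
   show "integrable lborel (\<lambda>p. \<bar>gK K' p * (?f (fst p) * ?f (snd p)) - gK K' p * (?h (fst p) * ?h (snd p))\<bar>)"
    using gi[OF *(3)] gi[OF *(4)] by simp
   show "integrable lborel (\<lambda>p. G * (?f (fst p) * ?d (snd p) + ?d (fst p) * ?h (snd p)))"
    using fd(1,3) by simp
   fix p
   have "gK K' p * (?f (fst p) * ?f (snd p)) - gK K' p * (?h (fst p) * ?h (snd p))
     = gK K' p * (?f (fst p) * (?f (snd p) - ?h (snd p)) + (?f (fst p) - ?h (fst p)) * ?h (snd p))"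
    by (simp add: algebra_simps)
   also have "\<bar>\<dots>\<bar> \<le> G * (?f (fst p) * ?d (snd p) + ?d (fst p) * ?h (snd p))"
   proof -
    have "\<bar>?f (fst p) * (?f (snd p) - ?h (snd p)) + (?f (fst p) - ?h (fst p)) * ?h (snd p)\<bar>
      \<le> ?f (fst p) * ?d (snd p) + ?d (fst p) * ?h (snd p)"
     by (rule order_trans[OF abs_triangle_ineq]) (use mol_nonneg[OF \<eta> *(1)] in \<open>simp add: abs_mult\<close>)
    then show ?thesis unfolding abs_mult[of "gK K' p"] using G by (intro mult_mono) auto
   qed
   finally show "\<bar>gK K' p * (?f (fst p) * ?f (snd p)) - gK K' p * (?h (fst p) * ?h (snd p))\<bar>
     \<le> G * (?f (fst p) * ?d (snd p) + ?d (fst p) * ?h (snd p))" .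
  qed
  also have "\<dots> = 2 * G * N" using fd by simp
  also have "\<dots> \<le> 2 * (G + 1) * (L + 2) * min 1 (norm (x - y) / e)"
  proof -
   let ?m = "min 1 (norm (x - y) / e)"
   have "N \<le> (L + 2) * ?m"
   proof (cases "norm (x - y) / e \<le> 1")
    case True
    have "L * (norm (x - y) / e) \<le> (L + 2) * (norm (x - y) / e)" using *(1) by (intro mult_right_mono) auto
    moreover have "min 1 (norm (x - y) / e) = norm (x - y) / e" using True by (rule min_absorb2)
    ultimately show ?thesis using N1 by (simp only:)
   next
    case False
    then have "min 1 (norm (x - y) / e) = 1" by (intro min_absorb1) simp
    then show ?thesis using N2 L(1) by simp
   qed
   then have "2 * G * N \<le> 2 * (G + 1) * ((L + 2) * ?m)" using G N0 by (intro mult_mono) auto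
   then show ?thesis by (simp only: mult.assoc)
  qed
  finally show "\<bar>cov ?f ?f - cov ?h ?h\<bar> \<le> 2 * (G + 1) * (L + 2) * min 1 (norm (x - y) / e)"
   unfolding split[OF *(3)] split[OF *(4)] inv by simp
 qed
qed

text \<open>Increments of the approximation are nondegenerate: near the diagonal by the energy bound for
  the logarithm, away from it because the variance exceeds the covariance.\<close>

lemma increment_lower:
 assumes K: "compact K" "K \<subseteq> U" and \<eta>: "mollifier \<eta>"
 obtains \<rho> c where "0 < \<rho>" "0 < c" "\<And>\<epsilon> x y. 0 < \<epsilon> ==> \<epsilon> < \<rho> ==> x \<in> K ==> y \<in> K ==>
  c * (min 1 (norm (x - y) / \<epsilon>))\<^sup>2 \<le> cov (mol \<eta> \<epsilon> x) (mol \<eta> \<epsilon> x) + cov (mol \<eta> \<epsilon> y) (mol \<eta> \<epsilon> y)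
   - 2 * \<bar>cov (mol \<eta> \<epsilon> x) (mol \<eta> \<epsilon> y)\<bar>"
proof -
 obtain \<rho>0 c0 where c0: "0 < \<rho>0" "0 \<le> c0"
  "\<And>\<epsilon> \<delta> x y. 0 < \<epsilon> ==> \<epsilon> < \<rho>0 ==> 0 < \<delta> ==> \<delta> < \<rho>0 ==> x \<in> K ==> y \<in> K ==> x \<noteq> y ==>
   \<bar>cov (mol \<eta> \<epsilon> x) (mol \<eta> \<delta> y)\<bar> \<le> - ln (norm (x - y)) + c0"
  "\<And>\<epsilon> \<delta> x y. 0 < \<epsilon> ==> \<epsilon> < \<rho>0 ==> 0 < \<delta> ==> \<delta> < \<rho>0 ==> x \<in> K ==> y \<in> K ==>
   - ln (norm (x - y) + \<epsilon> + \<delta>) - c0 \<le> cov (mol \<eta> \<epsilon> x) (mol \<eta> \<delta> y)"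
  by (rule cov_log_bounds[OF K \<eta> \<eta>]) blast
 obtain \<rho>1 K' where K': "0 < \<rho>1" "compact K'" "K' \<subseteq> U" "\<And>x u. x \<in> K ==> dist x u \<le> \<rho>1 ==> u \<in> K'"
  using compact_neighbourhood[OF K(1) U_open K(2)] by metis
 \<comment> \<open>At a distance beyond \<open>A\<close> scales the variances exceed the covariance by a constant.\<close>
 define A where "A = exp (2 * c0 + 2)"
 have A: "0 < A" "ln A = 2 * c0 + 2" by (simp_all add: A_def)
 obtain cA where cA: "0 < cA" "\<And>z. norm z \<le> A ==> cA * (norm z)\<^sup>2 \<le>
  (LINT p|lborel. (\<eta> (fst p) - \<eta> (fst p + z)) * (\<eta> (snd p) - \<eta> (snd p + z)) * - ln (norm (fst p - snd p)))"
  by (rule log_energy_lower[OF \<eta> A(1)]) blast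
 obtain L where L: "0 < L"
  "\<And>\<epsilon> x y. 0 < \<epsilon> ==> (LINT u|lborel. \<bar>mol \<eta> \<epsilon> x u - mol \<eta> \<epsilon> y u\<bar>) \<le> L * (norm (x - y) / \<epsilon>)"
  by (rule translate_L1_bound[OF \<eta>]) blast
 \<comment> \<open>An oscillation of \<open>g\<close> by \<open>e\<close> uses up at most half of the logarithmic energy.\<close>
 define e where "e = cA / (2 * L\<^sup>2)"
 have e: "0 < e" using cA(1) L(1) by (simp add: e_def)
 obtain s where s: "0 < s" "\<And>x u v. x \<in> K' ==> u \<in> K' ==> v \<in> K' ==> dist u x < s ==> dist v x < s ==>
   \<bar>g u v - g x x\<bar> < e"
 proof -
  have "uniformly_continuous_on (K' \<times> K') (\<lambda>(x, y). g x y)"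
   using K' by (intro compact_uniformly_continuous continuous_on_subset[OF g_continuous] compact_Times) auto
  then obtain d where d: "0 < d" "\<And>p q. p \<in> K' \<times> K' ==> q \<in> K' \<times> K' ==> dist q p < d ==>
    dist ((\<lambda>(x, y). g x y) q) ((\<lambda>(x, y). g x y) p) < e"
   using e unfolding uniformly_continuous_on_def by meson
  show ?thesis
  proof (rule that[of "d / 2"])
   fix x u v assume *: "x \<in> K'" "u \<in> K'" "v \<in> K'" "dist u x < d / 2" "dist v x < d / 2"
   have "dist (u, v) (x, x) \<le> dist u x + dist v x"
    unfolding dist_Pair_Pair by (rule sqrt_sum_squares_le_sum) auto
   then have "dist (u, v) (x, x) < d" using *(4,5) by linarith
   from d(2)[OF _ _ this] *(1-3) show "\<bar>g u v - g x x\<bar> < e" by (simp add: dist_real_def)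
  qed (use d in simp)
 qed
 define \<rho> where "\<rho> = Min {\<rho>0, \<rho>1, s / (A + 2), exp (- c0) / (A + 2)}"
 have \<rho>: "0 < \<rho>" using c0(1) K'(1) s(1) A(1) by (simp add: \<rho>_def)
 have \<rho>le: "\<rho> \<le> \<rho>0" "\<rho> \<le> \<rho>1" "\<rho> \<le> s / (A + 2)" "\<rho> \<le> exp (- c0) / (A + 2)"
  unfolding \<rho>_def by (rule Min_le; simp)+
 show ?thesis
 proof (rule that)
  show "0 < \<rho>" by (rule \<rho>)
  show "0 < min (cA / 2) 1" using cA(1) by simp
  fix \<epsilon> x y assume *: "0 < \<epsilon>" "\<epsilon> < \<rho>" "x \<in> K" "y \<in> K"
  let ?f = "mol \<eta> \<epsilon> x" and ?h = "mol \<eta> \<epsilon> y"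
  let ?V = "cov ?f ?f + cov ?h ?h - 2 * \<bar>cov ?f ?h\<bar>"
  define r where "r = norm (x - y)"
  have e0: "\<epsilon> < \<rho>0" using *(2) \<rho>le(1) by linarith
  show "min (cA / 2) 1 * (min 1 (norm (x - y) / \<epsilon>))\<^sup>2 \<le> ?V"
  proof (cases "r \<le> A * \<epsilon>")
   case False
   then have r: "0 < r" using mult_pos_pos[OF A(1) *(1)] by linarith
   then have xy: "x \<noteq> y" by (auto simp: r_def)
   have v: "- ln (2 * \<epsilon>) - c0 \<le> cov (mol \<eta> \<epsilon> z) (mol \<eta> \<epsilon> z)" if "z \<in> K" for z
    using c0(4)[OF *(1) e0 *(1) e0 that that] by simp
   have u: "\<bar>cov ?f ?h\<bar> \<le> - ln r + c0"
    using c0(3)[OF *(1) e0 *(1) e0 *(3,4) xy] by (simp add: r_def)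
   have "ln (A * \<epsilon>) \<le> ln r" using False A(1) *(1) r by (intro ln_mono) auto
   then have "2 * c0 + 2 + ln \<epsilon> \<le> ln r" using A *(1) by (simp add: ln_mult_pos)
   moreover have "ln (2 * \<epsilon>) = ln 2 + ln \<epsilon>" using *(1) by (simp add: ln_mult_pos)
   moreover have "ln 2 < (1::real)" using ln_2_less_1 .
   ultimately have "1 \<le> ?V" using v[OF *(3)] v[OF *(4)] u by linarith
   moreover have "min (cA / 2) 1 * (min 1 (norm (x - y) / \<epsilon>))\<^sup>2 \<le> 1 * 1"
    using *(1) cA(1) by (intro mult_mono power_le_one) (auto simp: min_le_iff_disj)
   ultimately show ?thesis by simp
  next
   case near: True
   define z where "z = (y - x) /\<^sub>R \<epsilon>"
   have nz: "norm z = r / \<epsilon>"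
    unfolding z_def norm_scaleR r_def using *(1) by (simp add: norm_minus_commute[of y x] divide_inverse mult.commute)
   have zA: "norm z \<le> A" unfolding nz using near *(1) by (simp add: divide_le_eq)
   let ?d = "\<lambda>u. 1 * ?f u + (- 1) * ?h u"
   have dt: "test_function UNIV ?d" by (rule translate_difference_test[OF \<eta> *(1)])
   have dsupp: "dist u x < s \<and> u \<in> K'" if "?d u \<noteq> 0" for u
   proof -
    have "?f u \<noteq> 0 \<or> ?h u \<noteq> 0" using that by auto
    then have "dist x u < \<epsilon> \<or> dist y u < \<epsilon>" using mol_support[OF \<eta> *(1)] by blast
    then have u: "dist x u < \<epsilon> + r" "u \<in> K'"
    proof -
     assume a: "dist x u < \<epsilon> \<or> dist y u < \<epsilon>"
     show "dist x u < \<epsilon> + r"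
      using a
     proof
      assume "dist x u < \<epsilon>"
      then show ?thesis using norm_ge_zero[of "x - y"] unfolding r_def by linarith
     next
      assume "dist y u < \<epsilon>"
      then show ?thesis using dist_triangle[of x u y] unfolding r_def dist_norm by linarith
     qed
     show "u \<in> K'" using a K'(4)[OF *(3), of u] K'(4)[OF *(4), of u] *(2) \<rho>le(2) by auto
    qed
    have "\<epsilon> + r \<le> (A + 2) * \<epsilon>" using near *(1) by (simp add: algebra_simps)
    also have "\<dots> \<le> (A + 2) * \<rho>" using *(2) A(1) by (intro mult_left_mono) auto
    also have "\<dots> \<le> s" using \<rho>le(3) A(1) by (simp add: pos_le_divide_eq mult.commute)
    finally show ?thesis using u by (simp add: dist_commute)
   qed
   have xK: "x \<in> K'" using K'(4)[OF *(3), of x] K'(1) by simp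
   have di: "integrable lborel ?d" by (rule test_function_integrable[OF dt])
   have d0: "(LINT u|lborel. ?d u) = 0"
    using test_function_integrable[OF mol_test_function[OF \<eta> *(1)]] mol_integral[OF \<eta> *(1)] by simp
   have ai: "integrable lborel (\<lambda>u. \<bar>?d u\<bar>)" using di by simp
   have a1: "(LINT u|lborel. \<bar>?d u\<bar>) \<le> L * norm z"
    using L(2)[OF *(1), of x y] unfolding nz r_def by simp
   have sp1: "cov ?d ?d = (LINT p|lborel. - ln (norm (fst p - snd p)) * ?d (fst p) * ?d (snd p))
     + (LINT p|lborel. gK K' p * (?d (fst p) * ?d (snd p)))"
    by (rule cov_split(1)[OF K'(2,3) dt _ dt]) (use dsupp in auto)
   have sp2: "integrable lborel (\<lambda>p. gK K' p * (?d (fst p) * ?d (snd p)))"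
    by (rule cov_split(2)[OF K'(2,3) dt _ dt]) (use dsupp in auto)
   have Vd: "cov ?d ?d = cov ?f ?f + cov ?h ?h - 2 * cov ?f ?h"
    unfolding cov_combination[OF mol_test_function[OF \<eta> *(1)] mol_test_function[OF \<eta> *(1)]] by simp
   have Cpos: "0 \<le> cov ?f ?h"
   proof -
    have "r + \<epsilon> + \<epsilon> \<le> (A + 2) * \<epsilon>" using near by (simp add: algebra_simps)
    also have "\<dots> \<le> (A + 2) * \<rho>" using *(2) A(1) by (intro mult_left_mono) auto
    also have "\<dots> \<le> exp (- c0)" using \<rho>le(4) A(1) by (simp add: pos_le_divide_eq mult.commute)
    finally have up: "r + \<epsilon> + \<epsilon> \<le> exp (- c0)" .
    have "0 < r + \<epsilon> + \<epsilon>" using *(1) norm_ge_zero[of "x - y"] unfolding r_def by linarith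
    then have "ln (r + \<epsilon> + \<epsilon>) \<le> ln (exp (- c0))" using up by (intro ln_mono) auto
    then show ?thesis using c0(4)[OF *(1) e0 *(1) e0 *(3,4)] by (simp add: r_def)
   qed
   have logpart: "cA * (norm z)\<^sup>2 \<le> (LINT p|lborel. - ln (norm (fst p - snd p)) * ?d (fst p) * ?d (snd p))"
   proof -
    let ?F = "\<lambda>p. - ln (norm (fst p - snd p)) * ?d (fst p) * ?d (snd p)"
    let ?q = "\<lambda>a. \<eta> a - \<eta> (a + z)"
    have \<eta>t: "test_function UNIV \<eta>" using \<eta> by (rule mollifier_test_function)
    have qt: "test_function UNIV ?q"
    proof -
     have "test_function UNIV (\<lambda>a. 1 *\<^sub>R \<eta> (z + 1 *\<^sub>R a))" by (rule test_function_affine[OF \<eta>t]) simp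
     then have "test_function UNIV (\<lambda>a. \<eta> (a + z))" by (simp add: add.commute)
     from test_function_combination[OF \<eta>t this, of 1 "- 1"] show ?thesis by simp
    qed
    have q0: "(LINT a|lborel. ?q a) = 0"
    proof -
     have [measurable]: "\<eta> \<in> borel_measurable borel" by (rule test_function_measurable[OF \<eta>t])
     have "(LINT a|lborel. \<eta> a) = (LINT a|lborel. \<eta> (a + z))"
      by (subst lborel_integral_affine[where c=1 and t=z]) (simp_all add: add.commute)
     moreover have "integrable lborel (\<lambda>a. \<eta> (a + z))"
      using lborel_integrable_affine[OF test_function_integrable[OF \<eta>t], of 1 z] by (simp add: add.commute)
     ultimately show ?thesis using test_function_integrable[OF \<eta>t] by simp
    qed
    note qq = integral_lborel_product[OF test_function_integrable[OF qt] test_function_integrable[OF qt]]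
    have dq: "?d (x + (- \<epsilon>) *\<^sub>R a) = ?q a / \<epsilon> ^ DIM('a)" for a
     unfolding mol_affine[OF *(1)] z_def by (simp add: diff_divide_distrib)
    have "?F \<in> borel_measurable borel" using log_pair_integrable_test[OF dt dt] by simp
    then have "(LINT p|lborel. ?F p) = \<bar>- \<epsilon>\<bar> ^ DIM('a \<times> 'a) *\<^sub>R (LINT p|lborel. ?F ((x, x) + (- \<epsilon>) *\<^sub>R p))"
     using *(1) by (intro lborel_integral_affine) auto
    also have "\<dots> = (LINT p|lborel. \<epsilon> ^ DIM('a \<times> 'a) * ?F ((x, x) + (- \<epsilon>) *\<^sub>R p))"
     using *(1) by simp
    also have "\<dots> = (LINT p|lborel. - ln \<epsilon> * (?q (fst p) * ?q (snd p)) + - ln (norm (fst p - snd p)) * ?q (fst p) * ?q (snd p))"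
    proof (rule integral_cong_AE)
     show "(\<lambda>p. \<epsilon> ^ DIM('a \<times> 'a) * ?F ((x, x) + (- \<epsilon>) *\<^sub>R p)) \<in> borel_measurable lborel"
      using lborel_integrable_affine[OF log_pair_integrable_test[OF dt dt], of "- \<epsilon>" "(x, x)"] *(1) by simp
     show "(\<lambda>p. - ln \<epsilon> * (?q (fst p) * ?q (snd p)) + - ln (norm (fst p - snd p)) * ?q (fst p) * ?q (snd p)) \<in> borel_measurable lborel"
      using log_pair_integrable_test[OF qt qt] qq(1) by (intro borel_measurable_add borel_measurable_times[OF borel_measurable_const]) (auto dest: borel_measurable_integrable)
     show "AE p in lborel. \<epsilon> ^ DIM('a \<times> 'a) * ?F ((x, x) + (- \<epsilon>) *\<^sub>R p)
       = - ln \<epsilon> * (?q (fst p) * ?q (snd p)) + - ln (norm (fst p - snd p)) * ?q (fst p) * ?q (snd p)"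
      using AE_lborel_prod_neq
     proof eventually_elim
      case (elim p)
      have "fst ((x, x) + (- \<epsilon>) *\<^sub>R p) = x + (- \<epsilon>) *\<^sub>R fst p" "snd ((x, x) + (- \<epsilon>) *\<^sub>R p) = x + (- \<epsilon>) *\<^sub>R snd p" by simp_all
      moreover have "ln (norm ((x + (- \<epsilon>) *\<^sub>R fst p) - (x + (- \<epsilon>) *\<^sub>R snd p))) = ln \<epsilon> + ln (norm (fst p - snd p))"
      proof -
       have "(x + (- \<epsilon>) *\<^sub>R fst p) - (x + (- \<epsilon>) *\<^sub>R snd p) = (- \<epsilon>) *\<^sub>R (fst p - snd p)" by (simp add: scaleR_diff_right)
       then have "norm ((x + (- \<epsilon>) *\<^sub>R fst p) - (x + (- \<epsilon>) *\<^sub>R snd p)) = \<epsilon> * norm (fst p - snd p)" using *(1) by simp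
       then show ?thesis using *(1) elim by (simp add: ln_mult_pos)
      qed
      ultimately have "?F ((x, x) + (- \<epsilon>) *\<^sub>R p)
        = - (ln \<epsilon> + ln (norm (fst p - snd p))) * (?q (fst p) / \<epsilon> ^ DIM('a)) * (?q (snd p) / \<epsilon> ^ DIM('a))"
       by (simp only: dq)
      then show ?case using *(1) by (simp add: power_add field_simps)
     qed
    qed
    also have "\<dots> = (LINT p|lborel. ?q (fst p) * ?q (snd p) * - ln (norm (fst p - snd p)))"
     using log_pair_integrable_test[OF qt qt] qq q0
     by (subst Bochner_Integration.integral_add) (simp_all add: mult_ac)
    finally show ?thesis using cA(2)[OF zA] by simp
   qed
   have gpart: "- (e * (L * norm z)\<^sup>2) \<le> (LINT p|lborel. gK K' p * (?d (fst p) * ?d (snd p)))"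
   proof -
    note dd = integral_lborel_product[OF di di] and aa = integral_lborel_product[OF ai ai]
    have "(LINT p|lborel. (- e) * (\<bar>?d (fst p)\<bar> * \<bar>?d (snd p)\<bar>))
      \<le> (LINT p|lborel. gK K' p * (?d (fst p) * ?d (snd p)) - g x x * (?d (fst p) * ?d (snd p)))"
    proof (rule integral_mono)
     show "integrable lborel (\<lambda>p. (- e) * (\<bar>?d (fst p)\<bar> * \<bar>?d (snd p)\<bar>))"
      by (rule integrable_mult_right[OF aa(1)])
     show "integrable lborel (\<lambda>p. gK K' p * (?d (fst p) * ?d (snd p)) - g x x * (?d (fst p) * ?d (snd p)))"
      by (rule Bochner_Integration.integrable_diff[OF sp2 integrable_mult_right[OF dd(1)]])
     fix p
     show "(- e) * (\<bar>?d (fst p)\<bar> * \<bar>?d (snd p)\<bar>) \<le> gK K' p * (?d (fst p) * ?d (snd p)) - g x x * (?d (fst p) * ?d (snd p))"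
     proof (cases "?d (fst p) = 0 \<or> ?d (snd p) = 0")
      case False
      have 1: "dist (fst p) x < s \<and> fst p \<in> K'" "dist (snd p) x < s \<and> snd p \<in> K'"
       using dsupp False by blast+
      then have "gK K' p = g (fst p) (snd p)" by (cases p) (simp add: gK_def)
      then have "\<bar>gK K' p - g x x\<bar> \<le> e"
       using s(2)[OF xK, of "fst p" "snd p"] 1 by simp
      then have "\<bar>(gK K' p - g x x) * (?d (fst p) * ?d (snd p))\<bar> \<le> e * \<bar>?d (fst p) * ?d (snd p)\<bar>"
       unfolding abs_mult[of "gK K' p - g x x"] by (rule mult_right_mono) auto
      then have "- (e * \<bar>?d (fst p) * ?d (snd p)\<bar>) \<le> (gK K' p - g x x) * (?d (fst p) * ?d (snd p))"
       by (simp only: abs_le_iff) linarith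
      then show ?thesis by (simp only: abs_mult left_diff_distrib mult_minus_left)
     qed auto
    qed
    also have "\<dots> = (LINT p|lborel. gK K' p * (?d (fst p) * ?d (snd p))) - g x x * 0"
     by (subst Bochner_Integration.integral_diff[OF sp2 integrable_mult_right[OF dd(1)]])
       (simp only: integral_mult_right_zero dd(2) d0 mult_zero_left)
    finally have "(- e) * ((LINT u|lborel. \<bar>?d u\<bar>) * (LINT u|lborel. \<bar>?d u\<bar>)) \<le> (LINT p|lborel. gK K' p * (?d (fst p) * ?d (snd p)))"
     by (simp only: integral_mult_right_zero aa(2))
    moreover have "(LINT u|lborel. \<bar>?d u\<bar>) * (LINT u|lborel. \<bar>?d u\<bar>) \<le> (L * norm z) * (L * norm z)"
     using a1 L(1) by (intro mult_mono) auto
    ultimately show ?thesis using e mult_left_mono[of _ _ e] unfolding power2_eq_square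
     by (smt (verit) mult_minus_left)
   qed
   have "e * (L * norm z)\<^sup>2 = cA / 2 * (norm z)\<^sup>2"
    using L(1) by (simp add: e_def power_mult_distrib)
   then have "cA / 2 * (norm z)\<^sup>2 \<le> cov ?d ?d" unfolding sp1 using logpart gpart by linarith
   then have V: "cA / 2 * (norm z)\<^sup>2 \<le> ?V" using Vd Cpos by simp
   have "min (cA / 2) 1 * (min 1 (norm (x - y) / \<epsilon>))\<^sup>2 \<le> cA / 2 * (norm z)\<^sup>2"
    unfolding nz r_def[symmetric] using *(1) cA(1) norm_ge_zero[of "x - y"]
    by (intro mult_mono power_mono) (auto simp: r_def)
   then show ?thesis using V by linarith
  qed
 qed
qed

end

section \<open>Second moments of oscillating integrals\<close>

lemma cnj_measurable [measurable]: "cnj \<in> borel_measurable borel"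
 by (intro borel_measurable_continuous_onI continuous_intros)

lemma cosh_measurable [measurable]: "(cosh :: real => real) \<in> borel_measurable borel"
 by (intro borel_measurable_continuous_onI continuous_intros)

text \<open>Fubini's theorem; the product of the two space integrals is an integral over pairs of points.\<close>

lemma second_moment:
 fixes A B :: "'w => 'a::euclidean_space => real" and W1 W2 :: "'a => complex"
 assumes M: "prob_space M"
  and A [measurable]: "(\<lambda>(w, x). A w x) \<in> borel_measurable (M \<Otimes>\<^sub>M borel)"
  and B [measurable]: "(\<lambda>(w, x). B w x) \<in> borel_measurable (M \<Otimes>\<^sub>M borel)"
  and b: "\<And>w x. \<bar>A w x\<bar> \<le> b" "\<And>w x. \<bar>B w x\<bar> \<le> b"
  and W: "integrable lborel W1" "integrable lborel W2"
 shows "(LINT w|M. (LINT x|lborel. W1 x * complex_of_real (A w x)) * cnj (LINT x|lborel. W2 x * complex_of_real (B w x)))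
  = (LINT p|lborel. W1 (fst p) * cnj (W2 (snd p)) * complex_of_real (LINT w|M. A w (fst p) * B w (snd p)))"
proof -
 interpret prob_space M by fact
 interpret PS: pair_sigma_finite M "lborel :: ('a \<times> 'a) measure" ..
 have [measurable]: "W1 \<in> borel_measurable borel" "W2 \<in> borel_measurable borel" using W by simp_all
 have b0: "0 \<le> b" using b(1) abs_ge_zero order_trans by blast
 define f where "f w p = (W1 (fst p) * complex_of_real (A w (fst p))) * (cnj (W2 (snd p)) * complex_of_real (B w (snd p)))" for w p
 define D where "D p = b * b * norm (W1 (fst p) * cnj (W2 (snd p)))" for p
 have Di: "integrable lborel D"
  unfolding D_def using integral_lborel_product(1)[OF W(1) integrable_cnj[OF W(2)]] by simp
 have fD: "norm (f w p) \<le> D p" for w p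
 proof -
  have "norm (f w p) = (\<bar>A w (fst p)\<bar> * \<bar>B w (snd p)\<bar>) * norm (W1 (fst p) * cnj (W2 (snd p)))"
   by (simp add: f_def norm_mult mult_ac)
  also have "\<dots> \<le> (b * b) * norm (W1 (fst p) * cnj (W2 (snd p)))"
   using b b0 by (intro mult_right_mono mult_mono) auto
  finally show ?thesis by (simp add: D_def)
 qed
 have [measurable]: "(\<lambda>x. cnj (W2 x)) \<in> borel_measurable borel"
  using borel_measurable_integrable[OF integrable_cnj[OF W(2)]] by simp
 have [measurable]: "(\<lambda>x. A (fst x) (fst (snd x))) \<in> borel_measurable (M \<Otimes>\<^sub>M (lborel \<Otimes>\<^sub>M lborel))"
  "(\<lambda>x. B (fst x) (snd (snd x))) \<in> borel_measurable (M \<Otimes>\<^sub>M (lborel \<Otimes>\<^sub>M lborel))"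
 proof -
  have 1: "(\<lambda>x. (fst x, fst (snd x))) \<in> M \<Otimes>\<^sub>M (lborel \<Otimes>\<^sub>M lborel) \<rightarrow>\<^sub>M M \<Otimes>\<^sub>M (borel :: 'a measure)"
   and 2: "(\<lambda>x. (fst x, snd (snd x))) \<in> M \<Otimes>\<^sub>M (lborel \<Otimes>\<^sub>M lborel) \<rightarrow>\<^sub>M M \<Otimes>\<^sub>M (borel :: 'a measure)"
   by measurable
  show "(\<lambda>x. A (fst x) (fst (snd x))) \<in> borel_measurable (M \<Otimes>\<^sub>M (lborel \<Otimes>\<^sub>M lborel))"
   "(\<lambda>x. B (fst x) (snd (snd x))) \<in> borel_measurable (M \<Otimes>\<^sub>M (lborel \<Otimes>\<^sub>M lborel))"
   using measurable_compose[OF 1 A] measurable_compose[OF 2 B] by simp_all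
 qed
 have fm [measurable]: "(\<lambda>(w, p). f w p) \<in> borel_measurable (M \<Otimes>\<^sub>M lborel)"
  unfolding f_def lborel_prod[symmetric] by measurable
 have Am: "(\<lambda>x. A w x) \<in> borel_measurable borel" "(\<lambda>x. B w x) \<in> borel_measurable borel" if "w \<in> space M" for w
  using that by measurable
 have fw: "f w \<in> borel_measurable lborel" if "w \<in> space M" for w
  using that by measurable
 have fi: "integrable lborel (f w)" if "w \<in> space M" for w
  by (rule Bochner_Integration.integrable_bound[OF Di fw[OF that]])
    (auto intro!: AE_I2 order_trans[OF fD])
 have i: "integrable (M \<Otimes>\<^sub>M lborel) (\<lambda>(w, p). f w p)"
 proof (rule PS.Fubini_integrable)
  show "integrable M (\<lambda>w. LINT p|lborel. norm (case (w, p) of (w, p) => f w p))"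
  proof (rule integrable_const_bound)
   show "AE w in M. norm (LINT p|lborel. norm (case (w, p) of (w, p) => f w p)) \<le> (LINT p|lborel. D p)"
   proof (rule AE_I2)
    fix w assume "w \<in> space M"
    then have "(LINT p|lborel. norm (f w p)) \<le> (LINT p|lborel. D p)"
     using fi Di fD by (intro integral_mono) auto
    then show "norm (LINT p|lborel. norm (case (w, p) of (w, p) => f w p)) \<le> (LINT p|lborel. D p)"
     by simp
   qed
  qed measurable
  show "AE w in M. integrable lborel (\<lambda>p. case (w, p) of (w, p) => f w p)"
   using fi by (auto intro!: AE_I2)
 qed measurable
 have "(LINT w|M. (LINT x|lborel. W1 x * complex_of_real (A w x)) * cnj (LINT x|lborel. W2 x * complex_of_real (B w x)))
   = (LINT w|M. LINT p|lborel. f w p)"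
 proof (intro Bochner_Integration.integral_cong refl)
  fix w assume w: "w \<in> space M"
  note [measurable] = Am[OF w]
  have i1: "integrable lborel (\<lambda>x. W1 x * complex_of_real (A w x))"
  proof (rule Bochner_Integration.integrable_bound)
   show "integrable lborel (\<lambda>x. b * norm (W1 x))" using W by simp
   show "AE x in lborel. norm (W1 x * complex_of_real (A w x)) \<le> norm (b * norm (W1 x))"
    using b(1)[of w] b0 by (auto simp: norm_mult mult.commute[of b] intro!: AE_I2 mult_left_mono)
  qed measurable
  have i2: "integrable lborel (\<lambda>x. cnj (W2 x) * complex_of_real (B w x))"
  proof (rule Bochner_Integration.integrable_bound)
   show "integrable lborel (\<lambda>x. b * norm (W2 x))" using W by simp
   show "AE x in lborel. norm (cnj (W2 x) * complex_of_real (B w x)) \<le> norm (b * norm (W2 x))"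
    using b(2)[of w] b0 by (auto simp: norm_mult mult.commute[of b] intro!: AE_I2 mult_left_mono)
  qed measurable
  have "cnj (LINT x|lborel. W2 x * complex_of_real (B w x)) = (LINT x|lborel. cnj (W2 x) * complex_of_real (B w x))"
   using integral_bounded_linear'[OF bounded_linear_cnj bounded_linear_cnj, of lborel "\<lambda>x. W2 x * complex_of_real (B w x)"] by simp
  then show "(LINT x|lborel. W1 x * complex_of_real (A w x)) * cnj (LINT x|lborel. W2 x * complex_of_real (B w x))
    = (LINT p|lborel. f w p)"
   unfolding f_def using integral_lborel_product(2)[OF i1 i2] by simp
 qed
 also have "\<dots> = (LINT p|lborel. LINT w|M. f w p)"
  by (rule PS.Fubini_integral[OF i, symmetric])
 also have "\<dots> = (LINT p|lborel. W1 (fst p) * cnj (W2 (snd p)) * complex_of_real (LINT w|M. A w (fst p) * B w (snd p)))"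
 proof (intro Bochner_Integration.integral_cong refl)
  fix p :: "'a \<times> 'a"
  have "(LINT w|M. f w p) = (LINT w|M. (W1 (fst p) * cnj (W2 (snd p))) * complex_of_real (A w (fst p) * B w (snd p)))"
   by (intro Bochner_Integration.integral_cong refl) (simp add: f_def mult_ac)
  also have "\<dots> = W1 (fst p) * cnj (W2 (snd p)) * complex_of_real (LINT w|M. A w (fst p) * B w (snd p))"
   by (simp only: integral_mult_right_zero integral_complex_of_real)
  finally show "(LINT w|M. f w p) = W1 (fst p) * cnj (W2 (snd p)) * complex_of_real (LINT w|M. A w (fst p) * B w (snd p))" .
 qed
 finally show ?thesis .
qed

lemma second_moment_le:
 fixes A :: "'w => 'a::euclidean_space => real" and W :: "'a => complex"
 assumes M: "prob_space M" and A: "(\<lambda>(w, x). A w x) \<in> borel_measurable (M \<Otimes>\<^sub>M borel)"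
  and b: "\<And>w x. \<bar>A w x\<bar> \<le> b" and W: "integrable lborel W"
 shows "(LINT w|M. (norm (LINT x|lborel. W x * complex_of_real (A w x)))\<^sup>2)
  \<le> (LINT p|lborel. norm (W (fst p)) * norm (W (snd p)) * \<bar>LINT w|M. A w (fst p) * A w (snd p)\<bar>)"
proof -
 let ?T = "\<lambda>w. LINT x|lborel. W x * complex_of_real (A w x)"
 have "complex_of_real (LINT w|M. (norm (?T w))\<^sup>2) = (LINT w|M. ?T w * cnj (?T w))"
  unfolding integral_complex_of_real[symmetric] complex_norm_square ..
 also have "\<dots> = (LINT p|lborel. W (fst p) * cnj (W (snd p)) * complex_of_real (LINT w|M. A w (fst p) * A w (snd p)))"
  by (rule second_moment[OF M A A b b W W])
 finally have "norm (complex_of_real (LINT w|M. (norm (?T w))\<^sup>2))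
   \<le> (LINT p|lborel. norm (W (fst p) * cnj (W (snd p)) * complex_of_real (LINT w|M. A w (fst p) * A w (snd p))))"
  by (simp only: integral_norm_bound)
 then show ?thesis by (simp add: norm_mult)
qed

lemma (in prob_space) expectation_le_sqrt:
 fixes Y :: "'a => complex"
 assumes [measurable]: "Y \<in> borel_measurable M" and b: "\<And>w. w \<in> space M ==> norm (Y w) \<le> b"
  and e: "(LINT w|M. (norm (Y w))\<^sup>2) \<le> e"
 shows "(LINT w|M. norm (Y w)) \<le> sqrt e"
proof -
 have i1: "integrable M (\<lambda>w. norm (Y w))"
  by (rule integrable_const_bound[of _ b]) (use b in auto)
 have i2: "integrable M (\<lambda>w. (norm (Y w))\<^sup>2)"
  by (rule integrable_const_bound[of _ "b\<^sup>2"]) (use b in \<open>auto intro!: power_mono\<close>)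
 have "0 \<le> variance (\<lambda>w. norm (Y w))" by (rule variance_positive)
 then have "(LINT w|M. norm (Y w))\<^sup>2 \<le> e"
  unfolding variance_eq[OF i1 i2] using e by linarith
 then show ?thesis by (rule real_le_rsqrt)
qed

lemma nn_integral_norm_powr_ball':
 fixes s :: real
 assumes "0 \<le> s" "s < DIM('a)"
 shows "(\<integral>\<^sup>+w. ennreal \<bar>norm w powr - s\<bar> * indicator (ball (0::'a::euclidean_space) r) w \<partial>lborel) < \<infinity>"
proof (cases "0 < r")
 case True
 then show ?thesis using nn_integral_norm_powr_ball[OF True assms] by simp
qed (simp add: ball_empty)

lemma test_function_D:
 fixes \<phi> :: "'a::euclidean_space => 'b::real_normed_vector"
 assumes "test_function U \<phi>"
 shows "test_function UNIV \<phi>" "compact (fun_support \<phi>)" "fun_support \<phi> \<subseteq> U"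
  "\<And>x. \<phi> x \<noteq> 0 ==> x \<in> fun_support \<phi>"
 using assms closure_subset[of "{x. \<phi> x \<noteq> 0}"] unfolding test_function_def fun_support_def by auto

lemma powr_pair_integrable:
 fixes \<phi> :: "'a::euclidean_space => complex" and s :: real
 assumes \<phi>: "test_function UNIV \<phi>" and s: "0 \<le> s" "s < DIM('a)"
 shows "integrable lborel (\<lambda>p. norm (fst p - snd p) powr - s * norm (\<phi> (fst p)) * norm (\<phi> (snd p)))"
proof -
 have [measurable]: "\<phi> \<in> borel_measurable borel" using \<phi> by (rule test_function_measurable)
 obtain B R where b: "0 < B" "0 < R" "\<And>x. norm (\<phi> x) \<le> B" "\<And>x. R < norm x ==> \<phi> x = 0"
  by (rule test_function_bounds[OF \<phi>]) blast
 have "integrable lborel (\<lambda>(u, v). norm (u - v) powr - s * norm (\<phi> u) * norm (\<phi> v))"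
  by (rule convolution_pair_integrable[of "\<lambda>x. norm (\<phi> x)" "\<lambda>x. norm (\<phi> x)" "\<lambda>w. norm w powr - s" B R])
    (use b nn_integral_norm_powr_ball'[OF s] in auto)
 then show ?thesis by (simp add: case_prod_beta')
qed

context log_field
begin

definition var :: "('a => real) => real => 'a => real" where
 "var \<eta> e x = cov (mol \<eta> e x) (mol \<eta> e x)"

definition weight :: "real => ('a => real) => real => ('a => complex) => 'a => complex" where
 "weight \<beta> \<eta> e \<phi> x = \<phi> x * complex_of_real (exp (\<beta>\<^sup>2 * var \<eta> e x / 2))"

definition pairing :: "real => ('a => real) => real => ('a => complex) => (real => real) => 'w => complex" where
 "pairing \<beta> \<eta> e \<phi> H w = (LINT x|lborel. weight \<beta> \<eta> e \<phi> x * complex_of_real (H (X w (mol \<eta> e x))))"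

lemma mol_field_measurable [measurable]:
 assumes "mollifier \<eta>" "0 < e"
 shows "(\<lambda>(w, x). X w (mol \<eta> e x)) \<in> borel_measurable (M \<Otimes>\<^sub>M borel)"
 unfolding mol_def by (rule X_translates_measurable[OF test_function_rescale[OF assms]])

lemma var_measurable [measurable]:
 assumes [measurable]: "mollifier \<eta>" "0 < e"
 shows "var \<eta> e \<in> borel_measurable borel"
proof -
 have [measurable]: "(\<lambda>(w, x). X w (mol \<eta> e x)) \<in> borel_measurable (M \<Otimes>\<^sub>M borel)"
  by (rule mol_field_measurable[OF assms])
 show ?thesis unfolding var_def[abs_def] cov_def by measurable
qed

lemma weight_measurable:
 assumes "mollifier \<eta>" "0 < e" "test_function UNIV \<phi>"
 shows "weight \<beta> \<eta> e \<phi> \<in> borel_measurable borel"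
proof -
 have [measurable]: "var \<eta> e \<in> borel_measurable borel" by (rule var_measurable[OF assms(1,2)])
 have [measurable]: "\<phi> \<in> borel_measurable borel" by (rule test_function_measurable[OF assms(3)])
 show ?thesis unfolding weight_def[abs_def] by measurable
qed

lemma pairing_measurable:
 assumes "mollifier \<eta>" "0 < e" "test_function UNIV \<phi>" and [measurable]: "H \<in> borel_measurable borel"
 shows "pairing \<beta> \<eta> e \<phi> H \<in> borel_measurable M"
proof -
 have [measurable]: "(\<lambda>(w, x). X w (mol \<eta> e x)) \<in> borel_measurable (M \<Otimes>\<^sub>M borel)"
  by (rule mol_field_measurable[OF assms(1,2)])
 have [measurable]: "weight \<beta> \<eta> e \<phi> \<in> borel_measurable borel" by (rule weight_measurable[OF assms(1-3)])
 show ?thesis unfolding pairing_def[abs_def] by measurable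
qed

text \<open>The cutoff to \<open>U\<close> is invisible under a test function supported in \<open>U\<close>.\<close>

lemma approx_pairing_eq_lebesgue:
 assumes \<phi>: "test_function U \<phi>"
 shows "approx_pairing M U X \<eta> e \<beta> H \<phi> w
  = (LINT x|lebesgue. weight \<beta> \<eta> e \<phi> x * complex_of_real (H (X w (mol \<eta> e x))))"
 unfolding approx_pairing_def set_lebesgue_integral_def
proof (intro Bochner_Integration.integral_cong refl)
 fix x
 show "indicator U x *\<^sub>R (\<phi> x * complex_of_real (exp (1/2 * \<beta>\<^sup>2 * approx_cov M U X \<eta> e x x) * H (conv_approx U X \<eta> e w x)))
   = weight \<beta> \<eta> e \<phi> x * complex_of_real (H (X w (mol \<eta> e x)))"
 proof (cases "x \<in> U")
  case True
  then show ?thesis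
   by (simp add: weight_def var_def cov_def approx_cov_def conv_approx_def mol_def)
 next
  case False
  then have "\<phi> x = 0" using test_function_D(3,4)[OF \<phi>] by blast
  then show ?thesis by (simp add: weight_def)
 qed
qed

lemma approx_pairing_eq:
 assumes \<phi>: "test_function U \<phi>" and \<eta>: "mollifier \<eta>" "0 < e" and [measurable]: "H \<in> borel_measurable borel"
  and w: "w \<in> space M"
 shows "approx_pairing M U X \<eta> e \<beta> H \<phi> w = pairing \<beta> \<eta> e \<phi> H w"
proof -
 have [measurable]: "weight \<beta> \<eta> e \<phi> \<in> borel_measurable borel"
  by (rule weight_measurable[OF \<eta> test_function_D(1)[OF \<phi>]])
 have [measurable]: "(\<lambda>(w, x). X w (mol \<eta> e x)) \<in> borel_measurable (M \<Otimes>\<^sub>M borel)"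
  by (rule mol_field_measurable[OF \<eta>])
 have "(\<lambda>x. X w (mol \<eta> e x)) \<in> borel_measurable borel" using w by measurable
 then have "(\<lambda>x. weight \<beta> \<eta> e \<phi> x * complex_of_real (H (X w (mol \<eta> e x)))) \<in> borel_measurable lborel"
  by measurable
 then show ?thesis
  unfolding approx_pairing_eq_lebesgue[OF \<phi>] pairing_def by (rule integral_completion)
qed

lemma weight_integrable:
 assumes \<phi>: "test_function U \<phi>" and \<eta>: "mollifier \<eta>"
 obtains \<rho> where "0 < \<rho>" "\<And>e. 0 < e ==> e < \<rho> ==> integrable lborel (weight \<beta> \<eta> e \<phi>)"
proof -
 note D = test_function_D[OF \<phi>]
 obtain \<rho> c where c: "0 < \<rho>" "0 \<le> c"
  "\<And>e \<delta> x y. 0 < e ==> e < \<rho> ==> 0 < \<delta> ==> \<delta> < \<rho> ==> x \<in> fun_support \<phi> ==> y \<in> fun_support \<phi> ==>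
   cov (mol \<eta> e x) (mol \<eta> \<delta> y) \<le> - ln e + c"
  by (rule cov_log_bounds[OF D(2,3) \<eta> \<eta>]) blast
 obtain B R where b: "0 < B" "0 < R" "\<And>x. norm (\<phi> x) \<le> B" "\<And>x. R < norm x ==> \<phi> x = 0"
  by (rule test_function_bounds[OF D(1)]) blast
 show ?thesis
 proof (rule that[OF c(1)])
  fix e :: real assume e: "0 < e" "e < \<rho>"
  show "integrable lborel (weight \<beta> \<eta> e \<phi>)"
  proof (rule integrable_bounded_support)
   show "weight \<beta> \<eta> e \<phi> \<in> borel_measurable borel" by (rule weight_measurable[OF \<eta> e(1) D(1)])
   show "norm (weight \<beta> \<eta> e \<phi> x) \<le> B * exp (\<beta>\<^sup>2 * (- ln e + c) / 2)" for x
   proof (cases "\<phi> x = 0")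
    case False
    then have "x \<in> fun_support \<phi>" by (rule D(4))
    then have "var \<eta> e x \<le> - ln e + c" unfolding var_def using c(3) e by simp
    then have "exp (\<beta>\<^sup>2 * var \<eta> e x / 2) \<le> exp (\<beta>\<^sup>2 * (- ln e + c) / 2)"
     by (simp add: mult_left_mono)
    then show ?thesis unfolding weight_def norm_mult using b(1,3) by (intro mult_mono) auto
   qed (use b(1) in \<open>simp add: weight_def\<close>)
   show "weight \<beta> \<eta> e \<phi> x = 0" if "R < norm x" for x using b(4)[OF that] by (simp add: weight_def)
  qed
 qed
qed

lemma pairing_integrand:
 assumes \<eta>: "mollifier \<eta>" "0 < e" and [measurable]: "H \<in> borel_measurable borel"
  and H: "\<And>t. \<bar>H t\<bar> \<le> b"
  and W: "integrable lborel (weight \<beta> \<eta> e \<phi>)" and w: "w \<in> space M"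
 shows "integrable lborel (\<lambda>x. weight \<beta> \<eta> e \<phi> x * complex_of_real (H (X w (mol \<eta> e x))))"
  and "norm (pairing \<beta> \<eta> e \<phi> H w) \<le> b * (LINT x|lborel. norm (weight \<beta> \<eta> e \<phi> x))"
proof -
 have b0: "0 \<le> b" using H[of 0] by linarith
 have [measurable]: "weight \<beta> \<eta> e \<phi> \<in> borel_measurable borel" using W by simp
 have [measurable]: "(\<lambda>(w, x). X w (mol \<eta> e x)) \<in> borel_measurable (M \<Otimes>\<^sub>M borel)"
  by (rule mol_field_measurable[OF \<eta>])
 have [measurable]: "(\<lambda>x. X w (mol \<eta> e x)) \<in> borel_measurable borel" using w by measurable
 have bd: "norm (weight \<beta> \<eta> e \<phi> x * complex_of_real (H (X w (mol \<eta> e x)))) \<le> b * norm (weight \<beta> \<eta> e \<phi> x)" for x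
  using H[of "X w (mol \<eta> e x)"] by (simp add: norm_mult mult.commute[of b] mult_left_mono)
 have iW: "integrable lborel (\<lambda>x. b * norm (weight \<beta> \<eta> e \<phi> x))" using W by simp
 show i: "integrable lborel (\<lambda>x. weight \<beta> \<eta> e \<phi> x * complex_of_real (H (X w (mol \<eta> e x))))"
  by (rule Bochner_Integration.integrable_bound[OF iW]) (use bd b0 in \<open>auto intro!: AE_I2\<close>)
 have "norm (pairing \<beta> \<eta> e \<phi> H w) \<le> (LINT x|lborel. b * norm (weight \<beta> \<eta> e \<phi> x))"
  unfolding pairing_def
  by (rule order_trans[OF integral_norm_bound]) (intro integral_mono integrable_norm i iW bd)
 then show "norm (pairing \<beta> \<eta> e \<phi> H w) \<le> b * (LINT x|lborel. norm (weight \<beta> \<eta> e \<phi> x))" by simp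
qed

text \<open>The exponential weights are exactly the inverse of the damping that the two variances cause in the
  expectation of a product of cosines, so that only the covariance survives.\<close>

lemma weighted_cos_cos:
 assumes f: "test_function UNIV f" and h: "test_function UNIV h"
 shows "exp (\<beta>\<^sup>2 * cov f f / 2) * exp (\<beta>\<^sup>2 * cov h h / 2) * (LINT w|M. cos (\<beta> * X w f) * cos (\<beta> * X w h))
  = cosh (\<beta>\<^sup>2 * cov f h)"
 unfolding expectation_cos_cos[OF f h] cosh_def
 by (simp add: field_simps exp_add[symmetric] exp_minus[symmetric] power2_eq_square)

text \<open>Dominated convergence with the majorant \<open>|x - y|\<close> to the power \<open>-
  \<beta>\<^sup>2\<close>. The limit does not depend on the mollifiers and the scales.\<close>

lemma cross_limit:
 fixes \<beta> :: real
 assumes \<beta>: "\<beta>\<^sup>2 < DIM('a)" and \<phi>: "test_function U \<phi>" and \<eta>: "mollifier \<eta>" and \<eta>': "mollifier \<eta>'"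
  and e: "\<And>n. 0 < e n" "e \<longlonglongrightarrow> 0" and d: "\<And>n. 0 < \<delta> n" "\<delta> \<longlonglongrightarrow> 0"
 shows "(\<lambda>n. LINT w|M. pairing \<beta> \<eta> (e n) \<phi> (\<lambda>t. cos (\<beta> * t)) w * cnj (pairing \<beta> \<eta>' (\<delta> n) \<phi> (\<lambda>t. cos (\<beta> * t)) w))
  \<longlonglongrightarrow> (LINT p|lborel. \<phi> (fst p) * cnj (\<phi> (snd p)) *
    complex_of_real (cosh (\<beta>\<^sup>2 * (- ln (norm (fst p - snd p)) + gK (fun_support \<phi>) p))))"
proof -
 note D = test_function_D[OF \<phi>]
 let ?K = "fun_support \<phi>"
 let ?cos = "\<lambda>t::real. cos (\<beta> * t)"
 have [measurable]: "\<phi> \<in> borel_measurable borel" by (rule test_function_measurable[OF D(1)])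
 have [measurable]: "gK ?K \<in> borel_measurable borel" by (rule gK_measurable[OF D(2,3)])
 have [measurable]: "?cos \<in> borel_measurable borel"
  by (intro borel_measurable_continuous_onI continuous_intros)
 obtain \<rho>1 c where c: "0 < \<rho>1" "0 \<le> c"
  "\<And>e \<delta> x y. 0 < e ==> e < \<rho>1 ==> 0 < \<delta> ==> \<delta> < \<rho>1 ==> x \<in> ?K ==> y \<in> ?K ==> x \<noteq> y ==>
   \<bar>cov (mol \<eta> e x) (mol \<eta>' \<delta> y)\<bar> \<le> - ln (norm (x - y)) + c"
  by (rule cov_log_bounds[OF D(2,3) \<eta> \<eta>']) blast
 obtain \<rho>2 where r2: "0 < \<rho>2" "\<And>e. 0 < e ==> e < \<rho>2 ==> integrable lborel (weight \<beta> \<eta> e \<phi>)"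
  by (rule weight_integrable[OF \<phi> \<eta>]) blast
 obtain \<rho>3 where r3: "0 < \<rho>3" "\<And>e. 0 < e ==> e < \<rho>3 ==> integrable lborel (weight \<beta> \<eta>' e \<phi>)"
  by (rule weight_integrable[OF \<phi> \<eta>']) blast
 define \<rho> where "\<rho> = min \<rho>1 (min \<rho>2 \<rho>3)"
 have \<rho>: "0 < \<rho>" using c r2 r3 by (simp add: \<rho>_def)
 have "\<forall>\<^sub>F n in sequentially. e n < \<rho> \<and> \<delta> n < \<rho>"
  using order_tendstoD(2)[OF e(2) \<rho>] order_tendstoD(2)[OF d(2) \<rho>] by eventually_elim simp
 then obtain N where N: "\<And>n. N \<le> n ==> e n < \<rho> \<and> \<delta> n < \<rho>" unfolding eventually_sequentially by blast
 let ?C = "\<lambda>n p. cov (mol \<eta> (e n) (fst p)) (mol \<eta>' (\<delta> n) (snd p))"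
 let ?f = "\<lambda>n p. \<phi> (fst p) * cnj (\<phi> (snd p)) * complex_of_real (cosh (\<beta>\<^sup>2 * ?C n p))"
 let ?l = "\<lambda>p. \<phi> (fst p) * cnj (\<phi> (snd p)) * complex_of_real (cosh (\<beta>\<^sup>2 * (- ln (norm (fst p - snd p)) + gK ?K p)))"
 have eq: "(LINT w|M. pairing \<beta> \<eta> (e n) \<phi> ?cos w * cnj (pairing \<beta> \<eta>' (\<delta> n) \<phi> ?cos w)) = (LINT p|lborel. ?f n p)"
  if n: "N \<le> n" for n
 proof -
  have W: "integrable lborel (weight \<beta> \<eta> (e n) \<phi>)" "integrable lborel (weight \<beta> \<eta>' (\<delta> n) \<phi>)"
   using N[OF n] e(1)[of n] d(1)[of n] r2(2)[of "e n"] r3(2)[of "\<delta> n"] by (auto simp: \<rho>_def)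
  have meas: "(\<lambda>(w, x). ?cos (X w (mol \<eta> (e n) x))) \<in> borel_measurable (M \<Otimes>\<^sub>M borel)"
   "(\<lambda>(w, x). ?cos (X w (mol \<eta>' (\<delta> n) x))) \<in> borel_measurable (M \<Otimes>\<^sub>M borel)"
   using mol_field_measurable[OF \<eta> e(1)[of n]] mol_field_measurable[OF \<eta>' d(1)[of n]] by measurable
  show ?thesis
   unfolding pairing_def
  proof (subst second_moment[OF prob_space_axioms meas _ _ W, of 1])
   show "(LINT p|lborel. weight \<beta> \<eta> (e n) \<phi> (fst p) * cnj (weight \<beta> \<eta>' (\<delta> n) \<phi> (snd p)) *
     complex_of_real (LINT w|M. ?cos (X w (mol \<eta> (e n) (fst p))) * ?cos (X w (mol \<eta>' (\<delta> n) (snd p))))) = (LINT p|lborel. ?f n p)"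
   proof (intro Bochner_Integration.integral_cong refl)
    fix p :: "'a \<times> 'a"
    show "weight \<beta> \<eta> (e n) \<phi> (fst p) * cnj (weight \<beta> \<eta>' (\<delta> n) \<phi> (snd p)) *
     complex_of_real (LINT w|M. ?cos (X w (mol \<eta> (e n) (fst p))) * ?cos (X w (mol \<eta>' (\<delta> n) (snd p)))) = ?f n p"
     unfolding weighted_cos_cos[OF mol_test_function[OF \<eta> e(1)] mol_test_function[OF \<eta>' d(1)], symmetric]
     by (simp add: weight_def var_def)
   qed
  qed simp_all
 qed
 have "(\<lambda>n. LINT p|lborel. ?f (n + N) p) \<longlonglongrightarrow> (LINT p|lborel. ?l p)"
 proof (rule integral_dominated_convergence)
  let ?w = "\<lambda>p. exp (\<beta>\<^sup>2 * c) * (norm (fst p - snd p) powr - \<beta>\<^sup>2 * norm (\<phi> (fst p)) * norm (\<phi> (snd p)))"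
  show "integrable lborel ?w"
   using powr_pair_integrable[OF D(1), of "\<beta>\<^sup>2"] \<beta> by (intro integrable_mult_right) auto
  have "(\<lambda>p::'a\<times>'a. \<phi> (fst p)) \<in> borel_measurable borel" "(\<lambda>p::'a\<times>'a. cnj (\<phi> (snd p))) \<in> borel_measurable borel"
   "(\<lambda>p::'a\<times>'a. ln (norm (fst p - snd p))) \<in> borel_measurable borel"
   unfolding borel_prod[symmetric] by measurable
  note m = this
  have ml: "(\<lambda>p. complex_of_real (cosh (\<beta>\<^sup>2 * (- ln (norm (fst p - snd p)) + gK ?K p)))) \<in> borel_measurable borel"
  proof -
   have "(\<lambda>p. \<beta>\<^sup>2 * (- ln (norm (fst p - snd p)) + gK ?K p)) \<in> borel_measurable borel"
    by (intro borel_measurable_times borel_measurable_const borel_measurable_add borel_measurable_uminus m(3)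
      gK_measurable D(2,3))
   then have "(\<lambda>p. cosh (\<beta>\<^sup>2 * (- ln (norm (fst p - snd p)) + gK ?K p))) \<in> borel_measurable borel"
    by (rule measurable_compose[OF _ cosh_measurable])
   moreover have "complex_of_real \<in> borel_measurable borel"
    by (intro borel_measurable_continuous_onI continuous_intros)
   ultimately show ?thesis by (rule measurable_compose)
  qed
  show "?l \<in> borel_measurable lborel"
   by (intro borel_measurable_times) (use m(1,2) ml in simp_all)
  show "?f (n + N) \<in> borel_measurable lborel" for n
  proof -
   have [measurable]: "(\<lambda>(w, x). X w (mol \<eta> (e (n + N)) x)) \<in> borel_measurable (M \<Otimes>\<^sub>M borel)"
    "(\<lambda>(w, x). X w (mol \<eta>' (\<delta> (n + N)) x)) \<in> borel_measurable (M \<Otimes>\<^sub>M borel)"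
    using mol_field_measurable[OF \<eta> e(1)] mol_field_measurable[OF \<eta>' d(1)] by auto
   have [measurable]: "?C (n + N) \<in> borel_measurable borel"
    unfolding cov_def borel_prod[symmetric] by measurable
   have "(\<lambda>p. complex_of_real (cosh (\<beta>\<^sup>2 * ?C (n + N) p))) \<in> borel_measurable borel"
    by measurable
   then show ?thesis
    using m(1,2) by (intro borel_measurable_times) simp_all
  qed
  show "AE p in lborel. (\<lambda>n. ?f (n + N) p) \<longlonglongrightarrow> ?l p"
   using AE_lborel_prod_neq
  proof eventually_elim
   case (elim p)
   show ?case
   proof (cases "\<phi> (fst p) = 0 \<or> \<phi> (snd p) = 0")
    case False
    then have K: "fst p \<in> ?K" "snd p \<in> ?K" using D(4) by auto
    then have "gK ?K p = g (fst p) (snd p)" by (cases p) (simp add: gK_def)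
    moreover have "(\<lambda>n. ?C n p) \<longlonglongrightarrow> - ln (norm (fst p - snd p)) + g (fst p) (snd p)"
     using K D(3) elim by (intro cov_limit[OF \<eta> \<eta>' e d]) auto
    from LIMSEQ_ignore_initial_segment[OF this, of N]
    have "(\<lambda>n. ?C (n + N) p) \<longlonglongrightarrow> - ln (norm (fst p - snd p)) + g (fst p) (snd p)" .
    ultimately have "(\<lambda>n. ?C (n + N) p) \<longlonglongrightarrow> - ln (norm (fst p - snd p)) + gK ?K p"
     by (simp only:)
    then show ?thesis unfolding cosh_def by (intro tendsto_intros)
   qed auto
  qed
  fix n
  show "AE p in lborel. norm (?f (n + N) p) \<le> ?w p"
   using AE_lborel_prod_neq
  proof eventually_elim
   case (elim p)
   show ?case
   proof (cases "\<phi> (fst p) = 0 \<or> \<phi> (snd p) = 0")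
    case False
    then have K: "fst p \<in> ?K" "snd p \<in> ?K" using D(4) by auto
    have "\<bar>?C (n + N) p\<bar> \<le> - ln (norm (fst p - snd p)) + c"
     using N[of "n + N"] e(1) d(1) K elim by (intro c(3)) (auto simp: \<rho>_def)
    then have "\<beta>\<^sup>2 * \<bar>?C (n + N) p\<bar> \<le> \<beta>\<^sup>2 * (- ln (norm (fst p - snd p)) + c)" by (intro mult_left_mono) auto
    then have "exp (\<beta>\<^sup>2 * \<bar>?C (n + N) p\<bar>) \<le> exp (\<beta>\<^sup>2 * (- ln (norm (fst p - snd p)) + c))" by simp
    also have "\<dots> = exp (\<beta>\<^sup>2 * c) * norm (fst p - snd p) powr - \<beta>\<^sup>2"
     using elim by (simp add: powr_def exp_add[symmetric] algebra_simps)
    finally have "cosh (\<beta>\<^sup>2 * ?C (n + N) p) \<le> exp (\<beta>\<^sup>2 * c) * norm (fst p - snd p) powr - \<beta>\<^sup>2"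
    proof (rule order_trans[rotated])
     have "cosh y \<le> exp \<bar>y\<bar>" for y :: real
     proof -
      have "exp y + exp (- y) \<le> exp \<bar>y\<bar> + exp \<bar>y\<bar>" by (intro add_mono) simp_all
      then show ?thesis by (simp add: cosh_def)
     qed
     from this[of "\<beta>\<^sup>2 * ?C (n + N) p"] show "cosh (\<beta>\<^sup>2 * ?C (n + N) p) \<le> exp (\<beta>\<^sup>2 * \<bar>?C (n + N) p\<bar>)"
      by (simp add: abs_mult)
    qed
    from mult_left_mono[OF this, of "norm (\<phi> (fst p)) * norm (\<phi> (snd p))"]
    show ?thesis by (simp add: norm_mult mult_ac)
   qed auto
  qed
 qed
 then have "(\<lambda>n. LINT w|M. pairing \<beta> \<eta> (e (n + N)) \<phi> ?cos w * cnj (pairing \<beta> \<eta>' (\<delta> (n + N)) \<phi> ?cos w))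
   \<longlonglongrightarrow> (LINT p|lborel. ?l p)"
  by (simp only: eq le_add2)
 then show ?thesis by (rule LIMSEQ_offset)
qed


text \<open>Polarisation: the second moments and the mixed moment have the same limit.\<close>

lemma pairing_difference:
 fixes \<beta> :: real
 assumes \<beta>: "\<beta>\<^sup>2 < DIM('a)" and \<phi>: "test_function U \<phi>" and \<eta>: "mollifier \<eta>" and \<eta>': "mollifier \<eta>'"
  and e: "\<And>n. 0 < e n" "e \<longlonglongrightarrow> 0" and d: "\<And>n. 0 < \<delta> n" "\<delta> \<longlonglongrightarrow> 0"
 shows "(\<lambda>n. LINT w|M. norm (pairing \<beta> \<eta> (e n) \<phi> (\<lambda>t. cos (\<beta> * t)) w - pairing \<beta> \<eta>' (\<delta> n) \<phi> (\<lambda>t. cos (\<beta> * t)) w)) \<longlonglongrightarrow> 0"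
proof -
 note D = test_function_D[OF \<phi>]
 let ?cos = "\<lambda>t::real. cos (\<beta> * t)"
 have cm: "?cos \<in> borel_measurable borel"
  by (intro borel_measurable_continuous_onI continuous_intros)
 obtain \<rho>2 where r2: "0 < \<rho>2" "\<And>e. 0 < e ==> e < \<rho>2 ==> integrable lborel (weight \<beta> \<eta> e \<phi>)"
  by (rule weight_integrable[OF \<phi> \<eta>]) blast
 obtain \<rho>3 where r3: "0 < \<rho>3" "\<And>e. 0 < e ==> e < \<rho>3 ==> integrable lborel (weight \<beta> \<eta>' e \<phi>)"
  by (rule weight_integrable[OF \<phi> \<eta>']) blast
 let ?A = "\<lambda>n. pairing \<beta> \<eta> (e n) \<phi> ?cos" and ?B = "\<lambda>n. pairing \<beta> \<eta>' (\<delta> n) \<phi> ?cos"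
 let ?q = "\<lambda>n. Re (LINT w|M. ?A n w * cnj (?A n w)) + Re (LINT w|M. ?B n w * cnj (?B n w)) - 2 * Re (LINT w|M. ?A n w * cnj (?B n w))"
 have [measurable]: "?A n \<in> borel_measurable M" "?B n \<in> borel_measurable M" for n
  by (intro pairing_measurable \<eta> \<eta>' e d D(1) cm)+
 let ?I = "LINT p|lborel. \<phi> (fst p) * cnj (\<phi> (snd p)) *
    complex_of_real (cosh (\<beta>\<^sup>2 * (- ln (norm (fst p - snd p)) + gK (fun_support \<phi>) p)))"
 have "?q \<longlonglongrightarrow> Re ?I + Re ?I - 2 * Re ?I"
  by (intro tendsto_intros cross_limit[OF \<beta> \<phi> \<eta> \<eta> e e] cross_limit[OF \<beta> \<phi> \<eta>' \<eta>' d d] cross_limit[OF \<beta> \<phi> \<eta> \<eta>' e d])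
 then have q0: "(\<lambda>n. sqrt (?q n)) \<longlonglongrightarrow> 0"
  using tendsto_real_sqrt[of ?q 0 sequentially] by simp
 have "\<forall>\<^sub>F n in sequentially. e n < \<rho>2 \<and> \<delta> n < \<rho>3"
  using order_tendstoD(2)[OF e(2) r2(1)] order_tendstoD(2)[OF d(2) r3(1)] by eventually_elim simp
 then have "\<forall>\<^sub>F n in sequentially. (LINT w|M. norm (?A n w - ?B n w)) \<le> sqrt (?q n)"
 proof eventually_elim
  case (elim n)
  define b where "b = (LINT x|lborel. norm (weight \<beta> \<eta> (e n) \<phi> x)) + (LINT x|lborel. norm (weight \<beta> \<eta>' (\<delta> n) \<phi> x))"
  have W: "integrable lborel (weight \<beta> \<eta> (e n) \<phi>)" "integrable lborel (weight \<beta> \<eta>' (\<delta> n) \<phi>)"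
   using elim r2(2)[OF e(1)] r3(2)[OF d(1)] by auto
  have b0: "0 \<le> (LINT x|lborel. norm (weight \<beta> \<eta> (e n) \<phi> x))" "0 \<le> (LINT x|lborel. norm (weight \<beta> \<eta>' (\<delta> n) \<phi> x))"
   by simp_all
  have A: "norm (?A n w) \<le> b" and B: "norm (?B n w) \<le> b" if "w \<in> space M" for w
  proof -
   have "norm (?A n w) \<le> 1 * (LINT x|lborel. norm (weight \<beta> \<eta> (e n) \<phi> x))"
    by (rule pairing_integrand(2)[OF \<eta> e(1) cm _ W(1) that]) simp
   moreover have "norm (?B n w) \<le> 1 * (LINT x|lborel. norm (weight \<beta> \<eta>' (\<delta> n) \<phi> x))"
    by (rule pairing_integrand(2)[OF \<eta>' d(1) cm _ W(2) that]) simp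
   ultimately show "norm (?A n w) \<le> b" "norm (?B n w) \<le> b" unfolding b_def using b0 by linarith+
  qed
  have prod: "integrable M (\<lambda>w. P w * cnj (Q w))"
   if [measurable]: "P \<in> borel_measurable M" "Q \<in> borel_measurable M"
    and "\<And>w. w \<in> space M ==> norm (P w) \<le> b" "\<And>w. w \<in> space M ==> norm (Q w) \<le> b" for P Q :: "'w => complex"
  proof (rule integrable_const_bound[of _ "b * b"])
   show "AE w in M. norm (P w * cnj (Q w)) \<le> b * b"
   proof (rule AE_I2)
    fix w assume w: "w \<in> space M"
    have "0 \<le> b" using order_trans[OF norm_ge_zero that(3)[OF w]] .
    then show "norm (P w * cnj (Q w)) \<le> b * b"
     unfolding norm_mult complex_mod_cnj by (intro mult_mono that(3,4) w norm_ge_zero)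
   qed
  qed measurable
  note i = prod[of "?A n" "?A n"] prod[of "?B n" "?B n"] prod[of "?A n" "?B n"]
  have "(LINT w|M. (norm (?A n w - ?B n w))\<^sup>2)
    = (LINT w|M. Re (?A n w * cnj (?A n w)) + Re (?B n w * cnj (?B n w)) - 2 * Re (?A n w * cnj (?B n w)))"
  proof (intro Bochner_Integration.integral_cong refl)
   have "(norm (a - b))\<^sup>2 = Re (a * cnj a) + Re (b * cnj b) - 2 * Re (a * cnj b)" for a b :: complex
    unfolding cmod_power2[of "a - b"] by (simp add: power2_eq_square algebra_simps)
   then show "(norm (?A n w - ?B n w))\<^sup>2 = Re (?A n w * cnj (?A n w)) + Re (?B n w * cnj (?B n w)) - 2 * Re (?A n w * cnj (?B n w))" for w .
  qed
  also have "\<dots> = ?q n"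
  proof -
   have "(LINT w|M. Re (f1 w) + Re (f2 w) - 2 * Re (f3 w)) = Re (LINT w|M. f1 w) + Re (LINT w|M. f2 w) - 2 * Re (LINT w|M. f3 w)"
    if "integrable M f1" "integrable M f2" "integrable M f3" for f1 f2 f3 :: "'w => complex"
    using that by simp
   then show ?thesis using i A B \<open>\<And>n. ?A n \<in> borel_measurable M\<close> \<open>\<And>n. ?B n \<in> borel_measurable M\<close> by blast
  qed
  finally have "(LINT w|M. (norm (?A n w - ?B n w))\<^sup>2) \<le> ?q n" by (rule eq_refl)
  then show ?case
  proof (rule expectation_le_sqrt[rotated 2])
   show "norm (?A n w - ?B n w) \<le> b + b" if "w \<in> space M" for w
    using A[OF that] B[OF that] norm_triangle_ineq4[of "?A n w" "?B n w"] by linarith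
  qed measurable
 qed
 then show ?thesis
  by (intro tendsto_sandwich[OF _ _ tendsto_const q0]) auto
qed

end

text \<open>With \<open>d = a - b\<close> and \<open>V = vx + vy - 2 |C|\<close>, the left side is
  \<open>|C|\<close> minus half of \<open>d\<^sup>2 vx + b d (vx - vy) + (a b - 1) V\<close>. The outer terms
  absorb the mixed one because \<open>2 L\<^sup>2 \<le> c \<Lambda>\<close>, and \<open>a b - 1 \<ge> a b /
  2\<close> away from \<open>a = b\<close>. The additive constant covers \<open>a = b = 1\<close>, where no
  damping remains.\<close>

lemma mode_exponent_aux:
 fixes a b vx vy C \<tau> \<Lambda> L c :: real
 assumes ab: "1 \<le> b" "b \<le> a" "a = b \<or> 2 \<le> a * b"
  and osc: "\<bar>vx - vy\<bar> \<le> L * \<tau>" and \<tau>: "0 \<le> \<tau>" "\<tau> \<le> 1"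
  and inc: "c * \<tau>\<^sup>2 \<le> vx + vy - 2 * \<bar>C\<bar>" and \<Lambda>: "\<Lambda> \<le> vx" "0 < \<Lambda>" "2 * L\<^sup>2 \<le> c * \<Lambda>" and c: "0 < c"
 shows "(vx + vy) / 2 - (a\<^sup>2 * vx + b\<^sup>2 * vy - 2 * a * b * \<bar>C\<bar>) / 2
  \<le> \<bar>C\<bar> - \<Lambda> * (a - b)\<^sup>2 / 4 - c / 8 * (a * b) * \<tau>\<^sup>2 + c / 8"
proof -
 define V where "V = vx + vy - 2 * \<bar>C\<bar>"
 define d where "d = a - b"
 have d0: "0 \<le> d" using ab by (simp add: d_def)
 have ab1: "1 \<le> a * b" using ab mult_mono[of 1 a 1 b] by simp
 have V: "c * \<tau>\<^sup>2 \<le> V" using inc by (simp add: V_def)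
 have \<tau>2: "0 \<le> \<tau>\<^sup>2" "\<tau>\<^sup>2 \<le> 1" using \<tau> by (auto simp: power_le_one)
 have id: "(vx + vy) / 2 - (a\<^sup>2 * vx + b\<^sup>2 * vy - 2 * a * b * \<bar>C\<bar>) / 2
   = \<bar>C\<bar> - (d\<^sup>2 * vx + b * d * (vx - vy) + (a * b - 1) * V) / 2"
  by (simp add: V_def d_def power2_eq_square field_simps)
 have main: "\<Lambda> * d\<^sup>2 / 2 + c / 4 * (a * b) * \<tau>\<^sup>2 - c / 4 \<le> d\<^sup>2 * vx + b * d * (vx - vy) + (a * b - 1) * V"
 proof (cases "a = b")
  case True
  have "(a * b - 1) * (c * \<tau>\<^sup>2) \<le> (a * b - 1) * V" using ab1 V by (intro mult_left_mono) auto
  moreover have "c / 4 * (a * b) * \<tau>\<^sup>2 - c / 4 \<le> (a * b - 1) * (c * \<tau>\<^sup>2)"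
  proof -
   have "0 \<le> c * \<tau>\<^sup>2 * ((a * b - 1) * 3) + c * (1 - \<tau>\<^sup>2)"
    using c \<tau>2 ab1 by (intro add_nonneg_nonneg mult_nonneg_nonneg) auto
   then show ?thesis by (simp add: field_simps)
  qed
  ultimately show ?thesis using True by (simp add: d_def)
 next
  case False
  then have two: "2 \<le> a * b" using ab(3) by simp
  have 1: "\<Lambda> * d\<^sup>2 \<le> d\<^sup>2 * vx" using mult_right_mono[OF \<Lambda>(1), of "d\<^sup>2"] by (simp add: mult.commute)
  have 2: "(a * b / 2) * (c * \<tau>\<^sup>2) \<le> (a * b - 1) * V"
   using two V c \<tau>2 by (intro mult_mono) auto
  have "\<bar>b * d * (vx - vy)\<bar> \<le> b * d * (L * \<tau>)"
   unfolding abs_mult using ab(1) d0 osc by (simp add: mult_left_mono)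
  then have 3: "- (b * d * (L * \<tau>)) \<le> b * d * (vx - vy)" by (simp only: abs_le_iff) linarith
  have 4: "b * d * (L * \<tau>) \<le> \<Lambda> * d\<^sup>2 / 2 + c / 4 * (a * b) * \<tau>\<^sup>2"
  proof -
   have "2 * (\<Lambda> * d) * (b * L * \<tau>) \<le> (\<Lambda> * d)\<^sup>2 + (b * L * \<tau>)\<^sup>2" by (rule sum_squares_bound)
   moreover have "(b * L * \<tau>)\<^sup>2 = b\<^sup>2 * \<tau>\<^sup>2 * L\<^sup>2" by (simp add: power_mult_distrib)
   moreover have "2 * (b\<^sup>2 * \<tau>\<^sup>2 * L\<^sup>2) \<le> (a * b) * \<tau>\<^sup>2 * (c * \<Lambda>)"
   proof -
    have "b\<^sup>2 \<le> a * b" using ab by (simp add: power2_eq_square mult_right_mono)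
    have "b\<^sup>2 * \<tau>\<^sup>2 * (2 * L\<^sup>2) \<le> (a * b) * \<tau>\<^sup>2 * (c * \<Lambda>)"
    proof (rule mult_mono)
     show "b\<^sup>2 * \<tau>\<^sup>2 \<le> a * b * \<tau>\<^sup>2" using \<open>b\<^sup>2 \<le> a * b\<close> \<tau>2(1) by (rule mult_right_mono)
    qed (use \<Lambda>(3) \<tau>2 ab1 in simp_all)
    then show ?thesis by simp
   qed
   ultimately have "2 * (\<Lambda> * d) * (b * L * \<tau>) \<le> (\<Lambda> * d)\<^sup>2 + (a * b) * \<tau>\<^sup>2 * (c * \<Lambda>) / 2" by linarith
   then have "\<Lambda> * (2 * (b * d * (L * \<tau>))) \<le> \<Lambda> * (\<Lambda> * d\<^sup>2 + (a * b) * \<tau>\<^sup>2 * c / 2)"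
    by (simp add: power2_eq_square algebra_simps)
   then show ?thesis using \<Lambda>(2) by (simp add: mult_ac)
  qed
  have "c / 2 * (a * b) * \<tau>\<^sup>2 = (a * b / 2) * (c * \<tau>\<^sup>2)" by simp
  then show ?thesis using 1 2 3 4 c by (simp add: field_simps)
 qed
 show ?thesis unfolding id using main unfolding d_def by (simp add: field_simps)
qed

lemma mode_exponent:
 fixes vx vy C \<tau> \<Lambda> L c :: real and k l :: nat
 assumes kl: "1 \<le> k" "1 \<le> l"
  and osc: "\<bar>vx - vy\<bar> \<le> L * \<tau>" and \<tau>: "0 \<le> \<tau>" "\<tau> \<le> 1"
  and inc: "c * \<tau>\<^sup>2 \<le> vx + vy - 2 * \<bar>C\<bar>" and \<Lambda>: "\<Lambda> \<le> vx" "\<Lambda> \<le> vy" "0 < \<Lambda>" "2 * L\<^sup>2 \<le> c * \<Lambda>" and c: "0 < c"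
 shows "(vx + vy) / 2 - ((real k)\<^sup>2 * vx + (real l)\<^sup>2 * vy - 2 * real k * real l * \<bar>C\<bar>) / 2
  \<le> \<bar>C\<bar> - \<Lambda> * (real k - real l)\<^sup>2 / 4 - c / 8 * (real k * real l) * \<tau>\<^sup>2 + c / 8"
proof -
 have two: "real k = real l \<or> 2 \<le> real k * real l"
 proof (cases "k = l")
  case False
  then have "2 \<le> k \<or> 2 \<le> l" using kl by linarith
  then have "2 \<le> k * l" using kl mult_le_mono[of 2 k 1 l] mult_le_mono[of 1 k 2 l] by auto
  then have "real 2 \<le> real (k * l)" by (simp only: of_nat_le_iff)
  then show ?thesis by simp
 qed simp
 show ?thesis
 proof (cases "l \<le> k")
  case True
  then show ?thesis
   using mode_exponent_aux[of "real l" "real k" vx vy L \<tau> c C \<Lambda>] kl two osc \<tau> inc \<Lambda> c by simp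
 next
  case False
  have "vy + vx - 2 * \<bar>C\<bar> = vx + vy - 2 * \<bar>C\<bar>" by simp
  then have "(vy + vx) / 2 - ((real l)\<^sup>2 * vy + (real k)\<^sup>2 * vx - 2 * real l * real k * \<bar>C\<bar>) / 2
   \<le> \<bar>C\<bar> - \<Lambda> * (real l - real k)\<^sup>2 / 4 - c / 8 * (real l * real k) * \<tau>\<^sup>2 + c / 8"
   using False kl two osc \<tau> inc \<Lambda> c
   by (intro mode_exponent_aux[of "real k" "real l" vy vx L \<tau> c C \<Lambda>]) (auto simp: abs_minus_commute mult.commute)
  then show ?thesis by (simp add: power2_commute[of "real l"] mult_ac add_ac)
 qed
qed

section \<open>The modes of a periodic function\<close>

lemma gaussian_scaled_integral:
 assumes s: "0 < s"
 shows "(LINT w|lborel. exp (- s * (norm (w::'a::euclidean_space))\<^sup>2))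
  = (LINT w|lborel. exp (- (norm (w::'a))\<^sup>2)) / sqrt s ^ DIM('a)"
proof -
 have "(LINT w|lborel. exp (- (norm (w::'a))\<^sup>2))
   = \<bar>sqrt s\<bar> ^ DIM('a) *\<^sub>R (LINT w|lborel. exp (- (norm (0 + sqrt s *\<^sub>R (w::'a)))\<^sup>2))"
  using s by (intro lborel_integral_affine) auto
 also have "\<dots> = sqrt s ^ DIM('a) * (LINT w|lborel. exp (- s * (norm (w::'a))\<^sup>2))"
  using s by (simp add: power_mult_distrib)
 finally show ?thesis using s by simp
qed

lemma exp_neg_le_inverse: "exp (- x) \<le> 1 / x" if "0 < x" for x :: real
proof -
 have "x \<le> exp x" using exp_ge_add_one_self[of x] by linarith
 then show ?thesis using that by (simp add: exp_minus inverse_eq_divide frac_le)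
qed

text \<open>Two geometric series, one on each side of \<open>k\<close>.\<close>

lemma sum_exp_distance:
 "(\<Sum>l=1..N. exp (- \<bar>real k - real l\<bar>)) \<le> 2 / (1 - exp (- 1))"
proof -
 let ?q = "exp (- 1) :: real"
 have q: "0 \<le> ?q" "?q < 1" by simp_all
 have geo: "(\<Sum>j\<in>J. ?q ^ j) \<le> 1 / (1 - ?q)" if "finite J" for J :: "nat set"
 proof -
  have "(\<Sum>j\<in>J. ?q ^ j) \<le> (\<Sum>j. ?q ^ j)"
   using q that by (intro sum_le_suminf summable_geometric) auto
  then show ?thesis using q by (simp add: suminf_geometric)
 qed
 have p: "exp (- real j) = ?q ^ j" for j by (simp add: exp_of_nat_mult[symmetric])
 have "(\<Sum>l=1..N. exp (- \<bar>real k - real l\<bar>))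
   \<le> (\<Sum>l\<in>{1..N} \<inter> {..k}. exp (- \<bar>real k - real l\<bar>)) + (\<Sum>l\<in>{1..N} - {..k}. exp (- \<bar>real k - real l\<bar>))"
  by (subst sum.Int_Diff[of "{1..N}" _ "{..k}"]) auto
 also have "(\<Sum>l\<in>{1..N} \<inter> {..k}. exp (- \<bar>real k - real l\<bar>)) = (\<Sum>j\<in>(\<lambda>l. k - l) ` ({1..N} \<inter> {..k}). ?q ^ j)"
  by (subst sum.reindex) (auto simp: inj_on_def p[symmetric] of_nat_diff intro!: sum.cong)
 also have "\<dots> \<le> 1 / (1 - ?q)" by (intro geo) auto
 also have "(\<Sum>l\<in>{1..N} - {..k}. exp (- \<bar>real k - real l\<bar>)) = (\<Sum>j\<in>(\<lambda>l. l - k) ` ({1..N} - {..k}). ?q ^ j)"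
  by (subst sum.reindex) (auto simp: inj_on_def p[symmetric] of_nat_diff intro!: sum.cong)
 also have "\<dots> \<le> 1 / (1 - ?q)" by (intro geo) auto
 finally show ?thesis by simp
qed

text \<open>As \<open>1 / (k l)\<close> is at most the mean of \<open>1 / k\<^sup>2\<close> and \<open>1 /
  l\<^sup>2\<close>, one of the two indices can be summed against the exponential first.\<close>

lemma double_sum_bound:
 "(\<Sum>k=1..N. \<Sum>l=1..N. exp (- \<bar>real k - real l\<bar>) / (real k * real l))
  \<le> (\<Sum>k. 1 / (real (Suc k))\<^sup>2) * (2 / (1 - exp (- 1)))"
proof -
 let ?e = "\<lambda>k l. exp (- \<bar>real k - real l\<bar>)" and ?Q = "2 / (1 - exp (- 1)) :: real"
 have Q: "0 \<le> ?Q" by simp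
 have "(\<Sum>k=1..N. \<Sum>l=1..N. ?e k l / (real k * real l))
   \<le> (\<Sum>k=1..N. \<Sum>l=1..N. (?e k l / (real k)\<^sup>2 + ?e k l / (real l)\<^sup>2) / 2)"
 proof (intro sum_mono)
  fix k l assume "k \<in> {1..N}" "l \<in> {1..N}"
  then have kl: "0 < real k" "0 < real l" by auto
  have "1 / (real k * real l) \<le> (1 / (real k)\<^sup>2 + 1 / (real l)\<^sup>2) / 2"
   using sum_squares_bound[of "1 / real k" "1 / real l"] by (simp add: power_divide)
  from mult_left_mono[OF this, of "?e k l"]
  show "?e k l / (real k * real l) \<le> (?e k l / (real k)\<^sup>2 + ?e k l / (real l)\<^sup>2) / 2"
   by (simp add: distrib_left)
 qed
 also have "\<dots> = ((\<Sum>k=1..N. \<Sum>l=1..N. ?e k l / (real k)\<^sup>2) + (\<Sum>k=1..N. \<Sum>l=1..N. ?e k l / (real l)\<^sup>2)) / 2"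
  by (simp add: sum_divide_distrib[symmetric] sum.distrib)
 also have "(\<Sum>k=1..N. \<Sum>l=1..N. ?e k l / (real l)\<^sup>2) = (\<Sum>k=1..N. \<Sum>l=1..N. ?e k l / (real k)\<^sup>2)"
  by (subst sum.swap) (simp add: abs_minus_commute)
 finally have half: "(\<Sum>k=1..N. \<Sum>l=1..N. ?e k l / (real k * real l)) \<le> (\<Sum>k=1..N. \<Sum>l=1..N. ?e k l / (real k)\<^sup>2)"
  by simp
 also have "(\<Sum>k=1..N. \<Sum>l=1..N. ?e k l / (real k)\<^sup>2) \<le> (\<Sum>k=1..N. 1 / (real k)\<^sup>2 * ?Q)"
 proof (intro sum_mono)
  fix k
  have "(\<Sum>l=1..N. ?e k l / (real k)\<^sup>2) = 1 / (real k)\<^sup>2 * (\<Sum>l=1..N. ?e k l)"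
   by (simp add: sum_divide_distrib[symmetric])
  also have "\<dots> \<le> 1 / (real k)\<^sup>2 * ?Q" by (intro mult_left_mono sum_exp_distance) auto
  finally show "(\<Sum>l=1..N. ?e k l / (real k)\<^sup>2) \<le> 1 / (real k)\<^sup>2 * ?Q" .
 qed
 also have "(\<Sum>k=1..N. 1 / (real k)\<^sup>2 * ?Q) = (\<Sum>k=1..N. 1 / (real k)\<^sup>2) * ?Q"
  by (rule sum_distrib_right[symmetric])
 also have "(\<Sum>k=1..N. 1 / (real k)\<^sup>2) = (\<Sum>k<N. 1 / (real (Suc k))\<^sup>2)"
  by (rule sum.reindex_bij_witness[of _ Suc "\<lambda>k. k - 1"]) auto
 also have "\<dots> * ?Q \<le> (\<Sum>k. 1 / (real (Suc k))\<^sup>2) * ?Q"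
 proof (rule mult_right_mono[OF sum_le_suminf Q])
  have "summable (\<lambda>n::nat. inverse (real n ^ 2))"
   using inverse_power_summable[of 2, where 'a=real] by (simp add: power_inverse)
  then have "summable (\<lambda>n::nat. inverse (real (Suc n) ^ 2))"
   by (subst summable_Suc_iff[of "\<lambda>n. inverse (real n ^ 2)"])
  then show "summable (\<lambda>k. 1 / (real (Suc k))\<^sup>2)" by (simp only: inverse_eq_divide)
 qed auto
 finally show ?thesis .
qed

context log_field
begin

definition mode :: "real => nat => real => real" where
 "mode \<beta> k t = cos (real k * \<beta> * t)"

lemma mode_measurable [measurable]: "mode \<beta> k \<in> borel_measurable borel"
 unfolding mode_def[abs_def] by (intro borel_measurable_continuous_onI continuous_intros)

lemma mode_bounded: "\<bar>mode \<beta> k t\<bar> \<le> 1"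
 by (simp add: mode_def)

text \<open>Of the two exponentials in the correlation of two cosines, the one in which the covariance has the
  favourable sign dominates.\<close>

lemma weighted_mode_bound:
 assumes f: "test_function UNIV f" and h: "test_function UNIV h"
 shows "exp (\<beta>\<^sup>2 * cov f f / 2) * exp (\<beta>\<^sup>2 * cov h h / 2) * \<bar>LINT w|M. mode \<beta> k (X w f) * mode \<beta> l (X w h)\<bar>
  \<le> exp (\<beta>\<^sup>2 * ((cov f f + cov h h) / 2 - ((real k)\<^sup>2 * cov f f + (real l)\<^sup>2 * cov h h - 2 * real k * real l * \<bar>cov f h\<bar>) / 2))"
proof -
 let ?s = "real k * \<beta>" and ?t = "real l * \<beta>"
 define Q where "Q = \<beta>\<^sup>2 * ((real k)\<^sup>2 * cov f f + (real l)\<^sup>2 * cov h h - 2 * real k * real l * \<bar>cov f h\<bar>)"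
 have pm: "real k * real l * cov f h \<le> real k * real l * \<bar>cov f h\<bar>" "- (real k * real l * cov f h) \<le> real k * real l * \<bar>cov f h\<bar>"
 proof -
  show "real k * real l * cov f h \<le> real k * real l * \<bar>cov f h\<bar>" by (rule mult_left_mono[OF abs_ge_self]) simp
  have "real k * real l * - cov f h \<le> real k * real l * \<bar>cov f h\<bar>" by (rule mult_left_mono[OF abs_ge_minus_self]) simp
  then show "- (real k * real l * cov f h) \<le> real k * real l * \<bar>cov f h\<bar>" by (simp only: mult_minus_right)
 qed
 have 1: "Q \<le> ?s\<^sup>2 * cov f f + ?t\<^sup>2 * cov h h - 2 * ?s * ?t * cov f h"
 proof -
  have "\<beta>\<^sup>2 * (real k * real l * cov f h) \<le> \<beta>\<^sup>2 * (real k * real l * \<bar>cov f h\<bar>)" by (intro mult_left_mono pm) auto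
  then show ?thesis by (simp add: Q_def power_mult_distrib power2_eq_square algebra_simps)
 qed
 have 2: "Q \<le> ?s\<^sup>2 * cov f f + ?t\<^sup>2 * cov h h + 2 * ?s * ?t * cov f h"
 proof -
  have "\<beta>\<^sup>2 * - (real k * real l * cov f h) \<le> \<beta>\<^sup>2 * (real k * real l * \<bar>cov f h\<bar>)" by (intro mult_left_mono pm) auto
  then show ?thesis by (simp add: Q_def power_mult_distrib power2_eq_square algebra_simps)
 qed
 have "\<bar>LINT w|M. mode \<beta> k (X w f) * mode \<beta> l (X w h)\<bar> \<le> exp (- Q / 2)"
  unfolding mode_def expectation_cos_cos[OF f h]
 proof -
  have "exp (- (?s\<^sup>2 * cov f f + ?t\<^sup>2 * cov h h - 2 * ?s * ?t * cov f h) / 2) \<le> exp (- Q / 2)"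
   "exp (- (?s\<^sup>2 * cov f f + ?t\<^sup>2 * cov h h + 2 * ?s * ?t * cov f h) / 2) \<le> exp (- Q / 2)"
   using 1 2 by simp_all
  moreover have "\<bar>(x + y) / 2\<bar> \<le> z" if "x \<le> z" "y \<le> z" "0 \<le> x" "0 \<le> y" for x y z :: real
   using that by simp
  ultimately show "\<bar>(exp (- (?s\<^sup>2 * cov f f + ?t\<^sup>2 * cov h h - 2 * ?s * ?t * cov f h) / 2) +
    exp (- (?s\<^sup>2 * cov f f + ?t\<^sup>2 * cov h h + 2 * ?s * ?t * cov f h) / 2)) / 2\<bar> \<le> exp (- Q / 2)"
   by (simp only: exp_ge_zero)
 qed
 then have "exp (\<beta>\<^sup>2 * cov f f / 2) * exp (\<beta>\<^sup>2 * cov h h / 2) * \<bar>LINT w|M. mode \<beta> k (X w f) * mode \<beta> l (X w h)\<bar>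
   \<le> exp (\<beta>\<^sup>2 * cov f f / 2) * exp (\<beta>\<^sup>2 * cov h h / 2) * exp (- Q / 2)"
  by (intro mult_left_mono) auto
 also have "\<dots> = exp (\<beta>\<^sup>2 * cov f f / 2 + \<beta>\<^sup>2 * cov h h / 2 + - Q / 2)" by (simp only: exp_add)
 also have "\<beta>\<^sup>2 * cov f f / 2 + \<beta>\<^sup>2 * cov h h / 2 + - Q / 2
   = \<beta>\<^sup>2 * ((cov f f + cov h h) / 2 - ((real k)\<^sup>2 * cov f f + (real l)\<^sup>2 * cov h h - 2 * real k * real l * \<bar>cov f h\<bar>) / 2)"
  unfolding Q_def by (simp add: field_simps)
 finally show ?thesis .
qed

text \<open>The absolute value of the integrand in the correlation of two modes.\<close>

definition mode_kernel :: "real => ('a => real) => real => ('a => complex) => nat => nat => 'a \<times> 'a => real" where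
 "mode_kernel \<beta> \<eta> e \<phi> k l p = norm (weight \<beta> \<eta> e \<phi> (fst p)) * norm (weight \<beta> \<eta> e \<phi> (snd p)) *
  \<bar>LINT w|M. mode \<beta> k (X w (mol \<eta> e (fst p))) * mode \<beta> l (X w (mol \<eta> e (snd p)))\<bar>"

lemma mode_kernel_nonneg: "0 \<le> mode_kernel \<beta> \<eta> e \<phi> k l p"
 by (simp add: mode_kernel_def)

lemma mode_kernel_measurable:
 assumes \<eta>: "mollifier \<eta>" "0 < e" and \<phi>: "test_function UNIV \<phi>"
 shows "mode_kernel \<beta> \<eta> e \<phi> k l \<in> borel_measurable borel"
proof -
 have [measurable]: "weight \<beta> \<eta> e \<phi> \<in> borel_measurable borel" by (rule weight_measurable[OF \<eta> \<phi>])
 have [measurable]: "(\<lambda>(w, x). X w (mol \<eta> e x)) \<in> borel_measurable (M \<Otimes>\<^sub>M borel)"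
  by (rule mol_field_measurable[OF \<eta>])
 show ?thesis
  unfolding mode_kernel_def[abs_def] borel_prod[symmetric] by measurable
qed

lemma mode_kernel_bound:
 assumes \<eta>: "mollifier \<eta>" "0 < e"
 shows "mode_kernel \<beta> \<eta> e \<phi> k l p \<le> norm (\<phi> (fst p)) * norm (\<phi> (snd p)) *
  exp (\<beta>\<^sup>2 * ((var \<eta> e (fst p) + var \<eta> e (snd p)) / 2 - ((real k)\<^sup>2 * var \<eta> e (fst p) + (real l)\<^sup>2 * var \<eta> e (snd p)
   - 2 * real k * real l * \<bar>cov (mol \<eta> e (fst p)) (mol \<eta> e (snd p))\<bar>) / 2))"
proof -
 have "mode_kernel \<beta> \<eta> e \<phi> k l p = (norm (\<phi> (fst p)) * norm (\<phi> (snd p))) *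
   (exp (\<beta>\<^sup>2 * var \<eta> e (fst p) / 2) * exp (\<beta>\<^sup>2 * var \<eta> e (snd p) / 2) *
   \<bar>LINT w|M. mode \<beta> k (X w (mol \<eta> e (fst p))) * mode \<beta> l (X w (mol \<eta> e (snd p)))\<bar>)"
  by (simp add: mode_kernel_def weight_def norm_mult mult_ac)
 then show ?thesis
  unfolding var_def
  by (simp only:) (intro mult_left_mono weighted_mode_bound mol_test_function \<eta> mult_nonneg_nonneg norm_ge_zero)
qed

text \<open>A single mode is dominated, uniformly in its order and in the scale, by an integrable power of
  the distance; for the modes beyond the first the diverging variance kills it pointwise.\<close>

lemma single_mode_kernel:
 fixes \<beta> :: real
 assumes \<phi>: "test_function U \<phi>" and \<eta>: "mollifier \<eta>"
 obtains \<rho> c where "0 < \<rho>" "0 \<le> c"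
  "\<And>e k p. 0 < e ==> e < \<rho> ==> 1 \<le> k ==> fst p \<noteq> snd p ==>
   mode_kernel \<beta> \<eta> e \<phi> k k p \<le> exp (\<beta>\<^sup>2 * c) * (norm (fst p - snd p) powr - \<beta>\<^sup>2 * norm (\<phi> (fst p)) * norm (\<phi> (snd p)))"
  "\<And>e k p. 0 < e ==> e < \<rho> ==> 2 \<le> k ==> fst p \<noteq> snd p ==>
   mode_kernel \<beta> \<eta> e \<phi> k k p \<le> exp (\<beta>\<^sup>2 * (7 * c)) * norm (fst p - snd p) powr - (4 * \<beta>\<^sup>2) * norm (\<phi> (fst p)) * norm (\<phi> (snd p)) * (2 * e) powr (3 * \<beta>\<^sup>2)"
proof -
 note D = test_function_D[OF \<phi>]
 let ?K = "fun_support \<phi>"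
 obtain \<rho> c where c: "0 < \<rho>" "0 \<le> c"
  "\<And>e \<delta> x y. 0 < e ==> e < \<rho> ==> 0 < \<delta> ==> \<delta> < \<rho> ==> x \<in> ?K ==> y \<in> ?K ==> x \<noteq> y ==>
   \<bar>cov (mol \<eta> e x) (mol \<eta> \<delta> y)\<bar> \<le> - ln (norm (x - y)) + c"
  "\<And>e \<delta> x y. 0 < e ==> e < \<rho> ==> 0 < \<delta> ==> \<delta> < \<rho> ==> x \<in> ?K ==> y \<in> ?K ==>
   - ln (norm (x - y) + e + \<delta>) - c \<le> cov (mol \<eta> e x) (mol \<eta> \<delta> y)"
  by (rule cov_log_bounds[OF D(2,3) \<eta> \<eta>]) blast
 show ?thesis
 proof (rule that[OF c(1,2)])
  fix e :: real and k :: nat and p :: "'a \<times> 'a"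
  assume e: "0 < e" "e < \<rho>" and p: "fst p \<noteq> snd p"
  define r where "r = norm (fst p - snd p)"
  have r: "0 < r" using p by (simp add: r_def)
  let ?C = "cov (mol \<eta> e (fst p)) (mol \<eta> e (snd p))" and ?v = "var \<eta> e (fst p)" and ?w = "var \<eta> e (snd p)"
  have SC: "2 * \<bar>?C\<bar> \<le> ?v + ?w"
   unfolding var_def by (intro cov_abs_le mol_test_function \<eta> e)
  have id: "(?v + ?w) / 2 - ((real k)\<^sup>2 * ?v + (real k)\<^sup>2 * ?w - 2 * real k * real k * \<bar>?C\<bar>) / 2
    = \<bar>?C\<bar> - ((real k)\<^sup>2 - 1) * ((?v + ?w) / 2 - \<bar>?C\<bar>)"
   by (simp add: power2_eq_square field_simps)
  have zero: "mode_kernel \<beta> \<eta> e \<phi> k k p = 0" if "\<phi> (fst p) = 0 \<or> \<phi> (snd p) = 0"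
   using that by (auto simp: mode_kernel_def weight_def)
  note b = mode_kernel_bound[OF \<eta> e(1), of \<beta> \<phi> k k p, unfolded id]
  {
   assume k: "1 \<le> k"
   show "mode_kernel \<beta> \<eta> e \<phi> k k p \<le> exp (\<beta>\<^sup>2 * c) * (norm (fst p - snd p) powr - \<beta>\<^sup>2 * norm (\<phi> (fst p)) * norm (\<phi> (snd p)))"
   proof (cases "\<phi> (fst p) = 0 \<or> \<phi> (snd p) = 0")
    case False
    then have K: "fst p \<in> ?K" "snd p \<in> ?K" using D(4) by auto
    have "1 \<le> (real k)\<^sup>2" using k by simp
    then have "0 \<le> ((real k)\<^sup>2 - 1) * ((?v + ?w) / 2 - \<bar>?C\<bar>)" using SC by (intro mult_nonneg_nonneg) auto
    moreover have "\<bar>?C\<bar> \<le> - ln r + c" unfolding r_def using e K p by (intro c(3))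
    ultimately have "\<beta>\<^sup>2 * (\<bar>?C\<bar> - ((real k)\<^sup>2 - 1) * ((?v + ?w) / 2 - \<bar>?C\<bar>)) \<le> \<beta>\<^sup>2 * (- ln r + c)"
     by (intro mult_left_mono) auto
    then have "exp (\<beta>\<^sup>2 * (\<bar>?C\<bar> - ((real k)\<^sup>2 - 1) * ((?v + ?w) / 2 - \<bar>?C\<bar>))) \<le> exp (\<beta>\<^sup>2 * (- ln r + c))" by simp
    also have "\<dots> = exp (\<beta>\<^sup>2 * c) * r powr - \<beta>\<^sup>2"
     using r by (simp add: powr_def exp_add[symmetric] algebra_simps)
    finally have "norm (\<phi> (fst p)) * norm (\<phi> (snd p)) * exp (\<beta>\<^sup>2 * (\<bar>?C\<bar> - ((real k)\<^sup>2 - 1) * ((?v + ?w) / 2 - \<bar>?C\<bar>)))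
      \<le> norm (\<phi> (fst p)) * norm (\<phi> (snd p)) * (exp (\<beta>\<^sup>2 * c) * r powr - \<beta>\<^sup>2)"
     by (intro mult_left_mono) auto
    then show ?thesis using b unfolding r_def by (simp add: mult_ac)
   qed (use zero in auto)
  next
   assume k: "2 \<le> k"
   show "mode_kernel \<beta> \<eta> e \<phi> k k p \<le> exp (\<beta>\<^sup>2 * (7 * c)) * norm (fst p - snd p) powr - (4 * \<beta>\<^sup>2) * norm (\<phi> (fst p)) * norm (\<phi> (snd p)) * (2 * e) powr (3 * \<beta>\<^sup>2)"
   proof (cases "\<phi> (fst p) = 0 \<or> \<phi> (snd p) = 0")
    case False
    then have K: "fst p \<in> ?K" "snd p \<in> ?K" using D(4) by auto
    have "(2::real)\<^sup>2 \<le> (real k)\<^sup>2" using k by (intro power_mono) auto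
    then have "3 * ((?v + ?w) / 2 - \<bar>?C\<bar>) \<le> ((real k)\<^sup>2 - 1) * ((?v + ?w) / 2 - \<bar>?C\<bar>)"
     using SC by (intro mult_right_mono) auto
    moreover have "\<bar>?C\<bar> \<le> - ln r + c" unfolding r_def using e K p by (intro c(3))
    moreover have "- ln (2 * e) - c \<le> ?v" "- ln (2 * e) - c \<le> ?w"
     using c(4)[OF e e K(1) K(1)] c(4)[OF e e K(2) K(2)] by (simp_all add: var_def)
    ultimately have "\<bar>?C\<bar> - ((real k)\<^sup>2 - 1) * ((?v + ?w) / 2 - \<bar>?C\<bar>) \<le> 7 * c + 4 * - ln r + 3 * ln (2 * e)"
     by (simp add: field_simps)
    then have "\<beta>\<^sup>2 * (\<bar>?C\<bar> - ((real k)\<^sup>2 - 1) * ((?v + ?w) / 2 - \<bar>?C\<bar>)) \<le> \<beta>\<^sup>2 * (7 * c + 4 * - ln r + 3 * ln (2 * e))"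
     by (intro mult_left_mono) auto
    then have "exp (\<beta>\<^sup>2 * (\<bar>?C\<bar> - ((real k)\<^sup>2 - 1) * ((?v + ?w) / 2 - \<bar>?C\<bar>))) \<le> exp (\<beta>\<^sup>2 * (7 * c + 4 * - ln r + 3 * ln (2 * e)))" by simp
    also have "\<dots> = exp (\<beta>\<^sup>2 * (7 * c)) * r powr - (4 * \<beta>\<^sup>2) * (2 * e) powr (3 * \<beta>\<^sup>2)"
     using r e by (simp add: powr_def exp_add[symmetric] algebra_simps)
    finally have "norm (\<phi> (fst p)) * norm (\<phi> (snd p)) * exp (\<beta>\<^sup>2 * (\<bar>?C\<bar> - ((real k)\<^sup>2 - 1) * ((?v + ?w) / 2 - \<bar>?C\<bar>)))
      \<le> norm (\<phi> (fst p)) * norm (\<phi> (snd p)) * (exp (\<beta>\<^sup>2 * (7 * c)) * r powr - (4 * \<beta>\<^sup>2) * (2 * e) powr (3 * \<beta>\<^sup>2))"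
     by (intro mult_left_mono) auto
    then show ?thesis using b unfolding r_def by (simp add: mult_ac)
   qed (use zero in auto)
  }
 qed
qed


lemma pairing_mode_second_moment:
 assumes \<phi>: "test_function U \<phi>" and \<eta>: "mollifier \<eta>" "0 < e" and W: "integrable lborel (weight \<beta> \<eta> e \<phi>)"
 shows "(LINT w|M. (norm (pairing \<beta> \<eta> e \<phi> (mode \<beta> k) w))\<^sup>2) \<le> (LINT p|lborel. mode_kernel \<beta> \<eta> e \<phi> k k p)"
proof -
 have "(\<lambda>(w, x). X w (mol \<eta> e x)) \<in> borel_measurable (M \<Otimes>\<^sub>M borel)"
  by (rule mol_field_measurable[OF \<eta>])
 then have A: "(\<lambda>(w, x). mode \<beta> k (X w (mol \<eta> e x))) \<in> borel_measurable (M \<Otimes>\<^sub>M borel)"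
  by measurable
 show ?thesis
  using second_moment_le[OF prob_space_axioms A mode_bounded W]
  unfolding pairing_def mode_kernel_def .
qed

text \<open>The \<open>L\<^sup>1\<close> norm is bounded by the \<open>L\<^sup>2\<close> norm, for which the
  kernel of a single mode has a majorant.\<close>

lemma mode_uniform_bound:
 fixes \<beta> :: real
 assumes \<beta>: "\<beta>\<^sup>2 < DIM('a)" and \<phi>: "test_function U \<phi>" and \<eta>: "mollifier \<eta>"
 obtains \<rho> B where "0 < \<rho>" "0 \<le> B" "\<And>e k. 0 < e ==> e < \<rho> ==> 1 \<le> k ==>
   (LINT w|M. norm (pairing \<beta> \<eta> e \<phi> (mode \<beta> k) w)) \<le> B"
proof -
 note D = test_function_D[OF \<phi>]
 obtain \<rho>1 c where c: "0 < \<rho>1" "0 \<le> c" "\<And>e k p. 0 < e ==> e < \<rho>1 ==> 1 \<le> k ==> fst p \<noteq> snd p ==>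
   mode_kernel \<beta> \<eta> e \<phi> k k p \<le> exp (\<beta>\<^sup>2 * c) * (norm (fst p - snd p) powr - \<beta>\<^sup>2 * norm (\<phi> (fst p)) * norm (\<phi> (snd p)))"
  by (rule single_mode_kernel[OF \<phi> \<eta>, of \<beta>]) blast
 obtain \<rho>2 where r2: "0 < \<rho>2" "\<And>e. 0 < e ==> e < \<rho>2 ==> integrable lborel (weight \<beta> \<eta> e \<phi>)"
  by (rule weight_integrable[OF \<phi> \<eta>]) blast
 let ?w = "\<lambda>p. exp (\<beta>\<^sup>2 * c) * (norm (fst p - snd p) powr - \<beta>\<^sup>2 * norm (\<phi> (fst p)) * norm (\<phi> (snd p)))"
 have wi: "integrable lborel ?w"
  using powr_pair_integrable[OF D(1), of "\<beta>\<^sup>2"] \<beta> by (intro integrable_mult_right) auto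
 define B where "B = sqrt (LINT p|lborel. ?w p)"
 show ?thesis
 proof (rule that)
  show "0 < min \<rho>1 \<rho>2" using c r2 by simp
  show "0 \<le> B" unfolding B_def by simp
  fix e :: real and k :: nat assume e: "0 < e" "e < min \<rho>1 \<rho>2" and k: "1 \<le> k"
  have W: "integrable lborel (weight \<beta> \<eta> e \<phi>)" using r2 e by simp
  have ae: "AE p in lborel. mode_kernel \<beta> \<eta> e \<phi> k k p \<le> ?w p"
   using AE_lborel_prod_neq by eventually_elim (use c(3)[OF e(1) _ k] e(2) in simp)
  have mi: "integrable lborel (mode_kernel \<beta> \<eta> e \<phi> k k)"
  proof (rule Bochner_Integration.integrable_bound[OF wi])
   show "mode_kernel \<beta> \<eta> e \<phi> k k \<in> borel_measurable lborel"
    using mode_kernel_measurable[OF \<eta> e(1) D(1)] by simp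
   show "AE p in lborel. norm (mode_kernel \<beta> \<eta> e \<phi> k k p) \<le> norm (?w p)"
    using ae by eventually_elim (simp add: mode_kernel_nonneg)
  qed
  have "(LINT w|M. (norm (pairing \<beta> \<eta> e \<phi> (mode \<beta> k) w))\<^sup>2) \<le> (LINT p|lborel. ?w p)"
   by (rule order_trans[OF pairing_mode_second_moment[OF \<phi> \<eta> e(1) W] integral_mono_AE[OF mi wi ae]])
  then show "(LINT w|M. norm (pairing \<beta> \<eta> e \<phi> (mode \<beta> k) w)) \<le> B"
   unfolding B_def
  proof (rule expectation_le_sqrt[rotated 2])
   show "pairing \<beta> \<eta> e \<phi> (mode \<beta> k) \<in> borel_measurable M"
    by (rule pairing_measurable[OF \<eta> e(1) D(1) mode_measurable])
   show "norm (pairing \<beta> \<eta> e \<phi> (mode \<beta> k) w) \<le> 1 * (LINT x|lborel. norm (weight \<beta> \<eta> e \<phi> x))" if "w \<in> space M" for w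
    by (rule pairing_integrand(2)[OF \<eta> e(1) mode_measurable mode_bounded W that])
  qed
 qed
qed

lemma higher_mode_vanishes:
 fixes \<beta> :: real
 assumes \<beta>: "0 < \<beta>" "\<beta>\<^sup>2 < DIM('a)" and \<phi>: "test_function U \<phi>" and \<eta>: "mollifier \<eta>" and k: "2 \<le> k"
  and e: "\<And>n. 0 < e n" "e \<longlonglongrightarrow> 0"
 shows "(\<lambda>n. LINT w|M. norm (pairing \<beta> \<eta> (e n) \<phi> (mode \<beta> k) w)) \<longlonglongrightarrow> 0"
proof -
 note D = test_function_D[OF \<phi>]
 obtain \<rho>1 c where c: "0 < \<rho>1" "0 \<le> c" "\<And>e k p. 0 < e ==> e < \<rho>1 ==> 1 \<le> k ==> fst p \<noteq> snd p ==>
   mode_kernel \<beta> \<eta> e \<phi> k k p \<le> exp (\<beta>\<^sup>2 * c) * (norm (fst p - snd p) powr - \<beta>\<^sup>2 * norm (\<phi> (fst p)) * norm (\<phi> (snd p)))"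
  "\<And>e k p. 0 < e ==> e < \<rho>1 ==> 2 \<le> k ==> fst p \<noteq> snd p ==>
   mode_kernel \<beta> \<eta> e \<phi> k k p \<le> exp (\<beta>\<^sup>2 * (7 * c)) * norm (fst p - snd p) powr - (4 * \<beta>\<^sup>2) * norm (\<phi> (fst p)) * norm (\<phi> (snd p)) * (2 * e) powr (3 * \<beta>\<^sup>2)"
  by (rule single_mode_kernel[OF \<phi> \<eta>, of \<beta>]) blast
 obtain \<rho>2 where r2: "0 < \<rho>2" "\<And>e. 0 < e ==> e < \<rho>2 ==> integrable lborel (weight \<beta> \<eta> e \<phi>)"
  by (rule weight_integrable[OF \<phi> \<eta>]) blast
 let ?w = "\<lambda>p. exp (\<beta>\<^sup>2 * c) * (norm (fst p - snd p) powr - \<beta>\<^sup>2 * norm (\<phi> (fst p)) * norm (\<phi> (snd p)))"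
 have wi: "integrable lborel ?w"
  using powr_pair_integrable[OF D(1), of "\<beta>\<^sup>2"] \<beta> by (intro integrable_mult_right) auto
 have "\<forall>\<^sub>F n in sequentially. e n < min \<rho>1 \<rho>2"
  using order_tendstoD(2)[OF e(2), of "min \<rho>1 \<rho>2"] c(1) r2(1) by simp
 then obtain N where N: "\<And>n. N \<le> n ==> e n < min \<rho>1 \<rho>2" unfolding eventually_sequentially by blast
 let ?m = "\<lambda>n. mode_kernel \<beta> \<eta> (e (n + N)) \<phi> k k"
 have "(\<lambda>n. LINT p|lborel. ?m n p) \<longlonglongrightarrow> (LINT p|(lborel :: ('a \<times> 'a) measure). 0)"
 proof (rule integral_dominated_convergence[OF _ _ wi])
  show "?m n \<in> borel_measurable lborel" for n
   using mode_kernel_measurable[OF \<eta> e(1) D(1)] by simp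
  show "AE p in lborel. norm (?m n p) \<le> ?w p" for n
   using AE_lborel_prod_neq
   by eventually_elim (use c(3)[OF e(1)[of "n + N"]] k N[of "n + N"] in \<open>simp add: mode_kernel_nonneg\<close>)
  show "AE p in lborel. (\<lambda>n. ?m n p) \<longlonglongrightarrow> 0"
   using AE_lborel_prod_neq
  proof eventually_elim
   case (elim p)
   let ?u = "\<lambda>n. exp (\<beta>\<^sup>2 * (7 * c)) * norm (fst p - snd p) powr - (4 * \<beta>\<^sup>2) * norm (\<phi> (fst p)) * norm (\<phi> (snd p)) * (2 * e (n + N)) powr (3 * \<beta>\<^sup>2)"
   have "(\<lambda>n. (2 * e (n + N)) powr (3 * \<beta>\<^sup>2)) \<longlonglongrightarrow> (2 * 0) powr (3 * \<beta>\<^sup>2)"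
    using \<beta>(1) e(1)[THEN less_imp_le]
    by (intro tendsto_powr' tendsto_intros LIMSEQ_ignore_initial_segment e(2)) (auto intro!: always_eventually)
   then have "?u \<longlonglongrightarrow> exp (\<beta>\<^sup>2 * (7 * c)) * norm (fst p - snd p) powr - (4 * \<beta>\<^sup>2) * norm (\<phi> (fst p)) * norm (\<phi> (snd p)) * 0"
    by (intro tendsto_mult_left) simp
   then have "?u \<longlonglongrightarrow> 0" by simp
   moreover have "?m n p \<le> ?u n" for n
    using N[of "n + N"] by (intro c(4) e k elim) simp
   ultimately show ?case
    by (intro tendsto_sandwich[OF _ _ tendsto_const \<open>?u \<longlonglongrightarrow> 0\<close>]) (auto simp: mode_kernel_nonneg)
  qed
 qed auto
 then have s0: "(\<lambda>n. sqrt (LINT p|lborel. ?m n p)) \<longlonglongrightarrow> 0"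
  using tendsto_real_sqrt by fastforce
 have "(LINT w|M. norm (pairing \<beta> \<eta> (e (n + N)) \<phi> (mode \<beta> k) w)) \<le> sqrt (LINT p|lborel. ?m n p)" for n
 proof (rule expectation_le_sqrt)
  have W: "integrable lborel (weight \<beta> \<eta> (e (n + N)) \<phi>)" using r2 e N[of "n + N"] by simp
  show "pairing \<beta> \<eta> (e (n + N)) \<phi> (mode \<beta> k) \<in> borel_measurable M"
   by (rule pairing_measurable[OF \<eta> e(1) D(1) mode_measurable])
  show "norm (pairing \<beta> \<eta> (e (n + N)) \<phi> (mode \<beta> k) w) \<le> 1 * (LINT x|lborel. norm (weight \<beta> \<eta> (e (n + N)) \<phi> x))" if "w \<in> space M" for w
   by (rule pairing_integrand(2)[OF \<eta> e(1) mode_measurable mode_bounded W that])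
  show "(LINT w|M. (norm (pairing \<beta> \<eta> (e (n + N)) \<phi> (mode \<beta> k) w))\<^sup>2) \<le> (LINT p|lborel. ?m n p)"
   by (rule pairing_mode_second_moment[OF \<phi> \<eta> e(1) W])
 qed
 then have "(\<lambda>n. LINT w|M. norm (pairing \<beta> \<eta> (e (n + N)) \<phi> (mode \<beta> k) w)) \<longlonglongrightarrow> 0"
  by (intro tendsto_sandwich[OF _ _ tendsto_const s0]) auto
 then show ?thesis by (rule LIMSEQ_offset)
qed

text \<open>Different modes are almost orthogonal: by the variance oscillation bound their correlation decays
  exponentially in the difference of their orders, and by the nondegeneracy of the increments only
  points within a fraction of the scale that shrinks with the orders contribute.\<close>

lemma mode_kernel_integral:
 fixes \<beta> :: real
 assumes dim: "2 \<le> DIM('a)" and \<beta>: "0 < \<beta>" "\<beta>\<^sup>2 < DIM('a)" and \<phi>: "test_function U \<phi>" and \<eta>: "mollifier \<eta>"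
 obtains \<rho> B where "0 < \<rho>" "0 \<le> B" "\<And>e k l. 0 < e ==> e < \<rho> ==> 1 \<le> k ==> 1 \<le> l ==>
   integrable lborel (mode_kernel \<beta> \<eta> e \<phi> k l)"
  "\<And>e k l. 0 < e ==> e < \<rho> ==> 1 \<le> k ==> 1 \<le> l ==>
   (LINT p|lborel. mode_kernel \<beta> \<eta> e \<phi> k l p) \<le> B * (exp (- \<bar>real k - real l\<bar>) / (real k * real l))"
proof -
 note D = test_function_D[OF \<phi>]
 let ?K = "fun_support \<phi>"
 obtain \<rho>1 c1 where c1: "0 < \<rho>1" "0 \<le> c1"
  "\<And>e \<delta> x y. 0 < e ==> e < \<rho>1 ==> 0 < \<delta> ==> \<delta> < \<rho>1 ==> x \<in> ?K ==> y \<in> ?K ==>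
   cov (mol \<eta> e x) (mol \<eta> \<delta> y) \<le> - ln e + c1"
  "\<And>e \<delta> x y. 0 < e ==> e < \<rho>1 ==> 0 < \<delta> ==> \<delta> < \<rho>1 ==> x \<in> ?K ==> y \<in> ?K ==> x \<noteq> y ==>
   \<bar>cov (mol \<eta> e x) (mol \<eta> \<delta> y)\<bar> \<le> - ln (norm (x - y)) + c1"
  "\<And>e \<delta> x y. 0 < e ==> e < \<rho>1 ==> 0 < \<delta> ==> \<delta> < \<rho>1 ==> x \<in> ?K ==> y \<in> ?K ==>
   - ln (norm (x - y) + e + \<delta>) - c1 \<le> cov (mol \<eta> e x) (mol \<eta> \<delta> y)"
  by (rule cov_log_bounds[OF D(2,3) \<eta> \<eta>]) blast
 obtain \<rho>2 L where L: "0 < \<rho>2" "0 < L" "\<And>e x y. 0 < e ==> e < \<rho>2 ==> x \<in> ?K ==> y \<in> ?K ==>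
   \<bar>cov (mol \<eta> e x) (mol \<eta> e x) - cov (mol \<eta> e y) (mol \<eta> e y)\<bar> \<le> L * min 1 (norm (x - y) / e)"
  by (rule variance_oscillation[OF D(2,3) \<eta>]) blast
 obtain \<rho>3 c where c: "0 < \<rho>3" "0 < c" "\<And>e x y. 0 < e ==> e < \<rho>3 ==> x \<in> ?K ==> y \<in> ?K ==>
  c * (min 1 (norm (x - y) / e))\<^sup>2 \<le> cov (mol \<eta> e x) (mol \<eta> e x) + cov (mol \<eta> e y) (mol \<eta> e y)
   - 2 * \<bar>cov (mol \<eta> e x) (mol \<eta> e y)\<bar>"
  by (rule increment_lower[OF D(2,3) \<eta>]) blast
 obtain Bp Rp where bp: "0 < Bp" "0 < Rp" "\<And>x. norm (\<phi> x) \<le> Bp" "\<And>x. Rp < norm x ==> \<phi> x = 0"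
  by (rule test_function_bounds[OF D(1)]) blast
 \<comment> \<open>\<open>\<Lambda>\<close> is a level that all variances exceed at small scales; it has to absorb the oscillation of the
  variance and to make the damping in the difference of the orders at least \<open>exp (- (k - l)\<^sup>2)\<close>.\<close>
 define \<Lambda> where "\<Lambda> = 2 * L\<^sup>2 / c + 4 / \<beta>\<^sup>2"
 have \<Lambda>: "0 < \<Lambda>" "2 * L\<^sup>2 \<le> c * \<Lambda>" "4 \<le> \<beta>\<^sup>2 * \<Lambda>"
  using c(2) \<beta>(1) L(2) by (simp_all add: \<Lambda>_def add_pos_pos distrib_left)
 define \<gamma> where "\<gamma> = \<beta>\<^sup>2 * c / 8"
 have \<gamma>: "0 < \<gamma>" using c(2) \<beta>(1) by (simp add: \<gamma>_def)
 define \<rho> where "\<rho> = Min {\<rho>1, \<rho>2, \<rho>3, 1, exp (- (\<Lambda> + c1)) / 2}"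
 have \<rho>: "0 < \<rho>" using c1(1) L(1) c(1) by (simp add: \<rho>_def)
 have \<rho>le: "\<rho> \<le> \<rho>1" "\<rho> \<le> \<rho>2" "\<rho> \<le> \<rho>3" "\<rho> \<le> 1" "\<rho> \<le> exp (- (\<Lambda> + c1)) / 2"
  unfolding \<rho>_def by (rule Min_le; simp)+
 let ?pw = "\<lambda>p. norm (fst p - snd p) powr - \<beta>\<^sup>2 * norm (\<phi> (fst p)) * norm (\<phi> (snd p))"
 have pwi: "integrable lborel ?pw"
  using powr_pair_integrable[OF D(1), of "\<beta>\<^sup>2"] \<beta> by auto
 define P where "P = (LINT p|lborel. ?pw p)"
 have P: "0 \<le> P" unfolding P_def by simp
 define J where "J = (LINT w|lborel. exp (- (norm (w::'a))\<^sup>2))"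
 have J: "0 \<le> J" unfolding J_def by simp
 define F where "F = (LINT x|lborel. norm (\<phi> x))"
 have F: "0 \<le> F" unfolding F_def by simp
 define E where "E = exp (\<gamma> + \<beta>\<^sup>2 * c1)"
 have E: "0 < E" by (simp add: E_def)
 define B where "B = E * (Bp * F * J / sqrt \<gamma> ^ DIM('a) + P / \<gamma>)"
 have main: "integrable lborel (mode_kernel \<beta> \<eta> e \<phi> k l) \<and>
   (LINT p|lborel. mode_kernel \<beta> \<eta> e \<phi> k l p) \<le> B * (exp (- \<bar>real k - real l\<bar>) / (real k * real l))"
  if e: "0 < e" "e < \<rho>" and k: "1 \<le> k" and l: "1 \<le> l" for e k l
 proof -
  define m where "m = real k * real l"
  have m: "1 \<le> m" unfolding m_def using k l mult_mono[of 1 "real k" 1 "real l"] by simp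
  define s where "s = \<gamma> * m / e\<^sup>2"
  have s: "0 < s" using \<gamma> m e by (simp add: s_def)
  let ?G = "\<lambda>w::'a. exp (- s * (norm w)\<^sup>2)"
  let ?g = "\<lambda>p. ?G (fst p - snd p) * norm (\<phi> (fst p)) * norm (\<phi> (snd p))"
  define q where "q = exp (- \<bar>real k - real l\<bar>)"
  have q: "0 < q" by (simp add: q_def)
  let ?U = "\<lambda>p. E * q * (e powr - \<beta>\<^sup>2 * ?g p + ?pw p / (\<gamma> * m))"
  have meas\<phi>: "(\<lambda>x. norm (\<phi> x)) \<in> borel_measurable borel"
   using test_function_measurable[OF D(1)] by measurable
  note cv = convolution_pair_le[OF meas\<phi> meas\<phi> integrable_gaussian[OF s] _ _ norm_ge_zero bp(3) _ norm_ge_zero bp(3), of Rp]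
  have gi: "integrable lborel ?g" by (rule cv(1)) (use bp(4) in auto)
  have gJ: "(LINT p|lborel. ?g p) \<le> Bp * F * (LINT w|lborel. ?G w)"
   unfolding F_def by (rule cv(2)) (use bp(4) in auto)
  have Ui: "integrable lborel ?U" using gi pwi by simp
  have ae: "AE p in lborel. mode_kernel \<beta> \<eta> e \<phi> k l p \<le> ?U p"
   using AE_lborel_prod_neq
  proof eventually_elim
   case (elim p)
   define r where "r = norm (fst p - snd p)"
   have r: "0 < r" using elim by (simp add: r_def)
   define n where "n = norm (\<phi> (fst p)) * norm (\<phi> (snd p))"
   have n: "0 \<le> n" by (simp add: n_def)
   have U: "?U p = n * (E * q * (e powr - \<beta>\<^sup>2 * exp (- s * r\<^sup>2) + r powr - \<beta>\<^sup>2 / (\<gamma> * m)))"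
    by (simp add: n_def r_def algebra_simps)
   show ?case
   proof (cases "\<phi> (fst p) = 0 \<or> \<phi> (snd p) = 0")
    case True
    then show ?thesis unfolding U by (auto simp: mode_kernel_def weight_def n_def)
   next
    case False
    then have K: "fst p \<in> ?K" "snd p \<in> ?K" using D(4) by auto
    let ?C = "cov (mol \<eta> e (fst p)) (mol \<eta> e (snd p))" and ?v = "var \<eta> e (fst p)" and ?w = "var \<eta> e (snd p)"
    define \<tau> where "\<tau> = min 1 (r / e)"
    have \<tau>: "0 \<le> \<tau>" "\<tau> \<le> 1" using r e by (auto simp: \<tau>_def)
    have e1: "e < \<rho>1" "e < \<rho>2" "e < \<rho>3" "e < 1" "e < exp (- (\<Lambda> + c1)) / 2" using e \<rho>le by linarith+
    have "ln (2 * e) \<le> ln (exp (- (\<Lambda> + c1)))" using e1(5) e(1) by (intro ln_mono) auto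
    then have vL: "\<Lambda> \<le> ?v" "\<Lambda> \<le> ?w"
     using c1(5)[OF e(1) e1(1) e(1) e1(1) K(1) K(1)] c1(5)[OF e(1) e1(1) e(1) e1(1) K(2) K(2)] by (simp_all add: var_def)
    have vU: "?v \<le> - ln e + c1" "?w \<le> - ln e + c1"
     unfolding var_def using c1(3)[OF e(1) e1(1) e(1) e1(1)] K by auto
    have osc: "\<bar>?v - ?w\<bar> \<le> L * \<tau>"
     unfolding var_def \<tau>_def r_def by (rule L(3)[OF e(1) e1(2) K])
    have inc: "c * \<tau>\<^sup>2 \<le> ?v + ?w - 2 * \<bar>?C\<bar>"
     unfolding var_def \<tau>_def r_def by (rule c(3)[OF e(1) e1(3) K])
    have Ce: "\<bar>?C\<bar> \<le> - ln e + c1" using inc vU c(2) zero_le_power2[of \<tau>] mult_nonneg_nonneg[of c "\<tau>\<^sup>2"] by linarith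
    have Cr: "\<bar>?C\<bar> \<le> - ln r + c1"
     unfolding r_def by (rule c1(4)[OF e(1) e1(1) e(1) e1(1) K elim])
    let ?X = "(?v + ?w) / 2 - ((real k)\<^sup>2 * ?v + (real l)\<^sup>2 * ?w - 2 * real k * real l * \<bar>?C\<bar>) / 2"
    have X1: "?X \<le> \<bar>?C\<bar> - \<Lambda> * (real k - real l)\<^sup>2 / 4 - c / 8 * m * \<tau>\<^sup>2 + c / 8"
     unfolding m_def by (rule mode_exponent[OF k l osc \<tau> inc vL \<Lambda>(1,2) c(2)])
    have kl: "\<bar>real k - real l\<bar> \<le> \<beta>\<^sup>2 * (\<Lambda> * (real k - real l)\<^sup>2 / 4)"
    proof -
     have "\<bar>real k - real l\<bar> \<le> (real k - real l)\<^sup>2"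
     proof (cases "k = l")
      case False
      then have "1 \<le> \<bar>real k - real l\<bar>" by (cases "k < l") auto
      then have "\<bar>real k - real l\<bar> * 1 \<le> \<bar>real k - real l\<bar> * \<bar>real k - real l\<bar>" by (intro mult_left_mono) auto
      then show ?thesis by (simp add: power2_eq_square)
     qed simp
     also have "\<dots> = 4 * (real k - real l)\<^sup>2 / 4" by simp
     also have "\<dots> \<le> (\<beta>\<^sup>2 * \<Lambda>) * (real k - real l)\<^sup>2 / 4"
      using \<Lambda>(3) by (intro divide_right_mono mult_right_mono) auto
     finally show ?thesis by (simp add: mult_ac)
    qed
    have X2: "\<beta>\<^sup>2 * ?X \<le> \<beta>\<^sup>2 * \<bar>?C\<bar> - \<bar>real k - real l\<bar> - \<gamma> * m * \<tau>\<^sup>2 + \<gamma>"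
    proof -
     have "\<beta>\<^sup>2 * ?X \<le> \<beta>\<^sup>2 * (\<bar>?C\<bar> - \<Lambda> * (real k - real l)\<^sup>2 / 4 - c / 8 * m * \<tau>\<^sup>2 + c / 8)"
      by (rule mult_left_mono[OF X1]) simp
     also have "\<dots> = \<beta>\<^sup>2 * \<bar>?C\<bar> - \<beta>\<^sup>2 * (\<Lambda> * (real k - real l)\<^sup>2 / 4) - \<gamma> * m * \<tau>\<^sup>2 + \<gamma>"
      by (simp add: \<gamma>_def algebra_simps)
     finally show ?thesis using kl by linarith
    qed
    have split: "exp (\<beta>\<^sup>2 * ?X) \<le> E * q * (exp (\<beta>\<^sup>2 * y) * exp (- (\<gamma> * m * \<tau>\<^sup>2)))" if "\<bar>?C\<bar> \<le> y + c1" for y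
    proof -
     have "\<beta>\<^sup>2 * \<bar>?C\<bar> \<le> \<beta>\<^sup>2 * (y + c1)" using that by (intro mult_left_mono) auto
     then have "exp (\<beta>\<^sup>2 * ?X) \<le> exp ((\<gamma> + \<beta>\<^sup>2 * c1) + - \<bar>real k - real l\<bar> + (\<beta>\<^sup>2 * y + - (\<gamma> * m * \<tau>\<^sup>2)))"
      using X2 by (simp add: distrib_left)
     then show ?thesis unfolding E_def q_def exp_add by simp
    qed
    have "exp (\<beta>\<^sup>2 * ?X) \<le> E * q * (e powr - \<beta>\<^sup>2 * exp (- s * r\<^sup>2) + r powr - \<beta>\<^sup>2 / (\<gamma> * m))"
    proof (cases "r \<le> e")
     case True
     then have "\<tau> = r / e" using e(1) by (simp add: \<tau>_def min_def)
     then have "\<gamma> * m * \<tau>\<^sup>2 = s * r\<^sup>2" by (simp add: s_def power_divide)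
     moreover have "exp (\<beta>\<^sup>2 * - ln e) = e powr - \<beta>\<^sup>2" using e(1) by (simp add: powr_def)
     ultimately have "exp (\<beta>\<^sup>2 * ?X) \<le> E * q * (e powr - \<beta>\<^sup>2 * exp (- s * r\<^sup>2))" using split[OF Ce] by simp
     also have "\<dots> \<le> E * q * (e powr - \<beta>\<^sup>2 * exp (- s * r\<^sup>2) + r powr - \<beta>\<^sup>2 / (\<gamma> * m))"
      using E q \<gamma> m by (intro mult_left_mono) auto
     finally show ?thesis .
    next
     case False
     then have "\<tau> = 1" using e(1) by (simp add: \<tau>_def min_def)
     moreover have "exp (- (\<gamma> * m)) \<le> 1 / (\<gamma> * m)" using \<gamma> m by (intro exp_neg_le_inverse) simp
     moreover have "exp (\<beta>\<^sup>2 * - ln r) = r powr - \<beta>\<^sup>2" using r by (simp add: powr_def)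
     ultimately have "exp (\<beta>\<^sup>2 * ?X) \<le> E * q * (r powr - \<beta>\<^sup>2 * exp (- (\<gamma> * m)))" using split[OF Cr] by simp
     also have "\<dots> \<le> E * q * (r powr - \<beta>\<^sup>2 * (1 / (\<gamma> * m)))"
      using E q \<open>exp (- (\<gamma> * m)) \<le> 1 / (\<gamma> * m)\<close> by (intro mult_left_mono) auto
     also have "\<dots> \<le> E * q * (e powr - \<beta>\<^sup>2 * exp (- s * r\<^sup>2) + r powr - \<beta>\<^sup>2 / (\<gamma> * m))"
      using E q by (intro mult_left_mono) auto
     finally show ?thesis .
    qed
    then have "n * exp (\<beta>\<^sup>2 * ?X) \<le> ?U p" unfolding U using n by (rule mult_left_mono)
    then show ?thesis
     using mode_kernel_bound[OF \<eta> e(1), of \<beta> \<phi> k l p] unfolding n_def by (rule order_trans[rotated])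
   qed
  qed
  have mi: "integrable lborel (mode_kernel \<beta> \<eta> e \<phi> k l)"
  proof (rule Bochner_Integration.integrable_bound[OF Ui])
   show "mode_kernel \<beta> \<eta> e \<phi> k l \<in> borel_measurable lborel"
    using mode_kernel_measurable[OF \<eta> e(1) D(1)] by simp
   show "AE p in lborel. norm (mode_kernel \<beta> \<eta> e \<phi> k l p) \<le> norm (?U p)"
    using ae
   proof eventually_elim
    case (elim p)
    show ?case
     unfolding real_norm_def abs_of_nonneg[OF mode_kernel_nonneg] by (rule order_trans[OF elim abs_ge_self])
   qed
  qed
  have "(LINT p|lborel. mode_kernel \<beta> \<eta> e \<phi> k l p) \<le> (LINT p|lborel. ?U p)"
   by (rule integral_mono_AE[OF mi Ui ae])
  also have "\<dots> = E * q * (e powr - \<beta>\<^sup>2 * (LINT p|lborel. ?g p) + P / (\<gamma> * m))"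
   using gi pwi by (simp add: P_def)
  also have "\<dots> \<le> E * q * (Bp * F * J / sqrt \<gamma> ^ DIM('a) / m + P / \<gamma> / m)"
  proof (intro mult_left_mono add_mono)
   have "(LINT p|lborel. ?g p) \<le> Bp * F * (J / sqrt s ^ DIM('a))"
    using gJ unfolding gaussian_scaled_integral[OF s] J_def .
   also have "sqrt s = sqrt \<gamma> * sqrt m / e"
    using e(1) by (simp add: s_def real_sqrt_mult real_sqrt_divide)
   finally have g1: "(LINT p|lborel. ?g p) \<le> Bp * F * J / sqrt \<gamma> ^ DIM('a) * (e ^ DIM('a) / sqrt m ^ DIM('a))"
    by (simp add: power_mult_distrib power_divide)
   have "m \<le> sqrt m ^ DIM('a)"
   proof -
    have "m = sqrt m ^ 2" using m by simp
    also have "\<dots> \<le> sqrt m ^ DIM('a)" using m dim by (intro power_increasing) auto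
    finally show ?thesis .
   qed
   then have g2: "e ^ DIM('a) / sqrt m ^ DIM('a) \<le> e ^ DIM('a) / m"
    using m e(1) by (intro divide_left_mono) auto
   have g3: "e powr - \<beta>\<^sup>2 * e ^ DIM('a) \<le> 1"
   proof -
    have "e powr - \<beta>\<^sup>2 * e ^ DIM('a) = e powr (DIM('a) - \<beta>\<^sup>2)"
     using e(1) by (simp add: powr_realpow[symmetric] powr_add[symmetric])
    also have "\<dots> \<le> 1" using e \<rho>le(4) \<beta>(2) by (intro powr_le1) auto
    finally show ?thesis .
   qed
   let ?H = "Bp * F * J / sqrt \<gamma> ^ DIM('a)"
   have H: "0 \<le> ?H" using bp(1) F J \<gamma> by (intro divide_nonneg_nonneg mult_nonneg_nonneg) auto
   have "e powr - \<beta>\<^sup>2 * (LINT p|lborel. ?g p) \<le> e powr - \<beta>\<^sup>2 * (?H * (e ^ DIM('a) / m))"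
    using g1 mult_left_mono[OF g2 H] by (intro mult_left_mono) auto
   also have "\<dots> = (e powr - \<beta>\<^sup>2 * e ^ DIM('a)) * (?H / m)" by simp
   also have "\<dots> \<le> 1 * (?H / m)"
   proof (rule mult_right_mono[OF g3])
    show "0 \<le> ?H / m" by (rule divide_nonneg_nonneg[OF H]) (use m in linarith)
   qed
   finally show "e powr - \<beta>\<^sup>2 * (LINT p|lborel. ?g p) \<le> ?H / m" by simp
  qed (use E q in auto)
  also have "\<dots> = B * (q / m)"
   unfolding B_def add_divide_distrib[symmetric] by (simp only: times_divide_eq_right times_divide_eq_left mult.assoc mult.commute[of q])
  finally show ?thesis using mi unfolding q_def m_def by simp
 qed
 show ?thesis
 proof (rule that[OF \<rho>])
  show "0 \<le> B" unfolding B_def using E bp(1) F J \<gamma> P by (intro mult_nonneg_nonneg add_nonneg_nonneg divide_nonneg_nonneg) auto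
 qed (use main in auto)
qed

end

section \<open>The cosine of the field\<close>

text \<open>Convergence to \<open>0\<close> in mean, expressed by a nonnegative integral so that no integrability has to be
  carried along.\<close>

definition L1_null :: "'w measure => (nat => 'w => complex) => bool" where
 "L1_null M Y \<longleftrightarrow> (\<lambda>n. \<integral>\<^sup>+w. ennreal (norm (Y n w)) \<partial>M) \<longlonglongrightarrow> 0"

lemma L1_null_bound:
 assumes le: "\<And>e. 0 < e ==> \<forall>\<^sub>F n in sequentially. (\<integral>\<^sup>+w. ennreal (norm (Y n w)) \<partial>M) \<le> ennreal e"
 shows "L1_null M Y"
 unfolding L1_null_def
proof (rule order_tendstoI)
 fix a :: ennreal assume "a < 0" then show "\<forall>\<^sub>F n in sequentially. a < (\<integral>\<^sup>+w. ennreal (norm (Y n w)) \<partial>M)" by simp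
next
 fix a :: ennreal assume a: "0 < a"
 obtain e :: real where e: "0 < e" "ennreal e < a"
 proof (cases a)
  case (real r)
  then show ?thesis using a that[of "r / 2"] by (auto simp: ennreal_lessI)
 qed (use that[of 1] in auto)
 show "\<forall>\<^sub>F n in sequentially. (\<integral>\<^sup>+w. ennreal (norm (Y n w)) \<partial>M) < a"
  using le[OF e(1)] by eventually_elim (rule le_less_trans[OF _ e(2)])
qed

lemma L1_nullD:
 assumes "L1_null M Y" "0 < e"
 shows "\<forall>\<^sub>F n in sequentially. (\<integral>\<^sup>+w. ennreal (norm (Y n w)) \<partial>M) \<le> ennreal e"
 using order_tendstoD(2)[OF assms(1)[unfolded L1_null_def], of "ennreal e"] assms(2)
 by (auto elim: eventually_mono)

lemma L1_null_add:
 assumes [measurable]: "\<And>n. Y n \<in> borel_measurable M" "\<And>n. Z n \<in> borel_measurable M"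
  and "L1_null M Y" "L1_null M Z" and le: "\<And>n w. w \<in> space M ==> norm (W n w) \<le> norm (Y n w) + norm (Z n w)"
 shows "L1_null M W"
proof (rule L1_null_bound)
 fix e :: real assume e: "0 < e"
 have e2: "0 < e / 2" using e by simp
 show "\<forall>\<^sub>F n in sequentially. (\<integral>\<^sup>+w. ennreal (norm (W n w)) \<partial>M) \<le> ennreal e"
  using L1_nullD[OF assms(3) e2] L1_nullD[OF assms(4) e2]
 proof eventually_elim
  case (elim n)
  have "(\<integral>\<^sup>+w. ennreal (norm (W n w)) \<partial>M) \<le> (\<integral>\<^sup>+w. ennreal (norm (Y n w)) + ennreal (norm (Z n w)) \<partial>M)"
   by (intro nn_integral_mono) (use le in \<open>simp flip: ennreal_plus\<close>)
  also have "\<dots> = (\<integral>\<^sup>+w. ennreal (norm (Y n w)) \<partial>M) + (\<integral>\<^sup>+w. ennreal (norm (Z n w)) \<partial>M)"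
   by (rule nn_integral_add) measurable
  also have "\<dots> \<le> ennreal (e / 2) + ennreal (e / 2)" using elim by (rule add_mono)
  also have "\<dots> = ennreal e" using e by (simp flip: ennreal_plus)
  finally show ?case .
 qed
qed

text \<open>Markov's inequality.\<close>

lemma L1_null_in_probability:
 fixes Y :: "nat => 'w => complex"
 assumes M: "finite_measure M" and [measurable]: "\<And>n. Y n \<in> borel_measurable M" "Z \<in> borel_measurable M"
  and null: "L1_null M (\<lambda>n w. Y n w - Z w)"
 shows "tendsto_in_probability M Y Z"
 unfolding tendsto_in_probability_def
proof (intro conjI allI impI)
 interpret finite_measure M by fact
 fix e :: real assume e: "0 < e"
 let ?I = "\<lambda>n. \<integral>\<^sup>+w. ennreal (norm (Y n w - Z w)) \<partial>M"
 have mk: "emeasure M {w \<in> space M. e < dist (Y n w) (Z w)} \<le> ennreal (1 / e) * ?I n" for n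
 proof -
  have "emeasure M {w \<in> space M. e < dist (Y n w) (Z w)}
    \<le> emeasure M {w \<in> space M. 1 \<le> ennreal (1 / e) * ennreal (norm (Y n w - Z w))}"
  proof (intro emeasure_mono subsetI)
   fix w assume "w \<in> {w \<in> space M. e < dist (Y n w) (Z w)}"
   then have "1 \<le> 1 / e * norm (Y n w - Z w)" "w \<in> space M" using e by (simp_all add: dist_norm)
   then show "w \<in> {w \<in> space M. 1 \<le> ennreal (1 / e) * ennreal (norm (Y n w - Z w))}"
    using e ennreal_leI[of 1 "1 / e * norm (Y n w - Z w)"] by (simp add: ennreal_mult[symmetric])
  qed measurable
  also have "\<dots> \<le> ennreal (1 / e) * (\<integral>\<^sup>+w. ennreal (norm (Y n w - Z w)) * indicator (space M) w \<partial>M)"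
   by (rule nn_integral_Markov_inequality) measurable
  also have "(\<integral>\<^sup>+w. ennreal (norm (Y n w - Z w)) * indicator (space M) w \<partial>M) = ?I n"
   by (intro nn_integral_cong) simp
  finally show ?thesis .
 qed
 show "(\<lambda>n. measure M {w \<in> space M. e < dist (Y n w) (Z w)}) \<longlonglongrightarrow> 0"
 proof (rule order_tendstoI)
  fix a :: real assume "a < 0"
  then show "\<forall>\<^sub>F n in sequentially. a < measure M {w \<in> space M. e < dist (Y n w) (Z w)}"
   by (auto intro!: always_eventually less_le_trans[OF _ measure_nonneg])
 next
  fix a :: real assume a: "0 < a"
  have "0 < e * (a / 2)" using a e by simp
  from L1_nullD[OF null this]
  show "\<forall>\<^sub>F n in sequentially. measure M {w \<in> space M. e < dist (Y n w) (Z w)} < a"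
  proof eventually_elim
   case (elim n)
   have "emeasure M {w \<in> space M. e < dist (Y n w) (Z w)} \<le> ennreal (1 / e) * ennreal (e * (a / 2))"
    using mk elim by (meson mult_left_mono order_trans zero_le)
   also have "\<dots> = ennreal (a / 2)" using e a by (simp flip: ennreal_mult)
   finally have "measure M {w \<in> space M. e < dist (Y n w) (Z w)} \<le> a / 2"
    using a by (simp add: emeasure_eq_measure)
   then show ?case using a by simp
  qed
 qed
qed measurable

text \<open>The error is split in halves; the factor \<open>norm a + 1\<close> avoids a division by \<open>0\<close>.\<close>

lemma tendsto_in_probability_multiple:
 fixes A T :: "nat => 'w => complex" and a :: complex
 assumes M: "finite_measure M" and [measurable]: "\<And>n. A n \<in> borel_measurable M"
  and null: "L1_null M (\<lambda>n w. A n w - a * T n w)" and T: "tendsto_in_probability M T Z"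
 shows "tendsto_in_probability M A (\<lambda>w. a * Z w)"
 unfolding tendsto_in_probability_def
proof (intro conjI allI impI)
 interpret finite_measure M by fact
 have [measurable]: "T n \<in> borel_measurable M" "Z \<in> borel_measurable M" for n
  using T by (auto simp: tendsto_in_probability_def)
 show "A n \<in> borel_measurable M" "(\<lambda>w. a * Z w) \<in> borel_measurable M" for n by measurable
 fix e :: real assume e: "0 < e"
 let ?A = "\<lambda>n. {w \<in> space M. e / 2 < dist (A n w - a * T n w) 0}"
 let ?T = "\<lambda>n. {w \<in> space M. e / (2 * (norm a + 1)) < dist (T n w) (Z w)}"
 let ?E = "\<lambda>n. {w \<in> space M. e < dist (A n w) (a * Z w)}"
 have p: "0 < e / 2" "0 < e / (2 * (norm a + 1))" using e by (simp_all add: add_nonneg_pos)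
 have "tendsto_in_probability M (\<lambda>n w. A n w - a * T n w) (\<lambda>_. 0)"
  using null by (intro L1_null_in_probability[OF M]) simp_all
 then have lA: "(\<lambda>n. measure M (?A n)) \<longlonglongrightarrow> 0" using p(1) unfolding tendsto_in_probability_def by blast
 have lT: "(\<lambda>n. measure M (?T n)) \<longlonglongrightarrow> 0" using p(2) T unfolding tendsto_in_probability_def by blast
 have sub: "?E n \<subseteq> ?A n \<union> ?T n" for n
 proof (rule subsetI, rule ccontr)
  fix w assume w: "w \<in> ?E n" "w \<notin> ?A n \<union> ?T n"
  then have 1: "norm (A n w - a * T n w) \<le> e / 2" "norm (T n w - Z w) \<le> e / (2 * (norm a + 1))"
   by (auto simp: dist_norm)
  have "norm a * norm (T n w - Z w) \<le> (norm a + 1) * (e / (2 * (norm a + 1)))"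
   using 1(2) e by (intro mult_mono) auto
  also have "\<dots> = e / 2" by (simp add: field_simps add_nonneg_eq_0_iff)
  finally have 2: "norm (a * T n w - a * Z w) \<le> e / 2" by (simp add: norm_mult flip: right_diff_distrib)
  have "norm (A n w - a * Z w) \<le> norm (A n w - a * T n w) + norm (a * T n w - a * Z w)"
   using norm_triangle_ineq[of "A n w - a * T n w" "a * T n w - a * Z w"] by simp
  then show False using w(1) 1(1) 2 by (simp add: dist_norm)
 qed
 have le: "measure M (?E n) \<le> measure M (?A n) + measure M (?T n)" for n
  by (rule order_trans[OF finite_measure_mono[OF sub] measure_Un_le]) measurable
 have l0: "(\<lambda>n. measure M (?A n) + measure M (?T n)) \<longlonglongrightarrow> 0"
  using tendsto_add[OF lA lT] unfolding add_0 .
 show "(\<lambda>n. measure M (?E n)) \<longlonglongrightarrow> 0"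
 proof (rule Lim_null_comparison[OF always_eventually l0], intro allI)
  show "norm (measure M (?E n)) \<le> measure M (?A n) + measure M (?T n)" for n
   unfolding real_norm_def abs_of_nonneg[OF measure_nonneg] by (rule le)
 qed
qed

context log_field
begin

lemma pairing_integrable:
 assumes \<phi>: "test_function UNIV \<phi>" and \<eta>: "mollifier \<eta>" "0 < e" and W: "integrable lborel (weight \<beta> \<eta> e \<phi>)"
  and H: "H \<in> borel_measurable borel" "\<And>t. \<bar>H t\<bar> \<le> b"
 shows "integrable M (pairing \<beta> \<eta> e \<phi> H)"
proof (rule integrable_const_bound)
 show "pairing \<beta> \<eta> e \<phi> H \<in> borel_measurable M" by (rule pairing_measurable[OF \<eta> \<phi> H(1)])
 show "AE w in M. norm (pairing \<beta> \<eta> e \<phi> H w) \<le> b * (LINT x|lborel. norm (weight \<beta> \<eta> e \<phi> x))"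
  by (intro AE_I2 pairing_integrand(2)[OF \<eta> H W])
qed

lemma cos_bounded_measurable:
 "(\<lambda>t::real. cos (\<beta> * t)) \<in> borel_measurable borel" "\<And>t. \<bar>cos (\<beta> * t)\<bar> \<le> 1"
 by (auto intro!: borel_measurable_continuous_onI continuous_intros)

lemma pairing_difference_null:
 fixes \<beta> :: real
 assumes \<beta>: "\<beta>\<^sup>2 < DIM('a)" and \<phi>: "test_function U \<phi>" and \<eta>: "mollifier \<eta>" and \<eta>': "mollifier \<eta>'"
  and e: "\<And>n. 0 < e n" "e \<longlonglongrightarrow> 0" and d: "\<And>n. 0 < \<delta> n" "\<delta> \<longlonglongrightarrow> 0"
 shows "L1_null M (\<lambda>n w. pairing \<beta> \<eta> (e n) \<phi> (\<lambda>t. cos (\<beta> * t)) w - pairing \<beta> \<eta>' (\<delta> n) \<phi> (\<lambda>t. cos (\<beta> * t)) w)"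
proof (rule L1_null_bound)
 fix r :: real assume r: "0 < r"
 note D = test_function_D[OF \<phi>]
 obtain \<rho>2 where r2: "0 < \<rho>2" "\<And>e. 0 < e ==> e < \<rho>2 ==> integrable lborel (weight \<beta> \<eta> e \<phi>)"
  by (rule weight_integrable[OF \<phi> \<eta>]) blast
 obtain \<rho>3 where r3: "0 < \<rho>3" "\<And>e. 0 < e ==> e < \<rho>3 ==> integrable lborel (weight \<beta> \<eta>' e \<phi>)"
  by (rule weight_integrable[OF \<phi> \<eta>']) blast
 show "\<forall>\<^sub>F n in sequentially. (\<integral>\<^sup>+w. ennreal (norm (pairing \<beta> \<eta> (e n) \<phi> (\<lambda>t. cos (\<beta> * t)) w - pairing \<beta> \<eta>' (\<delta> n) \<phi> (\<lambda>t. cos (\<beta> * t)) w)) \<partial>M) \<le> ennreal r"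
  using order_tendstoD(2)[OF e(2) r2(1)] order_tendstoD(2)[OF d(2) r3(1)]
   order_tendstoD(2)[OF pairing_difference[OF \<beta> \<phi> \<eta> \<eta>' e d] r]
 proof eventually_elim
  case (elim n)
  have "integrable M (\<lambda>w. norm (pairing \<beta> \<eta> (e n) \<phi> (\<lambda>t. cos (\<beta> * t)) w - pairing \<beta> \<eta>' (\<delta> n) \<phi> (\<lambda>t. cos (\<beta> * t)) w))"
   by (intro integrable_norm Bochner_Integration.integrable_diff
     pairing_integrable[OF D(1) \<eta> e(1) r2(2)[OF e(1) elim(1)] cos_bounded_measurable]
     pairing_integrable[OF D(1) \<eta>' d(1) r3(2)[OF d(1) elim(2)] cos_bounded_measurable])
  then show ?case using elim by (subst nn_integral_eq_integral) (auto intro!: ennreal_leI)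
 qed
qed

text \<open>Approximations of the cosine are Cauchy in mean; the limit of one of them serves for all, by the
  comparison of two approximations at equal index.\<close>

lemma cos_limit_exists:
 fixes \<beta> :: real and \<eta> :: "'a => real"
 assumes \<beta>: "\<beta>\<^sup>2 < DIM('a)" and \<phi>: "test_function U \<phi>" and \<eta>: "mollifier \<eta>"
 obtains Y where "Y \<in> borel_measurable M"
  "\<And>\<eta>' c. mollifier \<eta>' ==> scale_sequence c ==> L1_null M (\<lambda>n w. pairing \<beta> \<eta>' (c n) \<phi> (\<lambda>t. cos (\<beta> * t)) w - Y w)"
proof -
 note D = test_function_D[OF \<phi>]
 let ?cos = "\<lambda>t::real. cos (\<beta> * t)"
 obtain \<rho> where r: "0 < \<rho>" "\<And>\<epsilon>. 0 < \<epsilon> ==> \<epsilon> < \<rho> ==> integrable lborel (weight \<beta> \<eta> \<epsilon> \<phi>)"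
  by (rule weight_integrable[OF \<phi> \<eta>]) blast
 define c where "c n = \<rho> / real (n + 2)" for n
 have c: "0 < c n" "c n < \<rho>" for n using r(1) by (simp_all add: c_def field_simps add_pos_nonneg)
 have c0: "c \<longlonglongrightarrow> 0"
 proof -
  have "(\<lambda>n. \<rho> / real n) \<longlonglongrightarrow> 0" by (rule lim_const_over_n)
  from LIMSEQ_ignore_initial_segment[OF this, of 2] show ?thesis by (simp add: c_def[abs_def])
 qed
 let ?s = "\<lambda>n. pairing \<beta> \<eta> (c n) \<phi> ?cos"
 have si: "integrable M (?s n)" for n
  by (rule pairing_integrable[OF D(1) \<eta> c(1) r(2)[OF c] cos_bounded_measurable])
 have [measurable]: "?s n \<in> borel_measurable M" for n using si by simp
 have cauchy: "\<exists>N. \<forall>i\<ge>N. \<forall>j\<ge>N. (LINT w|M. norm (?s i w - ?s j w)) < e" if e: "0 < e" for e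
 proof (rule ccontr)
  define D where "D i j = (LINT w|M. norm (?s i w - ?s j w))" for i j
  assume "\<not> ?thesis"
  then have "\<forall>N. \<exists>p. N \<le> fst p \<and> N \<le> snd p \<and> e \<le> D (fst p) (snd p)"
   unfolding D_def[symmetric] by (simp add: not_less)
  from choice[OF this] obtain p where p: "\<forall>N. N \<le> fst (p N) \<and> N \<le> snd (p N) \<and> e \<le> D (fst (p N)) (snd (p N))" by blast
  define i j where "i N = fst (p N)" and "j N = snd (p N)" for N
  have ij: "\<And>N. N \<le> i N" "\<And>N. N \<le> j N" "\<And>N. e \<le> (LINT w|M. norm (?s (i N) w - ?s (j N) w))"
   using p unfolding D_def[symmetric] i_def j_def by simp_all
  have sub: "(\<lambda>N. c (k N)) \<longlonglongrightarrow> 0" if "\<And>N. N \<le> k N" for k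
   by (rule filterlim_compose[OF c0 filterlim_at_top_mono[OF filterlim_ident]]) (use that in auto)
  have "(\<lambda>N. LINT w|M. norm (?s (i N) w - ?s (j N) w)) \<longlonglongrightarrow> 0"
   using pairing_difference[OF \<beta> \<phi> \<eta> \<eta>, of "\<lambda>N. c (i N)" "\<lambda>N. c (j N)"] c(1) sub ij(1,2) by blast
  then have "e \<le> 0" by (rule LIMSEQ_le_const) (use ij(3) in blast)
  then show False using e by simp
 qed
 obtain q where q: "strict_mono q" "AE w in M. Cauchy (\<lambda>i. ?s (q i) w)"
  using cauchy_L1_AE_cauchy_subseq[of M ?s, OF si cauchy] by blast
 define Y where "Y w = lim (\<lambda>i. ?s (q i) w)" for w
 have Ym [measurable]: "Y \<in> borel_measurable M" unfolding Y_def[abs_def] by (rule borel_measurable_lim_metric) measurable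
 have conv: "AE w in M. (\<lambda>i. ?s (q i) w) \<longlonglongrightarrow> Y w"
  using q(2) by eventually_elim (simp add: Y_def Cauchy_convergent_iff convergent_LIMSEQ_iff)
 have null: "L1_null M (\<lambda>n w. ?s n w - Y w)"
 proof (rule L1_null_bound)
  fix e :: real assume e: "0 < e"
  obtain N where N: "\<And>i j. N \<le> i ==> N \<le> j ==> (LINT w|M. norm (?s i w - ?s j w)) < e" using cauchy[OF e] by blast
  show "\<forall>\<^sub>F n in sequentially. (\<integral>\<^sup>+w. ennreal (norm (?s n w - Y w)) \<partial>M) \<le> ennreal e"
   unfolding eventually_sequentially
  proof (intro exI[of _ N] allI impI)
   fix n assume n: "N \<le> n"
   have "(\<integral>\<^sup>+w. ennreal (norm (?s n w - Y w)) \<partial>M) = (\<integral>\<^sup>+w. liminf (\<lambda>i. ennreal (norm (?s n w - ?s (q i) w))) \<partial>M)"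
   proof (rule nn_integral_cong_AE)
    show "AE w in M. ennreal (norm (?s n w - Y w)) = liminf (\<lambda>i. ennreal (norm (?s n w - ?s (q i) w)))"
     using conv
    proof eventually_elim
     case (elim w)
     have "(\<lambda>i. ennreal (norm (?s n w - ?s (q i) w))) \<longlonglongrightarrow> ennreal (norm (?s n w - Y w))"
      by (intro tendsto_ennrealI tendsto_norm tendsto_diff tendsto_const elim)
     then show ?case by (intro lim_imp_Liminf[symmetric]) auto
    qed
   qed
   also have "\<dots> \<le> liminf (\<lambda>i. \<integral>\<^sup>+w. ennreal (norm (?s n w - ?s (q i) w)) \<partial>M)"
    by (rule nn_integral_liminf) measurable
   also have "\<dots> \<le> ennreal e"
   proof (rule Liminf_le)
    show "\<forall>\<^sub>F i in sequentially. (\<integral>\<^sup>+w. ennreal (norm (?s n w - ?s (q i) w)) \<partial>M) \<le> ennreal e"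
     unfolding eventually_sequentially
    proof (intro exI[of _ N] allI impI)
     fix i assume "N \<le> i"
     then have "N \<le> q i" using seq_suble[OF q(1), of i] by linarith
     have "integrable M (\<lambda>w. norm (?s n w - ?s (q i) w))" using si by simp
     then show "(\<integral>\<^sup>+w. ennreal (norm (?s n w - ?s (q i) w)) \<partial>M) \<le> ennreal e"
      using N[OF n \<open>N \<le> q i\<close>] by (subst nn_integral_eq_integral) (auto intro!: ennreal_leI)
    qed
   qed (rule trivial_limit_sequentially)
   finally show "(\<integral>\<^sup>+w. ennreal (norm (?s n w - Y w)) \<partial>M) \<le> ennreal e" .
  qed
 qed
 show ?thesis
 proof (rule that[OF Ym])
  fix \<eta>' :: "'a => real" and c' assume \<eta>': "mollifier \<eta>'" and "scale_sequence c'"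
  then have c': "\<And>n. 0 < c' n" "c' \<longlonglongrightarrow> 0" by (auto simp: scale_sequence_def)
  show "L1_null M (\<lambda>n w. pairing \<beta> \<eta>' (c' n) \<phi> ?cos w - Y w)"
  proof (rule L1_null_add[OF _ _ pairing_difference_null[OF \<beta> \<phi> \<eta>' \<eta> c' c(1) c0] null])
   have [measurable]: "pairing \<beta> \<eta>' (c' n) \<phi> ?cos \<in> borel_measurable M" for n
    by (rule pairing_measurable[OF \<eta>' c'(1) D(1) cos_bounded_measurable(1)])
   show "(\<lambda>w. pairing \<beta> \<eta>' (c' n) \<phi> ?cos w - ?s n w) \<in> borel_measurable M" "(\<lambda>w. ?s n w - Y w) \<in> borel_measurable M" for n
    by measurable
   show "norm (pairing \<beta> \<eta>' (c' n) \<phi> ?cos w - Y w) \<le> norm (pairing \<beta> \<eta>' (c' n) \<phi> ?cos w - ?s n w) + norm (?s n w - Y w)" for n w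
    using norm_triangle_ineq[of "pairing \<beta> \<eta>' (c' n) \<phi> ?cos w - ?s n w" "?s n w - Y w"] by simp
  qed
 qed
qed

text \<open>The choice in the definition of the cosine is realised by the limit in mean just constructed.\<close>

lemma cos_chaos_limit:
 fixes \<beta> :: real
 assumes \<beta>: "\<beta>\<^sup>2 < DIM('a)" and \<phi>: "test_function U \<phi>" and \<eta>: "mollifier \<eta>" and c: "scale_sequence c"
 shows "tendsto_in_probability M (\<lambda>n. approx_pairing M U X \<eta> (c n) \<beta> (\<lambda>t. cos (\<beta> * t)) \<phi>) (cos_chaos M U X \<beta> \<phi>)"
proof -
 obtain Y where Y: "Y \<in> borel_measurable M"
  "\<And>\<eta>' c. mollifier \<eta>' ==> scale_sequence c ==> L1_null M (\<lambda>n w. pairing \<beta> \<eta>' (c n) \<phi> (\<lambda>t. cos (\<beta> * t)) w - Y w)"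
  by (rule cos_limit_exists[OF \<beta> \<phi> \<eta>]) blast
 have lim: "tendsto_in_probability M (\<lambda>n. approx_pairing M U X \<eta>' (c' n) \<beta> (\<lambda>t. cos (\<beta> * t)) \<phi>) Y"
  if \<eta>': "mollifier \<eta>'" and c': "scale_sequence c'" for \<eta>' c'
 proof (rule L1_null_in_probability[OF finite_measure_axioms _ Y(1)])
  have p: "0 < c' n" for n using c' by (simp add: scale_sequence_def)
  have eq: "approx_pairing M U X \<eta>' (c' n) \<beta> (\<lambda>t. cos (\<beta> * t)) \<phi> w = pairing \<beta> \<eta>' (c' n) \<phi> (\<lambda>t. cos (\<beta> * t)) w"
   if "w \<in> space M" for n w
   by (rule approx_pairing_eq[OF \<phi> \<eta>' p cos_bounded_measurable(1) that])
  show "approx_pairing M U X \<eta>' (c' n) \<beta> (\<lambda>t. cos (\<beta> * t)) \<phi> \<in> borel_measurable M" for n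
   by (rule measurable_cong[THEN iffD2, OF eq]) (simp, rule pairing_measurable[OF \<eta>' p test_function_D(1)[OF \<phi>] cos_bounded_measurable(1)])
  have "(\<integral>\<^sup>+w. ennreal (norm (approx_pairing M U X \<eta>' (c' n) \<beta> (\<lambda>t. cos (\<beta> * t)) \<phi> w - Y w)) \<partial>M)
    = (\<integral>\<^sup>+w. ennreal (norm (pairing \<beta> \<eta>' (c' n) \<phi> (\<lambda>t. cos (\<beta> * t)) w - Y w)) \<partial>M)" for n
   by (intro nn_integral_cong) (simp add: eq)
  then show "L1_null M (\<lambda>n w. approx_pairing M U X \<eta>' (c' n) \<beta> (\<lambda>t. cos (\<beta> * t)) \<phi> w - Y w)"
   using Y(2)[OF \<eta>' c'] unfolding L1_null_def by simp
 qed
 have ex: "\<exists>Y. \<forall>\<eta> c. mollifier \<eta> \<longrightarrow> scale_sequence c \<longrightarrow>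
    tendsto_in_probability M (\<lambda>n. approx_pairing M U X \<eta> (c n) \<beta> (\<lambda>t. cos (\<beta> * t)) \<phi>) Y"
  by (rule exI[of _ Y]) (intro allI impI, rule lim)
 have all: "\<forall>\<eta> c. mollifier \<eta> \<longrightarrow> scale_sequence c \<longrightarrow> tendsto_in_probability M
   (\<lambda>n. approx_pairing M U X \<eta> (c n) \<beta> (\<lambda>t. cos (\<beta> * t)) \<phi>) (cos_chaos M U X \<beta> \<phi>)"
  unfolding cos_chaos_def by (rule someI_ex[OF ex])
 show ?thesis by (rule all[THEN spec, THEN spec, THEN mp, THEN mp, OF \<eta> c])
qed

end

section \<open>Cosine polynomials of the field\<close>

context log_field
begin

definition cos_poly :: "real => nat => (nat => real) => real => real" where
 "cos_poly \<beta> N b t = (\<Sum>k=1..N. b k * mode \<beta> k t)"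

lemma cos_poly_measurable [measurable]: "cos_poly \<beta> N b \<in> borel_measurable borel"
 unfolding cos_poly_def[abs_def] by measurable

lemma cos_poly_bounded: "\<bar>cos_poly \<beta> N b t\<bar> \<le> (\<Sum>k=1..N. \<bar>b k\<bar>)"
proof -
 have "\<bar>cos_poly \<beta> N b t\<bar> \<le> (\<Sum>k=1..N. \<bar>b k * mode \<beta> k t\<bar>)" unfolding cos_poly_def by (rule sum_abs)
 also have "\<dots> \<le> (\<Sum>k=1..N. \<bar>b k\<bar>)"
  using mode_bounded by (intro sum_mono) (simp add: abs_mult mult_left_le)
 finally show ?thesis .
qed

lemma pairing_cos_poly:
 assumes \<eta>: "mollifier \<eta>" "0 < e" and W: "integrable lborel (weight \<beta> \<eta> e \<phi>)" and w: "w \<in> space M"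
 shows "pairing \<beta> \<eta> e \<phi> (cos_poly \<beta> N b) w = (\<Sum>k=1..N. complex_of_real (b k) * pairing \<beta> \<eta> e \<phi> (mode \<beta> k) w)"
proof -
 let ?w = "weight \<beta> \<eta> e \<phi>" and ?m = "\<lambda>k x. complex_of_real (mode \<beta> k (X w (mol \<eta> e x)))"
 have i: "integrable lborel (\<lambda>x. ?w x * ?m k x)" for k
  by (rule pairing_integrand(1)[OF \<eta> mode_measurable mode_bounded W w])
 have "pairing \<beta> \<eta> e \<phi> (cos_poly \<beta> N b) w = (LINT x|lborel. (\<Sum>k=1..N. complex_of_real (b k) * (?w x * ?m k x)))"
  unfolding pairing_def by (intro Bochner_Integration.integral_cong refl) (simp add: cos_poly_def sum_distrib_left mult_ac)
 also have "\<dots> = (\<Sum>k=1..N. LINT x|lborel. complex_of_real (b k) * (?w x * ?m k x))"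
  by (rule Bochner_Integration.integral_sum) (simp add: i)
 also have "\<dots> = (\<Sum>k=1..N. complex_of_real (b k) * pairing \<beta> \<eta> e \<phi> (mode \<beta> k) w)"
  unfolding pairing_def using i by simp
 finally show ?thesis .
qed

lemma pairing_cos_poly_diff:
 assumes \<eta>: "mollifier \<eta>" "0 < e" and W: "integrable lborel (weight \<beta> \<eta> e \<phi>)" and w: "w \<in> space M"
  and pad: "\<And>k. N < k ==> b k = 0" "\<And>k. N' < k ==> b' k = 0"
 shows "pairing \<beta> \<eta> e \<phi> (cos_poly \<beta> N b) w - pairing \<beta> \<eta> e \<phi> (cos_poly \<beta> N' b') w
  = pairing \<beta> \<eta> e \<phi> (cos_poly \<beta> (max N N') (\<lambda>k. b k - b' k)) w"
proof -
 let ?p = "\<lambda>k. pairing \<beta> \<eta> e \<phi> (mode \<beta> k) w"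
 have e: "(\<Sum>k=1..n. complex_of_real (d k) * ?p k) = (\<Sum>k=1..max N N'. complex_of_real (d k) * ?p k)"
  if "n \<le> max N N'" "\<And>k. n < k ==> d k = 0" for n d
  by (rule sum.mono_neutral_left) (use that in auto)
 show ?thesis
  unfolding pairing_cos_poly[OF \<eta> W w]
  using e[of N b] e[of N' b'] pad by (simp add: sum_subtractf left_diff_distrib)
qed

text \<open>Since distinct orders are nearly orthogonal, the mean is controlled by the largest coefficient.\<close>

lemma cos_poly_uniform_bound:
 fixes \<beta> :: real
 assumes dim: "2 \<le> DIM('a)" and \<beta>: "0 < \<beta>" "\<beta>\<^sup>2 < DIM('a)" and \<phi>: "test_function U \<phi>" and \<eta>: "mollifier \<eta>"
 obtains \<rho> B where "0 < \<rho>" "0 \<le> B" "\<And>e N b m. 0 < e ==> e < \<rho> ==> (\<And>k. \<bar>b k\<bar> \<le> m) ==>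
   (LINT w|M. norm (pairing \<beta> \<eta> e \<phi> (cos_poly \<beta> N b) w)) \<le> B * m"
proof -
 note D = test_function_D[OF \<phi>]
 obtain \<rho>1 B where B: "0 < \<rho>1" "0 \<le> B"
  "\<And>e k l. 0 < e ==> e < \<rho>1 ==> 1 \<le> k ==> 1 \<le> l ==> integrable lborel (mode_kernel \<beta> \<eta> e \<phi> k l)"
  "\<And>e k l. 0 < e ==> e < \<rho>1 ==> 1 \<le> k ==> 1 \<le> l ==>
   (LINT p|lborel. mode_kernel \<beta> \<eta> e \<phi> k l p) \<le> B * (exp (- \<bar>real k - real l\<bar>) / (real k * real l))"
  by (rule mode_kernel_integral[OF dim \<beta> \<phi> \<eta>]) blast
 obtain \<rho>2 where r2: "0 < \<rho>2" "\<And>e. 0 < e ==> e < \<rho>2 ==> integrable lborel (weight \<beta> \<eta> e \<phi>)"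
  by (rule weight_integrable[OF \<phi> \<eta>]) blast
 define S :: real where "S = (\<Sum>k. 1 / (real (Suc k))\<^sup>2) * (2 / (1 - exp (- 1)))"
 have S: "(\<Sum>k=1..N. \<Sum>l=1..N. exp (- \<bar>real k - real l\<bar>) / (real k * real l)) \<le> S" for N
  unfolding S_def by (rule double_sum_bound)
 have S0: "0 \<le> S" using S[of 0] by simp
 have main: "(LINT w|M. norm (pairing \<beta> \<eta> e \<phi> (cos_poly \<beta> N b) w)) \<le> sqrt (B * S) * m"
  if e: "0 < e" "e < min \<rho>1 \<rho>2" and b: "\<And>k. \<bar>b k\<bar> \<le> m" for e N b m
 proof -
  have e1: "e < \<rho>1" "e < \<rho>2" using e by auto
  note W = r2(2)[OF e(1) e1(2)]
  have m: "0 \<le> m" using b[of 0] by linarith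
  let ?Y = "pairing \<beta> \<eta> e \<phi> (cos_poly \<beta> N b)" and ?mk = "mode_kernel \<beta> \<eta> e \<phi>"
  let ?f = "\<lambda>x. mol \<eta> e x" and ?w = "\<lambda>x. norm (weight \<beta> \<eta> e \<phi> x)"
  have Xm [measurable]: "(\<lambda>w. X w (?f x)) \<in> borel_measurable M" for x
   by (rule X_measurable[OF mol_test_function[OF \<eta> e(1)]])
  have mi: "integrable M (\<lambda>w. mode \<beta> k (X w (?f x)) * mode \<beta> l (X w (?f y)))" for k l x y
   by (rule integrable_const_bound[where B=1])
    (auto simp: abs_mult intro!: mult_le_one mode_bounded)
  have corr: "\<bar>LINT w|M. cos_poly \<beta> N b (X w (?f x)) * cos_poly \<beta> N b (X w (?f y))\<bar>
    \<le> m\<^sup>2 * (\<Sum>k=1..N. \<Sum>l=1..N. \<bar>LINT w|M. mode \<beta> k (X w (?f x)) * mode \<beta> l (X w (?f y))\<bar>)" for x y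
  proof -
   let ?E = "\<lambda>k l. LINT w|M. mode \<beta> k (X w (?f x)) * mode \<beta> l (X w (?f y))"
   have "(LINT w|M. cos_poly \<beta> N b (X w (?f x)) * cos_poly \<beta> N b (X w (?f y)))
     = (LINT w|M. (\<Sum>k=1..N. \<Sum>l=1..N. (b k * b l) * (mode \<beta> k (X w (?f x)) * mode \<beta> l (X w (?f y)))))"
    by (intro Bochner_Integration.integral_cong refl) (simp add: cos_poly_def sum_product mult_ac)
   also have "\<dots> = (\<Sum>k=1..N. \<Sum>l=1..N. (b k * b l) * ?E k l)"
    using mi by simp
   finally have "\<bar>LINT w|M. cos_poly \<beta> N b (X w (?f x)) * cos_poly \<beta> N b (X w (?f y))\<bar> = \<bar>\<Sum>k=1..N. \<Sum>l=1..N. (b k * b l) * ?E k l\<bar>"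
    by simp
   also have "\<dots> \<le> (\<Sum>k=1..N. \<Sum>l=1..N. m\<^sup>2 * \<bar>?E k l\<bar>)"
   proof (intro order_trans[OF sum_abs] sum_mono)
    fix k l
    have "\<bar>b k\<bar> * \<bar>b l\<bar> \<le> m * m" using b m by (intro mult_mono) auto
    then show "\<bar>b k * b l * ?E k l\<bar> \<le> m\<^sup>2 * \<bar>?E k l\<bar>"
     unfolding abs_mult power2_eq_square by (rule mult_right_mono) simp
   qed
   finally show ?thesis by (simp add: sum_distrib_left)
  qed
  have A: "(\<lambda>(w, x). cos_poly \<beta> N b (X w (?f x))) \<in> borel_measurable (M \<Otimes>\<^sub>M borel)"
  proof -
   have [measurable]: "(\<lambda>(w, x). X w (mol \<eta> e x)) \<in> borel_measurable (M \<Otimes>\<^sub>M borel)"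
    by (rule mol_field_measurable[OF \<eta> e(1)])
   show ?thesis by measurable
  qed
  have gi: "integrable lborel (\<lambda>p. m\<^sup>2 * (\<Sum>k=1..N. \<Sum>l=1..N. ?mk k l p))"
   by (intro integrable_mult_right Bochner_Integration.integrable_sum B(3)[OF e(1) e1(1)]) auto
  have "(LINT w|M. (norm (?Y w))\<^sup>2) \<le> (LINT p|lborel. ?w (fst p) * ?w (snd p) *
    \<bar>LINT w|M. cos_poly \<beta> N b (X w (?f (fst p))) * cos_poly \<beta> N b (X w (?f (snd p)))\<bar>)"
   using second_moment_le[OF prob_space_axioms A cos_poly_bounded W] unfolding pairing_def .
  also have "\<dots> \<le> (LINT p|lborel. m\<^sup>2 * (\<Sum>k=1..N. \<Sum>l=1..N. ?mk k l p))"
  proof (rule integral_mono'[OF gi])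
   fix p
   have "?w (fst p) * ?w (snd p) * \<bar>LINT w|M. cos_poly \<beta> N b (X w (?f (fst p))) * cos_poly \<beta> N b (X w (?f (snd p)))\<bar>
     \<le> ?w (fst p) * ?w (snd p) * (m\<^sup>2 * (\<Sum>k=1..N. \<Sum>l=1..N. \<bar>LINT w|M. mode \<beta> k (X w (?f (fst p))) * mode \<beta> l (X w (?f (snd p)))\<bar>))"
    by (intro mult_left_mono corr) simp
   also have "\<dots> = m\<^sup>2 * (\<Sum>k=1..N. \<Sum>l=1..N. ?mk k l p)"
    unfolding mode_kernel_def by (simp add: sum_distrib_left mult_ac)
   finally show "?w (fst p) * ?w (snd p) * \<bar>LINT w|M. cos_poly \<beta> N b (X w (?f (fst p))) * cos_poly \<beta> N b (X w (?f (snd p)))\<bar>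
     \<le> m\<^sup>2 * (\<Sum>k=1..N. \<Sum>l=1..N. ?mk k l p)" .
   show "0 \<le> m\<^sup>2 * (\<Sum>k=1..N. \<Sum>l=1..N. ?mk k l p)"
    by (intro mult_nonneg_nonneg sum_nonneg mode_kernel_nonneg) simp
  qed
  also have "\<dots> = m\<^sup>2 * (\<Sum>k=1..N. \<Sum>l=1..N. LINT p|lborel. ?mk k l p)"
  proof -
   have "integrable lborel (?mk k l)" if "k \<in> {1..N}" "l \<in> {1..N}" for k l using B(3)[OF e(1) e1(1)] that by simp
   then have "(LINT p|lborel. (\<Sum>k=1..N. \<Sum>l=1..N. ?mk k l p)) = (\<Sum>k=1..N. \<Sum>l=1..N. LINT p|lborel. ?mk k l p)"
    by (subst Bochner_Integration.integral_sum) (auto intro!: sum.cong Bochner_Integration.integral_sum Bochner_Integration.integrable_sum)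
   then show ?thesis by (simp only: integral_mult_right_zero)
  qed
  also have "\<dots> \<le> m\<^sup>2 * (\<Sum>k=1..N. \<Sum>l=1..N. B * (exp (- \<bar>real k - real l\<bar>) / (real k * real l)))"
   by (intro mult_left_mono sum_mono B(4)[OF e(1) e1(1)]) auto
  also have "\<dots> = m\<^sup>2 * (B * (\<Sum>k=1..N. \<Sum>l=1..N. exp (- \<bar>real k - real l\<bar>) / (real k * real l)))"
   unfolding sum_distrib_left ..
  also have "\<dots> \<le> m\<^sup>2 * (B * S)"
   by (intro mult_left_mono S B(2)) simp
  finally have le: "(LINT w|M. (norm (?Y w))\<^sup>2) \<le> m\<^sup>2 * (B * S)" .
  have "(LINT w|M. norm (?Y w)) \<le> sqrt (m\<^sup>2 * (B * S))"
   by (rule expectation_le_sqrt[OF pairing_measurable[OF \<eta> e(1) D(1) cos_poly_measurable] _ le])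
    (rule pairing_integrand(2)[OF \<eta> e(1) cos_poly_measurable cos_poly_bounded W])
  then show ?thesis using m by (simp add: real_sqrt_mult mult_ac)
 qed
 show ?thesis
  by (rule that[of "min \<rho>1 \<rho>2" "sqrt (B * S)"]) (use B(1,2) r2(1) S0 main in auto)
qed

lemma nn_integral_norm_triangle:
 fixes A B C :: "'w => complex"
 assumes [measurable]: "A \<in> borel_measurable M" "B \<in> borel_measurable M" "C \<in> borel_measurable M"
 shows "(\<integral>\<^sup>+w. ennreal (norm (A w - C w)) \<partial>M) \<le> (\<integral>\<^sup>+w. ennreal (norm (A w - B w)) \<partial>M) + (\<integral>\<^sup>+w. ennreal (norm (B w - C w)) \<partial>M)"
proof -
 have "(\<integral>\<^sup>+w. ennreal (norm (A w - C w)) \<partial>M) \<le> (\<integral>\<^sup>+w. ennreal (norm (A w - B w)) + ennreal (norm (B w - C w)) \<partial>M)"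
  using norm_triangle_ineq[of "A w - B w" "B w - C w" for w]
  by (intro nn_integral_mono) (simp flip: ennreal_plus)
 also have "\<dots> = (\<integral>\<^sup>+w. ennreal (norm (A w - B w)) \<partial>M) + (\<integral>\<^sup>+w. ennreal (norm (B w - C w)) \<partial>M)"
  by (rule nn_integral_add) measurable
 finally show ?thesis .
qed

lemma nn_integral_pairing_le:
 assumes \<phi>: "test_function UNIV \<phi>" and \<eta>: "mollifier \<eta>" "0 < \<epsilon>" and W: "integrable lborel (weight \<beta> \<eta> \<epsilon> \<phi>)"
  and H: "H \<in> borel_measurable borel" "\<And>t. \<bar>H t\<bar> \<le> b" and e: "(LINT w|M. norm (pairing \<beta> \<eta> \<epsilon> \<phi> H w)) \<le> e"
 shows "(\<integral>\<^sup>+w. ennreal (norm (pairing \<beta> \<eta> \<epsilon> \<phi> H w)) \<partial>M) \<le> ennreal e"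
 using e by (subst nn_integral_eq_integral[OF integrable_norm[OF pairing_integrable[OF \<phi> \<eta> W H]]]) (auto intro: ennreal_leI)

text \<open>The limit of cosine polynomials that converge uniformly in the scale inherits their behaviour: only the
  first mode survives.\<close>

lemma cos_poly_limit_null:
 fixes \<beta> :: real and Y :: "nat => 'w => complex"
 assumes \<beta>: "0 < \<beta>" "\<beta>\<^sup>2 < DIM('a)" and \<phi>: "test_function U \<phi>" and \<eta>: "mollifier \<eta>"
  and e: "\<And>n. 0 < \<epsilon> n" "\<epsilon> \<longlonglongrightarrow> 0" and Ym: "\<And>n. Y n \<in> borel_measurable M" and \<rho>: "0 < \<rho>"
  and pad: "\<And>j k. N j < k ==> b j k = 0"
  and close: "\<And>e. 0 < e ==> \<exists>J. \<forall>i\<ge>J. \<forall>j\<ge>J. \<forall>\<delta>. 0 < \<delta> \<longrightarrow> \<delta> < \<rho> \<longrightarrow>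
   (LINT w|M. norm (pairing \<beta> \<eta> \<delta> \<phi> (cos_poly \<beta> (max (N i) (N j)) (\<lambda>k. b i k - b j k)) w)) \<le> e"
  and limit: "\<And>n. \<epsilon> n < \<rho> ==>
   (\<lambda>j. \<integral>\<^sup>+w. ennreal (norm (pairing \<beta> \<eta> (\<epsilon> n) \<phi> (cos_poly \<beta> (N j) (b j)) w - Y n w)) \<partial>M) \<longlonglongrightarrow> 0"
  and a: "(\<lambda>j. b j 1) \<longlonglongrightarrow> a"
 shows "L1_null M (\<lambda>n w. Y n w - complex_of_real a * pairing \<beta> \<eta> (\<epsilon> n) \<phi> (\<lambda>t. cos (\<beta> * t)) w)"
proof (rule L1_null_bound)
 fix r :: real assume r: "0 < r"
 note D = test_function_D[OF \<phi>]
 have r4: "0 < r / 4" using r by simp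
 obtain \<rho>1 where r1: "0 < \<rho>1" "\<And>\<epsilon>. 0 < \<epsilon> ==> \<epsilon> < \<rho>1 ==> integrable lborel (weight \<beta> \<eta> \<epsilon> \<phi>)"
  by (rule weight_integrable[OF \<phi> \<eta>]) blast
 obtain \<rho>2 B where B: "0 < \<rho>2" "0 \<le> B" "\<And>\<epsilon> k. 0 < \<epsilon> ==> \<epsilon> < \<rho>2 ==> 1 \<le> k ==>
   (LINT w|M. norm (pairing \<beta> \<eta> \<epsilon> \<phi> (mode \<beta> k) w)) \<le> B"
  by (rule mode_uniform_bound[OF \<beta>(2) \<phi> \<eta>]) blast
 obtain J where J: "\<And>i j \<delta>. J \<le> i ==> J \<le> j ==> 0 < \<delta> ==> \<delta> < \<rho> ==>
   (LINT w|M. norm (pairing \<beta> \<eta> \<delta> \<phi> (cos_poly \<beta> (max (N i) (N j)) (\<lambda>k. b i k - b j k)) w)) \<le> r / 4"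
  using close[OF r4] by blast
 have "0 < r / 4 / (B + 1)" using r4 B(2) by simp
 then have "\<forall>\<^sub>F j in sequentially. dist (b j 1) a < r / 4 / (B + 1)" by (rule tendstoD[OF a])
 then obtain J' where J': "\<And>j. J' \<le> j ==> dist (b j 1) a < r / 4 / (B + 1)" unfolding eventually_sequentially by blast
 define j where "j = max J J'"
 have j: "J \<le> j" "\<bar>b j 1 - a\<bar> * B \<le> r / 4"
 proof -
  show "J \<le> j" by (simp add: j_def)
  have "\<bar>b j 1 - a\<bar> \<le> r / 4 / (B + 1)" using J'[of j] by (simp add: j_def dist_real_def)
  then have "\<bar>b j 1 - a\<bar> * B \<le> r / 4 / (B + 1) * (B + 1)" using B(2) r by (intro mult_mono) auto
  also have "\<dots> = r / 4" using B(2) nonzero_divide_eq_eq[of "B + 1" "r / 4" "r / 4 / (B + 1)"] by (simp del: divide_divide_eq_left)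
  finally show "\<bar>b j 1 - a\<bar> * B \<le> r / 4" .
 qed
 let ?m = "\<lambda>n k. pairing \<beta> \<eta> (\<epsilon> n) \<phi> (mode \<beta> k)"
 let ?E = "\<lambda>n k. LINT w|M. norm (?m n k w)"
 have "(\<lambda>n. \<Sum>k=2..N j. \<bar>b j k\<bar> * ?E n k) \<longlonglongrightarrow> (\<Sum>k=2..N j. \<bar>b j k\<bar> * 0)"
  by (intro tendsto_sum tendsto_mult tendsto_const higher_mode_vanishes[OF \<beta> \<phi> \<eta> _ e]) simp
 then have hi: "(\<lambda>n. \<Sum>k=2..N j. \<bar>b j k\<bar> * ?E n k) \<longlonglongrightarrow> 0" by simp
 show "\<forall>\<^sub>F n in sequentially. (\<integral>\<^sup>+w. ennreal (norm (Y n w - complex_of_real a * pairing \<beta> \<eta> (\<epsilon> n) \<phi> (\<lambda>t. cos (\<beta> * t)) w)) \<partial>M) \<le> ennreal r"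
  using order_tendstoD(2)[OF e(2) r1(1)] order_tendstoD(2)[OF e(2) B(1)] order_tendstoD(2)[OF e(2) \<rho>] order_tendstoD(2)[OF hi r4]
 proof eventually_elim
  case (elim n)
  note W = r1(2)[OF e(1) elim(1)]
  let ?P = "\<lambda>i. pairing \<beta> \<eta> (\<epsilon> n) \<phi> (cos_poly \<beta> (N i) (b i))"
  have [measurable]: "?P i \<in> borel_measurable M" for i by (rule pairing_measurable[OF \<eta> e(1) D(1) cos_poly_measurable])
  have [measurable]: "?m n k \<in> borel_measurable M" for k by (rule pairing_measurable[OF \<eta> e(1) D(1) mode_measurable])
  have [measurable]: "Y n \<in> borel_measurable M" by (rule Ym)
  have mi: "integrable M (\<lambda>w. norm (?m n k w))" for k
   by (rule integrable_norm[OF pairing_integrable[OF D(1) \<eta> e(1) W mode_measurable mode_bounded]])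
  obtain i where i: "J \<le> i" "(\<integral>\<^sup>+w. ennreal (norm (?P i w - Y n w)) \<partial>M) \<le> ennreal (r / 4)"
  proof -
   have "0 < ennreal (r / 4)" using r4 by simp
   from order_tendstoD(2)[OF limit[OF elim(3)] this]
   obtain I where "\<And>i. I \<le> i ==> (\<integral>\<^sup>+w. ennreal (norm (?P i w - Y n w)) \<partial>M) < ennreal (r / 4)"
    unfolding eventually_sequentially by blast
   then show ?thesis using that[of "max I J"] by (simp add: less_imp_le)
  qed
  have 1: "(\<integral>\<^sup>+w. ennreal (norm (Y n w - ?P i w)) \<partial>M) \<le> ennreal (r / 4)"
   using i(2) by (subst norm_minus_commute)
  have 2: "(\<integral>\<^sup>+w. ennreal (norm (?P i w - ?P j w)) \<partial>M) \<le> ennreal (r / 4)"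
  proof -
   have "(\<integral>\<^sup>+w. ennreal (norm (?P i w - ?P j w)) \<partial>M)
     = (\<integral>\<^sup>+w. ennreal (norm (pairing \<beta> \<eta> (\<epsilon> n) \<phi> (cos_poly \<beta> (max (N i) (N j)) (\<lambda>k. b i k - b j k)) w)) \<partial>M)"
    by (intro nn_integral_cong) (simp only: pairing_cos_poly_diff[OF \<eta> e(1) W _ pad pad])
   also have "\<dots> \<le> ennreal (r / 4)"
    by (rule nn_integral_pairing_le[OF D(1) \<eta> e(1) W cos_poly_measurable cos_poly_bounded J[OF i(1) j(1) e(1) elim(3)]])
   finally show ?thesis .
  qed
  have 3: "(\<integral>\<^sup>+w. ennreal (norm (?P j w - complex_of_real a * ?m n 1 w)) \<partial>M) \<le> ennreal (r / 2)"
  proof -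
   have pt: "norm (?P j w - complex_of_real a * ?m n 1 w) \<le> \<bar>b j 1 - a\<bar> * norm (?m n 1 w) + (\<Sum>k=2..N j. \<bar>b j k\<bar> * norm (?m n k w))"
    if "w \<in> space M" for w
   proof -
    have "?P j w = (\<Sum>k=1..max 1 (N j). complex_of_real (b j k) * ?m n k w)"
     unfolding pairing_cos_poly[OF \<eta> e(1) W that] by (rule sum.mono_neutral_left) (use pad in auto)
    also have "\<dots> = complex_of_real (b j 1) * ?m n 1 w + (\<Sum>k=2..N j. complex_of_real (b j k) * ?m n k w)"
     by (subst sum.atLeast_Suc_atMost) (auto simp: numeral_2_eq_2 max_def intro!: sum.cong)
    finally have "?P j w - complex_of_real a * ?m n 1 w
      = complex_of_real (b j 1 - a) * ?m n 1 w + (\<Sum>k=2..N j. complex_of_real (b j k) * ?m n k w)"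
     by (simp add: left_diff_distrib)
    then have "norm (?P j w - complex_of_real a * ?m n 1 w)
      \<le> norm (complex_of_real (b j 1 - a) * ?m n 1 w) + norm (\<Sum>k=2..N j. complex_of_real (b j k) * ?m n k w)"
     by (simp only: norm_triangle_ineq)
    also have "norm (complex_of_real (b j 1 - a) * ?m n 1 w) = \<bar>b j 1 - a\<bar> * norm (?m n 1 w)"
     unfolding norm_mult norm_of_real ..
    also have "norm (\<Sum>k=2..N j. complex_of_real (b j k) * ?m n k w) \<le> (\<Sum>k=2..N j. \<bar>b j k\<bar> * norm (?m n k w))"
     by (rule order_trans[OF norm_sum]) (simp only: norm_mult norm_of_real order_refl)
    finally show ?thesis by simp
   qed
   have si: "integrable M (\<lambda>w. \<bar>b j 1 - a\<bar> * norm (?m n 1 w) + (\<Sum>k=2..N j. \<bar>b j k\<bar> * norm (?m n k w)))"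
    using mi by (intro Bochner_Integration.integrable_add Bochner_Integration.integrable_sum integrable_mult_right) auto
   have "(\<integral>\<^sup>+w. ennreal (norm (?P j w - complex_of_real a * ?m n 1 w)) \<partial>M)
     \<le> (\<integral>\<^sup>+w. ennreal (\<bar>b j 1 - a\<bar> * norm (?m n 1 w) + (\<Sum>k=2..N j. \<bar>b j k\<bar> * norm (?m n k w))) \<partial>M)"
    by (intro nn_integral_mono ennreal_leI pt)
   also have "\<dots> = ennreal (LINT w|M. \<bar>b j 1 - a\<bar> * norm (?m n 1 w) + (\<Sum>k=2..N j. \<bar>b j k\<bar> * norm (?m n k w)))"
    by (rule nn_integral_eq_integral[OF si]) (auto intro!: AE_I2 add_nonneg_nonneg sum_nonneg)
   also have "(LINT w|M. \<bar>b j 1 - a\<bar> * norm (?m n 1 w) + (\<Sum>k=2..N j. \<bar>b j k\<bar> * norm (?m n k w)))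
     = \<bar>b j 1 - a\<bar> * ?E n 1 + (\<Sum>k=2..N j. \<bar>b j k\<bar> * ?E n k)"
    by (subst Bochner_Integration.integral_add) (auto intro!: Bochner_Integration.integrable_sum integrable_mult_right mi
      simp: Bochner_Integration.integral_sum mi)
   also have "ennreal (\<bar>b j 1 - a\<bar> * ?E n 1 + (\<Sum>k=2..N j. \<bar>b j k\<bar> * ?E n k)) \<le> ennreal (r / 2)"
   proof (rule ennreal_leI)
    have "\<bar>b j 1 - a\<bar> * ?E n 1 \<le> \<bar>b j 1 - a\<bar> * B"
     using B(3)[OF e(1) elim(2), of 1] by (intro mult_left_mono) auto
    then show "\<bar>b j 1 - a\<bar> * ?E n 1 + (\<Sum>k=2..N j. \<bar>b j k\<bar> * ?E n k) \<le> r / 2" using elim(4) j(2) by linarith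
   qed
   finally show ?thesis .
  qed
  have m1: "pairing \<beta> \<eta> (\<epsilon> n) \<phi> (\<lambda>t. cos (\<beta> * t)) = ?m n 1" by (simp add: mode_def[abs_def])
  have "(\<integral>\<^sup>+w. ennreal (norm (Y n w - complex_of_real a * ?m n 1 w)) \<partial>M)
    \<le> (\<integral>\<^sup>+w. ennreal (norm (Y n w - ?P i w)) \<partial>M) + (\<integral>\<^sup>+w. ennreal (norm (?P i w - complex_of_real a * ?m n 1 w)) \<partial>M)"
   by (rule nn_integral_norm_triangle) measurable
  also have "\<dots> \<le> (\<integral>\<^sup>+w. ennreal (norm (Y n w - ?P i w)) \<partial>M) + ((\<integral>\<^sup>+w. ennreal (norm (?P i w - ?P j w)) \<partial>M)
    + (\<integral>\<^sup>+w. ennreal (norm (?P j w - complex_of_real a * ?m n 1 w)) \<partial>M))"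
   by (intro add_left_mono nn_integral_norm_triangle) measurable
  also have "\<dots> \<le> ennreal (r / 4) + (ennreal (r / 4) + ennreal (r / 2))"
   by (intro add_mono 1 2 3)
  also have "\<dots> = ennreal r" using r by (simp flip: ennreal_plus)
  finally show ?case unfolding m1 .
 qed
qed

end

section \<open>Absolutely convergent Fourier series\<close>

lemma symmetric_int_sum:
 fixes f :: "int => 'b::comm_monoid_add"
 shows "(\<Sum>k\<in>{- int j..int j}. f k) = f 0 + (\<Sum>k=1..j. f (int k) + f (- int k))"
proof (induction j)
 case (Suc j)
 have "{- int (Suc j)..int (Suc j)} = insert (int (Suc j)) (insert (- int (Suc j)) {- int j..int j})" by auto
 then show ?case using Suc by (simp add: add_ac)
qed simp

text \<open>Symmetric partial sums of the Fourier series, averaged over \<open>x\<close> and \<open>- x\<close>: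
  the sines cancel by evenness, and the constant coefficient vanishes with the mean.\<close>

lemma cosine_series:
 assumes \<beta>: "0 < \<beta>" and ev: "even_fun H" and F: "abs_convergent_fourier (2 * pi / \<beta>) H" and mz: "mean_zero (2 * pi / \<beta>) H"
 obtains a :: "nat => real" where "summable (\<lambda>k. \<bar>a k\<bar>)"
  "\<And>x. (\<lambda>j. \<Sum>k=1..j. a k * cos (real k * \<beta> * x)) \<longlonglongrightarrow> H x"
proof -
 define T where "T = 2 * pi / \<beta>"
 let ?c = "fourier_coeff T H"
 have T: "2 * pi * of_int k * x / T = of_int k * \<beta> * x" for k x using \<beta> by (simp add: T_def)
 have c0: "?c 0 = 0"
  using mz by (simp add: fourier_coeff_def mean_zero_def T_def[symmetric] set_integral_complex_of_real)
 have sm: "(\<lambda>k. norm (?c k)) summable_on UNIV" using F by (simp add: abs_convergent_fourier_def T_def)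
 have lim: "(\<lambda>j. \<Sum>k\<in>{- int j..int j}. ?c k * cis (of_int k * \<beta> * x)) \<longlonglongrightarrow> complex_of_real (H x)" for x
 proof -
  have "((\<lambda>k. ?c k * cis (of_int k * \<beta> * x)) has_sum complex_of_real (H x)) UNIV"
   using F unfolding abs_convergent_fourier_def T_def[symmetric] T by blast
  then have "(sum (\<lambda>k. ?c k * cis (of_int k * \<beta> * x)) \<longlongrightarrow> complex_of_real (H x)) (finite_subsets_at_top UNIV)"
   unfolding has_sum_def .
  moreover have "filterlim (\<lambda>j. {- int j..int j}) (finite_subsets_at_top UNIV) sequentially"
   unfolding filterlim_finite_subsets_at_top
  proof (intro allI impI)
   fix A :: "int set" assume "finite A \<and> A \<subseteq> UNIV"
   then have A: "finite ((\<lambda>k. nat \<bar>k\<bar>) ` A)" by simp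
   show "\<forall>\<^sub>F j in sequentially. finite {- int j..int j} \<and> A \<subseteq> {- int j..int j} \<and> {- int j..int j} \<subseteq> UNIV"
    unfolding eventually_sequentially
   proof (intro exI[of _ "Max (insert 0 ((\<lambda>k. nat \<bar>k\<bar>) ` A))"] allI impI conjI subsetI)
    fix j k assume "Max (insert 0 ((\<lambda>k. nat \<bar>k\<bar>) ` A)) \<le> j" "k \<in> A"
    then have "nat \<bar>k\<bar> \<le> j" using A by simp
    then show "k \<in> {- int j..int j}" by auto
   qed auto
  qed
  ultimately show ?thesis by (rule filterlim_compose)
 qed
 have Re: "(\<lambda>j. \<Sum>k\<in>{- int j..int j}. Re (?c k) * cos (of_int k * \<beta> * x)) \<longlonglongrightarrow> H x" for x
 proof -
  have "(\<lambda>j. (Re (\<Sum>k\<in>{- int j..int j}. ?c k * cis (of_int k * \<beta> * x)) + Re (\<Sum>k\<in>{- int j..int j}. ?c k * cis (of_int k * \<beta> * - x))) / 2)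
    \<longlonglongrightarrow> (Re (complex_of_real (H x)) + Re (complex_of_real (H (- x)))) / 2"
   by (intro tendsto_divide tendsto_add tendsto_Re lim tendsto_const) simp
  moreover have "(Re (\<Sum>k\<in>{- int j..int j}. ?c k * cis (of_int k * \<beta> * x)) + Re (\<Sum>k\<in>{- int j..int j}. ?c k * cis (of_int k * \<beta> * - x))) / 2
    = (\<Sum>k\<in>{- int j..int j}. Re (?c k) * cos (of_int k * \<beta> * x))" for j
   by (simp add: sum.distrib[symmetric] sum_divide_distrib)
  ultimately show ?thesis using ev by (simp add: even_fun_def)
 qed
 define a where "a k = Re (?c (int k)) + Re (?c (- int k))" for k
 have sn: "summable (\<lambda>n. norm (?c (f n)))" if "inj f" for f :: "nat => int"
 proof -
  have "(\<lambda>k. norm (?c k)) summable_on range f" by (rule summable_on_subset_banach[OF sm]) simp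
  then have "(\<lambda>n. norm (?c (f n))) summable_on UNIV" using that by (simp add: summable_on_reindex o_def)
  then show ?thesis by (rule summable_on_imp_summable)
 qed
 show ?thesis
 proof (rule that)
  show "summable (\<lambda>k. \<bar>a k\<bar>)"
  proof (rule summable_comparison_test')
   show "summable (\<lambda>n. norm (?c (int n)) + norm (?c (- int n)))"
    by (intro summable_add sn) (auto simp: inj_def)
   show "norm \<bar>a n\<bar> \<le> norm (?c (int n)) + norm (?c (- int n))" if "0 \<le> n" for n
    using abs_Re_le_cmod[of "?c (int n)"] abs_Re_le_cmod[of "?c (- int n)"] by (simp add: a_def)
  qed
  show "(\<lambda>j. \<Sum>k=1..j. a k * cos (real k * \<beta> * x)) \<longlonglongrightarrow> H x" for x
   using Re[of x] unfolding symmetric_int_sum by (simp add: c0 a_def distrib_right)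
 qed
qed

section \<open>Passage to the completed probability space\<close>

text \<open>For a Lebesgue measurable \<open>H\<close> the approximating integrals agree with random variables
  only almost surely, which suffices in the completion.\<close>

lemma borel_measurable_completion_AE:
 fixes f g :: "'w => 'b::topological_space"
 assumes f: "f \<in> borel_measurable M" and ae: "AE x in M. g x = f x"
 shows "g \<in> borel_measurable (completion M)"
proof (rule measurableI)
 fix A :: "'b set" assume A: "A \<in> sets borel"
 show "g -` A \<inter> space (completion M) \<in> sets (completion M)"
 proof (rule completion.in_sets_AE)
  show "f -` A \<inter> space (completion M) \<in> sets (completion M)"
   by (rule measurable_sets[OF measurable_completion[OF f] A])
  show "AE x in completion M. x \<in> f -` A \<inter> space (completion M) \<longleftrightarrow> x \<in> g -` A \<inter> space (completion M)"
   using AE_completion[OF ae] by eventually_elim auto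
 qed auto
qed simp

lemma tendsto_in_probability_completion:
 fixes Y :: "nat => 'w => complex"
 assumes "tendsto_in_probability M Y Z"
 shows "tendsto_in_probability (completion M) Y Z"
proof -
 have m [measurable]: "\<And>n. Y n \<in> borel_measurable M" "Z \<in> borel_measurable M"
  and lim: "\<And>e. 0 < e ==> (\<lambda>n. measure M {w \<in> space M. e < dist (Y n w) (Z w)}) \<longlonglongrightarrow> 0"
  using assms unfolding tendsto_in_probability_def by blast+
 have "measure (completion M) {w \<in> space (completion M). e < dist (Y n w) (Z w)}
   = measure M {w \<in> space M. e < dist (Y n w) (Z w)}" for n e
  unfolding space_completion by (rule measure_completion) measurable
 then show ?thesis
  unfolding tendsto_in_probability_def using lim m by (simp add: measurable_completion)
qed

context log_field
begin

text \<open>The two ingredients of the theorem: the approximations of \<open>H\<close> are asymptotic in mean to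
  a multiple of those of the cosine, and these converge in probability.\<close>

lemma approx_pairing_limit:
 fixes \<beta> :: real
 assumes \<beta>: "\<beta>\<^sup>2 < DIM('a)" and \<phi>: "test_function U \<phi>" and \<eta>: "mollifier \<eta>" and c: "scale_sequence c"
  and Y: "\<And>n. Y n \<in> borel_measurable M" "\<And>n. AE w in M. approx_pairing M U X \<eta> (c n) \<beta> H \<phi> w = Y n w"
  and null: "L1_null M (\<lambda>n w. Y n w - complex_of_real a * pairing \<beta> \<eta> (c n) \<phi> (\<lambda>t. cos (\<beta> * t)) w)"
 shows "tendsto_in_probability (completion M) (\<lambda>n. approx_pairing M U X \<eta> (c n) \<beta> H \<phi>)
   (\<lambda>w. complex_of_real a * cos_chaos M U X \<beta> \<phi> w)"
proof (rule tendsto_in_probability_multiple)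
 have c0: "0 < c n" for n using c by (simp add: scale_sequence_def)
 have "emeasure (completion M) (space (completion M)) \<noteq> \<infinity>" by (simp add: emeasure_space_1)
 then show "finite_measure (completion M)" by (rule finite_measureI)
 show "approx_pairing M U X \<eta> (c n) \<beta> H \<phi> \<in> borel_measurable (completion M)" for n
  by (rule borel_measurable_completion_AE[OF Y])
 show "tendsto_in_probability (completion M) (\<lambda>n. approx_pairing M U X \<eta> (c n) \<beta> (\<lambda>t. cos (\<beta> * t)) \<phi>) (cos_chaos M U X \<beta> \<phi>)"
  by (rule tendsto_in_probability_completion[OF cos_chaos_limit[OF \<beta> \<phi> \<eta> c]])
 have "(\<integral>\<^sup>+w. ennreal (norm (approx_pairing M U X \<eta> (c n) \<beta> H \<phi> w - complex_of_real a * approx_pairing M U X \<eta> (c n) \<beta> (\<lambda>t. cos (\<beta> * t)) \<phi> w)) \<partial>completion M)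
   = (\<integral>\<^sup>+w. ennreal (norm (Y n w - complex_of_real a * pairing \<beta> \<eta> (c n) \<phi> (\<lambda>t. cos (\<beta> * t)) w)) \<partial>M)" for n
  unfolding nn_integral_completion
 proof (rule nn_integral_cong_AE)
  show "AE w in M. ennreal (norm (approx_pairing M U X \<eta> (c n) \<beta> H \<phi> w - complex_of_real a * approx_pairing M U X \<eta> (c n) \<beta> (\<lambda>t. cos (\<beta> * t)) \<phi> w))
    = ennreal (norm (Y n w - complex_of_real a * pairing \<beta> \<eta> (c n) \<phi> (\<lambda>t. cos (\<beta> * t)) w))"
   using Y(2)[of n] AE_space
   by eventually_elim (simp only: approx_pairing_eq[OF \<phi> \<eta> c0 cos_bounded_measurable(1)])
 qed
 then show "L1_null (completion M) (\<lambda>n w. approx_pairing M U X \<eta> (c n) \<beta> H \<phi> w - complex_of_real a * approx_pairing M U X \<eta> (c n) \<beta> (\<lambda>t. cos (\<beta> * t)) \<phi> w)"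
  using null unfolding L1_null_def by simp
qed

lemma cos_poly_l1_bound:
 assumes \<phi>: "test_function UNIV \<phi>" and \<eta>: "mollifier \<eta>" "0 < e" and W: "integrable lborel (weight \<beta> \<eta> e \<phi>)"
  and B: "\<And>k. 1 \<le> k ==> (LINT w|M. norm (pairing \<beta> \<eta> e \<phi> (mode \<beta> k) w)) \<le> B"
 shows "(LINT w|M. norm (pairing \<beta> \<eta> e \<phi> (cos_poly \<beta> N d) w)) \<le> B * (\<Sum>k=1..N. \<bar>d k\<bar>)"
proof -
 have mi: "integrable M (\<lambda>w. norm (pairing \<beta> \<eta> e \<phi> (mode \<beta> k) w))" for k
  by (rule integrable_norm[OF pairing_integrable[OF \<phi> \<eta> W mode_measurable mode_bounded]])
 have "(LINT w|M. norm (pairing \<beta> \<eta> e \<phi> (cos_poly \<beta> N d) w))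
   \<le> (LINT w|M. (\<Sum>k=1..N. \<bar>d k\<bar> * norm (pairing \<beta> \<eta> e \<phi> (mode \<beta> k) w)))"
 proof (rule integral_mono)
  show "integrable M (\<lambda>w. norm (pairing \<beta> \<eta> e \<phi> (cos_poly \<beta> N d) w))"
   by (rule integrable_norm[OF pairing_integrable[OF \<phi> \<eta> W cos_poly_measurable cos_poly_bounded]])
  show "integrable M (\<lambda>w. \<Sum>k=1..N. \<bar>d k\<bar> * norm (pairing \<beta> \<eta> e \<phi> (mode \<beta> k) w))"
   by (intro Bochner_Integration.integrable_sum integrable_mult_right mi)
  show "norm (pairing \<beta> \<eta> e \<phi> (cos_poly \<beta> N d) w) \<le> (\<Sum>k=1..N. \<bar>d k\<bar> * norm (pairing \<beta> \<eta> e \<phi> (mode \<beta> k) w))"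
   if "w \<in> space M" for w
   unfolding pairing_cos_poly[OF \<eta> W that]
   by (rule order_trans[OF norm_sum]) (simp only: norm_mult norm_of_real order_refl)
 qed
 also have "\<dots> = (\<Sum>k=1..N. LINT w|M. \<bar>d k\<bar> * norm (pairing \<beta> \<eta> e \<phi> (mode \<beta> k) w))"
  by (rule Bochner_Integration.integral_sum) (intro integrable_mult_right mi)
 also have "\<dots> \<le> (\<Sum>k=1..N. \<bar>d k\<bar> * B)"
 proof (rule sum_mono)
  fix k assume "k \<in> {1..N}"
  then have "(LINT w|M. norm (pairing \<beta> \<eta> e \<phi> (mode \<beta> k) w)) \<le> B" by (intro B) simp
  then show "(LINT w|M. \<bar>d k\<bar> * norm (pairing \<beta> \<eta> e \<phi> (mode \<beta> k) w)) \<le> \<bar>d k\<bar> * B"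
   unfolding integral_mult_right_zero by (rule mult_left_mono) simp
 qed
 also have "\<dots> = B * (\<Sum>k=1..N. \<bar>d k\<bar>)" by (simp add: sum_distrib_left mult.commute)
 finally show ?thesis .
qed

lemma pairing_diff:
 assumes \<eta>: "mollifier \<eta>" "0 < e" and W: "integrable lborel (weight \<beta> \<eta> e \<phi>)" and w: "w \<in> space M"
  and H: "H \<in> borel_measurable borel" "\<And>t. \<bar>H t\<bar> \<le> b" and H': "H' \<in> borel_measurable borel" "\<And>t. \<bar>H' t\<bar> \<le> b'"
 shows "pairing \<beta> \<eta> e \<phi> H w - pairing \<beta> \<eta> e \<phi> H' w = pairing \<beta> \<eta> e \<phi> (\<lambda>t. H t - H' t) w"
proof -
 have "pairing \<beta> \<eta> e \<phi> (\<lambda>t. H t - H' t) w = (LINT x|lborel. weight \<beta> \<eta> e \<phi> x * complex_of_real (H (X w (mol \<eta> e x)))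
   - weight \<beta> \<eta> e \<phi> x * complex_of_real (H' (X w (mol \<eta> e x))))"
  unfolding pairing_def by (simp add: right_diff_distrib)
 also have "\<dots> = pairing \<beta> \<eta> e \<phi> H w - pairing \<beta> \<eta> e \<phi> H' w"
  unfolding pairing_def
  by (rule Bochner_Integration.integral_diff[OF pairing_integrand(1)[OF \<eta> H W w] pairing_integrand(1)[OF \<eta> H' W w]])
 finally show ?thesis ..
qed

text \<open>Partial sums of the series converge uniformly, and their tails are controlled in mean by the uniform
  bound for single modes.\<close>

lemma summable_cosine_series_limit:
 fixes \<beta> :: real
 assumes \<beta>: "0 < \<beta>" "\<beta>\<^sup>2 < DIM('a)" and \<phi>: "test_function U \<phi>" and \<eta>: "mollifier \<eta>" and c: "scale_sequence c"
  and a: "summable (\<lambda>k. \<bar>a k\<bar>)" and H: "\<And>x. (\<lambda>j. \<Sum>k=1..j. a k * cos (real k * \<beta> * x)) \<longlonglongrightarrow> H x"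
 shows "tendsto_in_probability (completion M) (\<lambda>n. approx_pairing M U X \<eta> (c n) \<beta> H \<phi>)
   (\<lambda>w. complex_of_real (a 1) * cos_chaos M U X \<beta> \<phi> w)"
proof -
 note D = test_function_D[OF \<phi>]
 have c0: "\<And>n. 0 < c n" "c \<longlonglongrightarrow> 0" using c by (auto simp: scale_sequence_def)
 obtain \<rho>1 where r1: "0 < \<rho>1" "\<And>\<epsilon>. 0 < \<epsilon> ==> \<epsilon> < \<rho>1 ==> integrable lborel (weight \<beta> \<eta> \<epsilon> \<phi>)"
  by (rule weight_integrable[OF \<phi> \<eta>]) blast
 obtain \<rho>2 B where B: "0 < \<rho>2" "0 \<le> B" "\<And>\<epsilon> k. 0 < \<epsilon> ==> \<epsilon> < \<rho>2 ==> 1 \<le> k ==>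
   (LINT w|M. norm (pairing \<beta> \<eta> \<epsilon> \<phi> (mode \<beta> k) w)) \<le> B"
  by (rule mode_uniform_bound[OF \<beta>(2) \<phi> \<eta>]) blast
 let ?A = "\<lambda>k. \<bar>a k\<bar>"
 define b where "b j k = (if k \<le> j then a k else 0)" for j k :: nat
 have bP: "cos_poly \<beta> j (b j) x = (\<Sum>k=1..j. a k * cos (real k * \<beta> * x))" for j x
  by (auto simp: cos_poly_def b_def mode_def intro!: sum.cong)
 define tail where "tail J = suminf ?A - (\<Sum>k\<le>J. \<bar>a k\<bar>)" for J
 have tail: "(\<Sum>k=Suc J..N. \<bar>a k\<bar>) \<le> tail J" for J N
 proof -
  have "(\<Sum>k=Suc J..N. \<bar>a k\<bar>) + (\<Sum>k\<le>J. \<bar>a k\<bar>) = (\<Sum>k\<in>{Suc J..N} \<union> {..J}. \<bar>a k\<bar>)"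
   by (rule sum.union_disjoint[symmetric]) auto
  also have "\<dots> \<le> suminf ?A" by (rule sum_le_suminf[OF a]) auto
  finally show ?thesis by (simp add: tail_def)
 qed
 have t0: "tail \<longlonglongrightarrow> 0"
  unfolding tail_def[abs_def] using tendsto_diff[OF tendsto_const summable_LIMSEQ'[OF a], of "suminf ?A"] by simp
 have diff: "\<bar>b i k - b j k\<bar> \<le> (if J < k then \<bar>a k\<bar> else 0)" if "J \<le> i" "J \<le> j" for i j J k
  using that by (auto simp: b_def)
 have dsum: "(\<Sum>k=1..N. \<bar>b i k - b j k\<bar>) \<le> tail J" if "J \<le> i" "J \<le> j" for i j J N
 proof -
  have "(\<Sum>k=1..N. \<bar>b i k - b j k\<bar>) \<le> (\<Sum>k=1..N. if J < k then \<bar>a k\<bar> else 0)" by (intro sum_mono diff that)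
  also have "\<dots> = (\<Sum>k=Suc J..N. \<bar>a k\<bar>)"
   by (rule sum.mono_neutral_cong_right) auto
  finally show ?thesis using tail[of J N] by simp
 qed
 have pc: "\<bar>cos_poly \<beta> i (b i) x - cos_poly \<beta> j (b j) x\<bar> \<le> tail j" if "j \<le> i" for i j x
 proof -
  have "cos_poly \<beta> j (b j) x = (\<Sum>k=1..i. b j k * mode \<beta> k x)"
   unfolding cos_poly_def by (rule sum.mono_neutral_left) (use that in \<open>auto simp: b_def\<close>)
  then have "cos_poly \<beta> i (b i) x - cos_poly \<beta> j (b j) x = cos_poly \<beta> i (\<lambda>k. b i k - b j k) x"
   unfolding cos_poly_def by (simp add: left_diff_distrib sum_subtractf)
  then show ?thesis using cos_poly_bounded[of \<beta> i "\<lambda>k. b i k - b j k" x] dsum[of j i j i] that by linarith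
 qed
 have Hlim: "(\<lambda>j. cos_poly \<beta> j (b j) x) \<longlonglongrightarrow> H x" for x using H[of x] unfolding bP .
 have Hm: "H \<in> borel_measurable borel"
  by (rule borel_measurable_LIMSEQ_real[OF Hlim]) (simp add: cos_poly_measurable)
 have Hd: "\<bar>cos_poly \<beta> j (b j) x - H x\<bar> \<le> tail j" for j x
 proof -
  have "(\<lambda>i. \<bar>cos_poly \<beta> i (b i) x - cos_poly \<beta> j (b j) x\<bar>) \<longlonglongrightarrow> \<bar>H x - cos_poly \<beta> j (b j) x\<bar>"
   by (intro tendsto_rabs tendsto_diff Hlim tendsto_const)
  then have "\<bar>H x - cos_poly \<beta> j (b j) x\<bar> \<le> tail j"
   by (rule LIMSEQ_le_const2) (use pc in blast)
  then show ?thesis by (simp add: abs_minus_commute)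
 qed
 have Hb: "\<bar>H x\<bar> \<le> tail 0" for x using Hd[of 0 x] by (simp add: cos_poly_def)
 let ?\<rho> = "min \<rho>1 \<rho>2"
 have "L1_null M (\<lambda>n w. pairing \<beta> \<eta> (c n) \<phi> H w - complex_of_real (a 1) * pairing \<beta> \<eta> (c n) \<phi> (\<lambda>t. cos (\<beta> * t)) w)"
 proof (rule cos_poly_limit_null[OF \<beta> \<phi> \<eta> c0, where b = b and N = "\<lambda>j. j" and \<rho> = ?\<rho>])
  show "pairing \<beta> \<eta> (c n) \<phi> H \<in> borel_measurable M" for n by (rule pairing_measurable[OF \<eta> c0(1) D(1) Hm])
  show "0 < ?\<rho>" using r1(1) B(1) by simp
  show "b j k = 0" if "j < k" for j k using that by (simp add: b_def)
  show "(\<lambda>j. b j 1) \<longlonglongrightarrow> a 1"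
   by (rule tendsto_eventually) (auto simp: b_def eventually_sequentially intro!: exI[of _ 1])
  show "\<exists>J. \<forall>i\<ge>J. \<forall>j\<ge>J. \<forall>\<delta>. 0 < \<delta> \<longrightarrow> \<delta> < ?\<rho> \<longrightarrow>
   (LINT w|M. norm (pairing \<beta> \<eta> \<delta> \<phi> (cos_poly \<beta> (max i j) (\<lambda>k. b i k - b j k)) w)) \<le> e" if e: "0 < e" for e
  proof -
   have "0 < e / (B + 1)" using e B(2) by simp
   from order_tendstoD(2)[OF t0 this] obtain J where J: "tail J < e / (B + 1)" unfolding eventually_sequentially by blast
   have tJ: "0 \<le> tail J" using tail[of J 0] by simp
   have le: "B * tail J \<le> e"
   proof -
    have "B * tail J \<le> (B + 1) * (e / (B + 1))" using J B(2) tJ e by (intro mult_mono) auto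
    then show ?thesis using B(2) by (simp split: if_splits)
   qed
   show ?thesis
   proof (intro exI[of _ J] allI impI)
    fix i j \<delta> assume ij: "J \<le> i" "J \<le> j" and d: "0 < \<delta>" "\<delta> < ?\<rho>"
    have d': "\<delta> < \<rho>1" "\<delta> < \<rho>2" using d by auto
    have "(LINT w|M. norm (pairing \<beta> \<eta> \<delta> \<phi> (cos_poly \<beta> (max i j) (\<lambda>k. b i k - b j k)) w)) \<le> B * (\<Sum>k=1..max i j. \<bar>b i k - b j k\<bar>)"
     by (rule cos_poly_l1_bound[OF D(1) \<eta> d(1) r1(2)[OF d(1) d'(1)] B(3)[OF d(1) d'(2)]])
    also have "\<dots> \<le> B * tail J" by (rule mult_left_mono[OF dsum[OF ij] B(2)])
    finally show "(LINT w|M. norm (pairing \<beta> \<eta> \<delta> \<phi> (cos_poly \<beta> (max i j) (\<lambda>k. b i k - b j k)) w)) \<le> e" using le by simp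
   qed
  qed
  show "(\<lambda>j. \<integral>\<^sup>+w. ennreal (norm (pairing \<beta> \<eta> (c n) \<phi> (cos_poly \<beta> j (b j)) w - pairing \<beta> \<eta> (c n) \<phi> H w)) \<partial>M) \<longlonglongrightarrow> 0"
   if n: "c n < ?\<rho>" for n
  proof -
   have W: "integrable lborel (weight \<beta> \<eta> (c n) \<phi>)" using r1(2) c0(1) n by simp
   let ?I = "LINT x|lborel. norm (weight \<beta> \<eta> (c n) \<phi> x)"
   have le: "(\<integral>\<^sup>+w. ennreal (norm (pairing \<beta> \<eta> (c n) \<phi> (cos_poly \<beta> j (b j)) w - pairing \<beta> \<eta> (c n) \<phi> H w)) \<partial>M) \<le> ennreal (tail j * ?I)" for j
   proof -
    have "(\<lambda>t. cos_poly \<beta> j (b j) t - H t) \<in> borel_measurable borel"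
     using cos_poly_measurable Hm by (rule borel_measurable_diff)
    note bd = pairing_integrand(2)[OF \<eta> c0(1) this Hd W]
    have "(\<integral>\<^sup>+w. ennreal (norm (pairing \<beta> \<eta> (c n) \<phi> (cos_poly \<beta> j (b j)) w - pairing \<beta> \<eta> (c n) \<phi> H w)) \<partial>M) \<le> (\<integral>\<^sup>+w. ennreal (tail j * ?I) \<partial>M)"
     by (intro nn_integral_mono ennreal_leI)
      (simp only: pairing_diff[OF \<eta> c0(1) W _ cos_poly_measurable cos_poly_bounded Hm Hb] bd)
    also have "\<dots> = ennreal (tail j * ?I)" by (simp add: emeasure_space_1)
    finally show ?thesis .
   qed
   have "(\<lambda>j. ennreal (tail j * ?I)) \<longlonglongrightarrow> ennreal (0 * ?I)"
    by (intro tendsto_ennrealI tendsto_mult t0 tendsto_const)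
   then have "(\<lambda>j. ennreal (tail j * ?I)) \<longlonglongrightarrow> 0" by simp
   then show ?thesis
    by (rule tendsto_sandwich[OF _ _ tendsto_const, rotated 2]) (auto intro: always_eventually le)
  qed
 qed
 then show ?thesis
  using pairing_measurable[OF \<eta> c0(1) D(1) Hm] approx_pairing_eq[OF \<phi> \<eta> c0(1) Hm]
  by (intro approx_pairing_limit[OF \<beta>(2) \<phi> \<eta> c, where Y = "\<lambda>n. pairing \<beta> \<eta> (c n) \<phi> H"]) (auto intro: AE_I2)
qed

end

section \<open>Approximation by cosine polynomials in the mean\<close>

text \<open>Truncate, then use that a measurable function is almost everywhere a limit of continuous ones; the
  truncation supplies the majorant.\<close>

lemma L1_continuous_approximation:
 fixes H :: "real => real"
 assumes H: "H absolutely_integrable_on {a..b}" and e: "0 < e"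
 obtains h where "continuous_on UNIV h" "(\<integral>\<^sup>+x. ennreal \<bar>h x - H x\<bar> * indicator {a..b} x \<partial>lebesgue) \<le> ennreal e"
proof -
 define L where "L = lebesgue_on {a..b}"
 have Hi [measurable]: "integrable L H"
  using H by (simp add: L_def integrable_restrict_space set_integrable_def)
 have Hm [measurable]: "H \<in> borel_measurable L" using Hi by simp
 interpret L: finite_measure L unfolding L_def by (rule finite_measure_lebesgue_on) simp
 let ?c = "\<lambda>m::nat. \<lambda>y::real. max (- real m) (min (real m) y)"
 have cb: "\<bar>?c m y\<bar> \<le> real m" for m y by auto
 have e2: "0 < e / 2" using e by simp
 \<comment> \<open>A truncation of \<open>H\<close> is close to \<open>H\<close>.\<close>
 have "(\<lambda>m. LINT x|L. \<bar>?c m (H x) - H x\<bar>) \<longlonglongrightarrow> (LINT x|L. 0)"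
 proof (rule integral_dominated_convergence[where w="\<lambda>x. \<bar>H x\<bar>"])
  show "AE x in L. (\<lambda>m. \<bar>?c m (H x) - H x\<bar>) \<longlonglongrightarrow> 0"
  proof (rule AE_I2)
   fix x
   obtain n :: nat where "\<bar>H x\<bar> \<le> real n" using real_arch_simple by blast
   then have "\<bar>?c m (H x) - H x\<bar> = 0" if "n \<le> m" for m using that by auto
   then show "(\<lambda>m. \<bar>?c m (H x) - H x\<bar>) \<longlonglongrightarrow> 0" by (intro tendsto_eventually) (auto simp: eventually_sequentially)
  qed
 qed (use Hi in auto)
 then have "(\<lambda>m. LINT x|L. \<bar>?c m (H x) - H x\<bar>) \<longlonglongrightarrow> 0" by simp
 from order_tendstoD(2)[OF this e2] obtain m where m: "(LINT x|L. \<bar>?c m (H x) - H x\<bar>) < e / 2"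
  unfolding eventually_sequentially by blast
 have "(\<lambda>x. indicator {a..b} x *\<^sub>R H x) \<in> borel_measurable lebesgue"
  using H unfolding set_integrable_def by (rule borel_measurable_integrable)
 from lebesgue_measurable_imp_measurable_on_real[OF this, of UNIV]
 obtain N g where N: "negligible N" and g: "\<And>n. continuous_on UNIV (g n)"
  "\<And>x. x \<notin> N ==> (\<lambda>n. g n x) \<longlonglongrightarrow> indicator {a..b} x *\<^sub>R H x"
  unfolding measurable_on_def by auto
 have ch: "continuous_on UNIV (\<lambda>x. ?c m (g n x))" for n by (intro continuous_intros g)
 have gm [measurable]: "(\<lambda>x. ?c m (g n x)) \<in> borel_measurable L" for n
  unfolding L_def by (rule measurable_restrict_space1) (rule measurable_completion, use borel_measurable_continuous_onI[OF ch] in simp)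
 have "(\<lambda>n. LINT x|L. \<bar>?c m (g n x) - ?c m (H x)\<bar>) \<longlonglongrightarrow> (LINT x|L. 0)"
 proof (rule integral_dominated_convergence[where w="\<lambda>_. 2 * real m"])
  have "AE x in lebesgue. x \<notin> N" using N by (intro AE_not_in) (simp add: negligible_iff_null_sets)
  then have "AE x in lebesgue. x \<in> {a..b} \<longrightarrow> (\<lambda>n. \<bar>?c m (g n x) - ?c m (H x)\<bar>) \<longlonglongrightarrow> 0"
  proof eventually_elim
   case (elim x)
   show ?case
   proof
    assume "x \<in> {a..b}"
    then have "(\<lambda>n. g n x) \<longlonglongrightarrow> H x" using g(2)[OF elim] by simp
    then have "(\<lambda>n. ?c m (g n x)) \<longlonglongrightarrow> ?c m (H x)" by (intro tendsto_max tendsto_min tendsto_const)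
    then show "(\<lambda>n. \<bar>?c m (g n x) - ?c m (H x)\<bar>) \<longlonglongrightarrow> 0"
     by (intro tendsto_rabs_zero) (simp add: LIM_zero_iff)
   qed
  qed
  then show "AE x in L. (\<lambda>n. \<bar>?c m (g n x) - ?c m (H x)\<bar>) \<longlonglongrightarrow> 0"
   unfolding L_def by (subst AE_restrict_space_iff) auto
  show "AE x in L. norm \<bar>?c m (g n x) - ?c m (H x)\<bar> \<le> 2 * real m" for n
  proof (rule AE_I2)
   fix x show "norm \<bar>?c m (g n x) - ?c m (H x)\<bar> \<le> 2 * real m" 
    using abs_triangle_ineq4[of "?c m (g n x)" "?c m (H x)"] cb[of m "g n x"] cb[of m "H x"]
    unfolding real_norm_def abs_idempotent by linarith
  qed
 qed auto
 then have "(\<lambda>n. LINT x|L. \<bar>?c m (g n x) - ?c m (H x)\<bar>) \<longlonglongrightarrow> 0" by simp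
 from order_tendstoD(2)[OF this e2] obtain n where n: "(LINT x|L. \<bar>?c m (g n x) - ?c m (H x)\<bar>) < e / 2"
  unfolding eventually_sequentially by blast
 have cHi: "integrable L (\<lambda>x. ?c m (H x))" by (rule L.integrable_const_bound[where B="real m"]) (use cb in auto)
 have gi: "integrable L (\<lambda>x. ?c m (g n x))" by (rule L.integrable_const_bound[where B="real m"]) (use cb in auto)
 have "(\<integral>\<^sup>+x. ennreal \<bar>?c m (g n x) - H x\<bar> * indicator {a..b} x \<partial>lebesgue) = (\<integral>\<^sup>+x. ennreal \<bar>?c m (g n x) - H x\<bar> \<partial>L)"
  unfolding L_def by (subst nn_integral_restrict_space) auto
 also have "\<dots> = ennreal (LINT x|L. \<bar>?c m (g n x) - H x\<bar>)"
  by (rule nn_integral_eq_integral) (use gi Hi in auto)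
 also have "\<dots> \<le> ennreal e"
 proof (rule ennreal_leI)
  have "(LINT x|L. \<bar>?c m (g n x) - H x\<bar>) \<le> (LINT x|L. \<bar>?c m (g n x) - ?c m (H x)\<bar> + \<bar>?c m (H x) - H x\<bar>)"
  proof (rule integral_mono)
   fix x
   show "\<bar>?c m (g n x) - H x\<bar> \<le> \<bar>?c m (g n x) - ?c m (H x)\<bar> + \<bar>?c m (H x) - H x\<bar>"
    using abs_triangle_ineq[of "?c m (g n x) - ?c m (H x)" "?c m (H x) - H x"] by simp
  qed (use gi cHi Hi in auto)
  also have "\<dots> = (LINT x|L. \<bar>?c m (g n x) - ?c m (H x)\<bar>) + (LINT x|L. \<bar>?c m (H x) - H x\<bar>)"
   by (rule Bochner_Integration.integral_add) (use gi cHi Hi in auto)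
  finally show "(LINT x|L. \<bar>?c m (g n x) - H x\<bar>) \<le> e" using m n by linarith
 qed
 finally show ?thesis by (rule that[OF ch])
qed

text \<open>The period is normalised to \<open>2 \<pi>\<close> and constants are included, which makes the class
  closed under multiplication by \<open>cos\<close>.\<close>

definition cosine_polynomial :: "(real => real) => bool" where
 "cosine_polynomial f \<longleftrightarrow> (\<exists>N b. \<forall>x. f x = (\<Sum>k\<le>N::nat. b k * cos (real k * x)))"

lemma cosine_polynomial_mode: "cosine_polynomial (\<lambda>x. a * cos (real k * x))"
 unfolding cosine_polynomial_def
proof (intro exI allI)
 show "a * cos (real k * x) = (\<Sum>i\<le>k. (if i = k then a else 0) * cos (real i * x))" for x
  by (simp add: if_distrib[of "\<lambda>c. c * _"] cong: if_cong)
qed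

lemma cosine_polynomial_add:
 assumes "cosine_polynomial f" "cosine_polynomial g"
 shows "cosine_polynomial (\<lambda>x. f x + g x)"
proof -
 obtain N b N' b' where f: "\<And>x. f x = (\<Sum>k\<le>N. b k * cos (real k * x))" and g: "\<And>x. g x = (\<Sum>k\<le>N'. b' k * cos (real k * x))"
  using assms unfolding cosine_polynomial_def by blast
 let ?c = "\<lambda>k. (if k \<le> N then b k else 0) + (if k \<le> N' then b' k else 0)"
 have pad: "(\<Sum>k\<le>n. d k * cos (real k * x)) = (\<Sum>k\<le>N + N'. (if k \<le> n then d k else 0) * cos (real k * x))"
  if "n \<le> N + N'" for n d x
  by (rule sum.mono_neutral_cong_left) (use that in auto)
 have "f x + g x = (\<Sum>k\<le>N + N'. ?c k * cos (real k * x))" for x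
  unfolding f g pad[of N b x, OF le_add1] pad[of N' b' x, OF le_add2] by (simp add: distrib_right sum.distrib)
 then show ?thesis unfolding cosine_polynomial_def by (intro exI[of _ "N + N'"] exI[of _ ?c] allI)
qed

lemma cosine_polynomial_sum:
 assumes "\<And>i. i \<in> I ==> cosine_polynomial (f i)"
 shows "cosine_polynomial (\<lambda>x. \<Sum>i\<in>I. f i x)"
 using assms
proof (induction I rule: infinite_finite_induct)
 case (insert i I)
 then show ?case using cosine_polynomial_add[of "f i" "\<lambda>x. \<Sum>i\<in>I. f i x"] by simp
qed (use cosine_polynomial_mode[of 0 0] in auto)

text \<open>The product formula \<open>2 cos x cos (k x) = cos ((k + 1) x) + cos ((k - 1) x)\<close>.\<close>

lemma cosine_polynomial_mult_mode:
 assumes "cosine_polynomial f"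
 shows "cosine_polynomial (\<lambda>x. c * f x)" "cosine_polynomial (\<lambda>x. cos x * f x)"
proof -
 obtain N b where f: "f = (\<lambda>x. \<Sum>k\<le>N. b k * cos (real k * x))"
  using assms unfolding cosine_polynomial_def by blast
 show "cosine_polynomial (\<lambda>x. c * f x)"
  unfolding f sum_distrib_left mult.assoc[symmetric] by (intro cosine_polynomial_sum cosine_polynomial_mode)
 have "cosine_polynomial (\<lambda>x. cos x * (b k * cos (real k * x)))" for k
 proof (cases k)
  case 0
  then show ?thesis using cosine_polynomial_mode[of "b 0" 1] by (simp add: mult.commute)
 next
  case (Suc m)
  have "cos x * (b k * cos (real k * x)) = b k / 2 * cos (real (Suc k) * x) + b k / 2 * cos (real m * x)" for x
  proof -
   have eq: "real (Suc k) * x = real k * x + x" "real m * x = real k * x - x" by (simp_all add: Suc algebra_simps)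
   show ?thesis unfolding eq cos_add cos_diff by (simp add: algebra_simps)
  qed
  then show ?thesis by (simp only: cosine_polynomial_add cosine_polynomial_mode)
 qed
 then show "cosine_polynomial (\<lambda>x. cos x * f x)"
  unfolding f sum_distrib_left by (intro cosine_polynomial_sum)
qed

lemma cosine_polynomial_of_cos:
 assumes "real_polynomial_function p"
 shows "cosine_polynomial (\<lambda>x. p (cos x))"
proof -
 obtain a n where p: "p = (\<lambda>x. \<Sum>i\<le>n. a i * x ^ i)" using real_polynomial_function_imp_sum[OF assms] by blast
 have "cosine_polynomial (\<lambda>x. cos x ^ i)" for i
 proof (induction i)
  case 0
  show ?case using cosine_polynomial_mode[of 1 0] by simp
 next
  case (Suc i)
  then show ?case using cosine_polynomial_mult_mode(2)[OF Suc] by simp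
 qed
 then show ?thesis unfolding p by (intro cosine_polynomial_sum cosine_polynomial_mult_mode(1))
qed

text \<open>On half a period \<open>u = cos (\<beta> x)\<close> is a change of variable, so Weierstrass
  approximation of \<open>h (arccos u / \<beta>)\<close> by polynomials in \<open>u\<close> applies.\<close>

lemma continuous_cosine_approximation:
 assumes h: "continuous_on UNIV h" and e: "0 < e" and \<beta>: "0 < \<beta>"
 obtains N b where "\<And>x. x \<in> {0..pi / \<beta>} ==> \<bar>(\<Sum>k\<le>N::nat. b k * cos (real k * (\<beta> * x))) - h x\<bar> \<le> e"
proof -
 have "continuous_on {-1..1} (\<lambda>u. h (arccos u / \<beta>))"
  by (intro continuous_on_compose2[OF h] continuous_intros) (use \<beta> in auto)
 then obtain p where p: "real_polynomial_function p" "\<And>u. u \<in> {-1..1} ==> \<bar>h (arccos u / \<beta>) - p u\<bar> < e"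
  using Stone_Weierstrass_real_polynomial_function[of "{-1..1}" "\<lambda>u. h (arccos u / \<beta>)" e] e by auto
 obtain N b where b: "\<And>x. p (cos x) = (\<Sum>k\<le>N. b k * cos (real k * x))"
  using cosine_polynomial_of_cos[OF p(1)] unfolding cosine_polynomial_def by blast
 show ?thesis
 proof (rule that)
  fix x assume x: "x \<in> {0..pi / \<beta>}"
  then have "0 \<le> \<beta> * x" "\<beta> * x \<le> pi" using \<beta> by (auto simp: field_simps)
  then have "arccos (cos (\<beta> * x)) / \<beta> = x" using \<beta> by (simp add: arccos_cos)
  then show "\<bar>(\<Sum>k\<le>N. b k * cos (real k * (\<beta> * x))) - h x\<bar> \<le> e"
   using p(2)[of "cos (\<beta> * x)"] unfolding b[symmetric] by auto
 qed
qed

lemma periodic_multiple: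
 assumes "\<And>x. G (x + T) = G x"
 shows "G (x + real n * T) = G x"
proof (induction n)
 case (Suc n)
 have "G (x + real (Suc n) * T) = G (x + real n * T + T)" by (simp add: algebra_simps)
 then show ?case using Suc assms by simp
qed simp

lemma measurable_on_interval:
 fixes G :: "real => ennreal"
 assumes "G \<in> borel_measurable lebesgue"
 shows "(\<lambda>x. G x * indicator {a..b} x) \<in> borel_measurable lebesgue"
 by (intro borel_measurable_times_ennreal assms borel_measurable_indicator) simp

lemma nn_integral_const_add_on_interval:
 fixes G :: "real => ennreal"
 assumes "G \<in> borel_measurable lebesgue"
 shows "(\<integral>\<^sup>+x. c * indicator {a..b} x + G x * indicator {a..b} x \<partial>lebesgue)
  = c * emeasure lebesgue {a..b} + (\<integral>\<^sup>+x. G x * indicator {a..b} x \<partial>lebesgue)"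
 by (subst nn_integral_add[OF measurable_on_interval[OF measurable_const] measurable_on_interval[OF assms]])
  (simp_all add: nn_integral_cmult_indicator)

lemma nn_integral_reflect_interval:
 fixes G :: "real => ennreal"
 assumes [measurable]: "G \<in> borel_measurable lebesgue" and G: "\<And>x. G (t - x) = G x"
 shows "(\<integral>\<^sup>+x. G x * indicator {a..b} x \<partial>lebesgue) = (\<integral>\<^sup>+x. G x * indicator {t - b..t - a} x \<partial>lebesgue)"
proof -
 have "(\<integral>\<^sup>+x. G x * indicator {a..b} x \<partial>lebesgue) = ennreal \<bar>-1\<bar> * (\<integral>\<^sup>+x. G (t + -1 * x) * indicator {a..b} (t + -1 * x) \<partial>lebesgue)"
  by (rule nn_integral_real_affine_lebesgue[OF measurable_on_interval[OF assms(1)]]) simp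
 also have "\<dots> = (\<integral>\<^sup>+x. G x * indicator {t - b..t - a} x \<partial>lebesgue)"
  using G by (auto intro!: nn_integral_cong simp: indicator_def)
 finally show ?thesis .
qed

lemma nn_integral_shift_interval:
 fixes G :: "real => ennreal"
 assumes [measurable]: "G \<in> borel_measurable lebesgue" and G: "\<And>x. G (t + x) = G x"
 shows "(\<integral>\<^sup>+x. G x * indicator {a..b} x \<partial>lebesgue) = (\<integral>\<^sup>+x. G x * indicator {a - t..b - t} x \<partial>lebesgue)"
proof -
 have "(\<integral>\<^sup>+x. G x * indicator {a..b} x \<partial>lebesgue) = ennreal \<bar>1\<bar> * (\<integral>\<^sup>+x. G (t + 1 * x) * indicator {a..b} (t + 1 * x) \<partial>lebesgue)"
  by (rule nn_integral_real_affine_lebesgue[OF measurable_on_interval[OF assms(1)]]) simp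
 also have "\<dots> = (\<integral>\<^sup>+x. G x * indicator {a - t..b - t} x \<partial>lebesgue)"
  using G by (auto intro!: nn_integral_cong simp: indicator_def)
 finally show ?thesis .
qed

text \<open>The half lines are cut into periods, on which the exponential weight decays geometrically.\<close>

lemma periodic_exponential_bound:
 fixes G :: "real => ennreal"
 assumes [measurable]: "G \<in> borel_measurable lebesgue" and per: "\<And>x. G (x + T) = G x" and ev: "\<And>x. G (- x) = G x" and T: "0 < T"
 shows "(\<integral>\<^sup>+x. G x * ennreal (exp (- \<bar>x\<bar>)) \<partial>lebesgue)
  \<le> ennreal (2 / (1 - exp (- T))) * (\<integral>\<^sup>+x. G x * indicator {0..T} x \<partial>lebesgue)"
proof -
 let ?K = "\<integral>\<^sup>+x. G x * indicator {0..T} x \<partial>lebesgue"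
 note measurable_on_interval[OF assms(1), measurable]
 define q where "q = exp (- T)"
 have q: "0 < q" "q < 1" using T by (simp_all add: q_def)
 let ?I = "\<lambda>n::nat. {real n * T..real (Suc n) * T}" and ?I' = "\<lambda>n::nat. {- (real (Suc n) * T)..- (real n * T)}"
 let ?f = "\<lambda>n x. ennreal (q ^ n) * (G x * indicator (?I n) x + G x * indicator (?I' n) x)"
 have pt: "G x * ennreal (exp (- \<bar>x\<bar>)) \<le> (\<Sum>n. ?f n x)" for x
 proof -
  define n where "n = nat \<lfloor>\<bar>x\<bar> / T\<rfloor>"
  have "0 \<le> \<lfloor>\<bar>x\<bar> / T\<rfloor>" using T by simp
  then have n: "real n \<le> \<bar>x\<bar> / T" "\<bar>x\<bar> / T \<le> real (Suc n)" unfolding n_def by linarith+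
  then have n': "real n * T \<le> \<bar>x\<bar>" "\<bar>x\<bar> \<le> real (Suc n) * T" using T by (simp_all add: field_simps)
  have "exp (- \<bar>x\<bar>) \<le> exp (real n * - T)" using n'(1) by simp
  then have "exp (- \<bar>x\<bar>) \<le> q ^ n" by (simp add: q_def flip: exp_of_nat_mult)
  then have "G x * ennreal (exp (- \<bar>x\<bar>)) \<le> G x * ennreal (q ^ n)" by (intro mult_left_mono ennreal_leI) auto
  also have "\<dots> \<le> ?f n x"
  proof (cases "0 \<le> x")
   case True
   then have "x \<in> ?I n" using n' by auto
   then show ?thesis by (simp add: distrib_left mult.commute)
  next
   case False
   then have "x \<in> ?I' n" using n' by auto
   then show ?thesis by (simp add: distrib_left mult.commute)
  qed
  also have "\<dots> = sum (\<lambda>n. ?f n x) {n}" by simp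
  also have "\<dots> \<le> (\<Sum>n. ?f n x)" by (rule sum_le_suminf) auto
  finally show ?thesis .
 qed
 have shift: "(\<integral>\<^sup>+x. G x * indicator (?I n) x \<partial>lebesgue) = ?K" for n
 proof -
  have "(\<integral>\<^sup>+x. G x * indicator (?I n) x \<partial>lebesgue) = (\<integral>\<^sup>+x. G x * indicator {real n * T - real n * T..real (Suc n) * T - real n * T} x \<partial>lebesgue)"
   by (rule nn_integral_shift_interval) (use periodic_multiple[of G T, OF per] in \<open>simp_all add: add.commute\<close>)
  then show ?thesis by (simp add: algebra_simps)
 qed
 have refl: "(\<integral>\<^sup>+x. G x * indicator (?I' n) x \<partial>lebesgue) = ?K" for n
  using nn_integral_reflect_interval[of G 0 "- (real (Suc n) * T)" "- (real n * T)"] ev shift by simp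
 have "(\<integral>\<^sup>+x. G x * ennreal (exp (- \<bar>x\<bar>)) \<partial>lebesgue) \<le> (\<integral>\<^sup>+x. (\<Sum>n. ?f n x) \<partial>lebesgue)"
  by (intro nn_integral_mono pt)
 also have "\<dots> = (\<Sum>n. \<integral>\<^sup>+x. ?f n x \<partial>lebesgue)" by (rule nn_integral_suminf) measurable
 also have "\<dots> = (\<Sum>n. ennreal (q ^ n) * (?K + ?K))"
 proof (intro suminf_cong)
  fix n
  have "(\<integral>\<^sup>+x. ?f n x \<partial>lebesgue) = ennreal (q ^ n) * (\<integral>\<^sup>+x. G x * indicator (?I n) x + G x * indicator (?I' n) x \<partial>lebesgue)"
   by (rule nn_integral_cmult) measurable
  also have "(\<integral>\<^sup>+x. G x * indicator (?I n) x + G x * indicator (?I' n) x \<partial>lebesgue)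
    = (\<integral>\<^sup>+x. G x * indicator (?I n) x \<partial>lebesgue) + (\<integral>\<^sup>+x. G x * indicator (?I' n) x \<partial>lebesgue)"
   by (rule nn_integral_add) measurable
  finally show "(\<integral>\<^sup>+x. ?f n x \<partial>lebesgue) = ennreal (q ^ n) * (?K + ?K)" unfolding shift refl .
 qed
 also have "\<dots> = (\<Sum>n. ennreal (q ^ n)) * (?K + ?K)" by (rule ennreal_suminf_multc)
 also have "(\<Sum>n. ennreal (q ^ n)) = ennreal (1 / (1 - q))"
  using q geometric_sums[of q] by (intro suminf_ennreal_eq) auto
 also have "ennreal (1 / (1 - q)) * (?K + ?K) = ennreal (1 / (1 - q)) * (ennreal 2 * ?K)" by (simp add: mult_2)
 also have "\<dots> = ennreal (2 / (1 - q)) * ?K"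
  using q by (simp add: mult.assoc[symmetric] ennreal_mult[symmetric] del: ennreal_numeral)
 finally show ?thesis by (simp add: q_def)
qed

lemma cosine_has_integral:
 fixes \<beta> :: real and m :: int
 assumes \<beta>: "0 < \<beta>"
 shows "((\<lambda>x. cos (of_int m * \<beta> * x)) has_integral (if m = 0 then 2 * pi / \<beta> else 0)) {0..2 * pi / \<beta>}"
proof (cases "m = 0")
 case True
 then show ?thesis using \<beta> has_integral_const_real[of "1::real" 0 "2 * pi / \<beta>"] by simp
next
 case False
 let ?c = "of_int m * \<beta>"
 have c: "?c \<noteq> 0" using False \<beta> by simp
 have "((\<lambda>x. cos (?c * x)) has_integral (sin (?c * (2 * pi / \<beta>)) / ?c - sin (?c * 0) / ?c)) {0..2 * pi / \<beta>}"
 proof (rule fundamental_theorem_of_calculus)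
  show "0 \<le> 2 * pi / \<beta>" using \<beta> by simp
  fix x
  have "((\<lambda>x. sin (?c * x) / ?c) has_real_derivative cos (?c * x)) (at x within {0..2 * pi / \<beta>})"
   using c by (auto intro!: derivative_eq_intros)
  then show "((\<lambda>x. sin (?c * x) / ?c) has_vector_derivative cos (?c * x)) (at x within {0..2 * pi / \<beta>})"
   by (simp add: has_real_derivative_iff_has_vector_derivative)
 qed
 moreover have "?c * (2 * pi / \<beta>) = 2 * pi * of_int m" using \<beta> by simp
 ultimately show ?thesis using False by (simp add: sin_int_2pin)
qed

lemma integral_le_L1:
 fixes f :: "real => real"
 assumes f: "f absolutely_integrable_on S" and I: "(f has_integral I) S"
 shows "ennreal \<bar>I\<bar> \<le> (\<integral>\<^sup>+x. ennreal \<bar>f x\<bar> * indicator S x \<partial>lebesgue)"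
proof -
 have i: "(\<lambda>x. \<bar>f x\<bar>) integrable_on S" using f by (simp add: absolutely_integrable_on_def)
 have "\<bar>I\<bar> \<le> integral S (\<lambda>x. \<bar>f x\<bar>)"
  using integral_norm_bound_integral[OF has_integral_integrable[OF I] i] integral_unique[OF I] by simp
 then have "ennreal \<bar>I\<bar> \<le> ennreal (integral S (\<lambda>x. \<bar>f x\<bar>))" by (rule ennreal_leI)
 also have "\<dots> = (\<integral>\<^sup>+x. ennreal \<bar>f x\<bar> * indicator S x \<partial>lborel)"
  by (rule nn_integral_has_integral_lebesgue'[symmetric, OF _ integrable_integral[OF i]]) simp
 also have "\<dots> = (\<integral>\<^sup>+x. ennreal \<bar>f x\<bar> * indicator S x \<partial>lebesgue)" by (rule nn_integral_completion[symmetric])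
 finally show ?thesis .
qed

text \<open>Orthogonality of the cosines over a period.\<close>

lemma cosine_coefficient_bound:
 fixes \<beta> :: real
 assumes \<beta>: "0 < \<beta>" and l: "1 \<le> l" "l \<le> N"
  and m: "0 \<le> m" "(\<integral>\<^sup>+x. ennreal \<bar>\<Sum>k=1..N. b k * cos (real k * \<beta> * x)\<bar> * indicator {0..2 * pi / \<beta>} x \<partial>lebesgue) \<le> ennreal m"
 shows "\<bar>b l\<bar> \<le> \<beta> / pi * m"
proof -
 let ?T = "2 * pi / \<beta>"
 let ?P = "\<lambda>x. \<Sum>k=1..N. b k * cos (real k * \<beta> * x)"
 let ?f = "\<lambda>x. ?P x * cos (real l * \<beta> * x)"
 have prod: "((\<lambda>x. cos (real k * \<beta> * x) * cos (real l * \<beta> * x)) has_integral (if k = l then ?T / 2 else 0)) {0..?T}"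
  if k: "1 \<le> k" for k
 proof -
  have "((\<lambda>x. (cos (of_int (int k - int l) * \<beta> * x) + cos (of_int (int k + int l) * \<beta> * x)) / 2) has_integral
    ((if int k - int l = 0 then ?T else 0) + (if int k + int l = 0 then ?T else 0)) / 2) {0..?T}"
   by (intro has_integral_divide has_integral_add cosine_has_integral \<beta>)
  moreover have "(cos (of_int (int k - int l) * \<beta> * x) + cos (of_int (int k + int l) * \<beta> * x)) / 2 = cos (real k * \<beta> * x) * cos (real l * \<beta> * x)" for x
   by (simp add: distrib_right left_diff_distrib cos_add cos_diff)
  ultimately show ?thesis using l(1) k by auto
 qed
 have "((\<lambda>x. \<Sum>k=1..N. b k * (cos (real k * \<beta> * x) * cos (real l * \<beta> * x))) has_integral (\<Sum>k=1..N. b k * (if k = l then ?T / 2 else 0))) {0..?T}"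
  by (intro has_integral_sum has_integral_mult_right prod) auto
 then have I: "(?f has_integral b l * (?T / 2)) {0..?T}"
  using l by (simp add: sum_distrib_right mult.assoc if_distrib[of "\<lambda>c. _ * c"] cong: if_cong)
 have "?f absolutely_integrable_on {0..?T}"
  by (intro absolutely_integrable_continuous_real continuous_intros)
 from integral_le_L1[OF this I]
 have "ennreal \<bar>b l * (?T / 2)\<bar> \<le> (\<integral>\<^sup>+x. ennreal \<bar>?f x\<bar> * indicator {0..?T} x \<partial>lebesgue)" .
 also have "\<dots> \<le> (\<integral>\<^sup>+x. ennreal \<bar>?P x\<bar> * indicator {0..?T} x \<partial>lebesgue)"
  by (intro nn_integral_mono mult_right_mono ennreal_leI) (simp_all add: abs_mult mult_left_le)
 also have "\<dots> \<le> ennreal m" by (rule m(2))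
 finally have "\<bar>b l * (?T / 2)\<bar> \<le> m" using m(1) by simp
 then show ?thesis using \<beta> by (simp add: abs_mult field_simps)
qed

text \<open>Even periodic functions are determined by half a period, on which cosine polynomials are
  polynomials in one monotone variable.\<close>

lemma even_periodic_cosine_approximation:
 fixes \<beta> :: real
 assumes \<beta>: "0 < \<beta>" and per: "periodic (2 * pi / \<beta>) H" and ev: "even_fun H"
  and H: "H absolutely_integrable_on {0..2 * pi / \<beta>}" "H \<in> borel_measurable lebesgue" and mz: "mean_zero (2 * pi / \<beta>) H" and e: "0 < e"
 obtains N b where "(\<integral>\<^sup>+x. ennreal \<bar>(\<Sum>k=1..N. b k * cos (real k * \<beta> * x)) - H x\<bar> * indicator {0..2 * pi / \<beta>} x \<partial>lebesgue) \<le> ennreal e"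
proof -
 let ?T = "2 * pi / \<beta>"
 let ?N = "\<lambda>f. \<integral>\<^sup>+x. ennreal \<bar>f x\<bar> * indicator {0..?T} x \<partial>lebesgue"
 have T: "0 < ?T" using \<beta> by simp
 have Hhalf: "H absolutely_integrable_on {0..pi / \<beta>}"
  by (rule absolutely_integrable_on_subinterval[OF H(1)]) (use \<beta> in \<open>auto simp: field_simps\<close>)
 define d where "d = e / 8"
 have d: "0 < d" using e by (simp add: d_def)
 obtain h where h: "continuous_on UNIV h" "(\<integral>\<^sup>+x. ennreal \<bar>h x - H x\<bar> * indicator {0..pi / \<beta>} x \<partial>lebesgue) \<le> ennreal d"
  by (rule L1_continuous_approximation[OF Hhalf d])
 have "0 < d / (pi / \<beta>)" using d \<beta> by simp
 then obtain N b where b: "\<And>x. x \<in> {0..pi / \<beta>} ==> \<bar>(\<Sum>k\<le>N::nat. b k * cos (real k * (\<beta> * x))) - h x\<bar> \<le> d / (pi / \<beta>)"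
  using continuous_cosine_approximation[OF h(1) _ \<beta>] by blast
 let ?Q = "\<lambda>x. \<Sum>k\<le>N. b k * cos (real k * \<beta> * x)" and ?P = "\<lambda>x. \<Sum>k=1..N. b k * cos (real k * \<beta> * x)"
 have split: "(\<Sum>k\<le>n. f k) = f 0 + (\<Sum>k=1..n. f k)" for n and f :: "nat => real"
  by (induction n) simp_all
 have P0: "?Q x = b 0 + ?P x" for x
  unfolding split[of "\<lambda>k. b k * cos (real k * \<beta> * x)"] by simp
 have contP: "continuous_on S ?P" "continuous_on S ?Q" for S by (intro continuous_intros)+
 have Pm [measurable]: "?P \<in> borel_measurable lebesgue" "?Q \<in> borel_measurable lebesgue"
  by (rule measurable_completion, simp add: borel_measurable_continuous_onI contP)+
 have hm [measurable]: "h \<in> borel_measurable lebesgue" by (rule measurable_completion) (simp add: borel_measurable_continuous_onI h(1))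
 have Gm: "(\<lambda>x. ennreal \<bar>f x - H x\<bar>) \<in> borel_measurable lebesgue" if "f \<in> borel_measurable lebesgue" for f
  by (intro measurable_compose[OF _ measurable_ennreal] borel_measurable_abs borel_measurable_diff that H(2))
 have half: "(\<integral>\<^sup>+x. ennreal \<bar>?Q x - H x\<bar> * indicator {0..pi / \<beta>} x \<partial>lebesgue) \<le> ennreal (2 * d)"
 proof -
  have "(\<integral>\<^sup>+x. ennreal \<bar>?Q x - H x\<bar> * indicator {0..pi / \<beta>} x \<partial>lebesgue)
    \<le> (\<integral>\<^sup>+x. ennreal (d / (pi / \<beta>)) * indicator {0..pi / \<beta>} x + ennreal \<bar>h x - H x\<bar> * indicator {0..pi / \<beta>} x \<partial>lebesgue)"
  proof (rule nn_integral_mono)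
   fix x
   show "ennreal \<bar>?Q x - H x\<bar> * indicator {0..pi / \<beta>} x
     \<le> ennreal (d / (pi / \<beta>)) * indicator {0..pi / \<beta>} x + ennreal \<bar>h x - H x\<bar> * indicator {0..pi / \<beta>} x"
   proof (cases "x \<in> {0..pi / \<beta>}")
    case True
    have "\<bar>?Q x - H x\<bar> \<le> d / (pi / \<beta>) + \<bar>h x - H x\<bar>" using b[OF True] by (simp only: mult.assoc)
    then have "ennreal \<bar>?Q x - H x\<bar> \<le> ennreal (d / (pi / \<beta>)) + ennreal \<bar>h x - H x\<bar>"
     using d \<beta> by (simp add: ennreal_plus[symmetric] ennreal_leI del: ennreal_plus)
    then show ?thesis using True by simp
   qed simp
  qed
  also have "\<dots> = ennreal (d / (pi / \<beta>)) * emeasure lebesgue {0..pi / \<beta>} + (\<integral>\<^sup>+x. ennreal \<bar>h x - H x\<bar> * indicator {0..pi / \<beta>} x \<partial>lebesgue)"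
   by (rule nn_integral_const_add_on_interval[OF Gm[OF hm]])
  also have "ennreal (d / (pi / \<beta>)) * emeasure lebesgue {0..pi / \<beta>} = ennreal d"
   using \<beta> d by (simp add: ennreal_mult[symmetric])
  also have "ennreal d + (\<integral>\<^sup>+x. ennreal \<bar>h x - H x\<bar> * indicator {0..pi / \<beta>} x \<partial>lebesgue) \<le> ennreal d + ennreal d" by (rule add_left_mono[OF h(2)])
  also have "\<dots> = ennreal (2 * d)" using d by (simp flip: ennreal_plus)
  finally show ?thesis .
 qed
 have sym: "\<bar>?Q (?T - x) - H (?T - x)\<bar> = \<bar>?Q x - H x\<bar>" for x
 proof -
  have "cos (real k * \<beta> * (?T - x)) = cos (real k * \<beta> * x)" for k
  proof -
   have "real k * \<beta> * (?T - x) = 2 * pi * of_int (int k) - real k * \<beta> * x" using \<beta> by (simp add: field_simps)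
   then show ?thesis by (simp only: cos_diff sin_int_2pin cos_int_2pin mult_1 mult_zero_left add_0_right)
  qed
  moreover have "H (?T - x) = H x" using per ev unfolding periodic_def even_fun_def by (metis add.commute diff_conv_add_uminus)
  ultimately show ?thesis by simp
 qed
 have full0: "?N (\<lambda>x. ?Q x - H x) \<le> ennreal (4 * d)"
 proof -
  let ?G = "\<lambda>x. ennreal \<bar>?Q x - H x\<bar>"
  have "?N (\<lambda>x. ?Q x - H x) \<le> (\<integral>\<^sup>+x. ?G x * indicator {0..pi / \<beta>} x + ?G x * indicator {pi / \<beta>..?T} x \<partial>lebesgue)"
   by (intro nn_integral_mono) (auto simp: indicator_def)
  also have "\<dots> = (\<integral>\<^sup>+x. ?G x * indicator {0..pi / \<beta>} x \<partial>lebesgue) + (\<integral>\<^sup>+x. ?G x * indicator {pi / \<beta>..?T} x \<partial>lebesgue)"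
   by (rule nn_integral_add[OF measurable_on_interval[OF Gm[OF Pm(2)]] measurable_on_interval[OF Gm[OF Pm(2)]]])
  also have "(\<integral>\<^sup>+x. ?G x * indicator {pi / \<beta>..?T} x \<partial>lebesgue) = (\<integral>\<^sup>+x. ?G x * indicator {?T - ?T..?T - pi / \<beta>} x \<partial>lebesgue)"
   by (rule nn_integral_reflect_interval[OF Gm[OF Pm(2)]]) (simp only: sym)
  also have "{?T - ?T..?T - pi / \<beta>} = {0..pi / \<beta>}" by (simp add: diff_divide_distrib[symmetric])
  also have "(\<integral>\<^sup>+x. ?G x * indicator {0..pi / \<beta>} x \<partial>lebesgue) + (\<integral>\<^sup>+x. ?G x * indicator {0..pi / \<beta>} x \<partial>lebesgue) \<le> ennreal (2 * d) + ennreal (2 * d)"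
   by (rule add_mono[OF half half])
  also have "\<dots> = ennreal (4 * d)" using d by (simp flip: ennreal_plus)
  finally show ?thesis .
 qed
 \<comment> \<open>The constant term is small because both functions have nearly the same mean.\<close>
 have b0: "ennreal (\<bar>b 0\<bar> * ?T) \<le> ennreal (4 * d)"
 proof -
  have HI: "(H has_integral 0) {0..?T}"
   using set_lebesgue_integral_eq_integral[OF H(1)] mz by (simp add: mean_zero_def has_integral_iff)
  have "((\<lambda>x. \<Sum>k\<le>N. b k * cos (of_int (int k) * \<beta> * x)) has_integral (\<Sum>k\<le>N. b k * (if int k = 0 then ?T else 0))) {0..?T}"
   by (intro has_integral_sum has_integral_mult_right cosine_has_integral \<beta>) auto
  then have "(?Q has_integral b 0 * ?T) {0..?T}" by (simp add: if_distrib[of "\<lambda>c. _ * c"] cong: if_cong)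
  from has_integral_diff[OF this HI] have I: "((\<lambda>x. ?Q x - H x) has_integral b 0 * ?T) {0..?T}" by simp
  have "(\<lambda>x. ?Q x - H x) absolutely_integrable_on {0..?T}"
   by (rule set_integral_diff(1)[OF absolutely_integrable_continuous_real[OF contP(2)] H(1)])
  from integral_le_L1[OF this I] full0 have "ennreal \<bar>b 0 * ?T\<bar> \<le> ennreal (4 * d)" by (rule order_trans)
  then show ?thesis using T by (simp only: abs_mult abs_of_pos)
 qed
 have "?N (\<lambda>x. ?P x - H x) \<le> (\<integral>\<^sup>+x. ennreal \<bar>b 0\<bar> * indicator {0..?T} x + ennreal \<bar>?Q x - H x\<bar> * indicator {0..?T} x \<partial>lebesgue)"
 proof (rule nn_integral_mono)
  fix x
  have "\<bar>?P x - H x\<bar> \<le> \<bar>b 0\<bar> + \<bar>?Q x - H x\<bar>" using P0[of x] by linarith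
  then have "ennreal \<bar>?P x - H x\<bar> \<le> ennreal \<bar>b 0\<bar> + ennreal \<bar>?Q x - H x\<bar>"
   by (simp add: ennreal_plus[symmetric] ennreal_leI del: ennreal_plus)
  then show "ennreal \<bar>?P x - H x\<bar> * indicator {0..?T} x \<le> ennreal \<bar>b 0\<bar> * indicator {0..?T} x + ennreal \<bar>?Q x - H x\<bar> * indicator {0..?T} x"
   unfolding distrib_right[symmetric] by (rule mult_right_mono) simp
 qed
 also have "\<dots> = ennreal \<bar>b 0\<bar> * emeasure lebesgue {0..?T} + ?N (\<lambda>x. ?Q x - H x)"
  by (rule nn_integral_const_add_on_interval[OF Gm[OF Pm(2)]])
 also have "ennreal \<bar>b 0\<bar> * emeasure lebesgue {0..?T} = ennreal (\<bar>b 0\<bar> * ?T)"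
  using T by (simp add: ennreal_mult[symmetric])
 also have "ennreal (\<bar>b 0\<bar> * ?T) + ?N (\<lambda>x. ?Q x - H x) \<le> ennreal (4 * d) + ennreal (4 * d)" by (rule add_mono[OF b0 full0])
 also have "\<dots> = ennreal e" using d by (simp add: d_def flip: ennreal_plus)
 finally show ?thesis by (rule that)
qed

section \<open>Integrable periodic functions of the field\<close>

lemma locally_integrable_measurable:
 assumes "locally_integrable H"
 shows "H \<in> borel_measurable lebesgue"
proof (rule borel_measurable_LIMSEQ_real)
 fix x :: real
 obtain n :: nat where "\<bar>x\<bar> \<le> real n" using real_arch_simple by blast
 then have "indicator {- real m..real m} x *\<^sub>R H x = H x" if "n \<le> m" for m
  using that by (auto simp: indicator_def)
 then show "(\<lambda>m. indicator {- real m..real m} x *\<^sub>R H x) \<longlonglongrightarrow> H x"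
  by (intro tendsto_eventually) (auto simp: eventually_sequentially)
next
 fix m :: nat
 have "H absolutely_integrable_on {- real m..real m}" using assms by (simp add: locally_integrable_def)
 then show "(\<lambda>x. indicator {- real m..real m} x *\<^sub>R H x) \<in> borel_measurable lebesgue"
  unfolding set_integrable_def by (rule borel_measurable_integrable)
qed

text \<open>One sequence of cosine polynomials is fixed before any test function, so that the constant
  \<open>a\<close> is common to all of them. The coefficients converge because they are bounded by the
  \<open>L\<^sup>1\<close> norm.\<close>

lemma even_periodic_cosine_sequence:
 fixes \<beta> :: real
 assumes \<beta>: "0 < \<beta>" and per: "periodic (2 * pi / \<beta>) H" and ev: "even_fun H"
  and H: "locally_integrable H" and mz: "mean_zero (2 * pi / \<beta>) H"
 obtains N :: "nat => nat" and b :: "nat => nat => real" and a where "\<And>j k. N j < k ==> b j k = 0"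
  "\<And>j. (\<integral>\<^sup>+x. ennreal \<bar>(\<Sum>k=1..N j. b j k * cos (real k * \<beta> * x)) - H x\<bar> * indicator {0..2 * pi / \<beta>} x \<partial>lebesgue) \<le> ennreal (1 / real (Suc j))"
  "\<And>i j k. \<bar>b i k - b j k\<bar> \<le> \<beta> / pi * (1 / real (Suc i) + 1 / real (Suc j))"
  "(\<lambda>j. b j 1) \<longlonglongrightarrow> a"
proof -
 let ?I = "indicator {0..2 * pi / \<beta>} :: real => ennreal"
 have H1: "H absolutely_integrable_on {0..2 * pi / \<beta>}" using H by (simp add: locally_integrable_def)
 have H2: "H \<in> borel_measurable lebesgue" by (rule locally_integrable_measurable[OF H])
 have "\<exists>p. (\<integral>\<^sup>+x. ennreal \<bar>(\<Sum>k=1..fst p. snd p k * cos (real k * \<beta> * x)) - H x\<bar> * ?I x \<partial>lebesgue) \<le> ennreal (1 / real (Suc j))" for j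
 proof -
  have "0 < 1 / real (Suc j)" by simp
  from even_periodic_cosine_approximation[OF \<beta> per ev H1 H2 mz this]
  obtain N b where "(\<integral>\<^sup>+x. ennreal \<bar>(\<Sum>k=1..N. b k * cos (real k * \<beta> * x)) - H x\<bar> * ?I x \<partial>lebesgue) \<le> ennreal (1 / real (Suc j))" by blast
  then show ?thesis by (intro exI[of _ "(N, b)"]) simp
 qed
 then have "\<forall>j. \<exists>p. (\<integral>\<^sup>+x. ennreal \<bar>(\<Sum>k=1..fst p. snd p k * cos (real k * \<beta> * x)) - H x\<bar> * ?I x \<partial>lebesgue) \<le> ennreal (1 / real (Suc j))"
  by blast
 from choice[OF this] obtain p where p: "\<And>j. (\<integral>\<^sup>+x. ennreal \<bar>(\<Sum>k=1..fst (p j). snd (p j) k * cos (real k * \<beta> * x)) - H x\<bar> * ?I x \<partial>lebesgue) \<le> ennreal (1 / real (Suc j))"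
  by blast
 define N where "N j = fst (p j)" for j :: nat
 define b where "b j k = (if k \<in> {1..N j} then snd (p j) k else 0)" for j k
 let ?P = "\<lambda>j x. \<Sum>k=1..N j. b j k * cos (real k * \<beta> * x)"
 have P: "?P j x = (\<Sum>k=1..fst (p j). snd (p j) k * cos (real k * \<beta> * x))" for j x
  by (intro sum.cong) (auto simp: N_def b_def)
 have close: "(\<integral>\<^sup>+x. ennreal \<bar>?P j x - H x\<bar> * ?I x \<partial>lebesgue) \<le> ennreal (1 / real (Suc j))" for j
  unfolding P by (rule p)
 have "continuous_on UNIV (?P j)" for j by (intro continuous_intros)
 then have Pm: "?P j \<in> borel_measurable lebesgue" for j
  by (intro measurable_completion) (simp add: borel_measurable_continuous_onI)
 have Gm: "(\<lambda>x. ennreal \<bar>?P j x - H x\<bar> * ?I x) \<in> borel_measurable lebesgue" for j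
  by (intro measurable_on_interval measurable_compose[OF _ measurable_ennreal] borel_measurable_abs borel_measurable_diff Pm H2)
 have coeff: "\<bar>b i k - b j k\<bar> \<le> \<beta> / pi * (1 / real (Suc i) + 1 / real (Suc j))" for i j k
 proof (cases "k \<in> {1..max (N i) (N j)}")
  case True
  have pad: "?P j x = (\<Sum>k=1..max (N i) (N j). b j k * cos (real k * \<beta> * x))" if "N j \<le> max (N i) (N j)" for i j x
   by (rule sum.mono_neutral_left) (auto simp: b_def)
  have d: "(\<Sum>k=1..max (N i) (N j). (b i k - b j k) * cos (real k * \<beta> * x)) = ?P i x - ?P j x" for x
   using pad[of j i x] pad[of i j x] by (simp add: left_diff_distrib sum_subtractf max.commute)
  show ?thesis
  proof (rule cosine_coefficient_bound[OF \<beta>, of k "max (N i) (N j)" _ "\<lambda>k. b i k - b j k"])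
   have "(\<integral>\<^sup>+x. ennreal \<bar>?P i x - ?P j x\<bar> * ?I x \<partial>lebesgue)
     \<le> (\<integral>\<^sup>+x. ennreal \<bar>?P i x - H x\<bar> * ?I x + ennreal \<bar>?P j x - H x\<bar> * ?I x \<partial>lebesgue)"
   proof (rule nn_integral_mono)
    fix x
    have "\<bar>?P i x - ?P j x\<bar> \<le> \<bar>?P i x - H x\<bar> + \<bar>?P j x - H x\<bar>" by linarith
    then have "ennreal \<bar>?P i x - ?P j x\<bar> \<le> ennreal \<bar>?P i x - H x\<bar> + ennreal \<bar>?P j x - H x\<bar>"
     by (simp add: ennreal_plus[symmetric] ennreal_leI del: ennreal_plus)
    then show "ennreal \<bar>?P i x - ?P j x\<bar> * ?I x \<le> ennreal \<bar>?P i x - H x\<bar> * ?I x + ennreal \<bar>?P j x - H x\<bar> * ?I x"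
     unfolding distrib_right[symmetric] by (rule mult_right_mono) simp
   qed
   also have "\<dots> = (\<integral>\<^sup>+x. ennreal \<bar>?P i x - H x\<bar> * ?I x \<partial>lebesgue) + (\<integral>\<^sup>+x. ennreal \<bar>?P j x - H x\<bar> * ?I x \<partial>lebesgue)"
    by (rule nn_integral_add[OF Gm Gm])
   also have "\<dots> \<le> ennreal (1 / real (Suc i)) + ennreal (1 / real (Suc j))" by (rule add_mono[OF close close])
   also have "\<dots> = ennreal (1 / real (Suc i) + 1 / real (Suc j))" by (rule ennreal_plus[symmetric]) simp_all
   finally show "(\<integral>\<^sup>+x. ennreal \<bar>\<Sum>k=1..max (N i) (N j). (b i k - b j k) * cos (real k * \<beta> * x)\<bar> * ?I x \<partial>lebesgue)
     \<le> ennreal (1 / real (Suc i) + 1 / real (Suc j))" unfolding d .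
  qed (use True in auto)
 next
  case False
  then have "b i k = 0" "b j k = 0" by (auto simp: b_def)
  then show ?thesis using \<beta> by simp
 qed
 have "Cauchy (\<lambda>j. b j 1)"
 proof (rule metric_CauchyI)
  fix e :: real assume e: "0 < e"
  have "(\<lambda>j. \<beta> / pi * (1 / real (Suc j))) \<longlonglongrightarrow> \<beta> / pi * 0"
   by (intro tendsto_mult tendsto_const) (use LIMSEQ_inverse_real_of_nat in \<open>simp add: inverse_eq_divide\<close>)
  then have lim: "(\<lambda>j. \<beta> / pi * (1 / real (Suc j))) \<longlonglongrightarrow> 0" by simp
  have e2: "0 < e / 2" using e by simp
  from order_tendstoD(2)[OF lim e2] obtain J where J: "\<And>j. J \<le> j ==> \<beta> / pi * (1 / real (Suc j)) < e / 2"
   unfolding eventually_sequentially by blast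
  show "\<exists>J. \<forall>i\<ge>J. \<forall>j\<ge>J. dist (b i 1) (b j 1) < e"
  proof (intro exI[of _ J] allI impI)
   fix i j assume "J \<le> i" "J \<le> j"
   then have "\<beta> / pi * (1 / real (Suc i)) < e / 2" "\<beta> / pi * (1 / real (Suc j)) < e / 2" using J by blast+
   then show "dist (b i 1) (b j 1) < e" using coeff[of i 1 j] unfolding distrib_left dist_real_def by linarith
  qed
 qed
 then obtain a where a: "(\<lambda>j. b j 1) \<longlonglongrightarrow> a" using Cauchy_convergent convergent_def by blast
 have "b j k = 0" if "N j < k" for j k using that by (simp add: b_def)
 then show ?thesis by (rule that[OF _ close coeff a])
qed

text \<open>The value at \<open>0\<close> is kept, because a degenerate Gaussian charges this point.\<close>

lemma borel_version:
 fixes H :: "real => real"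
 assumes H: "H \<in> borel_measurable lebesgue"
 obtains H' N where "H' \<in> borel_measurable borel" "N \<in> null_sets lborel" "0 \<notin> N" "\<And>x. x \<notin> N ==> H x = H' x"
proof -
 obtain g where g: "g \<in> borel_measurable lborel" "AE x in lborel. H x = g x"
  using completion_ex_borel_measurable_real[OF H] by blast
 obtain N where N: "N \<in> null_sets lborel" "{x \<in> space lborel. H x \<noteq> g x} \<subseteq> N"
  using AE_E2[OF g(2)] AE_E[OF g(2)] by (metis (lifting) null_setsI)
 show ?thesis
 proof (rule that[of "\<lambda>x. if x = 0 then H 0 else g x" "N - {0}"])
  have "g \<in> borel_measurable borel" using g(1) by simp
  then show "(\<lambda>x. if x = 0 then H 0 else g x) \<in> borel_measurable borel" by measurable
  show "N - {0} \<in> null_sets lborel" by (rule null_set_Diff[OF N(1)]) simp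
  show "H x = (if x = 0 then H 0 else g x)" if "x \<notin> N - {0}" for x using that N(2) by auto
 qed simp
qed

text \<open>From \<open>(|t| - v)\<^sup>2 \<ge> 0\<close>.\<close>

lemma normal_density_exp_bound:
 assumes v: "1 \<le> v" "v \<le> S"
 shows "normal_density 0 (sqrt v) t \<le> exp (S / 2) * exp (- \<bar>t\<bar>)"
proof -
 have "0 \<le> (\<bar>t\<bar> - v)\<^sup>2" by simp
 then have "2 * v * \<bar>t\<bar> - v * v \<le> t\<^sup>2" by (simp add: power2_eq_square algebra_simps)
 then have "\<bar>t\<bar> - v / 2 \<le> t\<^sup>2 / (2 * v)" using v by (simp add: field_simps)
 then have e: "exp (- t\<^sup>2 / (2 * v)) \<le> exp (S / 2 + - \<bar>t\<bar>)" using v by simp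
 have "1 \<le> 2 * pi * v" using v pi_gt3 mult_mono[of 1 "2 * pi" 1 v] by simp
 then have "1 \<le> sqrt (2 * pi * v)" by simp
 then have "1 / sqrt (2 * pi * v) \<le> 1" by simp
 then have "1 / sqrt (2 * pi * v) * exp (- t\<^sup>2 / (2 * v)) \<le> 1 * exp (S / 2 + - \<bar>t\<bar>)"
  using v by (intro mult_mono e) auto
 then show ?thesis using v by (simp add: normal_density_def mult_exp_exp)
qed

context log_field
begin

text \<open>A nondegenerate Gaussian has a density, and a degenerate one is \<open>0\<close> almost surely.\<close>

lemma avoids_null_set:
 assumes f: "test_function UNIV f" and N: "N \<in> null_sets lborel" "0 \<notin> N"
 shows "AE w in M. X w f \<notin> N"
 using gaussian[OF f] unfolding centered_gaussian_def
proof (elim conjE disjE exE)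
 assume "AE w in M. X w f = 0"
 then show ?thesis by eventually_elim (use N(2) in simp)
next
 fix \<sigma> :: real assume "distributed M lborel (\<lambda>w. X w f) (\<lambda>x. ennreal (normal_density 0 \<sigma> x))"
 then have d: "distr M lborel (\<lambda>w. X w f) = density lborel (\<lambda>x. ennreal (normal_density 0 \<sigma> x))"
  and m: "(\<lambda>w. X w f) \<in> measurable M lborel"
  unfolding distributed_def by auto
 have "AE x in lborel. x \<notin> N" by (rule AE_not_in[OF N(1)])
 then have "AE x in density lborel (\<lambda>x. ennreal (normal_density 0 \<sigma> x)). x \<notin> N"
  by (subst AE_density) (auto elim: eventually_mono)
 then have ae: "AE x in distr M lborel (\<lambda>w. X w f). x \<notin> N" unfolding d .
 have S: "{x \<in> space lborel. x \<notin> N} \<in> sets lborel"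
  using N(1) by (intro sets.sets_Collect_neg) auto
 show ?thesis by (rule iffD1[OF AE_distr_iff[OF m S] ae])
qed

text \<open>By Fubini's theorem, almost every realization takes values in the exceptional set only on a null set
  of points.\<close>

lemma approx_pairing_version:
 assumes \<phi>: "test_function U \<phi>" and \<eta>: "mollifier \<eta>" "0 < e" and H': "H' \<in> borel_measurable borel"
  and N: "N \<in> null_sets lborel" "0 \<notin> N" "\<And>x. x \<notin> N ==> H x = H' x"
 shows "AE w in M. approx_pairing M U X \<eta> e \<beta> H \<phi> w = pairing \<beta> \<eta> e \<phi> H' w"
proof -
 let ?Z = "\<lambda>w x. X w (mol \<eta> e x)"
 have Zm [measurable]: "(\<lambda>(w, x). ?Z w x) \<in> borel_measurable (M \<Otimes>\<^sub>M borel)" by (rule mol_field_measurable[OF \<eta>])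
 have [measurable]: "weight \<beta> \<eta> e \<phi> \<in> borel_measurable borel" by (rule weight_measurable[OF \<eta> test_function_D(1)[OF \<phi>]])
 have Nm [measurable]: "N \<in> sets borel" using N(1) by auto
 have "AE x in lborel. AE w in M. ?Z w x \<notin> N"
  by (intro AE_I2 avoids_null_set[OF mol_test_function[OF \<eta>] N(1,2)])
 moreover have "pair_sigma_finite M lborel"
  by (intro pair_sigma_finite.intro sigma_finite_measure_axioms lborel.sigma_finite_measure_axioms)
 moreover have "{p \<in> space (M \<Otimes>\<^sub>M lborel). ?Z (fst p) (snd p) \<notin> N} \<in> sets (M \<Otimes>\<^sub>M lborel)" by measurable
 ultimately have "AE w in M. AE x in lborel. ?Z w x \<notin> N"
  using pair_sigma_finite.AE_commute[of M lborel "\<lambda>w x. ?Z w x \<notin> N"] by simp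
 then show ?thesis
  using AE_space
 proof eventually_elim
  case (elim w)
  have [measurable]: "(\<lambda>x. ?Z w x) \<in> borel_measurable borel" using elim(2) by measurable
  let ?f = "\<lambda>x. weight \<beta> \<eta> e \<phi> x * complex_of_real (H (?Z w x))" and ?f' = "\<lambda>x. weight \<beta> \<eta> e \<phi> x * complex_of_real (H' (?Z w x))"
  have f': "?f' \<in> borel_measurable lborel" using H' by measurable
  have ae: "AE x in lebesgue. ?f' x = ?f x"
  proof (rule AE_completion)
   show "AE x in lborel. ?f' x = ?f x" using elim(1) by eventually_elim (simp add: N(3))
  qed
  have f: "?f \<in> borel_measurable lebesgue" by (rule borel_measurable_AE[OF measurable_completion[OF f'] ae])
  have "approx_pairing M U X \<eta> e \<beta> H \<phi> w = (LINT x|lebesgue. ?f x)" by (rule approx_pairing_eq_lebesgue[OF \<phi>])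
  also have "\<dots> = (LINT x|lebesgue. ?f' x)"
   by (rule Bochner_Integration.integral_cong_AE[OF f measurable_completion[OF f']]) (use ae in eventually_elim, rule sym)
  also have "\<dots> = pairing \<beta> \<eta> e \<phi> H' w" unfolding pairing_def by (rule integral_completion[OF f'])
  finally show ?case .
 qed
qed

text \<open>At a fixed scale the variances on the support are bounded away from \<open>0\<close> and \<open>\<infinity>\<close>, so the Gaussian
  densities have a common integrable majorant.\<close>

lemma pairing_L1_majorant:
 assumes \<phi>: "test_function U \<phi>" and \<eta>: "mollifier \<eta>"
 obtains \<rho> K where "0 < \<rho>" "\<And>e. 0 \<le> K e"
  "\<And>e F. 0 < e ==> e < \<rho> ==> F \<in> borel_measurable borel ==>
   (\<integral>\<^sup>+w. (\<integral>\<^sup>+x. ennreal (norm (weight \<beta> \<eta> e \<phi> x * complex_of_real (F (X w (mol \<eta> e x))))) \<partial>lborel) \<partial>M)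
    \<le> ennreal (K e) * (\<integral>\<^sup>+t. ennreal \<bar>F t\<bar> * ennreal (exp (- \<bar>t\<bar>)) \<partial>lborel)"
proof -
 note D = test_function_D[OF \<phi>]
 obtain \<rho>1 c where c: "0 < \<rho>1" "0 \<le> c"
  "\<And>e \<delta> x y. 0 < e ==> e < \<rho>1 ==> 0 < \<delta> ==> \<delta> < \<rho>1 ==> x \<in> fun_support \<phi> ==> y \<in> fun_support \<phi> ==>
   cov (mol \<eta> e x) (mol \<eta> \<delta> y) \<le> - ln e + c"
  "\<And>e \<delta> x y. 0 < e ==> e < \<rho>1 ==> 0 < \<delta> ==> \<delta> < \<rho>1 ==> x \<in> fun_support \<phi> ==> y \<in> fun_support \<phi> ==>
   - ln (norm (x - y) + e + \<delta>) - c \<le> cov (mol \<eta> e x) (mol \<eta> \<delta> y)"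
  by (rule cov_log_bounds[OF D(2,3) \<eta> \<eta>]) blast
 obtain \<rho>2 where r2: "0 < \<rho>2" "\<And>e. 0 < e ==> e < \<rho>2 ==> integrable lborel (weight \<beta> \<eta> e \<phi>)"
  by (rule weight_integrable[OF \<phi> \<eta>]) blast
 define \<rho> where "\<rho> = min (min \<rho>1 \<rho>2) (exp (- (1 + c)) / 2)"
 define K where "K e = exp ((- ln e + c) / 2) * (LINT x|lborel. norm (weight \<beta> \<eta> e \<phi> x))" for e
 show ?thesis
 proof (rule that)
  show "0 < \<rho>" using c(1) r2(1) by (simp add: \<rho>_def)
  show "0 \<le> K e" for e by (simp add: K_def)
  fix e :: real and F :: "real => real"
  assume e: "0 < e" "e < \<rho>" and [measurable]: "F \<in> borel_measurable borel"
  have e1: "e < \<rho>1" "e < \<rho>2" "2 * e \<le> exp (- (1 + c))" using e by (auto simp: \<rho>_def)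
  have W: "integrable lborel (weight \<beta> \<eta> e \<phi>)" by (rule r2(2)[OF e(1) e1(2)])
  let ?W = "weight \<beta> \<eta> e \<phi>" and ?Z = "\<lambda>w x. X w (mol \<eta> e x)"
  let ?I = "\<integral>\<^sup>+t. ennreal \<bar>F t\<bar> * ennreal (exp (- \<bar>t\<bar>)) \<partial>lborel"
  have [measurable]: "?W \<in> borel_measurable borel" by (rule weight_measurable[OF \<eta> e(1) D(1)])
  have [measurable]: "(\<lambda>(w, x). ?Z w x) \<in> borel_measurable (M \<Otimes>\<^sub>M borel)" by (rule mol_field_measurable[OF \<eta> e(1)])
  have [measurable]: "(\<lambda>w. ?Z w x) \<in> borel_measurable M" for x by (rule X_measurable[OF mol_test_function[OF \<eta> e(1)]])
  have one: "(\<integral>\<^sup>+w. ennreal \<bar>F (?Z w x)\<bar> \<partial>M) \<le> ennreal (exp ((- ln e + c) / 2)) * ?I" if x: "x \<in> fun_support \<phi>" for x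
  proof -
   define v where "v = (LINT w|M. (?Z w x)\<^sup>2)"
   have vc: "v = cov (mol \<eta> e x) (mol \<eta> e x)" by (simp add: v_def cov_def power2_eq_square)
   have "ln (2 * e) \<le> ln (exp (- (1 + c)))" using e1(3) e(1) by (intro ln_mono) auto
   then have v1: "1 \<le> v" using c(4)[OF e(1) e1(1) e(1) e1(1) x x] unfolding vc by simp
   have v2: "v \<le> - ln e + c" using c(3)[OF e(1) e1(1) e(1) e1(1) x x] unfolding vc .
   have d: "distributed M lborel (\<lambda>w. ?Z w x) (\<lambda>t. ennreal (normal_density 0 (sqrt v) t))"
    using centered_gaussian_moments(3)[OF prob_space_axioms gaussian[OF mol_test_function[OF \<eta> e(1)]], of x] v1 unfolding v_def by simp
   have "(\<integral>\<^sup>+w. ennreal \<bar>F (?Z w x)\<bar> \<partial>M) = (\<integral>\<^sup>+t. ennreal (normal_density 0 (sqrt v) t) * ennreal \<bar>F t\<bar> \<partial>lborel)"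
    by (rule distributed_nn_integral[OF d, symmetric]) measurable
   also have "\<dots> \<le> (\<integral>\<^sup>+t. ennreal (exp ((- ln e + c) / 2)) * (ennreal \<bar>F t\<bar> * ennreal (exp (- \<bar>t\<bar>))) \<partial>lborel)"
   proof (rule nn_integral_mono)
    fix t
    have "ennreal (normal_density 0 (sqrt v) t) \<le> ennreal (exp ((- ln e + c) / 2) * exp (- \<bar>t\<bar>))"
     by (rule ennreal_leI[OF normal_density_exp_bound[OF v1 v2]])
    also have "\<dots> = ennreal (exp ((- ln e + c) / 2)) * ennreal (exp (- \<bar>t\<bar>))" by (rule ennreal_mult) simp_all
    finally show "ennreal (normal_density 0 (sqrt v) t) * ennreal \<bar>F t\<bar> \<le> ennreal (exp ((- ln e + c) / 2)) * (ennreal \<bar>F t\<bar> * ennreal (exp (- \<bar>t\<bar>)))"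
     using mult_right_mono[of _ _ "ennreal \<bar>F t\<bar>"] by (simp only: mult_ac) (metis mult.assoc mult.commute zero_le)
   qed
   also have "\<dots> = ennreal (exp ((- ln e + c) / 2)) * ?I" by (rule nn_integral_cmult) measurable
   finally show ?thesis .
  qed
  have "(\<integral>\<^sup>+w. (\<integral>\<^sup>+x. ennreal (norm (?W x * complex_of_real (F (?Z w x)))) \<partial>lborel) \<partial>M)
    = (\<integral>\<^sup>+x. (\<integral>\<^sup>+w. ennreal (norm (?W x * complex_of_real (F (?Z w x)))) \<partial>M) \<partial>lborel)"
  proof (rule pair_sigma_finite.Fubini'[symmetric])
   show "pair_sigma_finite M lborel"
    by (intro pair_sigma_finite.intro sigma_finite_measure_axioms lborel.sigma_finite_measure_axioms)
  qed measurable
  also have "\<dots> \<le> (\<integral>\<^sup>+x. ennreal (norm (?W x)) * (ennreal (exp ((- ln e + c) / 2)) * ?I) \<partial>lborel)"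
  proof (rule nn_integral_mono)
   fix x
   have "(\<integral>\<^sup>+w. ennreal (norm (?W x * complex_of_real (F (?Z w x)))) \<partial>M) = (\<integral>\<^sup>+w. ennreal (norm (?W x)) * ennreal \<bar>F (?Z w x)\<bar> \<partial>M)"
    by (intro nn_integral_cong) (simp add: norm_mult ennreal_mult)
   also have "\<dots> = ennreal (norm (?W x)) * (\<integral>\<^sup>+w. ennreal \<bar>F (?Z w x)\<bar> \<partial>M)" by (rule nn_integral_cmult) measurable
   also have "\<dots> \<le> ennreal (norm (?W x)) * (ennreal (exp ((- ln e + c) / 2)) * ?I)"
   proof (cases "\<phi> x = 0")
    case False
    then show ?thesis by (intro mult_left_mono one D(4)) simp_all
   qed (simp add: weight_def)
   finally show "(\<integral>\<^sup>+w. ennreal (norm (?W x * complex_of_real (F (?Z w x)))) \<partial>M) \<le> ennreal (norm (?W x)) * (ennreal (exp ((- ln e + c) / 2)) * ?I)" .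
  qed
  also have "\<dots> = (\<integral>\<^sup>+x. ennreal (norm (?W x)) \<partial>lborel) * (ennreal (exp ((- ln e + c) / 2)) * ?I)" by (rule nn_integral_multc) measurable
  also have "(\<integral>\<^sup>+x. ennreal (norm (?W x)) \<partial>lborel) = ennreal (LINT x|lborel. norm (?W x))"
   by (rule nn_integral_eq_integral[OF integrable_norm[OF W]]) simp
  also have "ennreal (LINT x|lborel. norm (?W x)) * (ennreal (exp ((- ln e + c) / 2)) * ?I) = ennreal (K e) * ?I"
   unfolding K_def mult.assoc[symmetric] by (subst ennreal_mult[symmetric]) (simp_all add: mult.commute)
  finally show "(\<integral>\<^sup>+w. (\<integral>\<^sup>+x. ennreal (norm (?W x * complex_of_real (F (?Z w x)))) \<partial>lborel) \<partial>M) \<le> ennreal (K e) * ?I" .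
 qed
qed

text \<open>The limit is taken along a sequence of cosine polynomials that converges in \<open>L\<^sup>1\<close>
  over a period: uniformly in the scale by the bound through the largest coefficient, and to the pairing with
  \<open>H\<close> at each fixed scale by the density bound.\<close>

lemma integrable_periodic_limit:
 fixes \<beta> a :: real
 assumes dim: "2 \<le> DIM('a)" and \<beta>: "0 < \<beta>" "\<beta>\<^sup>2 < DIM('a)" and \<phi>: "test_function U \<phi>" and \<eta>: "mollifier \<eta>" and c: "scale_sequence c"
  and per: "periodic (2 * pi / \<beta>) H" and ev: "even_fun H" and H: "locally_integrable H"
  and pad: "\<And>j k. N j < k ==> b j k = 0"
  and approx: "\<And>j. (\<integral>\<^sup>+x. ennreal \<bar>(\<Sum>k=1..N j. b j k * cos (real k * \<beta> * x)) - H x\<bar> * indicator {0..2 * pi / \<beta>} x \<partial>lebesgue) \<le> ennreal (1 / real (Suc j))"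
  and coeff: "\<And>i j k. \<bar>b i k - b j k\<bar> \<le> \<beta> / pi * (1 / real (Suc i) + 1 / real (Suc j))"
  and a: "(\<lambda>j. b j 1) \<longlonglongrightarrow> a"
 shows "tendsto_in_probability (completion M) (\<lambda>n. approx_pairing M U X \<eta> (c n) \<beta> H \<phi>)
   (\<lambda>w. complex_of_real a * cos_chaos M U X \<beta> \<phi> w)"
proof -
 note D = test_function_D[OF \<phi>]
 let ?T = "2 * pi / \<beta>"
 have T: "0 < ?T" using \<beta>(1) by simp
 have c0: "\<And>n. 0 < c n" "c \<longlonglongrightarrow> 0" using c by (auto simp: scale_sequence_def)
 have Hm: "H \<in> borel_measurable lebesgue" by (rule locally_integrable_measurable[OF H])
 obtain H' Z where H': "H' \<in> borel_measurable borel" and Z: "Z \<in> null_sets lborel" "0 \<notin> Z" "\<And>x. x \<notin> Z ==> H x = H' x"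
  by (rule borel_version[OF Hm]) blast
 have HH': "AE x in lborel. H x = H' x" using AE_not_in[OF Z(1)] by eventually_elim (rule Z(3))
 obtain \<rho>1 B where B: "0 < \<rho>1" "0 \<le> B" "\<And>\<epsilon> N b m. 0 < \<epsilon> ==> \<epsilon> < \<rho>1 ==> (\<And>k. \<bar>b k\<bar> \<le> m) ==>
   (LINT w|M. norm (pairing \<beta> \<eta> \<epsilon> \<phi> (cos_poly \<beta> N b) w)) \<le> B * m"
  by (rule cos_poly_uniform_bound[OF dim \<beta> \<phi> \<eta>]) blast
 obtain \<rho>2 where r2: "0 < \<rho>2" "\<And>\<epsilon>. 0 < \<epsilon> ==> \<epsilon> < \<rho>2 ==> integrable lborel (weight \<beta> \<eta> \<epsilon> \<phi>)"
  by (rule weight_integrable[OF \<phi> \<eta>]) blast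
 obtain \<rho>3 K where K: "0 < \<rho>3" "\<And>\<epsilon>. 0 \<le> K \<epsilon>"
  "\<And>\<epsilon> F. 0 < \<epsilon> ==> \<epsilon> < \<rho>3 ==> F \<in> borel_measurable borel ==>
   (\<integral>\<^sup>+w. (\<integral>\<^sup>+x. ennreal (norm (weight \<beta> \<eta> \<epsilon> \<phi> x * complex_of_real (F (X w (mol \<eta> \<epsilon> x))))) \<partial>lborel) \<partial>M)
    \<le> ennreal (K \<epsilon>) * (\<integral>\<^sup>+t. ennreal \<bar>F t\<bar> * ennreal (exp (- \<bar>t\<bar>)) \<partial>lborel)"
  by (rule pairing_L1_majorant[OF \<phi> \<eta>, of \<beta>]) blast
 define \<rho> where "\<rho> = min \<rho>1 (min \<rho>2 \<rho>3)"
 define Q where "Q = 2 / (1 - exp (- ?T))"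
 have Q: "0 \<le> Q" using T by (simp add: Q_def)
 let ?P = "\<lambda>j. cos_poly \<beta> (N j) (b j)"
 have Pd: "?P j x = (\<Sum>k=1..N j. b j k * cos (real k * \<beta> * x))" for j x by (simp add: cos_poly_def mode_def)
 have Pm: "?P j \<in> borel_measurable lebesgue" for j
  by (rule measurable_completion) (simp add: cos_poly_measurable)
 \<comment> \<open>Exponentially weighted means of a periodic even function are controlled by one period.\<close>
 have weighted: "(\<integral>\<^sup>+t. ennreal \<bar>F t\<bar> * ennreal (exp (- \<bar>t\<bar>)) \<partial>lborel) \<le> ennreal Q * (\<integral>\<^sup>+x. ennreal \<bar>F' x\<bar> * indicator {0..?T} x \<partial>lebesgue)"
  if m: "F' \<in> borel_measurable lebesgue" and F: "AE x in lborel. F x = F' x" and p: "\<And>x. F' (x + ?T) = F' x" "\<And>x. F' (- x) = F' x" for F F'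
 proof -
  have "(\<integral>\<^sup>+t. ennreal \<bar>F t\<bar> * ennreal (exp (- \<bar>t\<bar>)) \<partial>lborel) = (\<integral>\<^sup>+t. ennreal \<bar>F' t\<bar> * ennreal (exp (- \<bar>t\<bar>)) \<partial>lborel)"
   by (rule nn_integral_cong_AE) (use F in eventually_elim, simp)
  also have "\<dots> = (\<integral>\<^sup>+t. ennreal \<bar>F' t\<bar> * ennreal (exp (- \<bar>t\<bar>)) \<partial>lebesgue)" by (rule nn_integral_completion[symmetric])
  also have "\<dots> \<le> ennreal Q * (\<integral>\<^sup>+x. ennreal \<bar>F' x\<bar> * indicator {0..?T} x \<partial>lebesgue)"
   unfolding Q_def
   by (rule periodic_exponential_bound[OF _ _ _ T])
    (intro measurable_compose[OF _ measurable_ennreal] borel_measurable_abs m, simp_all only: p)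
  finally show ?thesis .
 qed
 have Hper: "H (x + ?T) = H x" "H (- x) = H x" for x using per ev by (auto simp: periodic_def even_fun_def)
 have Pper: "?P j (x + ?T) = ?P j x" "?P j (- x) = ?P j x" for j x
 proof -
  have "cos (real k * \<beta> * (x + ?T)) = cos (real k * \<beta> * x)" for k
  proof -
   have "real k * \<beta> * (x + ?T) = real k * \<beta> * x + 2 * pi * of_int (int k)" using \<beta>(1) by (simp add: field_simps)
   then show ?thesis by (simp only: cos_add sin_int_2pin cos_int_2pin mult_1_right mult_zero_right diff_0_right)
  qed
  then show "?P j (x + ?T) = ?P j x" unfolding Pd by simp
  show "?P j (- x) = ?P j x" unfolding Pd by simp
 qed
 have Hfin: "(\<integral>\<^sup>+t. ennreal \<bar>H' t\<bar> * ennreal (exp (- \<bar>t\<bar>)) \<partial>lborel) < \<infinity>"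
 proof -
  have "H absolutely_integrable_on {0..?T}" using H by (simp add: locally_integrable_def)
  then have i: "integrable lebesgue (\<lambda>x. indicator {0..?T} x *\<^sub>R H x)" by (simp only: set_integrable_def)
  have "(\<integral>\<^sup>+x. ennreal \<bar>H x\<bar> * indicator {0..?T} x \<partial>lebesgue) = (\<integral>\<^sup>+x. ennreal (norm (indicator {0..?T} x *\<^sub>R H x)) \<partial>lebesgue)"
   by (intro nn_integral_cong) (simp add: indicator_def)
  also have "\<dots> < \<infinity>" using i by (simp only: integrable_iff_bounded)
  finally have "ennreal Q * (\<integral>\<^sup>+x. ennreal \<bar>H x\<bar> * indicator {0..?T} x \<partial>lebesgue) < \<infinity>"
   by (simp add: ennreal_mult_less_top)
  moreover have "AE x in lborel. H' x = H x" using HH' by eventually_elim simp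
  ultimately show ?thesis using weighted[OF Hm _ Hper, of H'] by (meson le_less_trans)
 qed
 have diff_bound: "(\<integral>\<^sup>+w. ennreal (norm (pairing \<beta> \<eta> \<epsilon> \<phi> (?P j) w - pairing \<beta> \<eta> \<epsilon> \<phi> H' w)) \<partial>M) \<le> ennreal (K \<epsilon> * (Q * (1 / real (Suc j))))"
  if e: "0 < \<epsilon>" "\<epsilon> < \<rho>" for \<epsilon> j
 proof -
  have e1: "\<epsilon> < \<rho>1" "\<epsilon> < \<rho>2" "\<epsilon> < \<rho>3" using e(2) by (auto simp: \<rho>_def)
  note W = r2(2)[OF e(1) e1(2)]
  let ?w = "weight \<beta> \<eta> \<epsilon> \<phi>" and ?Z = "\<lambda>w x. X w (mol \<eta> \<epsilon> x)"
  let ?in = "\<lambda>F w. \<integral>\<^sup>+x. ennreal (norm (?w x * complex_of_real (F (?Z w x)))) \<partial>lborel"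
  have wm [measurable]: "?w \<in> borel_measurable borel" by (rule weight_measurable[OF \<eta> e(1) D(1)])
  have Zm [measurable]: "(\<lambda>(w, x). ?Z w x) \<in> borel_measurable (M \<Otimes>\<^sub>M borel)" by (rule mol_field_measurable[OF \<eta> e(1)])
  note H' [measurable]
  have "(\<integral>\<^sup>+w. ?in H' w \<partial>M) < \<infinity>"
   by (rule le_less_trans[OF K(3)[OF e(1) e1(3) H']]) (use Hfin in \<open>simp add: ennreal_mult_less_top\<close>)
  moreover have "?in H' \<in> borel_measurable M" by measurable
  ultimately have fin: "AE w in M. ?in H' w \<noteq> \<infinity>" by (intro nn_integral_PInf_AE) auto
  have dm: "(\<lambda>t. ?P j t - H' t) \<in> borel_measurable borel" using cos_poly_measurable H' by (rule borel_measurable_diff)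
  have "(\<integral>\<^sup>+w. ennreal (norm (pairing \<beta> \<eta> \<epsilon> \<phi> (?P j) w - pairing \<beta> \<eta> \<epsilon> \<phi> H' w)) \<partial>M) \<le> (\<integral>\<^sup>+w. ?in (\<lambda>t. ?P j t - H' t) w \<partial>M)"
  proof (rule nn_integral_mono_AE)
   show "AE w in M. ennreal (norm (pairing \<beta> \<eta> \<epsilon> \<phi> (?P j) w - pairing \<beta> \<eta> \<epsilon> \<phi> H' w)) \<le> ?in (\<lambda>t. ?P j t - H' t) w"
    using fin AE_space
   proof eventually_elim
    case (elim w)
    have [measurable]: "(\<lambda>x. ?Z w x) \<in> borel_measurable borel" using elim(2) by measurable
    have i1: "integrable lborel (\<lambda>x. ?w x * complex_of_real (?P j (?Z w x)))"
     by (rule pairing_integrand(1)[OF \<eta> e(1) cos_poly_measurable cos_poly_bounded W elim(2)])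
    have "(\<lambda>x. ?w x * complex_of_real (H' (?Z w x))) \<in> borel_measurable lborel" by measurable
    then have i2: "integrable lborel (\<lambda>x. ?w x * complex_of_real (H' (?Z w x)))"
     unfolding integrable_iff_bounded using elim(1) by (simp add: top.not_eq_extremum)
    have "pairing \<beta> \<eta> \<epsilon> \<phi> (?P j) w - pairing \<beta> \<eta> \<epsilon> \<phi> H' w = (LINT x|lborel. ?w x * complex_of_real (?P j (?Z w x) - H' (?Z w x)))"
     unfolding pairing_def Bochner_Integration.integral_diff[OF i1 i2, symmetric] by (simp add: right_diff_distrib)
    then show ?case using integral_norm_bound_ennreal[OF Bochner_Integration.integrable_diff[OF i1 i2]]
     by (simp add: right_diff_distrib)
   qed
  qed
  also have "\<dots> \<le> ennreal (K \<epsilon>) * (\<integral>\<^sup>+t. ennreal \<bar>?P j t - H' t\<bar> * ennreal (exp (- \<bar>t\<bar>)) \<partial>lborel)"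
   by (rule K(3)[OF e(1) e1(3) dm])
  also have "\<dots> \<le> ennreal (K \<epsilon>) * (ennreal Q * ennreal (1 / real (Suc j)))"
  proof (rule mult_left_mono)
   have "(\<integral>\<^sup>+t. ennreal \<bar>?P j t - H' t\<bar> * ennreal (exp (- \<bar>t\<bar>)) \<partial>lborel)
     \<le> ennreal Q * (\<integral>\<^sup>+x. ennreal \<bar>?P j x - H x\<bar> * indicator {0..?T} x \<partial>lebesgue)"
   proof (rule weighted)
    show "(\<lambda>x. ?P j x - H x) \<in> borel_measurable lebesgue" by (rule borel_measurable_diff[OF Pm Hm])
    show "AE x in lborel. ?P j x - H' x = ?P j x - H x" using HH' by eventually_elim simp
   qed (simp_all only: Pper Hper)
   also have "\<dots> \<le> ennreal Q * ennreal (1 / real (Suc j))"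
    unfolding Pd by (rule mult_left_mono[OF approx]) simp
   finally show "(\<integral>\<^sup>+t. ennreal \<bar>?P j t - H' t\<bar> * ennreal (exp (- \<bar>t\<bar>)) \<partial>lborel) \<le> ennreal Q * ennreal (1 / real (Suc j))" .
  qed simp
  also have "\<dots> = ennreal (K \<epsilon> * (Q * (1 / real (Suc j))))"
   using K(2)[of \<epsilon>] Q by (simp only: ennreal_mult mult_nonneg_nonneg zero_le_divide_1_iff of_nat_0_le_iff)
  finally show ?thesis .
 qed
 have inv0: "(\<lambda>j. 1 / real (Suc j)) \<longlonglongrightarrow> 0" using LIMSEQ_inverse_real_of_nat by (simp add: inverse_eq_divide)
 have "L1_null M (\<lambda>n w. pairing \<beta> \<eta> (c n) \<phi> H' w - complex_of_real a * pairing \<beta> \<eta> (c n) \<phi> (\<lambda>t. cos (\<beta> * t)) w)"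
 proof (rule cos_poly_limit_null[where b = b and N = N and a = a, OF \<beta> \<phi> \<eta> c0 _ _ pad _ _ a])
  show "pairing \<beta> \<eta> (c n) \<phi> H' \<in> borel_measurable M" for n by (rule pairing_measurable[OF \<eta> c0(1) D(1) H'])
  show "0 < \<rho>" using B(1) r2(1) K(1) by (simp add: \<rho>_def)
  show "\<exists>J. \<forall>i\<ge>J. \<forall>j\<ge>J. \<forall>\<delta>. 0 < \<delta> \<longrightarrow> \<delta> < \<rho> \<longrightarrow>
   (LINT w|M. norm (pairing \<beta> \<eta> \<delta> \<phi> (cos_poly \<beta> (max (N i) (N j)) (\<lambda>k. b i k - b j k)) w)) \<le> e" if e: "0 < e" for e
  proof -
   have "(\<lambda>j. B * (\<beta> / pi * (1 / real (Suc j)))) \<longlonglongrightarrow> B * (\<beta> / pi * 0)" by (intro tendsto_mult tendsto_const inv0)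
   then have lim: "(\<lambda>j. B * (\<beta> / pi * (1 / real (Suc j)))) \<longlonglongrightarrow> 0" by simp
   have e2: "0 < e / 2" using e by simp
   from order_tendstoD(2)[OF lim e2] obtain J where J: "\<And>j. J \<le> j ==> B * (\<beta> / pi * (1 / real (Suc j))) < e / 2"
    unfolding eventually_sequentially by blast
   show ?thesis
   proof (intro exI[of _ J] allI impI)
    fix i j \<delta> assume ij: "J \<le> i" "J \<le> j" and d: "0 < \<delta>" "\<delta> < \<rho>"
    have "\<delta> < \<rho>1" using d by (simp add: \<rho>_def)
    from B(3)[of \<delta> "\<lambda>k. b i k - b j k" "\<beta> / pi * (1 / real (Suc i) + 1 / real (Suc j))" "max (N i) (N j)", OF d(1) this coeff]
    show "(LINT w|M. norm (pairing \<beta> \<eta> \<delta> \<phi> (cos_poly \<beta> (max (N i) (N j)) (\<lambda>k. b i k - b j k)) w)) \<le> e"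
     using J[OF ij(1)] J[OF ij(2)] unfolding distrib_left by linarith
   qed
  qed
  show "(\<lambda>j. \<integral>\<^sup>+w. ennreal (norm (pairing \<beta> \<eta> (c n) \<phi> (?P j) w - pairing \<beta> \<eta> (c n) \<phi> H' w)) \<partial>M) \<longlonglongrightarrow> 0"
   if n: "c n < \<rho>" for n
  proof -
   have "(\<lambda>j. ennreal (K (c n) * (Q * (1 / real (Suc j))))) \<longlonglongrightarrow> ennreal (K (c n) * (Q * 0))"
    by (intro tendsto_ennrealI tendsto_mult tendsto_const inv0)
   then have "(\<lambda>j. ennreal (K (c n) * (Q * (1 / real (Suc j))))) \<longlonglongrightarrow> 0" by simp
   then show ?thesis
    by (rule tendsto_sandwich[OF always_eventually always_eventually tendsto_const, rotated 2]) (simp, intro allI diff_bound c0(1) n)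
  qed
 qed
 from approx_pairing_limit[OF \<beta>(2) \<phi> \<eta> c pairing_measurable[OF \<eta> c0(1) D(1) H'] approx_pairing_version[OF \<phi> \<eta> c0(1) H' Z] this]
 show ?thesis .
qed

end

theorem theorem3p18:
  fixes M :: "'w measure"
    and U :: "'a::euclidean_space set"
    and g :: "'a \<Rightarrow> 'a \<Rightarrow> real"
    and X :: "'w \<Rightarrow> ('a \<Rightarrow> real) \<Rightarrow> real"
    and \<eta> :: "'a \<Rightarrow> real"
    and c :: "nat \<Rightarrow> real"
    and \<beta> :: real
  assumes "log_correlated_field M U g X"
    and "mollifier \<eta>"
    and "scale_sequence c"
    and "0 < \<beta>" and "\<beta> < sqrt (real DIM('a))"
  shows "(\<forall>H. periodic (2 * pi / \<beta>) H \<longrightarrow> even_fun H \<longrightarrow>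
            abs_convergent_fourier (2 * pi / \<beta>) H \<longrightarrow> mean_zero (2 * pi / \<beta>) H \<longrightarrow>
            (\<exists>a::real. \<forall>\<phi>::'a \<Rightarrow> complex. test_function U \<phi> \<longrightarrow>
               tendsto_in_probability (completion M)
                 (\<lambda>n. approx_pairing M U X \<eta> (c n) \<beta> H \<phi>)
                 (\<lambda>\<omega>. complex_of_real a * cos_chaos M U X \<beta> \<phi> \<omega>)))
       \<and> (DIM('a) = 2 \<longrightarrow> C_times_on 2 (U \<times> U) (\<lambda>(x, y). g x y) \<longrightarrow>
            (\<forall>x\<in>U. \<forall>y\<in>U. g x x = g y y) \<longrightarrow> radially_decreasing \<eta> \<longrightarrow>
            (\<forall>H. periodic (2 * pi / \<beta>) H \<longrightarrow> even_fun H \<longrightarrow>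
               locally_integrable H \<longrightarrow> mean_zero (2 * pi / \<beta>) H \<longrightarrow>
               (\<exists>a::real. \<forall>\<phi>::'a \<Rightarrow> complex. test_function U \<phi> \<longrightarrow>
                  tendsto_in_probability (completion M)
                    (\<lambda>n. approx_pairing M U X \<eta> (c n) \<beta> H \<phi>)
                    (\<lambda>\<omega>. complex_of_real a * cos_chaos M U X \<beta> \<phi> \<omega>))))"
proof (intro conjI allI impI)
 interpret log_field M U g X by (rule log_field.intro[OF assms(1)])
 have "\<beta>\<^sup>2 < (sqrt (real DIM('a)))\<^sup>2" using assms(4,5) by (intro power_strict_mono) auto
 then have \<beta>: "\<beta>\<^sup>2 < DIM('a)" by simp
 show "\<exists>a::real. \<forall>\<phi>::'a \<Rightarrow> complex. test_function U \<phi> \<longrightarrow>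
   tendsto_in_probability (completion M) (\<lambda>n. approx_pairing M U X \<eta> (c n) \<beta> H \<phi>) (\<lambda>\<omega>. complex_of_real a * cos_chaos M U X \<beta> \<phi> \<omega>)"
  if H: "even_fun H" "abs_convergent_fourier (2 * pi / \<beta>) H" "mean_zero (2 * pi / \<beta>) H" for H
 proof -
  obtain a where a: "summable (\<lambda>k. \<bar>a k\<bar>)" "\<And>x. (\<lambda>j. \<Sum>k=1..j. a k * cos (real k * \<beta> * x)) \<longlonglongrightarrow> H x"
   by (rule cosine_series[OF assms(4) H]) blast
  show ?thesis
   by (intro exI[of _ "a 1"] allI impI) (rule summable_cosine_series_limit[OF assms(4) \<beta> _ assms(2,3) a])
 qed
 show "\<exists>a::real. \<forall>\<phi>::'a \<Rightarrow> complex. test_function U \<phi> \<longrightarrow>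
   tendsto_in_probability (completion M) (\<lambda>n. approx_pairing M U X \<eta> (c n) \<beta> H \<phi>) (\<lambda>\<omega>. complex_of_real a * cos_chaos M U X \<beta> \<phi> \<omega>)"
  if d: "DIM('a) = 2" and H: "periodic (2 * pi / \<beta>) H" "even_fun H" "locally_integrable H" "mean_zero (2 * pi / \<beta>) H" for H
 proof -
  obtain N :: "nat \<Rightarrow> nat" and b :: "nat \<Rightarrow> nat \<Rightarrow> real" and a where b: "\<And>j k. N j < k \<Longrightarrow> b j k = 0"
   "\<And>j. (\<integral>\<^sup>+x. ennreal \<bar>(\<Sum>k=1..N j. b j k * cos (real k * \<beta> * x)) - H x\<bar> * indicator {0..2 * pi / \<beta>} x \<partial>lebesgue) \<le> ennreal (1 / real (Suc j))"
   "\<And>i j k. \<bar>b i k - b j k\<bar> \<le> \<beta> / pi * (1 / real (Suc i) + 1 / real (Suc j))"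
   "(\<lambda>j. b j 1) \<longlonglongrightarrow> a"
   by (rule even_periodic_cosine_sequence[OF assms(4) H]) blast
  have "2 \<le> DIM('a)" using d by simp
  then show ?thesis
   by (intro exI[of _ a] allI impI) (rule integrable_periodic_limit[OF _ assms(4) \<beta> _ assms(2,3) H(1-3) b])
 qed
qed

end
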